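(* In cases {\bf A}, {\bf C}, {\bf D}, {\bf E}, {\bf F}, {\bf G} described below, the expansion coefficients of the function \[ \kappa(s) = 2\pi i s^2 \int_0^{i\infty} t(z)^{s-1} z f(z)\, d t(z) = \sum_{n=0}^\infty \kappa_n s^n \] are given by $\kappa_0=1$, $\kappa_1=0$ and \[ \kappa_{2+m} = \frac{4 \pi^2}{b \, m!} \left[\int_{z_0/(b z_0+1)}^{z_0} \log^m (t(z))\, g(z)\, dz\right]_{reg} \] for all $m \ge 0$, where $g(z) = \frac1{2 \pi i} \frac{t'(z)}{t(z)} f(z)$ is a modular form on $G$ of weight 3 and character $\chi$, and $b$ is the minimal positive integer such that $\begin{pmatrix}1 & 0 \\ b & 1\end{pmatrix} \in G$.
   Context: $z$ is the variable in the upper half-plane $\mathcal H$, $q=e^{2\pi i z}$, $\eta$ is the Dedekind eta function. The cases are ($(A,B,\lambda)$ are the parameters of the operator $L=\theta^2-t(A\theta(\theta+1)+\lambda)+Bt^2(\theta+1)^2$, $\theta=t\,d/dt$, whose solutions pulled back along $t(z)$ are spanned by $f(z)$ and $zf(z)$): {\bf A}: $(7,-8,2)$, $G=\Gamma_0(6)$, $t=\frac{\eta(z)^3\eta(6z)^9}{\eta(2z)^3\eta(3z)^9}$, $f=\frac{\eta(2z)\eta(3z)^6}{\eta(z)^2\eta(6z)^3}$, $\chi=\left(\frac{-3}{\cdot}\right)$, $b=6$. {\bf C}: $(10,9,3)$, $G=\Gamma_0(6)$, $t=\frac{\eta(z)^4\eta(6z)^8}{\eta(2z)^8\eta(3z)^4}$,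 $f=\frac{\eta(2z)^6\eta(3z)}{\eta(z)^3\eta(6z)^2}$, $\chi=\left(\frac{-3}{\cdot}\right)$, $b=6$. {\bf F}: $(17,72,6)$, $G=h^{-1}\Gamma_0(6)h$, $h=\begin{pmatrix}1&1/2\\0&1\end{pmatrix}$, $t=\frac{\eta(z)^5\eta(3z)\eta(4z)^5\eta(6z)^2\eta(12z)}{\eta(2z)^{14}}$, $f=\frac{\eta(2z)^{15}\eta(3z)^2\eta(12z)^2}{\eta(z)^6\eta(4z)^6\eta(6z)^5}$, $\chi$ the $h$-conjugate of $\left(\frac{-3}{\cdot}\right)$, $b=12$. {\bf E}: $(12,32,4)$, $G=\Gamma_0(8)$, $t=\frac{\eta(z)^4\eta(4z)^2\eta(8z)^4}{\eta(2z)^{10}}$, $f=\frac{\eta(2z)^{10}}{\eta(z)^4\eta(4z)^4}$, $\chi=\left(\frac{-4}{\cdot}\right)$, $b=8$. {\bf G}: $(0,-16,0)$, $G=\Gamma_0(8)$, $t=\frac{\eta(2z)^4\eta(8z)^8}{\eta(4z)^{12}}$, $f=\frac{\eta(4z)^{10}}{\eta(2z)^4\eta(8z)^4}$, $\chi=\left(\frac{-4}{\cdot}\right)$, $b=8$. {\bf D}: $(11,-1,3)$, $G=\Gamma_1(5)$, $t=q\prod_{n\ge1}(1-q^n)^{5(\frac n5)}$, $f=\left(t^{-1}\frac{\eta(5z)^5}{\eta(z)}\right)^{1/2}$, $\chi=1$, $b=5$. Regularization: a function $F:\mathcal H\to\mathbb C$ is regularizable as $z\to\infty$ if there is a polynomial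 $P\in\mathbb C[z]$ with $F(z)=P(z)+o(\mathrm{Im}(z)^{-N})$ for all $N\ge1$ as $\mathrm{Im}(z)\to\infty$ with $\mathrm{Re}(z)$ fixed; then $[F(z)]_{reg}:=P(0)$. Here the integral is regarded as a function of $z_0\in\mathcal H$. *)

theory Defs
  imports
    "HOL-Complex_Analysis.Complex_Analysis"
    "HOL-Number_Theory.Number_Theory"
    "HOL-Computational_Algebra.Computational_Algebra"
    "HOL-Library.Landau_Symbols"
begin

section \<open>Eta quotients\<close>

abbreviation upper_half :: "complex set" where
  "upper_half \<equiv> {z. Im z > 0}"

definition dedekind_eta :: "complex \<Rightarrow> complex" where
  "dedekind_eta z =
     exp (2 * of_real pi * \<i> * z / 24) * (\<Prod>n. 1 - exp (2 * of_real pi * \<i> * of_nat (Suc n) * z))"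

text \<open>The list \<open>[(d, r), \<dots>]\<close> stands for the product of all \<open>\<eta>(d z) ^ r\<close>.\<close>

definition eta_quotient :: "(nat \<times> int) list \<Rightarrow> complex \<Rightarrow> complex" where
  "eta_quotient ds z = (\<Prod>(d, r)\<leftarrow>ds. dedekind_eta (of_nat d * z) powi r)"

text \<open>
  For a nowhere vanishing holomorphic function \<open>F\<close> on the upper half-plane that is positive on
  the imaginary axis, this is the holomorphic branch of \<open>log F\<close> that is real there. It is uniquely
  determined on the upper half-plane: two holomorphic logarithms differ by a constant in
  \<open>2 \<pi> \<i> \<int>\<close>. It is in general not \<open>Ln (F z)\<close> with the principal branch \<open>Ln\<close>.
\<close>

definition log_branch :: "(complex \<Rightarrow> complex) \<Rightarrow> complex \<Rightarrow> complex" where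
  "log_branch F = (SOME l. l holomorphic_on upper_half \<and> (\<forall>z\<in>upper_half. exp (l z) = F z) \<and>
                           (\<forall>y>0. l (\<i> * of_real y) \<in> \<real>))"

lemma log_branch_exists:
  assumes "F holomorphic_on upper_half" "\<And>z. Im z > 0 \<Longrightarrow> F z \<noteq> 0"
    and "\<And>y. y > 0 \<Longrightarrow> \<exists>r>0. F (\<i> * of_real y) = of_real r"
  shows "\<exists>l. l holomorphic_on upper_half \<and> (\<forall>z\<in>upper_half. exp (l z) = F z) \<and>
             (\<forall>y>0. l (\<i> * of_real y) \<in> \<real>)"
proof -
  have "simply_connected upper_half"
    by (simp add: convex_halfspace_Im_gt convex_imp_simply_connected)
  moreover have "locally path_connected upper_half"
    by (simp add: open_halfspace_Im_gt open_imp_locally_path_connected)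
  ultimately obtain g where g: "g holomorphic_on upper_half" "\<And>z. z \<in> upper_half \<Longrightarrow> F z = exp (g z)"
    using simply_connected_imp_holomorphic_log[OF assms(1)] assms(2) by auto
  define h where "h y = Im (g (\<i> * of_real y)) / (2 * pi)" for y :: real
  have int: "h y \<in> \<int>" if "y > 0" for y
  proof -
    obtain r where r: "r > 0" "F (\<i> * of_real y) = of_real r"
      using assms(3)[OF \<open>y > 0\<close>] by blast
    then have "exp (g (\<i> * of_real y)) = exp (of_real (ln r))"
      using g(2)[of "\<i> * of_real y"] that by (simp add: exp_of_real)
    then obtain n :: int where "g (\<i> * of_real y) = of_real (ln r) + (of_int (2 * n) * pi) * \<i>"
      unfolding exp_eq by blast
    then have "h y = of_int n" by (simp add: h_def)
    then show ?thesis by simp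
  qed
  have cont: "continuous_on {0<..} h"
    unfolding h_def
    by (intro continuous_intros continuous_on_compose2[OF holomorphic_on_imp_continuous_on[OF g(1)]]) auto
  have "h constant_on {0<..}"
  proof (rule continuous_discrete_range_constant[OF _ cont])
    show "connected {0::real<..}" by simp
    show "\<exists>e>0. \<forall>y. y \<in> {0<..} \<and> h y \<noteq> h x \<longrightarrow> e \<le> norm (h y - h x)" if "x \<in> {0<..}" for x
    proof (intro exI[of _ 1] conjI allI impI)
      fix y assume y: "y \<in> {0<..} \<and> h y \<noteq> h x"
      with that int have "h y - h x \<in> \<int>" "h y - h x \<noteq> 0" by auto
      then show "1 \<le> norm (h y - h x)" unfolding real_norm_def by (rule Ints_nonzero_abs_ge1)
    qed simp
  qed
  then obtain k where k: "\<And>y. y > 0 \<Longrightarrow> h y = k" by (auto simp: constant_on_def)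
  obtain n :: int where n: "k = of_int n" using int[of 1] k[of 1] by (auto elim: Ints_cases)
  define l where "l z = g z - 2 * of_int n * of_real pi * \<i>" for z
  have "l holomorphic_on upper_half" unfolding l_def by (intro holomorphic_intros g(1))
  moreover have "exp (l z) = F z" if "z \<in> upper_half" for z
  proof -
    have "exp (l z) = exp (g z)"
      unfolding exp_eq l_def by (intro exI[of _ "-n"]) simp
    then show ?thesis using g(2)[OF that] by simp
  qed
  moreover have "l (\<i> * of_real y) \<in> \<real>" if "y > 0" for y
    using k[OF that] n by (simp add: complex_is_Real_iff l_def h_def field_simps)
  ultimately show ?thesis by blast
qed


section \<open>The Kronecker symbol\<close>

definition kronecker_prime :: "int \<Rightarrow> nat \<Rightarrow> int" where
  "kronecker_prime a p =
     (if p = 2 then (if even a then 0 else if a mod 8 \<in> {1, 7} then 1 else -1)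
      else Legendre a (int p))"

definition kronecker :: "int \<Rightarrow> int \<Rightarrow> int" where
  "kronecker a n =
     (if n = 0 then (if \<bar>a\<bar> = 1 then 1 else 0)
      else (if n < 0 \<and> a < 0 then -1 else 1) *
           (\<Prod>p\<in>prime_factors (nat \<bar>n\<bar>). kronecker_prime a p ^ multiplicity p (nat \<bar>n\<bar>)))"


section \<open>Groups and modular forms\<close>

text \<open>
  Matrices have real entries because the conjugate of \<open>\<Gamma>\<^sub>0(6)\<close> in case F is not contained
  in the integral matrices.
\<close>

definition mat2 :: "real \<Rightarrow> real \<Rightarrow> real \<Rightarrow> real \<Rightarrow> real^2^2" where
  "mat2 a b c d = vector [vector [a, b], vector [c, d]]"

definition automorphy :: "real^2^2 \<Rightarrow> complex \<Rightarrow> complex" where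
  "automorphy M z = of_real (M $ 2 $ 1) * z + of_real (M $ 2 $ 2)"

definition moebius_action :: "real^2^2 \<Rightarrow> complex \<Rightarrow> complex" where
  "moebius_action M z = (of_real (M $ 1 $ 1) * z + of_real (M $ 1 $ 2)) / automorphy M z"

definition SL2Z :: "(real^2^2) set" where
  "SL2Z = {mat2 (of_int a) (of_int b) (of_int c) (of_int d) | a b c d :: int. a * d - b * c = 1}"

definition Gamma0 :: "nat \<Rightarrow> (real^2^2) set" where
  "Gamma0 N = {mat2 (of_int a) (of_int b) (of_int c) (of_int d) | a b c d :: int.
                 a * d - b * c = 1 \<and> [c = 0] (mod int N)}"

definition Gamma1 :: "nat \<Rightarrow> (real^2^2) set" where
  "Gamma1 N = {mat2 (of_int a) (of_int b) (of_int c) (of_int d) | a b c d :: int.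
                 a * d - b * c = 1 \<and> [c = 0] (mod int N) \<and> [a = 1] (mod int N) \<and> [d = 1] (mod int N)}"

text \<open>
  The last condition is holomorphy at the cusps. It is meant for groups commensurable with
  \<open>SL\<^sub>2(\<int>)\<close>, whose cusps are the images of \<open>\<infinity>\<close> under \<open>SL\<^sub>2(\<int>)\<close>, and characters with a kernel
  of finite index: \<open>g\<close> slashed with an element of \<open>SL\<^sub>2(\<int>)\<close> then has a Fourier expansion at
  \<open>\<infinity>\<close>, and it has no negative exponents iff it is bounded near \<open>\<infinity>\<close>.
\<close>

definition modular_form ::
    "nat \<Rightarrow> (real^2^2) set \<Rightarrow> (real^2^2 \<Rightarrow> complex) \<Rightarrow> (complex \<Rightarrow> complex) \<Rightarrow> bool" where
  "modular_form k G \<psi> g \<longleftrightarrow>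
     g holomorphic_on upper_half \<and>
     (\<forall>M\<in>G. \<forall>z\<in>upper_half. g (moebius_action M z) = \<psi> M * automorphy M z ^ k * g z) \<and>
     (\<forall>M\<in>SL2Z. \<exists>Y>0. \<exists>C. \<forall>z. Im z \<ge> Y \<longrightarrow>
        norm (g (moebius_action M z) / automorphy M z ^ k) \<le> C)"


section \<open>The six cases\<close>

datatype apery_case = CaseA | CaseC | CaseD | CaseE | CaseF | CaseG

definition shift_mat :: "real^2^2" where
  "shift_mat = mat2 1 (1/2) 0 1"

primrec case_group :: "apery_case \<Rightarrow> (real^2^2) set" where
  "case_group CaseA = Gamma0 6"
| "case_group CaseC = Gamma0 6"
| "case_group CaseD = Gamma1 5"
| "case_group CaseE = Gamma0 8"
| "case_group CaseF = (\<lambda>M. matrix_inv shift_mat ** M ** shift_mat) ` Gamma0 6"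
| "case_group CaseG = Gamma0 8"

text \<open>
  A Dirichlet character is evaluated at a matrix through the lower right entry, which is an
  integer for the elements of \<open>\<Gamma>\<^sub>0(N)\<close>.
\<close>

definition kronecker_char :: "int \<Rightarrow> real^2^2 \<Rightarrow> complex" where
  "kronecker_char D M = of_int (kronecker D \<lfloor>M $ 2 $ 2\<rfloor>)"

primrec case_chi :: "apery_case \<Rightarrow> real^2^2 \<Rightarrow> complex" where
  "case_chi CaseA = kronecker_char (-3)"
| "case_chi CaseC = kronecker_char (-3)"
| "case_chi CaseD = (\<lambda>M. 1)"
| "case_chi CaseE = kronecker_char (-4)"
| "case_chi CaseF = (\<lambda>M. kronecker_char (-3) (shift_mat ** M ** matrix_inv shift_mat))"
| "case_chi CaseG = kronecker_char (-4)"

primrec case_b :: "apery_case \<Rightarrow> nat" where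
  "case_b CaseA = 6"
| "case_b CaseC = 6"
| "case_b CaseD = 5"
| "case_b CaseE = 8"
| "case_b CaseF = 12"
| "case_b CaseG = 8"

primrec case_t :: "apery_case \<Rightarrow> complex \<Rightarrow> complex" where
  "case_t CaseA = eta_quotient [(1, 3), (6, 9), (2, -3), (3, -9)]"
| "case_t CaseC = eta_quotient [(1, 4), (6, 8), (2, -8), (3, -4)]"
| "case_t CaseD = (\<lambda>z. exp (2 * of_real pi * \<i> * z) *
     (\<Prod>n. (1 - exp (2 * of_real pi * \<i> * of_nat (Suc n) * z)) powi (5 * kronecker (int (Suc n)) 5)))"
| "case_t CaseE = eta_quotient [(1, 4), (4, 2), (8, 4), (2, -10)]"
| "case_t CaseF = eta_quotient [(1, 5), (3, 1), (4, 5), (6, 2), (12, 1), (2, -14)]"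
| "case_t CaseG = eta_quotient [(2, 4), (8, 8), (4, -12)]"

text \<open>
  In case D the square root is the branch that is holomorphic on the upper half-plane and positive
  on the imaginary axis, that is, the one with \<open>f = 1 + O(q)\<close>.
\<close>

primrec case_f :: "apery_case \<Rightarrow> complex \<Rightarrow> complex" where
  "case_f CaseA = eta_quotient [(2, 1), (3, 6), (1, -2), (6, -3)]"
| "case_f CaseC = eta_quotient [(2, 6), (3, 1), (1, -3), (6, -2)]"
| "case_f CaseD = (\<lambda>z. exp (log_branch
     (\<lambda>w. inverse (case_t CaseD w) * (dedekind_eta (5 * w) ^ 5 / dedekind_eta w)) z / 2))"
| "case_f CaseE = eta_quotient [(2, 10), (1, -4), (4, -4)]"
| "case_f CaseF = eta_quotient [(2, 15), (3, 2), (12, 2), (1, -6), (4, -6), (6, -5)]"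
| "case_f CaseG = eta_quotient [(4, 10), (2, -4), (8, -4)]"

definition case_g :: "apery_case \<Rightarrow> complex \<Rightarrow> complex" where
  "case_g c z = 1 / (2 * of_real pi * \<i>) * (deriv (case_t c) z / case_t c z) * case_f c z"


section \<open>The function \<open>\<kappa>\<close>\<close>

text \<open>
  The path from \<open>0\<close> to \<open>\<i>\<infinity>\<close> is \<open>z = \<i> y\<close> with \<open>0 < y\<close>, so that \<open>dz = \<i> dy\<close>. On it \<open>t\<close> is positive,
  so that \<open>powr\<close> is the power formed with the real logarithm of \<open>t\<close>.
\<close>

definition kappa_integrand :: "apery_case \<Rightarrow> complex \<Rightarrow> real \<Rightarrow> complex" where
  "kappa_integrand c s y =
     (let z = \<i> * of_real y
      in case_t c z powr (s - 1) * z * case_f c z * deriv (case_t c) z * \<i>)"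

definition kappa :: "apery_case \<Rightarrow> complex \<Rightarrow> complex" where
  "kappa c s = 2 * of_real pi * \<i> * s^2 * integral {0<..} (kappa_integrand c s)"


section \<open>Regularization\<close>

definition regularizes :: "(complex \<Rightarrow> complex) \<Rightarrow> complex poly \<Rightarrow> bool" where
  "regularizes F P \<longleftrightarrow>
     (\<forall>N\<ge>1. \<forall>x::real.
        (\<lambda>y. F (Complex x y) - poly P (Complex x y)) \<in> o[at_top](\<lambda>y. of_real (1 / y ^ N)))"

definition regularizable :: "(complex \<Rightarrow> complex) \<Rightarrow> bool" where
  "regularizable F \<longleftrightarrow> (\<exists>P. regularizes F P)"

definition reg_value :: "(complex \<Rightarrow> complex) \<Rightarrow> complex" where
  "reg_value F = poly (THE P. regularizes F P) 0"

text \<open>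
  The integrand is holomorphic on the upper half-plane, so the choice of the straight path is
  immaterial.
\<close>

definition log_integral :: "apery_case \<Rightarrow> nat \<Rightarrow> complex \<Rightarrow> complex" where
  "log_integral c m z0 =
     contour_integral (linepath (z0 / (of_nat (case_b c) * z0 + 1)) z0)
       (\<lambda>z. log_branch (case_t c) z ^ m * case_g c z)"

end

theory Submission
  imports Defs
begin

text \<open>
  Write \<open>L = log t\<close>. Since \<open>f dt / t = 2 \<pi> \<i> g dz\<close>, the integral defining \<open>\<kappa>\<close> is a multiple of the
  integral of \<open>z e\<^bsup>s L(z)\<^esup> g(z)\<close> over the imaginary axis. There \<open>L(\<i> y) = - 2 \<pi> y + O(e\<^bsup>- 2 \<pi> y\<^esup>)\<close> and
  \<open>g = 1 + O(e\<^bsup>- 2 \<pi> y\<^esup>)\<close>; the main term \<open>y e\<^bsup>- 2 \<pi> s y\<^esup>\<close> produces \<open>\<kappa>\<^sub>0 = 1\<close> and \<open>\<kappa>\<^sub>1 = 0\<close>, and the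
  remainder may be expanded in powers of \<open>s\<close> under the integral sign. The map \<open>z / (b z + 1)\<close>
  fixes \<open>t\<close> and \<open>L\<close> and multiplies \<open>g dz\<close> by \<open>b z + 1\<close>. Hence the integral of \<open>L\<^sup>m g dz\<close> from
  \<open>z / (b z + 1)\<close> to \<open>z\<close> is a primitive of \<open>- b z L\<^sup>m g\<close>. It vanishes at the cusp 0, and its constant
  term at \<open>\<i> \<infinity>\<close> is the regularized value, which evaluates the coefficients.

  All modularity is derived from the Klein form. Its behaviour under \<open>- 1 / \<tau>\<close> follows from
  Liouville's theorem, the sixth power of \<open>\<eta>\<close> is an inverse product of Klein forms at the points of
  order 2, and in case D the function \<open>t\<close> is the fifth power of a quotient of Klein forms at points of
  order 5. This yields the expansions at all cusps. A function with integral exponents at the cusps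
  is invariant under the parabolic generators of the group, and for the groups at hand two of them
  together with the translation suffice.
\<close>

section \<open>Infinite products\<close>

text \<open>The multiplier system of eta consists of 24th roots of unity and is avoided: for a
  general element of the modular group only the sixth power is transformed, up to a constant that is
  never computed, and roots are extracted by continuity on the half-plane. What survives is the
  exponent at each cusp. The character does not come from a multiplier formula either: the parabolic
  steps act with trivial factor, and the parity of the weight fixes the value at -1. On the analytic
  side, \<open>z L^m g\<close> grows polynomially towards i infinity. Subtracting its leading
  monomial gives a convergent integral, and the same monomial accounts for the nonconstant part of
  the regularizing polynomial; hence the convergent integral is the regularized value divided by
  \<open>b\<close>. The factor 4 pi^2 is the product of 2 pi i from the definition of kappa and -2
  pi i from \<open>f dt / t\<close> and \<open>z dz = - y dy\<close>. Sum and integral may be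
  exchanged because the error terms decay like exp (- 2 pi y), which outweighs the growth of the
  exponential series for small \<open>s\<close>; the proof takes \<open>norm s < 1/8\<close>. Case F
  is reduced to level 6 by the translation \<open>z + 1/2\<close>, which replaces q by -q.\<close>

definition nome :: "complex \<Rightarrow> complex" where
  "nome z = exp (2 * of_real pi * \<i> * z)"

lemma nome_0 [simp]: "nome 0 = 1"
  and nome_nonzero [simp]: "nome z \<noteq> 0"
  and nome_add: "nome (z + w) = nome z * nome w"
  and nome_minus: "nome (- z) = inverse (nome z)"
  and nome_diff: "nome (z - w) = nome z / nome w"
  by (simp_all add: nome_def ring_distribs exp_add exp_diff exp_minus)

lemma nome_power: "nome z ^ n = nome (of_nat n * z)"
  by (simp add: nome_def flip: exp_of_nat_mult) (simp add: mult_ac)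

lemma nome_powi: "nome z powi n = nome (of_int n * z)"
  by (cases "n \<ge> 0") (simp_all add: power_int_def nome_power flip: nome_minus)

lemma nome_of_int [simp]: "nome (of_int n) = 1"
  using exp_integer_2pi[of "of_int n"] by (simp add: nome_def mult_ac)

lemma nome_of_nat [simp]: "nome (of_nat n) = 1"
  using nome_of_int[of "int n"] by simp

lemma nome_1 [simp]: "nome 1 = 1"
  using nome_of_nat[of 1] by simp

lemma nome_half: "nome (1/2) = -1"
  using exp_pi_i by (simp add: nome_def)

lemma norm_nome: "norm (nome z) = exp (- 2 * pi * Im z)"
  by (simp add: nome_def)

lemma norm_nome_less_1_iff: "norm (nome z) < 1 \<longleftrightarrow> Im z > 0"
  by (simp add: norm_nome zero_less_mult_iff)

lemma nome_eq_1_iff: "nome z = 1 \<longleftrightarrow> z \<in> \<int>"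
proof -
  have "nome z = 1 \<longleftrightarrow> (\<exists>n::int. z = of_int n)"
    unfolding nome_def exp_eq_1 by (auto simp: complex_eq_iff)
  then show ?thesis by (auto elim: Ints_cases)
qed

lemma has_field_derivative_nome [derivative_intros]:
  assumes "(f has_field_derivative f') (at z within A)"
  shows "((\<lambda>z. nome (f z)) has_field_derivative (2 * of_real pi * \<i> * f' * nome (f z))) (at z within A)"
  unfolding nome_def by (auto intro!: derivative_eq_intros assms)

lemma holomorphic_nome [holomorphic_intros]:
  "f holomorphic_on A \<Longrightarrow> (\<lambda>z. nome (f z)) holomorphic_on A"
  unfolding nome_def by (intro holomorphic_intros)

lemma tendsto_nome [tendsto_intros]:
  "(f \<longlongrightarrow> a) F \<Longrightarrow> ((\<lambda>z. nome (f z)) \<longlongrightarrow> nome a) F"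
  unfolding nome_def by (intro tendsto_intros)

text \<open>The q-Pochhammer symbol (x; q)_infinity. With \<open>q\<close> and \<open>x\<close>
  independent, the Euler product of eta, both theta factors of the Klein function and their values
  at torsion points are all instances.\<close>

definition qprod :: "complex \<Rightarrow> complex \<Rightarrow> complex" where
  "qprod q x = (\<Prod>n. 1 - q ^ n * x)"

lemma convergent_qprod:
  fixes q x :: complex
  assumes "norm q < 1"
  shows "convergent_prod (\<lambda>n. 1 - q ^ n * x)"
proof -
  have "summable (\<lambda>n. norm q ^ n * norm x)"
    using assms by (intro summable_mult2 summable_geometric) auto
  moreover have "norm (1 - q ^ n * x - 1) = norm q ^ n * norm x" for n
    by (simp add: norm_mult norm_power)
  ultimately have "summable (\<lambda>n. norm (1 - q ^ n * x - 1))"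
    by presburger
  then show ?thesis
    by (intro abs_convergent_prod_imp_convergent_prod summable_imp_abs_convergent_prod)
qed

lemma qprod_has_prod: "norm q < 1 \<Longrightarrow> (\<lambda>n. 1 - q ^ n * x) has_prod qprod q x"
  unfolding qprod_def by (intro convergent_prod_has_prod convergent_qprod)

lemma qprod_LIMSEQ: "norm q < 1 \<Longrightarrow> (\<lambda>n. \<Prod>i<n. 1 - q ^ i * x) \<longlonglongrightarrow> qprod q x"
  using convergent_prod_LIMSEQ[OF convergent_qprod, of q x]
  unfolding qprod_def LIMSEQ_lessThan_iff_atMost .

lemma qprod_0 [simp]: "qprod q 0 = 1"
  by (simp add: qprod_def)

lemma qprod_eq_0_iff: "norm q < 1 \<Longrightarrow> qprod q x = 0 \<longleftrightarrow> (\<exists>n. q ^ n * x = 1)"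
  using has_prod_eq_0_iff[OF qprod_has_prod, of q x] by (auto simp: image_iff)

lemma qprod_nonzero:
  assumes "norm q < 1" "norm x < 1"
  shows "qprod q x \<noteq> 0"
proof -
  have "norm (q ^ n * x) < 1" for n
    using mult_right_le_one_le[of "norm x" "norm q ^ n"] assms power_le_one[of "norm q" n]
    by (simp add: norm_mult norm_power mult.commute)
  then have "q ^ n * x \<noteq> 1" for n by (metis norm_one less_irrefl)
  with assms show ?thesis by (simp add: qprod_eq_0_iff)
qed

lemma qprod_rec:
  assumes "norm q < 1"
  shows "qprod q x = (1 - x) * qprod q (q * x)"
proof -
  have "(\<lambda>n. \<Prod>i<Suc n. 1 - q ^ i * x) \<longlonglongrightarrow> qprod q x"
    using qprod_LIMSEQ[OF assms] by (rule LIMSEQ_Suc)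
  moreover have "(\<Prod>i<Suc n. 1 - q ^ i * x) = (1 - x) * (\<Prod>i<n. 1 - q ^ i * (q * x))" for n
    by (subst prod.lessThan_Suc_shift) (simp add: mult_ac)
  moreover have "(\<lambda>n. (1 - x) * (\<Prod>i<n. 1 - q ^ i * (q * x))) \<longlonglongrightarrow> (1 - x) * qprod q (q * x)"
    by (intro tendsto_intros qprod_LIMSEQ assms)
  ultimately show ?thesis by (simp only: LIMSEQ_unique)
qed

lemma qprod_split:
  assumes "norm q < 1"
  shows "qprod q x = qprod (q\<^sup>2) x * qprod (q\<^sup>2) (q * x)"
proof -
  have q2: "norm (q\<^sup>2) < 1" using assms by (simp add: norm_power power_less_one_iff)
  have "strict_mono (\<lambda>n::nat. 2 * n)" by (simp add: strict_mono_def)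
  from LIMSEQ_subseq_LIMSEQ[OF qprod_LIMSEQ[OF assms] this]
  have "(\<lambda>n. \<Prod>i<2*n. 1 - q ^ i * x) \<longlonglongrightarrow> qprod q x" by (simp add: o_def)
  moreover have "(\<Prod>i<2*n. 1 - q ^ i * x)
      = (\<Prod>i<n. 1 - (q\<^sup>2) ^ i * x) * (\<Prod>i<n. 1 - (q\<^sup>2) ^ i * (q * x))" for n
    by (induction n) (simp_all add: power_mult mult_ac flip: power_mult)
  moreover have "(\<lambda>n. (\<Prod>i<n. 1 - (q\<^sup>2) ^ i * x) * (\<Prod>i<n. 1 - (q\<^sup>2) ^ i * (q * x)))
      \<longlonglongrightarrow> qprod (q\<^sup>2) x * qprod (q\<^sup>2) (q * x)"
    by (intro tendsto_intros qprod_LIMSEQ q2)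
  ultimately show ?thesis by (simp only: LIMSEQ_unique)
qed

lemma qprod_mult_minus:
  assumes "norm q < 1"
  shows "qprod q x * qprod q (- x) = qprod (q\<^sup>2) (x\<^sup>2)"
proof -
  have q2: "norm (q\<^sup>2) < 1" using assms by (simp add: norm_power power_less_one_iff)
  have "(\<lambda>n. (\<Prod>i<n. 1 - q ^ i * x) * (\<Prod>i<n. 1 - q ^ i * (- x)))
      \<longlonglongrightarrow> qprod q x * qprod q (- x)"
    by (intro tendsto_intros qprod_LIMSEQ assms)
  moreover have "(\<Prod>i<n. 1 - q ^ i * x) * (\<Prod>i<n. 1 - q ^ i * (- x))
      = (\<Prod>i<n. 1 - (q\<^sup>2) ^ i * x\<^sup>2)" for n
  proof -
    have "(1 - q ^ i * x) * (1 - q ^ i * (- x)) = 1 - (q\<^sup>2) ^ i * x\<^sup>2" for i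
      by (simp add: algebra_simps power2_eq_square flip: power_mult_distrib)
    then show ?thesis by (simp flip: prod.distrib)
  qed
  ultimately show ?thesis
    using qprod_LIMSEQ[OF q2, of "x\<^sup>2"] by (simp only: LIMSEQ_unique)
qed

text \<open>On a closed ball in \<open>S\<close> compactness bounds \<open>norm (a w)\<close> by
  some \<open>r < 1\<close> and \<open>norm (b w)\<close> by \<open>B\<close>, so
  \<open>r ^ n * B\<close> is a Weierstrass majorant and the partial products converge
  uniformly.\<close>

lemma qprod_holomorphic [holomorphic_intros]:
  assumes S: "open S" and a: "a holomorphic_on S" and b: "b holomorphic_on S"
    and lt: "\<And>w. w \<in> S \<Longrightarrow> norm (a w) < 1"
  shows "(\<lambda>w. qprod (a w) (b w)) holomorphic_on S"
proof (rule holomorphic_uniform_sequence[OF S])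
  show "(\<lambda>w. \<Prod>i<n. 1 - a w ^ i * b w) holomorphic_on S" for n
    by (intro holomorphic_intros a b)
next
  fix x assume "x \<in> S"
  then obtain d where d: "d > 0" "cball x d \<subseteq> S" using S open_contains_cball by blast
  have ca: "continuous_on (cball x d) a" "continuous_on (cball x d) b"
    using a b d(2) by (meson continuous_on_subset holomorphic_on_imp_continuous_on)+
  have "continuous_on (cball x d) (\<lambda>w. norm (a w))" by (intro continuous_intros ca)
  from continuous_attains_sup[OF compact_cball _ this] d(1)
  obtain y where y: "y \<in> cball x d" "\<And>w. w \<in> cball x d \<Longrightarrow> norm (a w) \<le> norm (a y)"
    by (metis centre_in_cball empty_iff less_imp_le)
  define r where "r = norm (a y)"
  have r: "r < 1" "r \<ge> 0" using lt y d(2) by (auto simp: r_def)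
  have "bounded (b ` cball x d)"
    by (intro compact_imp_bounded compact_continuous_image ca compact_cball)
  then obtain B where B: "\<And>w. w \<in> cball x d \<Longrightarrow> norm (b w) \<le> B"
    unfolding bounded_iff by blast
  have "uniformly_convergent_on (cball x d) (\<lambda>N w. \<Sum>n<N. norm (1 - a w ^ n * b w - 1))"
  proof (rule Weierstrass_m_test')
    show "norm (norm (1 - a w ^ n * b w - 1)) \<le> r ^ n * B" if "w \<in> cball x d" for w n
    proof -
      have "norm (1 - a w ^ n * b w - 1) = norm (a w) ^ n * norm (b w)"
        by (simp add: norm_mult norm_power)
      also have "\<dots> \<le> r ^ n * B"
        using B[OF that] y(2)[OF that] r by (intro mult_mono power_mono) (auto simp: r_def)
      finally show ?thesis by simp
    qed
    show "summable (\<lambda>n. r ^ n * B)" using r by (intro summable_mult2 summable_geometric) auto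
  qed
  then have uc: "uniformly_convergent_on (cball x d) (\<lambda>N w. \<Prod>n<N. 1 - a w ^ n * b w)"
    by (intro uniformly_convergent_on_prod') (auto intro!: continuous_intros ca)
  then obtain g where g: "uniform_limit (cball x d) (\<lambda>N w. \<Prod>n<N. 1 - a w ^ n * b w) g sequentially"
    by (auto simp: uniformly_convergent_on_def)
  have "g w = qprod (a w) (b w)" if "w \<in> cball x d" for w
    using LIMSEQ_unique[OF tendsto_uniform_limitI[OF g that] qprod_LIMSEQ] lt d(2) that by auto
  then have "uniform_limit (cball x d) (\<lambda>N w. \<Prod>n<N. 1 - a w ^ n * b w) (\<lambda>w. qprod (a w) (b w)) sequentially"
    using g by (subst uniform_limit_cong'[of _ _ "\<lambda>N w. \<Prod>n<N. 1 - a w ^ n * b w" _ g]) auto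
  with d(1,2) show "\<exists>d>0. cball x d \<subseteq> S \<and>
      uniform_limit (cball x d) (\<lambda>N w. \<Prod>i<N. 1 - a w ^ i * b w) (\<lambda>w. qprod (a w) (b w)) sequentially"
    by (intro exI[of _ d] conjI)
qed

lemma qprod_pos:
  assumes "\<bar>q\<bar> < 1" "q \<ge> 0" "\<bar>x\<bar> < 1"
  shows "\<exists>r>0. qprod (of_real q) (of_real x) = of_real r"
proof -
  have pos: "1 - q ^ n * x > 0" for n
  proof -
    have "q ^ n * x \<le> \<bar>q ^ n * x\<bar>" by (rule abs_ge_self)
    also have "\<dots> \<le> \<bar>x\<bar>"
      using assms power_le_one[of q n] by (simp add: abs_mult mult_left_le_one_le)
    finally have "q ^ n * x \<le> \<bar>x\<bar>" .
    with assms show ?thesis by linarith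
  qed
  have "(\<lambda>n. complex_of_real (1 - q ^ n * x)) has_prod qprod (of_real q) (of_real x)"
    using qprod_has_prod[of "complex_of_real q" "of_real x"] assms by simp
  moreover have "convergent_prod (\<lambda>n. 1 - q ^ n * x)"
  proof -
    have "convergent_prod (complex_of_real \<circ> (\<lambda>n. 1 - q ^ n * x))"
      using convergent_qprod[of "complex_of_real q" "of_real x"] assms by (simp add: o_def)
    then show ?thesis by (simp only: convergent_prod_of_real_iff)
  qed
  then obtain p where p: "(\<lambda>n. 1 - q ^ n * x) has_prod p" by blast
  then have "p > 0" by (rule has_prod_pos[OF _ pos])
  moreover have "(\<lambda>n. complex_of_real (1 - q ^ n * x)) has_prod of_real p"
    using p by (simp only: has_prod_of_real_iff)
  ultimately show ?thesis by (metis has_prod_unique2)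
qed

text \<open>After cancelling \<open>qprod q q\<close> this is Euler's identity: the products at the
  three points of order 2 multiply to 1. The factors are paired by \<open>qprod_mult_minus\<close>,
  and \<open>qprod_split\<close> recombines even and odd powers.\<close>

lemma qprod_telescope:
  assumes "norm q < 1" "p\<^sup>2 = q"
  shows "qprod q p * qprod q (- p) * qprod q (- q) * qprod q q = qprod q q"
proof -
  have "qprod q p * qprod q (- p) = qprod (q\<^sup>2) q"
    using qprod_mult_minus[OF assms(1), of p] assms(2) by metis
  moreover have "qprod q (- q) * qprod q q = qprod (q\<^sup>2) (q\<^sup>2)"
    using qprod_mult_minus[OF assms(1), of q] by (simp add: mult.commute)
  moreover have "qprod q q = qprod (q\<^sup>2) q * qprod (q\<^sup>2) (q\<^sup>2)"
    using qprod_split[OF assms(1), of q] by (simp add: power2_eq_square)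
  ultimately show ?thesis by (metis mult.assoc)
qed

text \<open>The product side of the formula for eta at \<open>z + 1/2\<close>. Splitting into even
  and odd exponents expresses the product at \<open>- q\<close> through those at \<open>q\<close>,
  \<open>q^2\<close> and \<open>q^4\<close>.\<close>

lemma qprod_minus_self:
  assumes q: "norm q < 1"
  shows "qprod (- q) (- q) * qprod q q * qprod (q^4) (q^4) = qprod (q\<^sup>2) (q\<^sup>2) ^ 3"
proof -
  have q2: "norm (q\<^sup>2) < 1" using q by (simp add: norm_power power_less_one_iff)
  have "qprod (- q) (- q) = qprod (q\<^sup>2) (- q) * qprod (q\<^sup>2) (q\<^sup>2)"
    using qprod_split[of "-q" "-q"] q by (simp add: power2_eq_square)
  moreover have "qprod q q = qprod (q\<^sup>2) q * qprod (q\<^sup>2) (q\<^sup>2)"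
    using qprod_split[OF q, of q] by (simp add: power2_eq_square)
  moreover have "qprod (q\<^sup>2) q * qprod (q\<^sup>2) (- q) = qprod (q^4) (q\<^sup>2)"
    using qprod_mult_minus[OF q2, of q] by (simp flip: power_mult)
  moreover have "qprod (q\<^sup>2) (q\<^sup>2) = qprod (q^4) (q\<^sup>2) * qprod (q^4) (q^4)"
    using qprod_split[OF q2, of "q\<^sup>2"] by (simp flip: power_mult power_add)
  moreover have "m * p * Z = Y ^ 3"
    if "m = A * Y" "p = B * Y" "B * A = W" "Y = W * Z" for m p A B W Y Z :: complex
  proof -
    have "m * p * Z = (B * A) * Z * Y * Y" by (simp only: that(1,2) mult_ac)
    also have "\<dots> = Y * Y * Y" by (simp only: that(3) flip: that(4))
    finally show ?thesis by (simp add: power3_eq_cube)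
  qed
  ultimately show ?thesis by blast
qed

section \<open>The Klein function\<close>

text \<open>Up to a constant this is theta_1 (u) / eta^3: odd in \<open>u\<close>, with simple zeros
  exactly at the lattice points. The first product contains the factor \<open>1 - nome u\<close>,
  the second starts with \<open>1 - nome (\<tau> - u)\<close>, so each lattice point is a zero of
  exactly one factor.\<close>

definition klein :: "complex \<Rightarrow> complex \<Rightarrow> complex" where
  "klein u \<tau> = nome (- u / 2) * qprod (nome \<tau>) (nome u) * qprod (nome \<tau>) (nome (\<tau> - u))
                / qprod (nome \<tau>) (nome \<tau>) ^ 2"

text \<open>Splitting off the factor that vanishes at \<open>u = 0\<close> makes both the oddness in
  \<open>u\<close> and the derivative at 0 visible.\<close>

lemma klein_alt:
  assumes "Im \<tau> > 0"
  shows "klein u \<tau> = (nome (- u / 2) - nome (u / 2)) * qprod (nome \<tau>) (nome (\<tau> + u))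
           * qprod (nome \<tau>) (nome (\<tau> - u)) / qprod (nome \<tau>) (nome \<tau>) ^ 2"
proof -
  have "nome (- u / 2) * (1 - nome u) = nome (- u / 2) - nome (u / 2)"
    by (simp add: algebra_simps flip: nome_add)
  moreover have "qprod (nome \<tau>) (nome u) = (1 - nome u) * qprod (nome \<tau>) (nome (\<tau> + u))"
    using qprod_rec[of "nome \<tau>" "nome u"] assms by (simp add: norm_nome_less_1_iff nome_add)
  ultimately show ?thesis by (simp add: klein_def mult.assoc [symmetric])
qed

lemma klein_minus:
  assumes "Im \<tau> > 0"
  shows "klein (- u) \<tau> = - klein u \<tau>"
proof -
  define c where "c = qprod (nome \<tau>) (nome (\<tau> + u)) * qprod (nome \<tau>) (nome (\<tau> - u)) / qprod (nome \<tau>) (nome \<tau>) ^ 2"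
  have "klein u \<tau> = (nome (- u / 2) - nome (u / 2)) * c"
    by (simp add: klein_alt[OF assms] c_def)
  moreover have "klein (- u) \<tau> = (nome (u / 2) - nome (- u / 2)) * c"
    by (simp add: klein_alt[OF assms] c_def mult_ac)
  ultimately show ?thesis by (simp only: mult_minus_left [symmetric] minus_diff_eq)
qed

lemma klein_add_1: "klein (u + 1) \<tau> = - klein u \<tau>"
proof -
  have "nome (- (u + 1) / 2) = - nome (- u / 2)"
  proof -
    have "- (u + 1) / 2 = - u / 2 - 1 / 2" by (simp add: field_simps)
    then show ?thesis by (simp only: nome_diff nome_half) simp
  qed
  then show ?thesis by (simp add: klein_def nome_add nome_diff)
qed

lemma klein_add_tau:
  assumes "Im \<tau> > 0"
  shows "klein (u + \<tau>) \<tau> = - nome (- u - \<tau> / 2) * klein u \<tau>"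
proof -
  have q: "norm (nome \<tau>) < 1" using assms by (simp add: norm_nome_less_1_iff)
  define c where "c = qprod (nome \<tau>) (nome (u + \<tau>)) * qprod (nome \<tau>) (nome (\<tau> - u)) / qprod (nome \<tau>) (nome \<tau>) ^ 2"
  have "qprod (nome \<tau>) (nome u) = (1 - nome u) * qprod (nome \<tau>) (nome (u + \<tau>))"
    using qprod_rec[OF q, of "nome u"] by (simp add: nome_add mult.commute)
  then have "klein u \<tau> = nome (- u / 2) * (1 - nome u) * c"
    by (simp add: klein_def c_def)
  moreover have "qprod (nome \<tau>) (nome (- u)) = (1 - nome (- u)) * qprod (nome \<tau>) (nome (\<tau> - u))"
    using qprod_rec[OF q, of "nome (- u)"] by (simp add: nome_diff nome_minus divide_inverse)
  then have "klein (u + \<tau>) \<tau> = nome (- (u + \<tau>) / 2) * (1 - nome (- u)) * c"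
    by (simp add: klein_def c_def)
  moreover have "nome (- (u + \<tau>) / 2) * (1 - nome (- u))
      = - nome (- u - \<tau> / 2) * (nome (- u / 2) * (1 - nome u))"
  proof -
    have "nome (- u - \<tau> / 2) * nome (- u / 2) = nome (- u) * nome (- (u + \<tau>) / 2)"
      unfolding nome_add[symmetric] by (rule arg_cong[of _ _ nome]) (simp add: field_simps)
    moreover have "nome (- u) * nome u = 1" by (simp flip: nome_add)
    moreover have "w * (1 - v) = - a * (b * (1 - x))" if "a * b = v * w" "v * x = 1" for a b v w x :: complex
    proof -
      have "- a * (b * (1 - x)) = - (a * b) + (a * b) * x" by (simp add: algebra_simps)
      also have "\<dots> = w * (1 - v)" using that by (simp add: algebra_simps)
      finally show ?thesis ..
    qed
    ultimately show ?thesis by blast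
  qed
  ultimately show ?thesis by (metis mult.assoc)
qed

lemma klein_tau_add_1: "klein u (\<tau> + 1) = klein u \<tau>"
  by (simp add: klein_def nome_add nome_diff)

lemma klein_eq_0_iff:
  assumes "Im \<tau> > 0"
  shows "klein u \<tau> = 0 \<longleftrightarrow> (\<exists>m n :: int. u = of_int m + of_int n * \<tau>)"
proof -
  have q: "norm (nome \<tau>) < 1" using assms by (simp add: norm_nome_less_1_iff)
  have [simp]: "qprod (nome \<tau>) (nome \<tau>) \<noteq> 0" by (rule qprod_nonzero[OF q q])
  have "klein u \<tau> = 0 \<longleftrightarrow> (\<exists>n. nome (of_nat n * \<tau> + u) = 1) \<or> (\<exists>n. nome (of_nat n * \<tau> + (\<tau> - u)) = 1)"
    by (simp add: klein_def qprod_eq_0_iff[OF q, of "nome u"] qprod_eq_0_iff[OF q, of "nome (\<tau> - u)"]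
        nome_power nome_add)
  also have "\<dots> \<longleftrightarrow> (\<exists>m n :: int. u = of_int m + of_int n * \<tau>)"
  proof safe
    fix n assume "nome (of_nat n * \<tau> + u) = 1"
    then obtain m :: int where m: "of_nat n * \<tau> + u = of_int m"
      unfolding nome_eq_1_iff by (auto elim: Ints_cases)
    have "u = of_int m + of_int (- int n) * \<tau>" by (simp flip: m)
    then show "\<exists>m n :: int. u = of_int m + of_int n * \<tau>" by blast
  next
    fix n assume "nome (of_nat n * \<tau> + (\<tau> - u)) = 1"
    then obtain m :: int where m: "of_nat n * \<tau> + (\<tau> - u) = of_int m"
      unfolding nome_eq_1_iff by (auto elim: Ints_cases)
    have "u = of_int (- m) + of_int (int n + 1) * \<tau>" by (simp add: algebra_simps flip: m)
    then show "\<exists>m n :: int. u = of_int m + of_int n * \<tau>" by blast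
  next
    fix m n :: int
    assume *: "\<nexists>k. nome (of_nat k * \<tau> + (\<tau> - (of_int m + of_int n * \<tau>))) = 1"
    show "\<exists>k. nome (of_nat k * \<tau> + (of_int m + of_int n * \<tau>)) = 1"
    proof (cases "n \<le> 0")
      case True
      then have "of_nat (nat (- n)) * \<tau> + (of_int m + of_int n * \<tau>) = of_int m" by simp
      then show ?thesis by (metis nome_of_int)
    next
      case False
      then have "of_nat (nat (n - 1)) * \<tau> + (\<tau> - (of_int m + of_int n * \<tau>)) = of_int (- m)"
        by (simp add: algebra_simps)
      then show ?thesis using * by (metis nome_of_int)
    qed
  qed
  finally show ?thesis .
qed

lemma klein_holomorphic [holomorphic_intros]:
  assumes "Im \<tau> > 0" "open S" "f holomorphic_on S"
  shows "(\<lambda>u. klein (f u) \<tau>) holomorphic_on S"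
proof -
  have q: "norm (nome \<tau>) < 1" using assms by (simp add: norm_nome_less_1_iff)
  show ?thesis unfolding klein_def
    by (intro holomorphic_intros assms) (use q qprod_nonzero[OF q q] in auto)
qed

text \<open>The derivative at the zero does not depend on \<tau>; this is what fixes the constant in
  \<open>klein_S\<close>.\<close>

lemma klein_over_self_tendsto:
  assumes "Im \<tau> > 0"
  shows "((\<lambda>u. klein u \<tau> / u) \<longlongrightarrow> - 2 * of_real pi * \<i>) (at 0)"
proof -
  have q: "norm (nome \<tau>) < 1" using assms by (simp add: norm_nome_less_1_iff)
  have [simp]: "qprod (nome \<tau>) (nome \<tau>) \<noteq> 0" by (rule qprod_nonzero[OF q q])
  define H where "H u = qprod (nome \<tau>) (nome (\<tau> + u)) * qprod (nome \<tau>) (nome (\<tau> - u))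
           / qprod (nome \<tau>) (nome \<tau>) ^ 2" for u
  have "H holomorphic_on UNIV" unfolding H_def
    by (intro holomorphic_intros) (use q in auto)
  then have "isCont H 0"
    using holomorphic_on_imp_continuous_on continuous_on_eq_continuous_at open_UNIV by blast
  moreover have "H 0 = 1" by (simp add: H_def power2_eq_square)
  ultimately have H: "(H \<longlongrightarrow> 1) (at 0)" by (simp add: isCont_def)
  have "((\<lambda>u. nome (- u / 2) - nome (u / 2)) has_field_derivative (- 2 * of_real pi * \<i>)) (at 0)"
    by (auto intro!: derivative_eq_intros)
  then have "((\<lambda>u. (nome (- u / 2) - nome (u / 2)) / u) \<longlongrightarrow> - 2 * of_real pi * \<i>) (at 0)"
    unfolding has_field_derivative_iff by simp
  from tendsto_mult[OF this H] show ?thesis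
    unfolding H_def klein_alt[OF assms] by (simp add: mult_ac)
qed

lemma periodic_int:
  fixes f :: "complex \<Rightarrow> 'a"
  assumes "\<And>u. f (u + p) = f u"
  shows "f (u + of_int n * p) = f u"
proof (induction n rule: int_induct[of _ 0])
  case (step1 i)
  then show ?case using assms[of "u + of_int i * p"] by (simp add: algebra_simps)
next
  case (step2 i)
  then show ?case using assms[of "u + of_int (i - 1) * p"] by (simp add: algebra_simps)
qed simp

text \<open>The quotient of the two sides is an elliptic function of \<open>u\<close> without poles.\<close>

theorem klein_S:
  assumes \<tau>: "Im \<tau> > 0"
  shows "klein (u / \<tau>) (- 1 / \<tau>) * nome (- (u\<^sup>2) / (2 * \<tau>)) = klein u \<tau> / \<tau>"
proof -
  have \<tau>0: "\<tau> \<noteq> 0" using \<tau> by auto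
  have \<tau>': "Im (- 1 / \<tau>) > 0" using \<tau> by (simp add: Im_divide power2_eq_square sum_squares_gt_zero_iff)
  define N where "N u = klein (u / \<tau>) (- 1 / \<tau>) * nome (- (u\<^sup>2) / (2 * \<tau>))" for u
  \<comment> \<open>At lattice points the quotient receives the value \<open>1 / \<tau>\<close>, its
    limit at 0; periodicity carries the limit to the other lattice points, so the extension is
    entire. The same value is later the constant of Liouville's theorem.\<close>
  define R where "R u = (if klein u \<tau> = 0 then 1 / \<tau> else N u / klein u \<tau>)" for u
  have N_add_1: "N (u + 1) = - N u" for u
  proof -
    define v where "v = u / \<tau> + 1 / \<tau>"
    have "klein (v + (- 1 / \<tau>)) (- 1 / \<tau>) = - nome (- v - (- 1 / \<tau>) / 2) * klein v (- 1 / \<tau>)"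
      by (rule klein_add_tau[OF \<tau>'])
    then have "klein v (- 1 / \<tau>) = - nome (v + (- 1 / \<tau>) / 2) * klein (u / \<tau>) (- 1 / \<tau>)"
      by (simp add: v_def nome_diff nome_minus nome_add)
    moreover have "nome (v + (- 1 / \<tau>) / 2) * nome (- ((u + 1)\<^sup>2) / (2 * \<tau>)) = nome (- (u\<^sup>2) / (2 * \<tau>))"
      unfolding nome_add[symmetric] using \<tau>0
      by (intro arg_cong[of _ _ nome]) (simp add: v_def field_simps power2_eq_square)
    ultimately show ?thesis by (simp add: N_def v_def add_divide_distrib)
  qed
  have N_add_\<tau>: "N (u + \<tau>) = - nome (- u - \<tau> / 2) * N u" for u
  proof -
    have "nome (- ((u + \<tau>)\<^sup>2) / (2 * \<tau>)) = nome (- u - \<tau> / 2) * nome (- (u\<^sup>2) / (2 * \<tau>))"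
      unfolding nome_add[symmetric] using \<tau>0
      by (intro arg_cong[of _ _ nome]) (simp add: field_simps power2_eq_square)
    moreover have "klein ((u + \<tau>) / \<tau>) (- 1 / \<tau>) = - klein (u / \<tau>) (- 1 / \<tau>)"
      using klein_add_1[of "u / \<tau>"] \<tau>0 by (simp add: add_divide_distrib)
    ultimately show ?thesis by (simp add: N_def)
  qed
  have R1: "R (u + 1) = R u" for u
    by (simp add: R_def N_add_1 klein_add_1)
  have R\<tau>: "R (u + \<tau>) = R u" for u
    by (simp add: R_def N_add_\<tau> klein_add_tau[OF \<tau>])
  have per: "R (u + (of_int m + of_int n * \<tau>)) = R u" for u m n
    using periodic_int[of R 1 "u + of_int n * \<tau>" m] periodic_int[of R \<tau> u n] R1 R\<tau>
    by (simp add: algebra_simps)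
  have holN: "N holomorphic_on UNIV"
    unfolding N_def by (intro holomorphic_intros \<tau>') (use \<tau>0 in auto)
  have holk: "(\<lambda>u. klein u \<tau>) holomorphic_on UNIV"
    by (intro holomorphic_intros \<tau>) auto
  have k0: "klein 0 \<tau> = 0" using klein_eq_0_iff[OF \<tau>, of 0] by (metis add_0 mult_zero_left of_int_0)
  have lim0: "(R \<longlongrightarrow> R 0) (at 0)"
  proof -
    have "filterlim (\<lambda>u. u / \<tau>) (at 0) (at 0)"
      using \<tau>0 by (auto simp: filterlim_at eventually_at intro!: tendsto_eq_intros exI[of _ 1])
    from filterlim_compose[OF klein_over_self_tendsto[OF \<tau>'] this]
    have 1: "((\<lambda>u. klein (u / \<tau>) (- 1 / \<tau>) / (u / \<tau>)) \<longlongrightarrow> - 2 * of_real pi * \<i>) (at 0)" .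
    have 2: "((\<lambda>u. nome (- (u\<^sup>2) / (2 * \<tau>)) / \<tau>) \<longlongrightarrow> nome (- (0\<^sup>2) / (2 * \<tau>)) / \<tau>) (at 0)"
      using \<tau>0 by (intro tendsto_intros) auto
    from tendsto_divide[OF tendsto_mult[OF 1 2] klein_over_self_tendsto[OF \<tau>]]
    have "((\<lambda>u. (klein (u / \<tau>) (- 1 / \<tau>) / (u / \<tau>)) * (nome (- (u\<^sup>2) / (2 * \<tau>)) / \<tau>) /
            (klein u \<tau> / u)) \<longlongrightarrow> 1 / \<tau>) (at 0)"
      by simp
    moreover have "\<forall>\<^sub>F u in at 0. klein u \<tau> / u \<noteq> 0"
      using klein_over_self_tendsto[OF \<tau>] by (rule tendsto_imp_eventually_ne) auto
    then have "\<forall>\<^sub>F u in at 0. (klein (u / \<tau>) (- 1 / \<tau>) / (u / \<tau>)) * (nome (- (u\<^sup>2) / (2 * \<tau>)) / \<tau>) /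
            (klein u \<tau> / u) = R u"
      by eventually_elim (use \<tau>0 in \<open>auto simp: R_def N_def field_simps\<close>)
    ultimately show ?thesis using k0 by (simp add: R_def[of 0] Lim_transform_eventually)
  qed
  have hol: "R field_differentiable at w" for w
  proof (cases "klein w \<tau> = 0")
    case False
    have "open {u. klein u \<tau> \<noteq> 0}"
      by (intro open_Collect_neq holomorphic_on_imp_continuous_on[OF holk] continuous_on_const)
    moreover have "(\<lambda>u. N u / klein u \<tau>) holomorphic_on {u. klein u \<tau> \<noteq> 0}"
      by (intro holomorphic_intros holomorphic_on_subset[OF holN] holomorphic_on_subset[OF holk]) auto
    then have "R holomorphic_on {u. klein u \<tau> \<noteq> 0}"
      by (rule holomorphic_transform) (auto simp: R_def)
    ultimately show ?thesis using False by (auto simp: holomorphic_on_open field_differentiable_def)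
  next
    case True
    then obtain m n :: int where w: "w = of_int m + of_int n * \<tau>"
      using klein_eq_0_iff[OF \<tau>] by blast
    have "\<forall>\<^sub>F u in at 0. klein u \<tau> / u \<noteq> 0"
      using klein_over_self_tendsto[OF \<tau>] by (rule tendsto_imp_eventually_ne) auto
    then obtain d where d: "d > 0" "\<And>u. u \<noteq> 0 \<Longrightarrow> dist u 0 < d \<Longrightarrow> klein u \<tau> \<noteq> 0"
      by (auto simp: eventually_at)
    have "(\<lambda>u. N u / klein u \<tau>) holomorphic_on ball 0 d - {0}"
      using d(2) by (intro holomorphic_intros holomorphic_on_subset[OF holN] holomorphic_on_subset[OF holk])
        (auto simp: dist_commute)
    then have "R holomorphic_on ball 0 d - {0}"
      by (rule holomorphic_transform) (use d(2) in \<open>auto simp: R_def dist_commute\<close>)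
    then have "R holomorphic_on ball 0 d"
      using lim0 d(1) by (intro no_isolated_singularity'[of "{0}" R "ball 0 d"])
        (auto simp: at_within_open[of _ "ball 0 d"])
    then have "R field_differentiable at (w - w)"
      using d(1) by (auto simp: holomorphic_on_open field_differentiable_def)
    then obtain D where D: "(R has_field_derivative D) (at (w - w))"
      by (auto simp: field_differentiable_def)
    have "((\<lambda>u. R (u - w)) has_field_derivative D * 1) (at w)"
      by (rule DERIV_chain2[of R D "\<lambda>u. u - w", OF D]) (auto intro!: derivative_eq_intros)
    moreover have "R (u - w) = R u" for u
      using per[of "u - w" m n] by (simp add: w)
    ultimately show ?thesis by (auto simp: field_differentiable_def)
  qed
  then have holR: "R holomorphic_on UNIV"
    by (auto simp: holomorphic_on_def field_differentiable_at_within)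
  have "bounded (range R)"
  proof -
    define K where "K = (\<lambda>p. of_real (fst p) + of_real (snd p) * \<tau>) ` ({0..1::real} \<times> {0..1::real})"
    have "compact K" unfolding K_def
      by (intro compact_continuous_image continuous_intros compact_Times compact_Icc)
    then have "bounded (R ` K)"
      by (intro compact_imp_bounded compact_continuous_image
          continuous_on_subset[OF holomorphic_on_imp_continuous_on[OF holR]]) auto
    moreover have "range R \<subseteq> R ` K"
    proof safe
      fix u
      define y where "y = Im u / Im \<tau>"
      define x where "x = Re u - y * Re \<tau>"
      have u: "u = of_real x + of_real y * \<tau>"
        using \<tau> by (simp add: x_def y_def complex_eq_iff)
      define v where "v = of_real (frac x) + of_real (frac y) * \<tau>"
      have "u = v + (of_int \<lfloor>x\<rfloor> + of_int \<lfloor>y\<rfloor> * \<tau>)"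
        by (simp add: u v_def frac_def algebra_simps)
      then have "R u = R v" by (simp add: per)
      moreover have "v \<in> K" unfolding K_def v_def
        by (intro image_eqI[of _ _ "(frac x, frac y)"]) (auto simp: frac_ge_0 less_imp_le frac_lt_1)
      ultimately show "R u \<in> R ` K" by blast
    qed
    ultimately show ?thesis by (rule bounded_subset)
  qed
  from Liouville_theorem[OF holR this] obtain C where C: "\<And>u. R u = C"
    by (auto simp: constant_on_def)
  have RC: "R u = 1 / \<tau>" for u using C[of u] C[of 0] k0 by (simp add: R_def)
  show ?thesis
  proof (cases "klein u \<tau> = 0")
    case False
    then show ?thesis using RC[of u] by (simp add: R_def N_def field_simps)
  next
    case True
    then obtain m n :: int where "u = of_int m + of_int n * \<tau>"
      using klein_eq_0_iff[OF \<tau>] by blast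
    then have "u / \<tau> = of_int n + of_int (- m) * (- 1 / \<tau>)" using \<tau>0 by (simp add: field_simps)
    then have "klein (u / \<tau>) (- 1 / \<tau>) = 0" using klein_eq_0_iff[OF \<tau>'] by blast
    with True show ?thesis by simp
  qed
qed

section \<open>Moebius transformations with integral coefficients\<close>

definition moebius_int :: "int \<Rightarrow> int \<Rightarrow> int \<Rightarrow> int \<Rightarrow> complex \<Rightarrow> complex" where
  "moebius_int a b c d z = (of_int a * z + of_int b) / (of_int c * z + of_int d)"

lemma int_linear_nonzero:
  assumes "Im z > 0" "c \<noteq> 0 \<or> d \<noteq> 0"
  shows "of_int c * z + of_int d \<noteq> 0"
proof
  assume eq: "of_int c * z + of_int d = 0"
  from arg_cong[OF eq, of Im] assms(1) have "c = 0" by simp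
  with eq assms(2) show False by simp
qed

lemma det_1_nonzero:
  fixes a b c d :: int
  assumes "a * d - b * c = 1"
  shows "c \<noteq> 0 \<or> d \<noteq> 0" "a \<noteq> 0 \<or> b \<noteq> 0"
  using assms by auto

lemma Im_moebius_int:
  assumes "Im z > 0" "a * d - b * c = 1"
  shows "Im (moebius_int a b c d z) = Im z / norm (of_int c * z + of_int d) ^ 2"
proof -
  have "Im ((of_int a * z + of_int b) * cnj (of_int c * z + of_int d)) = of_int (a * d - b * c) * Im z"
    by (simp add: algebra_simps)
  then show ?thesis
    unfolding moebius_int_def complex_div_cnj[of "_ + _"] using assms(2)
    by (simp del: complex_cnj_add complex_cnj_mult flip: of_real_power)
qed

lemma Im_moebius_int_pos:
  assumes "Im z > 0" "a * d - b * c = 1"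
  shows "Im (moebius_int a b c d z) > 0"
  using int_linear_nonzero[OF assms(1) det_1_nonzero(1)[OF assms(2)]] assms
  by (simp add: Im_moebius_int)

lemma moebius_int_T:
  assumes "Im z > 0" "a * d - b * c = 1"
  shows "moebius_int (a + n * c) (b + n * d) c d z = moebius_int a b c d z + of_int n"
  using int_linear_nonzero[OF assms(1) det_1_nonzero(1)[OF assms(2)]]
  by (simp add: moebius_int_def field_simps)

lemma moebius_int_S:
  assumes "Im z > 0" "a * d - b * c = 1"
  shows "moebius_int (- c) (- d) a b z = - 1 / moebius_int a b c d z"
  using int_linear_nonzero[OF assms(1) det_1_nonzero(1)[OF assms(2)]]
    int_linear_nonzero[OF assms(1) det_1_nonzero(2)[OF assms(2)]]
  by (simp add: moebius_int_def field_simps)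

lemma moebius_int_compose:
  assumes "Im z > 0" "a * d - b * c = 1"
  shows "moebius_int a' b' c' d' (moebius_int a b c d z)
           = moebius_int (a' * a + b' * c) (a' * b + b' * d) (c' * a + d' * c) (c' * b + d' * d) z"
    and "(of_int c' * moebius_int a b c d z + of_int d') * (of_int c * z + of_int d)
           = of_int (c' * a + d' * c) * z + of_int (c' * b + d' * d)"
proof -
  let ?j = "of_int c * z + of_int d"
  have j: "?j \<noteq> 0" by (rule int_linear_nonzero[OF assms(1) det_1_nonzero(1)[OF assms(2)]])
  have *: "(of_int x * moebius_int a b c d z + of_int y) * ?j
      = of_int (x * a + y * c) * z + of_int (x * b + y * d)" for x y
    using j by (simp add: moebius_int_def distrib_right) (simp add: algebra_simps)
  show "(of_int c' * moebius_int a b c d z + of_int d') * ?j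
           = of_int (c' * a + d' * c) * z + of_int (c' * b + d' * d)" by (rule *)
  show "moebius_int a' b' c' d' (moebius_int a b c d z)
           = moebius_int (a' * a + b' * c) (a' * b + b' * d) (c' * a + d' * c) (c' * b + d' * d) z"
    unfolding moebius_int_def[of a' b' c' d'] moebius_int_def[of "_ + _"] *[symmetric]
    using j by simp
qed

text \<open>The Euclidean algorithm on the first column. Translations reduce \<open>a\<close> modulo
  \<open>c\<close>, \<open>step\<close> has to lower \<open>|c|\<close>, and at \<open>c = 0\<close>
  only 1 and -1 times a translation remain. The invariant \<open>I\<close> is kept abstract so that
  the full modular group and its subgroups share the argument.\<close>

lemma translation_descent:
  fixes Q I :: "int \<Rightarrow> int \<Rightarrow> int \<Rightarrow> int \<Rightarrow> bool"
  assumes I_det: "\<And>a b c d. I a b c d \<Longrightarrow> a * d - b * c = 1"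
    and I_T: "\<And>a b c d n. I a b c d \<Longrightarrow> I (a + n * c) (b + n * d) c d"
    and Q_T: "\<And>a b c d n. I a b c d \<Longrightarrow> Q a b c d \<Longrightarrow> Q (a + n * c) (b + n * d) c d"
    and base: "Q 1 0 0 1" "Q (-1) 0 0 (-1)"
    and step: "\<And>a b c d. I a b c d \<Longrightarrow> c \<noteq> 0 \<Longrightarrow> 2 * \<bar>a\<bar> \<le> \<bar>c\<bar> \<Longrightarrow>
       \<exists>a' b' c' d'. I a' b' c' d' \<and> \<bar>c'\<bar> < \<bar>c\<bar> \<and> (Q a' b' c' d' \<longrightarrow> Q a b c d)"
  shows "I a b c d \<Longrightarrow> Q a b c d"
proof (induction "nat \<bar>c\<bar>" arbitrary: a b c d rule: less_induct)
  case less
  show ?case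
  proof (cases "c = 0")
    case True
    have "a * d = 1" using I_det[OF less.prems] True by simp
    then consider "a = 1" "d = 1" | "a = -1" "d = -1" using zmult_eq_1_iff by blast
    then show ?thesis
    proof cases
      case 1
      have "I 1 0 0 1" using I_T[OF less.prems, of "- b"] 1 True by simp
      from Q_T[OF this base(1), of b] 1 True show ?thesis by simp
    next
      case 2
      have "I (-1) 0 0 (-1)" using I_T[OF less.prems, of b] 2 True by simp
      from Q_T[OF this base(2), of "- b"] 2 True show ?thesis by simp
    qed
  next
    case False
    obtain n where n: "2 * \<bar>a + n * c\<bar> \<le> \<bar>c\<bar>"
    proof -
      \<comment> \<open>The residue of least absolute value is \<open>r\<close> or
        \<open>r - |c|\<close>; \<open>sgn c\<close> accounts for a negative
        \<open>c\<close>.\<close>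
      obtain k r where r: "0 \<le> r" "r < \<bar>c\<bar>" and ak: "a = \<bar>c\<bar> * k + r"
        using False that[of "a mod \<bar>c\<bar>" "a div \<bar>c\<bar>"] by simp
      have a: "r = a + (- (sgn c * k)) * c" and a': "r - \<bar>c\<bar> = a + (- (sgn c * k) - sgn c) * c"
        using False by (cases "c > 0"; simp add: ak algebra_simps)+
      show ?thesis
      proof (cases "2 * r \<le> \<bar>c\<bar>")
        case True
        then have "2 * \<bar>a + (- (sgn c * k)) * c\<bar> \<le> \<bar>c\<bar>"
          unfolding a[symmetric] using r(1) by simp
        then show ?thesis by (rule that)
      next
        case F: False
        then have "2 * \<bar>a + (- (sgn c * k) - sgn c) * c\<bar> \<le> \<bar>c\<bar>"
          unfolding a'[symmetric] using r by simp
        then show ?thesis by (rule that)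
      qed
    qed
    have I: "I (a + n * c) (b + n * d) c d" by (rule I_T[OF less.prems])
    obtain a' b' c' d' where "I a' b' c' d'" "\<bar>c'\<bar> < \<bar>c\<bar>"
      "Q a' b' c' d' \<longrightarrow> Q (a + n * c) (b + n * d) c d"
      using step[OF I False n] by blast
    with less.hyps[of c' a' b' d'] have "Q (a + n * c) (b + n * d) c d" by simp
    from Q_T[OF I this, of "- n"] show ?thesis by simp
  qed
qed

text \<open>With \<open>2 |a| <= |c|\<close> and \<open>c\<close> nonzero, the inversion makes
  \<open>|a| < |c|\<close> the absolute value of the lower left entry, so it serves as the step of
  the descent.\<close>

lemma SL2_induct:
  fixes Q :: "int \<Rightarrow> int \<Rightarrow> int \<Rightarrow> int \<Rightarrow> bool"
  assumes "a * d - b * c = 1"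
    and base: "Q 1 0 0 1" "Q (-1) 0 0 (-1)"
    and T: "\<And>a b c d n. a * d - b * c = 1 \<Longrightarrow> Q a b c d \<Longrightarrow> Q (a + n * c) (b + n * d) c d"
    and S: "\<And>a b c d. a * d - b * c = 1 \<Longrightarrow> Q a b c d \<Longrightarrow> Q (- c) (- d) a b"
  shows "Q a b c d"
proof (rule translation_descent[where I = "\<lambda>a b c d. a * d - b * c = 1"])
  fix a b c d :: int
  assume *: "a * d - b * c = 1" "c \<noteq> 0" "2 * \<bar>a\<bar> \<le> \<bar>c\<bar>"
  then have "c * (- b) - d * (- a) = 1" by (simp add: algebra_simps)
  from S[OF this] * this show "\<exists>a' b' c' d'. a' * d' - b' * c' = 1 \<and> \<bar>c'\<bar> < \<bar>c\<bar> \<and> (Q a' b' c' d' \<longrightarrow> Q a b c d)"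
    by (intro exI[of _ c] exI[of _ d] exI[of _ "- a"] exI[of _ "- b"]) auto
qed (use assms in \<open>auto simp: algebra_simps\<close>)

section \<open>Klein forms\<close>

text \<open>The Klein form with characteristic \<open>(x, y)\<close>. The quadratic exponential
  absorbs the Gaussian factor of \<open>klein_S\<close>, which leaves weight -1 without any
  multiplier.\<close>

definition klein_form :: "real \<Rightarrow> real \<Rightarrow> complex \<Rightarrow> complex" where
  "klein_form x y \<tau> = nome (of_real x * (of_real x * \<tau> + of_real y) / 2) * klein (of_real x * \<tau> + of_real y) \<tau>"

lemma klein_form_eq:
  "of_real x * \<tau> + of_real y = u \<Longrightarrow> klein_form x y \<tau> = nome (of_real x * u / 2) * klein u \<tau>"
  by (auto simp: klein_form_def)

lemma klein_form_T: "klein_form x y (\<tau> + 1) = klein_form x (x + y) \<tau>"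
proof -
  define u where "u = of_real x * \<tau> + of_real (x + y)"
  have "of_real x * (\<tau> + 1) + of_real y = u" by (simp add: u_def algebra_simps)
  then show ?thesis
    using klein_form_eq[of x "\<tau> + 1" y u] klein_form_eq[of x \<tau> "x + y" u] by (simp add: u_def klein_tau_add_1)
qed

lemma klein_form_T_int: "klein_form x y (\<tau> + of_int n) = klein_form x (of_int n * x + y) \<tau>"
proof (induction n arbitrary: y rule: int_induct[of _ 0])
  case (step1 i)
  have "klein_form x y (\<tau> + of_int (i + 1)) = klein_form x (x + y) (\<tau> + of_int i)"
    using klein_form_T[of x y "\<tau> + of_int i"] by (simp add: add_ac)
  then show ?case using step1(2)[of "x + y"] by (simp add: algebra_simps)
next
  case (step2 i)
  have "klein_form x (y - x) (\<tau> + of_int i) = klein_form x y (\<tau> + of_int (i - 1))"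
    using klein_form_T[of x "y - x" "\<tau> + of_int (i - 1)"] by (simp add: algebra_simps)
  then show ?case using step2(2)[of "y - x"] by (simp add: algebra_simps)
qed simp

lemma klein_form_S:
  assumes "Im \<tau> > 0"
  shows "klein_form x y (- 1 / \<tau>) = klein_form y (- x) \<tau> / \<tau>"
proof -
  have \<tau>0: "\<tau> \<noteq> 0" using assms by auto
  define u where "u = of_real y * \<tau> - of_real x"
  have 1: "of_real x * (- 1 / \<tau>) + of_real y = u / \<tau>" using \<tau>0 by (simp add: u_def field_simps)
  have 2: "of_real y * \<tau> + of_real (- x) = u" by (simp add: u_def)
  have "nome (- (u\<^sup>2) / (2 * \<tau>)) * nome (u\<^sup>2 / (2 * \<tau>)) = 1" by (simp flip: nome_add)
  then have "klein (u / \<tau>) (- 1 / \<tau>) = nome (u\<^sup>2 / (2 * \<tau>)) * (klein u \<tau> / \<tau>)"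
    unfolding klein_S[OF assms, symmetric] by (simp add: mult_ac)
  moreover have "nome (of_real x * (u / \<tau>) / 2) * nome (u\<^sup>2 / (2 * \<tau>)) = nome (of_real y * u / 2)"
    unfolding nome_add[symmetric] using \<tau>0
    by (intro arg_cong[of _ _ nome]) (simp add: u_def field_simps power2_eq_square)
  ultimately show ?thesis unfolding klein_form_def 1 2
    by (simp add: mult.assoc [symmetric])
qed

lemma klein_form_minus:
  assumes "Im \<tau> > 0"
  shows "klein_form (- x) (- y) \<tau> = - klein_form x y \<tau>"
proof -
  define u where "u = of_real x * \<tau> + of_real y"
  have "of_real (- x) * \<tau> + of_real (- y) = - u" by (simp add: u_def)
  from klein_form_eq[OF this] klein_form_eq[OF u_def[symmetric]] show ?thesis
    by (simp add: klein_minus[OF assms])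
qed

lemma klein_form_right_add_1: "klein_form x (y + 1) \<tau> = - nome (of_real x / 2) * klein_form x y \<tau>"
proof -
  define u where "u = of_real x * \<tau> + of_real y"
  have "of_real x * \<tau> + of_real (y + 1) = u + 1" by (simp add: u_def)
  moreover have "nome (of_real x * (u + 1) / 2) = nome (of_real x / 2) * nome (of_real x * u / 2)"
    unfolding nome_add[symmetric] by (intro arg_cong[of _ _ nome]) (simp add: field_simps)
  ultimately show ?thesis
    using klein_form_eq[of x \<tau> "y + 1" "u + 1"] klein_form_eq[OF u_def[symmetric]] by (simp add: klein_add_1)
qed

lemma klein_form_left_add_1:
  assumes "Im \<tau> > 0"
  shows "klein_form (x + 1) y \<tau> = - nome (- of_real y / 2) * klein_form x y \<tau>"
proof -
  define u where "u = of_real x * \<tau> + of_real y"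
  have "of_real (x + 1) * \<tau> + of_real y = u + \<tau>" by (simp add: u_def algebra_simps)
  moreover have "nome (of_real (x + 1) * (u + \<tau>) / 2) * nome (- u - \<tau> / 2)
     = nome (- of_real y / 2) * nome (of_real x * u / 2)"
    unfolding nome_add[symmetric] by (intro arg_cong[of _ _ nome]) (simp add: u_def field_simps)
  ultimately show ?thesis
    using klein_form_eq[of "x + 1" \<tau> y] klein_form_eq[OF u_def[symmetric]]
    by (simp only: klein_add_tau[OF assms]) (simp flip: mult.assoc)
qed

text \<open>The characteristic is a row vector on which the matrix acts from the right. No root of
  unity occurs here; they enter only when a characteristic is reduced modulo integers.\<close>

theorem klein_form_moebius:
  assumes "a * d - b * c = 1" "Im \<tau> > 0"
  shows "klein_form x y (moebius_int a b c d \<tau>) * (of_int c * \<tau> + of_int d)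
           = klein_form (of_int a * x + of_int c * y) (of_int b * x + of_int d * y) \<tau>"
proof -
  define Q where "Q a b c d \<longleftrightarrow> (\<forall>x y. \<forall>\<tau>. Im \<tau> > 0 \<longrightarrow>
      klein_form x y (moebius_int a b c d \<tau>) * (of_int c * \<tau> + of_int d)
           = klein_form (of_int a * x + of_int c * y) (of_int b * x + of_int d * y) \<tau>)"
    for a b c d :: int
  have "Q a b c d"
  proof (rule SL2_induct[OF assms(1)])
    show "Q 1 0 0 1" by (simp add: Q_def moebius_int_def)
    show "Q (-1) 0 0 (-1)" by (simp add: Q_def moebius_int_def klein_form_minus)
  next
    fix a b c d n :: int
    assume det: "a * d - b * c = 1" and Q: "Q a b c d"
    show "Q (a + n * c) (b + n * d) c d"
      unfolding Q_def
    proof (intro allI impI)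
      fix x y and \<tau> :: complex assume \<tau>: "Im \<tau> > 0"
      show "klein_form x y (moebius_int (a + n * c) (b + n * d) c d \<tau>) * (of_int c * \<tau> + of_int d) =
        klein_form (of_int (a + n * c) * x + of_int c * y) (of_int (b + n * d) * x + of_int d * y) \<tau>"
        using Q[unfolded Q_def, rule_format, OF \<tau>, of x "of_int n * x + y"]
        unfolding moebius_int_T[OF \<tau> det] klein_form_T_int by (simp add: algebra_simps)
    qed
  next
    fix a b c d :: int
    assume det: "a * d - b * c = 1" and Q: "Q a b c d"
    show "Q (- c) (- d) a b"
      unfolding Q_def
    proof (intro allI impI)
      fix x y and \<tau> :: complex assume \<tau>: "Im \<tau> > 0"
      define w where "w = moebius_int a b c d \<tau>"
      have w: "Im w > 0" unfolding w_def by (rule Im_moebius_int_pos[OF \<tau> det])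
      have nz: "of_int a * \<tau> + of_int b \<noteq> 0" "of_int c * \<tau> + of_int d \<noteq> 0"
        using int_linear_nonzero[OF \<tau>] det_1_nonzero[OF det] by auto
      have "klein_form x y (- 1 / w) * (of_int a * \<tau> + of_int b)
          = klein_form y (- x) w * (of_int c * \<tau> + of_int d)"
        unfolding klein_form_S[OF w] using nz by (simp add: w_def moebius_int_def)
      also have "\<dots> = klein_form (of_int a * y + of_int c * (- x)) (of_int b * y + of_int d * (- x)) \<tau>"
        unfolding w_def using Q[unfolded Q_def, rule_format, OF \<tau>] .
      finally show "klein_form x y (moebius_int (- c) (- d) a b \<tau>) * (of_int a * \<tau> + of_int b) =
        klein_form (of_int (- c) * x + of_int a * y) (of_int (- d) * x + of_int b * y) \<tau>"
        unfolding moebius_int_S[OF \<tau> det] w_def by (simp add: algebra_simps)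
    qed
  qed
  then show ?thesis using assms(2) by (simp add: Q_def)
qed

section \<open>The sixth power of the eta function\<close>

lemma dedekind_eta_eq: "dedekind_eta z = nome (z / 24) * qprod (nome z) (nome z)"
proof -
  have "exp (2 * of_real pi * \<i> * of_nat (Suc n) * z) = nome (of_nat (Suc n) * z)" for n
    by (simp only: nome_def mult_ac)
  then have "exp (2 * of_real pi * \<i> * of_nat (Suc n) * z) = nome z ^ n * nome z" for n
    by (simp only: power_Suc2 flip: nome_power)
  then show ?thesis by (simp add: dedekind_eta_def qprod_def nome_def mult_ac)
qed

lemma dedekind_eta_nonzero: "Im z > 0 \<Longrightarrow> dedekind_eta z \<noteq> 0"
  by (simp add: dedekind_eta_eq qprod_nonzero norm_nome_less_1_iff)

lemma dedekind_eta_holomorphic [holomorphic_intros]: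
  assumes "open S" "f holomorphic_on S" "\<And>z. z \<in> S \<Longrightarrow> Im (f z) > 0"
  shows "(\<lambda>z. dedekind_eta (f z)) holomorphic_on S"
  unfolding dedekind_eta_eq using assms
  by (intro holomorphic_intros) (auto simp: norm_nome_less_1_iff)

text \<open>Up to powers of \<open>q\<close> and constants, the three Klein forms are the squares of
  \<open>qprod q p\<close>, \<open>qprod q (- q)\<close> and \<open>qprod q (- p)\<close> with
  \<open>p^2 = q\<close>, each divided by \<open>qprod q q ^ 2\<close>. The numerators multiply to 1
  by \<open>qprod_telescope\<close>, and the sixth power of eta cancels the denominators.\<close>

lemma klein_form_2_torsion:
  assumes "Im \<tau> > 0"
  shows "klein_form (1/2) 0 \<tau> * klein_form 0 (1/2) \<tau> * klein_form (1/2) (1/2) \<tau> * dedekind_eta \<tau> ^ 6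
           = 2 * nome (- 3 / 8)"
proof -
  have q: "norm (nome \<tau>) < 1" using assms by (simp add: norm_nome_less_1_iff)
  define Q where "Q = qprod (nome \<tau>) (nome \<tau>)"
  define p where "p = nome (\<tau> / 2)"
  have Q0: "Q \<noteq> 0" unfolding Q_def by (rule qprod_nonzero[OF q q])
  have p: "p\<^sup>2 = nome \<tau>" by (simp add: p_def nome_power)
  have half: "nome (\<tau> / 2 + 1 / 2) = - p" "nome (1 / 2 + \<tau> / 2) = - p" "nome (\<tau> / 2 - 1 / 2) = - p"
      "nome (\<tau> - 1 / 2) = - nome \<tau>"
    by (simp_all add: nome_add nome_diff nome_half p_def)
  have m1: "qprod (nome \<tau>) (- 1) = 2 * qprod (nome \<tau>) (- nome \<tau>)"
    using qprod_rec[OF q, of "- 1"] by simp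
  have 1: "klein_form (1/2) 0 \<tau> = nome (- \<tau> / 8) * qprod (nome \<tau>) p ^ 2 / Q\<^sup>2"
  proof -
    have "nome (\<tau> / 8) * nome (- \<tau> / 4) = nome (- \<tau> / 8)"
      unfolding nome_add[symmetric] by (intro arg_cong[of _ _ nome]) simp
    moreover have "\<tau> - \<tau> / 2 = \<tau> / 2" by simp
    ultimately show ?thesis
      by (simp add: klein_form_def klein_def Q_def p_def power2_eq_square mult_ac)
  qed
  have 2: "klein_form 0 (1/2) \<tau> = 2 * nome (- 1 / 4) * qprod (nome \<tau>) (- nome \<tau>) ^ 2 / Q\<^sup>2"
    by (simp add: klein_form_def klein_def Q_def nome_half half m1 power2_eq_square)
  have 3: "klein_form (1/2) (1/2) \<tau> = nome (- \<tau> / 8 - 1 / 8) * qprod (nome \<tau>) (- p) ^ 2 / Q\<^sup>2"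
  proof -
    have "nome ((\<tau> / 2 + 1 / 2) / 4) * nome (- (\<tau> / 2 + 1 / 2) / 2) = nome (- \<tau> / 8 - 1 / 8)"
      unfolding nome_add[symmetric] by (intro arg_cong[of _ _ nome]) (simp add: field_simps)
    moreover have "\<tau> - (\<tau> / 2 + 1 / 2) = \<tau> / 2 - 1 / 2" by simp
    ultimately show ?thesis
      by (simp add: klein_form_def klein_def Q_def half power2_eq_square mult_ac)
  qed
  have tel: "qprod (nome \<tau>) p * qprod (nome \<tau>) (- p) * qprod (nome \<tau>) (- nome \<tau>) = 1"
    using qprod_telescope[OF q p] Q0 by (simp add: Q_def)
  have e: "nome (- \<tau> / 8) * nome (- 1 / 4) * nome (- \<tau> / 8 - 1 / 8) * nome (\<tau> / 4) = nome (- 3 / 8)"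
    unfolding nome_add[symmetric] by (intro arg_cong[of _ _ nome]) (simp add: field_simps)
  have eta: "dedekind_eta \<tau> ^ 6 = nome (\<tau> / 4) * Q ^ 6"
    by (simp add: dedekind_eta_eq Q_def power_mult_distrib nome_power)
  have "klein_form (1/2) 0 \<tau> * klein_form 0 (1/2) \<tau> * klein_form (1/2) (1/2) \<tau> * dedekind_eta \<tau> ^ 6
      = 2 * (nome (- \<tau> / 8) * nome (- 1 / 4) * nome (- \<tau> / 8 - 1 / 8) * nome (\<tau> / 4)) *
        (qprod (nome \<tau>) p * qprod (nome \<tau>) (- p) * qprod (nome \<tau>) (- nome \<tau>)) ^ 2 * (Q ^ 6 / (Q\<^sup>2 * Q\<^sup>2 * Q\<^sup>2))"
    unfolding 1 2 3 eta by (simp add: power_mult_distrib)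
  also have "\<dots> = 2 * nome (- 3 / 8)"
    unfolding e tel using Q0 by (simp flip: power_add)
  finally show ?thesis .
qed

lemma dedekind_eta_T_pow6: "dedekind_eta (z + of_int n) ^ 6 = nome (of_int n / 4) * dedekind_eta z ^ 6"
proof -
  have "nome ((z + of_int n) / 24) ^ 6 = nome (of_int n / 4) * nome (z / 24) ^ 6"
    unfolding nome_power nome_add[symmetric] by (intro arg_cong[of _ _ nome]) (simp add: field_simps)
  then show ?thesis
    by (simp add: dedekind_eta_eq power_mult_distrib nome_add[of z])
qed

text \<open>The inversion permutes the half-periods up to sign, except that
  \<open>(1/2, 1/2)\<close> goes to \<open>(1/2, - 1/2)\<close>; returning costs a factor
  \<open>nome (1/4)\<close>, that is i, up to sign.\<close>

lemma dedekind_eta_S_pow6: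
  assumes z: "Im z > 0"
  shows "dedekind_eta (- 1 / z) ^ 6 = nome (1 / 4) * z ^ 3 * dedekind_eta z ^ 6"
proof -
  have z0: "z \<noteq> 0" using z by auto
  have z': "Im (- 1 / z) > 0" using z by (simp add: Im_divide power2_eq_square sum_squares_gt_zero_iff)
  define P where "P \<tau> = klein_form (1/2) 0 \<tau> * klein_form 0 (1/2) \<tau> * klein_form (1/2) (1/2) \<tau>" for \<tau>
  have 1: "klein_form (1/2) 0 (- 1 / z) = - klein_form 0 (1/2) z / z"
    using klein_form_S[OF z, of "1/2" 0] klein_form_minus[OF z, of 0 "1/2"] by simp
  have 2: "klein_form 0 (1/2) (- 1 / z) = klein_form (1/2) 0 z / z"
    using klein_form_S[OF z, of 0 "1/2"] by simp
  have "klein_form (1/2) (1/2) z = - nome (1/4) * klein_form (1/2) (- (1/2)) z"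
    using klein_form_right_add_1[of "1/2" "- (1/2)" z] by simp
  then have 3: "nome (1/4) * klein_form (1/2) (1/2) (- 1 / z) = - klein_form (1/2) (1/2) z / z"
    using klein_form_S[OF z, of "1/2" "1/2"] by simp
  have "nome (1/4) * P (- 1 / z) = klein_form (1/2) 0 (- 1 / z) * klein_form 0 (1/2) (- 1 / z) *
      (nome (1/4) * klein_form (1/2) (1/2) (- 1 / z))"
    by (simp add: P_def)
  also have "\<dots> = P z / z ^ 3"
    unfolding 1 2 3 by (simp add: P_def power3_eq_cube)
  finally have P: "nome (1/4) * P (- 1 / z) = P z / z ^ 3" .
  have E: "P (- 1 / z) * dedekind_eta (- 1 / z) ^ 6 = P z * dedekind_eta z ^ 6"
    using klein_form_2_torsion[OF z] klein_form_2_torsion[OF z'] by (simp add: P_def)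
  have P0: "P z \<noteq> 0" using klein_form_2_torsion[OF z] by (auto simp: P_def)
  have "P z / z ^ 3 * dedekind_eta (- 1 / z) ^ 6 = nome (1/4) * (P z * dedekind_eta z ^ 6)"
    unfolding P[symmetric] E[symmetric] by simp
  with P0 z0 show ?thesis by (simp add: field_simps)
qed

text \<open>The constant is a fourth root of unity but is left open: only the exponents at the cusps
  are used later.\<close>

theorem dedekind_eta_moebius_pow6:
  assumes "a * d - b * c = 1"
  shows "\<exists>C. C \<noteq> 0 \<and> (\<forall>z. Im z > 0 \<longrightarrow>
           dedekind_eta (moebius_int a b c d z) ^ 6 = C * (of_int c * z + of_int d) ^ 3 * dedekind_eta z ^ 6)"
proof (rule SL2_induct[OF assms])
  show "\<exists>C. C \<noteq> 0 \<and> (\<forall>z. Im z > 0 \<longrightarrow>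
           dedekind_eta (moebius_int 1 0 0 1 z) ^ 6 = C * (of_int 0 * z + of_int 1) ^ 3 * dedekind_eta z ^ 6)"
    by (intro exI[of _ 1]) (simp add: moebius_int_def)
  show "\<exists>C. C \<noteq> 0 \<and> (\<forall>z. Im z > 0 \<longrightarrow>
           dedekind_eta (moebius_int (-1) 0 0 (-1) z) ^ 6 = C * (of_int 0 * z + of_int (-1)) ^ 3 * dedekind_eta z ^ 6)"
    by (intro exI[of _ "-1"]) (simp add: moebius_int_def)
next
  fix a b c d n :: int
  assume det: "a * d - b * c = 1"
    and "\<exists>C. C \<noteq> 0 \<and> (\<forall>z. Im z > 0 \<longrightarrow>
           dedekind_eta (moebius_int a b c d z) ^ 6 = C * (of_int c * z + of_int d) ^ 3 * dedekind_eta z ^ 6)"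
  then obtain C where "C \<noteq> 0" and C: "\<And>z. Im z > 0 \<Longrightarrow>
      dedekind_eta (moebius_int a b c d z) ^ 6 = C * (of_int c * z + of_int d) ^ 3 * dedekind_eta z ^ 6"
    by blast
  then show "\<exists>C. C \<noteq> 0 \<and> (\<forall>z. Im z > 0 \<longrightarrow> dedekind_eta (moebius_int (a + n * c) (b + n * d) c d z) ^ 6
           = C * (of_int c * z + of_int d) ^ 3 * dedekind_eta z ^ 6)"
    by (intro exI[of _ "nome (of_int n / 4) * C"])
       (simp add: moebius_int_T[OF _ det] dedekind_eta_T_pow6 mult.assoc del: of_int_add of_int_mult)
next
  fix a b c d :: int
  assume det: "a * d - b * c = 1"
    and "\<exists>C. C \<noteq> 0 \<and> (\<forall>z. Im z > 0 \<longrightarrow>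
           dedekind_eta (moebius_int a b c d z) ^ 6 = C * (of_int c * z + of_int d) ^ 3 * dedekind_eta z ^ 6)"
  then obtain C where "C \<noteq> 0" and C: "\<And>z. Im z > 0 \<Longrightarrow>
      dedekind_eta (moebius_int a b c d z) ^ 6 = C * (of_int c * z + of_int d) ^ 3 * dedekind_eta z ^ 6"
    by blast
  show "\<exists>C. C \<noteq> 0 \<and> (\<forall>z. Im z > 0 \<longrightarrow> dedekind_eta (moebius_int (- c) (- d) a b z) ^ 6
           = C * (of_int a * z + of_int b) ^ 3 * dedekind_eta z ^ 6)"
  proof (intro exI[of _ "nome (1 / 4) * C"] conjI allI impI)
    fix z :: complex assume z: "Im z > 0"
    have "of_int c * z + of_int d \<noteq> 0" using int_linear_nonzero[OF z] det_1_nonzero[OF det] by auto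
    then have "(moebius_int a b c d z * (of_int c * z + of_int d)) ^ 3 = (of_int a * z + of_int b) ^ 3"
      by (simp add: moebius_int_def)
    then show "dedekind_eta (moebius_int (- c) (- d) a b z) ^ 6
        = nome (1 / 4) * C * (of_int a * z + of_int b) ^ 3 * dedekind_eta z ^ 6"
      unfolding moebius_int_S[OF z det] dedekind_eta_S_pow6[OF Im_moebius_int_pos[OF z det]] C[OF z]
      by (simp add: power_mult_distrib mult_ac)
  qed (use \<open>C \<noteq> 0\<close> in simp)
qed

section \<open>Expansions at infinity\<close>

text \<open>Local behaviour at a cusp of width \<open>h\<close>. The exponent \<open>r\<close>
  refers to \<open>nome z\<close>, not to the local parameter \<open>nome (z / h)\<close>, and may
  be fractional. Since \<phi> has no zero on the whole disc, such expansions admit inverses, roots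
  and logarithms.\<close>

definition has_qexp :: "nat \<Rightarrow> real \<Rightarrow> complex \<Rightarrow> (complex \<Rightarrow> complex) \<Rightarrow> bool" where
  "has_qexp h r C F \<longleftrightarrow> h > 0 \<and> (\<exists>\<phi>. \<phi> holomorphic_on ball 0 1 \<and> (\<forall>w\<in>ball 0 1. \<phi> w \<noteq> 0) \<and> \<phi> 0 = C \<and>
     (\<forall>z. Im z > 0 \<longrightarrow> F z = nome (of_real r * z) * \<phi> (nome (z / of_nat h))))"

lemma has_qexpI:
  assumes "h > 0" "\<phi> holomorphic_on ball 0 1" "\<And>w. norm w < 1 \<Longrightarrow> \<phi> w \<noteq> 0" "\<phi> 0 = C"
    "\<And>z. Im z > 0 \<Longrightarrow> F z = nome (of_real r * z) * \<phi> (nome (z / of_nat h))"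
  shows "has_qexp h r C F"
  unfolding has_qexp_def using assms by (intro conjI exI[of _ \<phi>]) auto

lemma has_qexpE:
  assumes "has_qexp h r C F"
  obtains \<phi> where "h > 0" "\<phi> holomorphic_on ball 0 1" "\<And>w. norm w < 1 \<Longrightarrow> \<phi> w \<noteq> 0" "\<phi> 0 = C"
    "\<And>z. Im z > 0 \<Longrightarrow> F z = nome (of_real r * z) * \<phi> (nome (z / of_nat h))"
  using assms unfolding has_qexp_def by (metis mem_ball_0)

lemma norm_nome_div_less_1: "Im z > 0 \<Longrightarrow> h > 0 \<Longrightarrow> norm (nome (z / of_nat h)) < 1"
  by (simp add: norm_nome_less_1_iff)

lemma has_qexp_cong:
  assumes "has_qexp h r C F" "\<And>z. Im z > 0 \<Longrightarrow> F z = G z" "r = r'"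
  shows "has_qexp h r' C G"
  using assms by (auto simp: has_qexp_def)

lemma has_qexp_const: "h > 0 \<Longrightarrow> C \<noteq> 0 \<Longrightarrow> has_qexp h 0 C (\<lambda>_. C)"
  by (rule has_qexpI[where \<phi> = "\<lambda>_. C"]) auto

lemma has_qexp_mult:
  assumes "has_qexp h r C F" "has_qexp h r' C' G"
  shows "has_qexp h (r + r') (C * C') (\<lambda>z. F z * G z)"
proof -
  obtain \<phi> where \<phi>: "h > 0" "\<phi> holomorphic_on ball 0 1" "\<And>w. norm w < 1 \<Longrightarrow> \<phi> w \<noteq> 0" "\<phi> 0 = C"
    "\<And>z. Im z > 0 \<Longrightarrow> F z = nome (of_real r * z) * \<phi> (nome (z / of_nat h))"
    using assms(1) by (rule has_qexpE) blast
  obtain \<psi> where \<psi>: "\<psi> holomorphic_on ball 0 1" "\<And>w. norm w < 1 \<Longrightarrow> \<psi> w \<noteq> 0" "\<psi> 0 = C'"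
    "\<And>z. Im z > 0 \<Longrightarrow> G z = nome (of_real r' * z) * \<psi> (nome (z / of_nat h))"
    using assms(2) by (rule has_qexpE) blast
  show ?thesis
    by (rule has_qexpI[where \<phi> = "\<lambda>w. \<phi> w * \<psi> w"])
       (use \<phi> \<psi> in \<open>auto intro!: holomorphic_intros simp: nome_add distrib_right\<close>)
qed

lemma has_qexp_powi:
  assumes "has_qexp h r C F"
  shows "has_qexp h (of_int n * r) (C powi n) (\<lambda>z. F z powi n)"
proof -
  obtain \<phi> where \<phi>: "h > 0" "\<phi> holomorphic_on ball 0 1" "\<And>w. norm w < 1 \<Longrightarrow> \<phi> w \<noteq> 0" "\<phi> 0 = C"
    "\<And>z. Im z > 0 \<Longrightarrow> F z = nome (of_real r * z) * \<phi> (nome (z / of_nat h))"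
    using assms by (rule has_qexpE) blast
  show ?thesis
    by (rule has_qexpI[where \<phi> = "\<lambda>w. \<phi> w powi n"])
       (use \<phi> in \<open>auto intro!: holomorphic_intros simp: power_int_mult_distrib nome_powi mult.assoc\<close>)
qed

lemma has_qexp_power:
  assumes "has_qexp h r C F"
  shows "has_qexp h (of_nat n * r) (C ^ n) (\<lambda>z. F z ^ n)"
  using has_qexp_powi[OF assms, of "int n"] by simp

lemma has_qexp_inverse:
  assumes "has_qexp h r C F"
  shows "has_qexp h (- r) (inverse C) (\<lambda>z. inverse (F z))"
  using has_qexp_powi[OF assms, of "- 1"] by (simp add: power_int_minus)

text \<open>The source of all invariance below: an integral \<open>r * h\<close> makes the function
  periodic with period \<open>h\<close>.\<close>

lemma has_qexp_shift:
  assumes "has_qexp h r C F" "Im z > 0"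
  shows "F (z + of_nat h) = nome (of_real r * of_nat h) * F z"
proof -
  obtain \<phi> where \<phi>: "h > 0" 
    "\<And>z. Im z > 0 \<Longrightarrow> F z = nome (of_real r * z) * \<phi> (nome (z / of_nat h))"
    using assms(1) by (rule has_qexpE) blast
  have "nome ((z + of_nat h) / of_nat h) = nome (z / of_nat h)"
    using \<phi>(1) by (simp add: add_divide_distrib nome_add)
  then show ?thesis using \<phi>(2)[OF assms(2)] \<phi>(2)[of "z + of_nat h"] assms(2)
    by (simp add: distrib_left nome_add)
qed

lemma holomorphic_bounded_nome:
  assumes "\<phi> holomorphic_on ball 0 1" "Y > 0" "h > 0"
  shows "\<exists>B>0. \<forall>z. Im z \<ge> Y \<longrightarrow> norm (\<phi> (nome (z / of_nat h))) \<le> B"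
proof -
  define \<rho> where "\<rho> = exp (- 2 * pi * (Y / h))"
  have "\<rho> < 1" using assms(2,3) by (simp add: \<rho>_def)
  then have "cball 0 \<rho> \<subseteq> ball (0::complex) 1" by auto
  then have "bounded (\<phi> ` cball 0 \<rho>)"
    by (intro compact_imp_bounded compact_continuous_image compact_cball
        holomorphic_on_imp_continuous_on holomorphic_on_subset[OF assms(1)])
  then obtain B where B: "B > 0" "\<And>w. w \<in> cball 0 \<rho> \<Longrightarrow> norm (\<phi> w) \<le> B"
    unfolding bounded_pos by blast
  have "nome (z / of_nat h) \<in> cball 0 \<rho>" if "Im z \<ge> Y" for z
    using that assms(3) by (simp add: norm_nome \<rho>_def divide_right_mono)
  with B show ?thesis by blast
qed

lemma has_qexp_bounded:
  assumes "has_qexp h r C F" "r \<ge> 0" "Y > 0"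
  shows "\<exists>B>0. \<forall>z. Im z \<ge> Y \<longrightarrow> norm (F z) \<le> B"
proof -
  obtain \<phi> where \<phi>: "h > 0" "\<phi> holomorphic_on ball 0 1"
    "\<And>z. Im z > 0 \<Longrightarrow> F z = nome (of_real r * z) * \<phi> (nome (z / of_nat h))"
    using assms(1) by (rule has_qexpE) blast
  obtain B where B: "B > 0" "\<And>z. Im z \<ge> Y \<Longrightarrow> norm (\<phi> (nome (z / of_nat h))) \<le> B"
    using holomorphic_bounded_nome[OF \<phi>(2) assms(3) \<phi>(1)] by blast
  have "norm (F z) \<le> B" if "Im z \<ge> Y" for z
  proof -
    have "norm (nome (of_real r * z)) \<le> 1"
      using that assms(2,3) by (simp add: norm_nome)
    then have "norm (nome (of_real r * z)) * norm (\<phi> (nome (z / of_nat h))) \<le> 1 * B"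
      by (intro mult_mono B that) auto
    then show ?thesis using \<phi>(3)[of z] that assms(3) by (simp add: norm_mult)
  qed
  with B(1) show ?thesis by blast
qed

text \<open>The logarithmic derivative is again a series in the local parameter, with constant term
  \<open>2 pi i r\<close>. For \<open>r = 0\<close> it vanishes at the cusp, which produces the
  decay of \<open>g\<close> at 0.\<close>

lemma has_qexp_deriv:
  assumes "has_qexp h r C F"
  shows "\<exists>\<sigma>. \<sigma> holomorphic_on ball 0 1 \<and> (\<forall>z. Im z > 0 \<longrightarrow>
    (F has_field_derivative F z * (2 * of_real pi * \<i> * of_real r
        + nome (z / of_nat h) * \<sigma> (nome (z / of_nat h)))) (at z))"
proof -
  obtain \<phi> where \<phi>: "h > 0" "\<phi> holomorphic_on ball 0 1" "\<And>w. norm w < 1 \<Longrightarrow> \<phi> w \<noteq> 0"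
    "\<And>z. Im z > 0 \<Longrightarrow> F z = nome (of_real r * z) * \<phi> (nome (z / of_nat h))"
    using assms by (rule has_qexpE) blast
  define \<sigma> where "\<sigma> w = 2 * of_real pi * \<i> / of_nat h * deriv \<phi> w / \<phi> w" for w
  have "\<sigma> holomorphic_on ball 0 1"
    unfolding \<sigma>_def by (intro holomorphic_intros \<phi>(2)) (use \<phi>(3) in auto)
  moreover have "(F has_field_derivative F z * (2 * of_real pi * \<i> * of_real r
        + nome (z / of_nat h) * \<sigma> (nome (z / of_nat h)))) (at z)" if z: "Im z > 0" for z
  proof (rule has_field_derivative_transform_within_open[where S = upper_half])
    let ?w = "nome (z / of_nat h)"
    have w: "norm ?w < 1" by (rule norm_nome_div_less_1[OF z \<phi>(1)])
    have d: "(\<phi> has_field_derivative deriv \<phi> ?w) (at ?w)"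
      using \<phi>(2) w by (intro holomorphic_derivI[where S = "ball 0 1"]) auto
    have "((\<lambda>z. \<phi> (nome (z / of_nat h))) has_field_derivative
        deriv \<phi> ?w * (2 * of_real pi * \<i> * (1 / of_nat h) * ?w)) (at z)"
      by (rule DERIV_chain2[of \<phi> _ "\<lambda>z. nome (z / of_nat h)", OF d])
         (use \<phi>(1) in \<open>auto intro!: derivative_eq_intros\<close>)
    then show "((\<lambda>z. nome (of_real r * z) * \<phi> (nome (z / of_nat h))) has_field_derivative
        F z * (2 * of_real pi * \<i> * of_real r + ?w * \<sigma> ?w)) (at z)"
      by (auto intro!: derivative_eq_intros)
         (use \<phi>(1) \<phi>(3)[OF w] in \<open>simp add: \<phi>(4)[OF z] \<sigma>_def field_simps\<close>)
  qed (use z \<phi>(4) in \<open>auto simp: open_halfspace_Im_gt\<close>)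
  ultimately show ?thesis by blast
qed

text \<open>The difference between the given logarithm and the one built from a logarithm of \<phi>
  has exponential 1, hence derivative 0, hence is constant on the half-plane.\<close>

lemma has_qexp_log:
  assumes F: "has_qexp h r C F" and l: "l holomorphic_on upper_half" "\<And>z. Im z > 0 \<Longrightarrow> exp (l z) = F z"
  shows "\<exists>\<psi>. \<psi> holomorphic_on ball 0 1 \<and> exp (\<psi> 0) = C \<and>
     (\<forall>z. Im z > 0 \<longrightarrow> l z = 2 * of_real pi * \<i> * of_real r * z + \<psi> (nome (z / of_nat h)))"
proof -
  obtain \<phi> where \<phi>: "h > 0" "\<phi> holomorphic_on ball 0 1" "\<And>w. norm w < 1 \<Longrightarrow> \<phi> w \<noteq> 0" "\<phi> 0 = C"
    "\<And>z. Im z > 0 \<Longrightarrow> F z = nome (of_real r * z) * \<phi> (nome (z / of_nat h))"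
    using F by (rule has_qexpE) blast
  obtain \<psi> where \<psi>: "\<psi> holomorphic_on ball 0 1" "\<And>w. norm w < 1 \<Longrightarrow> \<phi> w = exp (\<psi> w)"
    using holomorphic_logarithm_exists[OF convex_ball open_ball \<phi>(2), of 0] \<phi>(3) by (metis centre_in_ball mem_ball_0 zero_less_one)
  define D where "D z = l z - 2 * of_real pi * \<i> * of_real r * z - \<psi> (nome (z / of_nat h))" for z
  have holD: "D holomorphic_on upper_half"
    unfolding D_def
    by (intro holomorphic_intros l(1) holomorphic_on_compose_gen[OF _ \<psi>(1), unfolded o_def])
       (use \<phi>(1) norm_nome_div_less_1 in auto)
  have expD: "exp (D z) = 1" if "Im z > 0" for z
    using l(2)[OF that] \<phi>(5)[OF that] \<psi>(2)[OF norm_nome_div_less_1[OF that \<phi>(1)]]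
    by (simp add: D_def exp_diff nome_def mult.assoc)
  have "(D has_field_derivative 0) (at z)" if z: "Im z > 0" for z
  proof -
    have d: "(D has_field_derivative deriv D z) (at z)"
      using holD z by (intro holomorphic_derivI[where S = upper_half]) (auto simp: open_halfspace_Im_gt)
    then have "((\<lambda>z. exp (D z)) has_field_derivative exp (D z) * deriv D z) (at z)"
      by (auto intro!: derivative_eq_intros)
    moreover have "((\<lambda>z. exp (D z)) has_field_derivative 0) (at z)"
      by (rule has_field_derivative_transform_within_open[of "\<lambda>_. 1" 0 z upper_half])
         (use expD z in \<open>auto simp: open_halfspace_Im_gt\<close>)
    ultimately have "exp (D z) * deriv D z = 0" by (rule DERIV_unique)
    with d show ?thesis by simp
  qed
  then have "\<exists>c. \<forall>z\<in>upper_half. D z = c"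
    by (intro has_field_derivative_zero_constant convex_halfspace_Im_gt)
       (auto intro: has_field_derivative_at_within)
  then obtain c where c: "\<And>z. Im z > 0 \<Longrightarrow> D z = c" by auto
  have "exp c = 1" using expD[of \<i>] c[of \<i>] by simp
  then have "exp (\<psi> 0 + c) = C" using \<psi>(2)[of 0] \<phi>(4) by (simp add: exp_add)
  moreover have "l z = 2 * of_real pi * \<i> * of_real r * z + (\<psi> (nome (z / of_nat h)) + c)" if "Im z > 0" for z
    using c[OF that] by (simp add: D_def algebra_simps)
  ultimately show ?thesis
    by (intro exI[of _ "\<lambda>w. \<psi> w + c"] conjI) (auto intro!: holomorphic_intros \<psi>(1))
qed

text \<open>Divide \<open>F\<close> by one explicit root \<open>G\<close>: the quotient is
  continuous on a connected set with values in the finite set of \<open>n\<close>-th roots of unity,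
  hence constant.\<close>

lemma has_qexp_root:
  assumes F: "has_qexp h r C (\<lambda>z. F z ^ n)" and n: "n > 0" and cont: "continuous_on upper_half F"
  shows "\<exists>C'. C' ^ n = C \<and> has_qexp h (r / real n) C' F"
proof -
  obtain \<phi> where \<phi>: "h > 0" "\<phi> holomorphic_on ball 0 1" "\<And>w. norm w < 1 \<Longrightarrow> \<phi> w \<noteq> 0" "\<phi> 0 = C"
    "\<And>z. Im z > 0 \<Longrightarrow> F z ^ n = nome (of_real r * z) * \<phi> (nome (z / of_nat h))"
    using F by (rule has_qexpE) blast
  obtain \<psi> where \<psi>: "\<psi> holomorphic_on ball 0 1" "\<And>w. norm w < 1 \<Longrightarrow> exp (\<psi> w) = \<phi> w"
    using holomorphic_logarithm_exists[OF convex_ball open_ball \<phi>(2), of 0] \<phi>(3) by (metis centre_in_ball mem_ball_0 zero_less_one)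
  define G where "G z = nome (of_real (r / real n) * z) * exp (\<psi> (nome (z / of_nat h)) / of_nat n)" for z
  have "(\<lambda>z. \<psi> (nome (z / of_nat h))) holomorphic_on upper_half"
    by (intro holomorphic_intros holomorphic_on_compose_gen[OF _ \<psi>(1), unfolded o_def])
       (use \<phi>(1) norm_nome_div_less_1 in auto)
  then have "G holomorphic_on upper_half"
    unfolding G_def by (intro holomorphic_intros) (use n in auto)
  then have contG: "continuous_on upper_half G" by (rule holomorphic_on_imp_continuous_on)
  have G0: "G z \<noteq> 0" for z by (simp add: G_def)
  have FG: "(F z / G z) ^ n = 1" if z: "Im z > 0" for z
  proof -
    have "G z ^ n = nome (of_real r * z) * \<phi> (nome (z / of_nat h))"
      using n \<psi>(2)[OF norm_nome_div_less_1[OF z \<phi>(1)]]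
      by (simp add: G_def power_mult_distrib nome_power flip: exp_of_nat_mult)
    then have "F z ^ n = G z ^ n" using \<phi>(5)[OF z] by simp
    then show ?thesis using G0[of z] by (simp add: power_divide)
  qed
  have "(\<lambda>z. F z / G z) constant_on upper_half"
  proof (rule continuous_finite_range_constant)
    show "connected upper_half" by (intro convex_connected convex_halfspace_Im_gt)
    show "continuous_on upper_half (\<lambda>z. F z / G z)" by (intro continuous_intros cont contG) (simp add: G0)
    have "(\<lambda>z. F z / G z) ` upper_half \<subseteq> {w. w ^ n = 1}" using FG by auto
    then show "finite ((\<lambda>z. F z / G z) ` upper_half)"
      using finite_subset finite_roots_unity[of n, where 'a = complex] n by auto
  qed
  then obtain c where c: "\<And>z. Im z > 0 \<Longrightarrow> F z / G z = c" by (auto simp: constant_on_def)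
  have cn: "c ^ n = 1" using FG[of \<i>] c[of \<i>] by simp
  then have c0: "c \<noteq> 0" using n by (auto simp: zero_power)
  have "has_qexp h (r / real n) (c * exp (\<psi> 0 / of_nat n)) F"
  proof (rule has_qexpI[where \<phi> = "\<lambda>w. c * exp (\<psi> w / of_nat n)"])
    show "F z = nome (of_real (r / real n) * z) * (c * exp (\<psi> (nome (z / of_nat h)) / of_nat n))" if "Im z > 0" for z
      using c[OF that] G0[of z] by (simp add: G_def field_simps)
  qed (use \<phi>(1) c0 n in \<open>auto intro!: holomorphic_intros \<psi>(1)\<close>)
  moreover have "(c * exp (\<psi> 0 / of_nat n)) ^ n = C"
    using n \<psi>(2)[of 0] \<phi>(4) cn by (simp add: power_mult_distrib flip: exp_of_nat_mult)
  ultimately show ?thesis by blast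
qed

section \<open>Eta quotients at the cusps\<close>

text \<open>The equation \<open>g * h = e * k\<close> says that the nome of
  \<open>(g z + \<beta>) / e\<close> is a root of unity times the \<open>k\<close>-th power of the
  local parameter of width \<open>h\<close>.\<close>

lemma dedekind_eta_pow6_has_qexp:
  assumes "g > 0" "h > 0" "g * h = e * k"
  shows "has_qexp h (real g / (4 * real e)) (nome (of_int \<beta> / (4 * of_nat e)))
           (\<lambda>z. dedekind_eta ((of_nat g * z + of_int \<beta>) / of_nat e) ^ 6)"
proof -
  have k: "k > 0" "e > 0" using assms by (auto intro!: Nat.gr0I)
  define \<zeta> where "\<zeta> = nome (of_int \<beta> / of_nat e)"
  have \<zeta>: "norm \<zeta> = 1" by (simp add: \<zeta>_def norm_nome)
  have lt: "norm (\<zeta> * w ^ k) < 1" if "norm w < 1" for w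
    using that k by (simp add: norm_mult \<zeta> norm_power power_less_one_iff)
  show ?thesis
  proof (rule has_qexpI[where \<phi> = "\<lambda>w. nome (of_int \<beta> / (4 * of_nat e)) * qprod (\<zeta> * w ^ k) (\<zeta> * w ^ k) ^ 6"])
    show "(\<lambda>w. nome (of_int \<beta> / (4 * of_nat e)) * qprod (\<zeta> * w ^ k) (\<zeta> * w ^ k) ^ 6) holomorphic_on ball 0 1"
      by (intro holomorphic_intros) (use lt in auto)
    show "nome (of_int \<beta> / (4 * of_nat e)) * qprod (\<zeta> * w ^ k) (\<zeta> * w ^ k) ^ 6 \<noteq> 0" if "norm w < 1" for w
      using qprod_nonzero[OF lt lt] that by simp
    fix z :: complex assume "Im z > 0"
    have ge: "of_nat g / of_nat e = (of_nat k / of_nat h :: complex)"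
      using arg_cong[OF assms(3), of "of_nat :: nat \<Rightarrow> complex"] k assms(2) by (simp add: field_simps)
    have "of_nat k * (z / of_nat h) + of_int \<beta> / of_nat e = (of_nat g * z + of_int \<beta>) / (of_nat e :: complex)"
      using ge by (simp add: add_divide_distrib) (metis times_divide_eq_left mult.commute)
    moreover have "\<zeta> * nome (z / of_nat h) ^ k = nome (of_nat k * (z / of_nat h) + of_int \<beta> / of_nat e)"
      by (simp only: \<zeta>_def nome_power nome_add mult.commute)
    ultimately have 1: "nome ((of_nat g * z + of_int \<beta>) / of_nat e) = \<zeta> * nome (z / of_nat h) ^ k"
      by (simp only:)
    have 2: "nome ((of_nat g * z + of_int \<beta>) / of_nat e / 24) ^ 6
        = nome (of_real (real g / (4 * real e)) * z) * nome (of_int \<beta> / (4 * of_nat e))"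
      unfolding nome_power nome_add[symmetric] using k
      by (intro arg_cong[of _ _ nome]) (simp add: field_simps)
    show "dedekind_eta ((of_nat g * z + of_int \<beta>) / of_nat e) ^ 6 = nome (of_real (real g / (4 * real e)) * z) *
        (nome (of_int \<beta> / (4 * of_nat e)) * qprod (\<zeta> * nome (z / of_nat h) ^ k) (\<zeta> * nome (z / of_nat h) ^ k) ^ 6)"
      unfolding dedekind_eta_eq[of "_ / _"] power_mult_distrib 1 2 by (simp only: mult_ac)
  qed (use assms k in \<open>auto simp: zero_power\<close>)
qed

text \<open>
  \<open>\<delta>\<close> times a matrix of determinant 1 is a matrix of determinant 1
  times an upper triangular one.
\<close>

lemma hermite_decomposition:
  fixes a b c d :: int and \<delta> g :: nat
  assumes "a * d - b * c = 1" "\<delta> > 0" and g_def: "g = gcd \<delta> (nat \<bar>c\<bar>)"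
  obtains e :: nat and x y c' \<beta> :: int where "\<delta> = g * e" "e > 0" "g > 0" "c = int g * c'"
    "(a * int e) * y - x * c' = 1"
    "\<And>z. Im z > 0 \<Longrightarrow> of_nat \<delta> * moebius_int a b c d z
        = moebius_int (a * int e) x c' y ((of_nat g * z + of_int \<beta>) / of_nat e)"
    "\<And>z. Im z > 0 \<Longrightarrow> of_int c' * ((of_nat g * z + of_int \<beta>) / of_nat e) + of_int y
        = (of_int c * z + of_int d) / of_nat e"
proof -
  have "int g dvd int (nat \<bar>c\<bar>)" unfolding int_dvd_int_iff g_def by (rule gcd_dvd2)
  then have g: "int g dvd c" "g dvd \<delta>" "g > 0"
    using assms(2) by (simp, simp only: g_def gcd_dvd1, simp add: g_def)
  obtain e where e: "\<delta> = g * e" using g by auto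
  obtain c' where c': "c = int g * c'" using g by auto
  have e0: "e > 0" using e assms(2) by (auto intro!: Nat.gr0I)
  have "int g = gcd (int \<delta>) (int (nat \<bar>c\<bar>))" by (simp only: g_def gcd_int_int_eq)
  also have "\<dots> = gcd (int \<delta>) c" by simp
  also have "\<dots> = gcd (int g * int e) (int g * c')" by (simp only: e c' of_nat_mult)
  also have "\<dots> = int g * gcd (int e) c'" by (simp add: gcd_mult_left)
  finally have "coprime (int e) c'" using g(3) by (simp add: coprime_iff_gcd_eq_1)
  moreover have "coprime a c'"
  proof (rule coprimeI)
    fix l assume "l dvd a" "l dvd c'"
    then have "l dvd a * d - b * c" by (simp add: c')
    then show "is_unit l" by (simp add: assms(1))
  qed
  ultimately have "coprime (a * int e) c'" by simp
  \<comment> \<open>The pair \<open>(a e, c')\<close> becomes the first column of the left factor;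
    Bezout supplies the second column.\<close>
  then obtain u v where "u * (a * int e) + v * c' = 1" using bezout_int[of "a * int e" c'] by auto
  then obtain x y where xy: "(a * int e) * y - x * c' = 1"
    using that by (metis diff_minus_eq_add mult.commute mult_minus_left)
  \<comment> \<open>The upper right entry of the triangular factor: the inverse of the left factor
    applied to the column \<open>(\<delta> b, d)\<close>.\<close>
  define \<beta> where "\<beta> = y * int \<delta> * b - x * d"
  have D: "of_int c' * ((of_nat g * z + of_int \<beta>) / of_nat e) + of_int y
        = (of_int c * z + of_int d) / (of_nat e :: complex)" for z
  proof -
    have "c' * \<beta> + y * int e = d"
    proof -
      have "c' * \<beta> + y * int e = y * int e * (1 + b * c) - x * c' * d" by (simp add: \<beta>_def e c' algebra_simps)
      also have "1 + b * c = a * d" using assms(1) by simp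
      also have "y * int e * (a * d) - x * c' * d = d * ((a * int e) * y - x * c')" by (simp add: algebra_simps)
      finally show ?thesis by (simp add: xy)
    qed
    from arg_cong[OF this, of "of_int :: int \<Rightarrow> complex"] show ?thesis
      using e0 by (simp add: c' field_simps)
  qed
  have N: "of_int (a * int e) * ((of_nat g * z + of_int \<beta>) / of_nat e) + of_int x
        = of_nat \<delta> * (of_int a * z + of_int b) / (of_nat e :: complex)" for z
  proof -
    have "a * \<beta> + x = b * int g"
    proof -
      have "a * \<beta> + x = a * y * int \<delta> * b - x * (a * d - 1)" by (simp add: \<beta>_def algebra_simps)
      also have "a * d - 1 = b * c" using assms(1) by simp
      also have "a * y * int \<delta> * b - x * (b * c) = b * int g * ((a * int e) * y - x * c')"
        by (simp add: e c' algebra_simps)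
      finally show ?thesis by (simp add: xy)
    qed
    from arg_cong[OF this, of "of_int :: int \<Rightarrow> complex"]
    have eq: "of_int a * of_int \<beta> + of_int x = (of_int b * of_nat g :: complex)" by simp
    have "of_int (a * int e) * ((of_nat g * z + of_int \<beta>) / of_nat e) + of_int x
        = of_int a * of_nat g * z + (of_int a * of_int \<beta> + of_int x)"
      using e0 by (simp add: field_simps)
    also have "\<dots> = of_nat \<delta> * (of_int a * z + of_int b) / of_nat e"
      unfolding eq using e0 by (simp add: e field_simps)
    finally show ?thesis .
  qed
  show ?thesis
  proof (rule that[OF e e0 g(3) c' xy])
    show "of_nat \<delta> * moebius_int a b c d z
        = moebius_int (a * int e) x c' y ((of_nat g * z + of_int \<beta>) / of_nat e)" if "Im z > 0" for z
      unfolding moebius_int_def N D using e0 by simp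
  qed (rule D)
qed

text \<open>By \<open>hermite_decomposition\<close> the order is \<open>g / (4 e)\<close> with
  \<open>e = \<delta> / g\<close>. The divisibility hypothesis amounts to
  \<open>e dvd g * h\<close>, so that the expansion fits into the width \<open>h\<close>.\<close>

lemma dedekind_eta_cusp_pow6:
  fixes a b c d :: int and \<delta> h :: nat
  assumes det: "a * d - b * c = 1" and "\<delta> > 0" "h > 0" "\<delta> dvd (gcd \<delta> (nat \<bar>c\<bar>))\<^sup>2 * h"
  shows "\<exists>C. has_qexp h ((real (gcd \<delta> (nat \<bar>c\<bar>)))\<^sup>2 / (4 * real \<delta>)) C
           (\<lambda>z. dedekind_eta (of_nat \<delta> * moebius_int a b c d z) ^ 6 / (of_int c * z + of_int d) ^ 3)"
proof -
  define g where "g = gcd \<delta> (nat \<bar>c\<bar>)"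
  obtain e :: nat and x y c' \<beta> :: int where e: "\<delta> = g * e" "e > 0" "g > 0" "c = int g * c'"
    "(a * int e) * y - x * c' = 1"
    "\<And>z. Im z > 0 \<Longrightarrow> of_nat \<delta> * moebius_int a b c d z
        = moebius_int (a * int e) x c' y ((of_nat g * z + of_int \<beta>) / of_nat e)"
    "\<And>z. Im z > 0 \<Longrightarrow> of_int c' * ((of_nat g * z + of_int \<beta>) / of_nat e) + of_int y
        = (of_int c * z + of_int d) / of_nat e"
    by (rule hermite_decomposition[OF det assms(2) g_def]) (rule that)
  obtain C where C: "C \<noteq> 0" "\<And>z. Im z > 0 \<Longrightarrow> dedekind_eta (moebius_int (a * int e) x c' y z) ^ 6
      = C * (of_int c' * z + of_int y) ^ 3 * dedekind_eta z ^ 6"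
    using dedekind_eta_moebius_pow6[OF e(5)] by blast
  have "\<delta> dvd g\<^sup>2 * h" using assms(4) by (simp only: g_def)
  then have "g * e dvd g * (g * h)" unfolding e(1) by (simp only: power2_eq_square mult_ac)
  then have "e dvd g * h" using e(3) by simp
  then obtain k where "g * h = e * k" by auto
  from has_qexp_mult[OF has_qexp_const[of h "C / of_nat e ^ 3"] dedekind_eta_pow6_has_qexp[OF e(3) assms(3) this, of \<beta>]]
  have "has_qexp h (0 + real g / (4 * real e)) (C / of_nat e ^ 3 * nome (of_int \<beta> / (4 * of_nat e)))
      (\<lambda>z. C / of_nat e ^ 3 * dedekind_eta ((of_nat g * z + of_int \<beta>) / of_nat e) ^ 6)"
    using assms(3) C(1) e(2) by simp
  then have "has_qexp h ((real g)\<^sup>2 / (4 * real \<delta>)) (C / of_nat e ^ 3 * nome (of_int \<beta> / (4 * of_nat e)))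
      (\<lambda>z. dedekind_eta (of_nat \<delta> * moebius_int a b c d z) ^ 6 / (of_int c * z + of_int d) ^ 3)"
  proof (rule has_qexp_cong)
    fix z :: complex assume z: "Im z > 0"
    then have w: "Im ((of_nat g * z + of_int \<beta>) / of_nat e) > 0" using e by simp
    have "of_int c * z + of_int d \<noteq> 0" using int_linear_nonzero[OF z] det_1_nonzero[OF det] by auto
    then show "C / of_nat e ^ 3 * dedekind_eta ((of_nat g * z + of_int \<beta>) / of_nat e) ^ 6
        = dedekind_eta (of_nat \<delta> * moebius_int a b c d z) ^ 6 / (of_int c * z + of_int d) ^ 3"
      unfolding e(6)[OF z] C(2)[OF w] e(7)[OF z] by (simp add: power_divide)
  qed (use e in \<open>simp add: power2_eq_square\<close>)
  then show ?thesis by (auto simp: g_def)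
qed

text \<open>Ligozat's formula for the order of an eta quotient at a cusp with denominator
  \<open>c\<close>, measured in \<open>nome z\<close>; multiplied by the width it is the order in
  the local parameter.\<close>

definition eta_order :: "int \<Rightarrow> (nat \<times> int) list \<Rightarrow> real" where
  "eta_order c ds = (\<Sum>(\<delta>, r)\<leftarrow>ds. of_int r * (real (gcd \<delta> (nat \<bar>c\<bar>)))\<^sup>2 / (24 * real \<delta>))"

lemma eta_quotient_Nil [simp]: "eta_quotient [] z = 1"
  and eta_quotient_Cons [simp]:
    "eta_quotient ((\<delta>, r) # ds) z = dedekind_eta (of_nat \<delta> * z) powi r * eta_quotient ds z"
  by (simp_all add: eta_quotient_def)

lemma eta_quotient_holomorphic:
  assumes "\<And>\<delta>. \<delta> \<in> fst ` set ds \<Longrightarrow> \<delta> > 0"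
  shows "eta_quotient ds holomorphic_on upper_half"
  using assms
proof (induction ds)
  case Nil
  then show ?case by (simp add: eta_quotient_def[abs_def])
next
  case (Cons p ds)
  obtain \<delta> r where p: "p = (\<delta>, r)" by force
  have \<delta>: "\<delta> > 0" using Cons.prems[of \<delta>] by (simp add: p)
  have "(\<lambda>z. dedekind_eta (of_nat \<delta> * z) powi r * eta_quotient ds z) holomorphic_on upper_half"
    by (intro holomorphic_intros Cons.IH Cons.prems)
       (use \<delta> in \<open>auto simp: open_halfspace_Im_gt intro!: dedekind_eta_nonzero\<close>)
  then show ?case by (simp add: p eta_quotient_Cons[abs_def])
qed

lemma eta_quotient_cusp_pow6:
  fixes a b c d :: int
  assumes det: "a * d - b * c = 1" and h: "h > 0"
    and ds: "\<And>\<delta>. \<delta> \<in> fst ` set ds \<Longrightarrow> \<delta> > 0 \<and> \<delta> dvd (gcd \<delta> (nat \<bar>c\<bar>))\<^sup>2 * h"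
  shows "\<exists>C. has_qexp h (6 * eta_order c ds) C
    (\<lambda>z. eta_quotient ds (moebius_int a b c d z) ^ 6 / (of_int c * z + of_int d) powi (3 * sum_list (map snd ds)))"
  using ds
proof (induction ds)
  case Nil
  then show ?case using has_qexp_const[OF h, of 1] by (auto simp: eta_order_def)
next
  case (Cons p ds)
  obtain \<delta> r where p: "p = (\<delta>, r)" by force
  have \<delta>: "\<delta> > 0" "\<delta> dvd (gcd \<delta> (nat \<bar>c\<bar>))\<^sup>2 * h" using Cons.prems[of \<delta>] by (simp_all add: p)
  have "\<And>\<delta>. \<delta> \<in> fst ` set ds \<Longrightarrow> \<delta> > 0 \<and> \<delta> dvd (gcd \<delta> (nat \<bar>c\<bar>))\<^sup>2 * h"
    by (rule Cons.prems) auto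
  from Cons.IH[OF this] obtain C where C: "has_qexp h (6 * eta_order c ds) C
    (\<lambda>z. eta_quotient ds (moebius_int a b c d z) ^ 6 / (of_int c * z + of_int d) powi (3 * sum_list (map snd ds)))"
    by auto
  obtain C' where "has_qexp h ((real (gcd \<delta> (nat \<bar>c\<bar>)))\<^sup>2 / (4 * real \<delta>)) C'
           (\<lambda>z. dedekind_eta (of_nat \<delta> * moebius_int a b c d z) ^ 6 / (of_int c * z + of_int d) ^ 3)"
    using dedekind_eta_cusp_pow6[OF det \<delta>(1) h \<delta>(2)] by blast
  from has_qexp_mult[OF has_qexp_powi[OF this, of r] C]
  have "has_qexp h (6 * eta_order c (p # ds)) (C' powi r * C)
    (\<lambda>z. eta_quotient (p # ds) (moebius_int a b c d z) ^ 6 / (of_int c * z + of_int d) powi (3 * sum_list (map snd (p # ds))))"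
  proof (rule has_qexp_cong)
    fix z :: complex assume z: "Im z > 0"
    let ?j = "of_int c * z + of_int d" and ?M = "moebius_int a b c d z"
    have j: "?j \<noteq> 0" using int_linear_nonzero[OF z] det_1_nonzero[OF det] by auto
    have "(dedekind_eta (of_nat \<delta> * ?M) ^ 6 / ?j ^ 3) powi r
        = (dedekind_eta (of_nat \<delta> * ?M) powi r) ^ 6 / ?j powi (3 * r)"
      by (simp add: power_int_divide_distrib power_int_power power_int_power' mult.commute)
    moreover have "?j powi (3 * r) * ?j powi (3 * sum_list (map snd ds)) = ?j powi (3 * sum_list (map snd (p # ds)))"
      using j by (simp add: p distrib_left power_int_add)
    ultimately show "(dedekind_eta (of_nat \<delta> * ?M) ^ 6 / ?j ^ 3) powi r *
        (eta_quotient ds ?M ^ 6 / ?j powi (3 * sum_list (map snd ds))) =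
        eta_quotient (p # ds) ?M ^ 6 / ?j powi (3 * sum_list (map snd (p # ds)))"
      by (simp add: p power_mult_distrib)
  qed (simp add: eta_order_def p)
  then show ?case by blast
qed

lemma moebius_int_holomorphic:
  assumes "a * d - b * c = 1"
  shows "moebius_int a b c d holomorphic_on upper_half"
  unfolding moebius_int_def using int_linear_nonzero det_1_nonzero[OF assms]
  by (intro holomorphic_intros) auto

text \<open>The sum of the exponents is twice the weight, so the automorphy factor of the sixth
  power is itself a sixth power and \<open>has_qexp_root\<close> applies. The ambiguity of the root
  only affects \<open>C\<close>.\<close>

theorem eta_quotient_cusp:
  fixes a b c d :: int
  assumes det: "a * d - b * c = 1" and h: "h > 0"
    and ds: "\<And>\<delta>. \<delta> \<in> fst ` set ds \<Longrightarrow> \<delta> > 0 \<and> \<delta> dvd (gcd \<delta> (nat \<bar>c\<bar>))\<^sup>2 * h"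
    and k: "sum_list (map snd ds) = 2 * int k"
  shows "\<exists>C. has_qexp h (eta_order c ds) C
    (\<lambda>z. eta_quotient ds (moebius_int a b c d z) / (of_int c * z + of_int d) ^ k)"
proof -
  define F where "F z = eta_quotient ds (moebius_int a b c d z) / (of_int c * z + of_int d) ^ k" for z
  obtain C where C: "has_qexp h (6 * eta_order c ds) C
    (\<lambda>z. eta_quotient ds (moebius_int a b c d z) ^ 6 / (of_int c * z + of_int d) powi (3 * sum_list (map snd ds)))"
    using eta_quotient_cusp_pow6[OF det h, of ds] ds by blast
  have "x powi (6 * int k) = (x ^ k) ^ 6" for x :: complex
    using power_int_of_nat[of x "6 * k"] by (simp add: mult.commute power_mult)
  then have "has_qexp h (6 * eta_order c ds) C (\<lambda>z. F z ^ 6)"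
    using C by (simp add: k F_def power_divide)
  moreover have "F holomorphic_on upper_half"
    unfolding F_def using int_linear_nonzero det_1_nonzero[OF det] ds Im_moebius_int_pos[OF _ det]
    by (intro holomorphic_intros moebius_int_holomorphic[OF det]
        holomorphic_on_compose_gen[OF moebius_int_holomorphic[OF det] eta_quotient_holomorphic, unfolded o_def]) auto
  then have "continuous_on upper_half F" by (rule holomorphic_on_imp_continuous_on)
  ultimately obtain C' where "has_qexp h (6 * eta_order c ds / 6) C' F"
    using has_qexp_root[of h "6 * eta_order c ds" C F 6] by auto
  then show ?thesis unfolding F_def by auto
qed

section \<open>Regularization\<close>

text \<open>Polynomials in \<open>z\<close> whose coefficients are power series in \<open>nome z\<close> without constant term.\<close>

inductive small :: "(complex \<Rightarrow> complex) \<Rightarrow> bool" where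
  monomial: "a holomorphic_on ball 0 1 \<Longrightarrow> a 0 = 0 \<Longrightarrow> small (\<lambda>z. z ^ j * a (nome z))"
| add: "small F \<Longrightarrow> small G \<Longrightarrow> small (\<lambda>z. F z + G z)"

lemma small_zero: "small (\<lambda>z. 0)"
  using small.monomial[of "\<lambda>_. 0" 0] by simp

lemma small_sum: "(\<And>i. i \<in> I \<Longrightarrow> small (F i)) \<Longrightarrow> small (\<lambda>z. \<Sum>i\<in>I. F i z)"
  by (induction I rule: infinite_finite_induct) (auto intro: small_zero small.add)

lemma small_times_series:
  assumes "small F" "c holomorphic_on ball 0 1"
  shows "small (\<lambda>z. z ^ k * c (nome z) * F z)"
  using assms(1)
proof induction
  case (monomial a j)
  have "small (\<lambda>z. z ^ (k + j) * ((\<lambda>w. c w * a w) (nome z)))"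
    by (rule small.monomial) (use monomial assms in \<open>auto intro!: holomorphic_intros\<close>)
  then show ?case by (simp add: power_add mult_ac)
next
  case (add F G)
  then show ?case using small.add by (fastforce simp: distrib_left)
qed

lemma small_cmult: "small F \<Longrightarrow> small (\<lambda>z. c * F z)"
  using small_times_series[of F "\<lambda>_. c" 0] by simp

lemma small_times_z: "small F \<Longrightarrow> small (\<lambda>z. z * F z)"
  using small_times_series[of F "\<lambda>_. 1" 1] by simp

lemma holomorphic_divide_self:
  assumes "a holomorphic_on ball 0 1" "a 0 = 0"
  shows "\<exists>d. d holomorphic_on ball 0 1 \<and> (\<forall>w\<in>ball 0 1. a w = w * d w)"
proof -
  define d where "d w = (if w = 0 then deriv a 0 else (a w - a 0) / (w - 0))" for w
  have "d holomorphic_on ball 0 1"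
    unfolding d_def[abs_def] by (rule pole_lemma_open[OF assms(1) open_ball])
  moreover have "a w = w * d w" for w by (simp add: d_def assms(2))
  ultimately show ?thesis by blast
qed

text \<open>Since dz = dq / (2 pi i q), the function to integrate in q is
  \<open>a q / (2 pi i q)\<close>, holomorphic at 0 because \<open>a 0 = 0\<close>.\<close>

lemma holomorphic_nome_antiderivative:
  assumes "a holomorphic_on ball 0 1" "a 0 = 0"
  shows "\<exists>A. A holomorphic_on ball 0 1 \<and> A 0 = 0 \<and>
     (\<forall>z. Im z > 0 \<longrightarrow> ((\<lambda>z. A (nome z)) has_field_derivative a (nome z)) (at z))"
proof -
  obtain d where d: "d holomorphic_on ball 0 1" "\<And>w. w \<in> ball 0 1 \<Longrightarrow> a w = w * d w"
    using holomorphic_divide_self[OF assms] by blast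
  obtain g where g: "\<And>w. w \<in> ball 0 1 \<Longrightarrow> (g has_field_derivative d w / (2 * of_real pi * \<i>)) (at w within ball 0 1)"
    by (rule holomorphic_convex_primitive'[of "ball 0 1" "\<lambda>w. d w / (2 * of_real pi * \<i>)"])
       (auto intro!: holomorphic_intros d(1))
  define A where "A w = g w - g 0" for w
  have A: "(A has_field_derivative d w / (2 * of_real pi * \<i>)) (at w)" if "norm w < 1" for w
    unfolding A_def using g[of w] that
    by (auto intro!: derivative_eq_intros simp: at_within_open[of w "ball 0 1"])
  have "A holomorphic_on ball 0 1"
    unfolding holomorphic_on_open[OF open_ball] by (intro ballI exI, rule A) simp
  moreover have "((\<lambda>z. A (nome z)) has_field_derivative a (nome z)) (at z)" if "Im z > 0" for z
  proof -
    have w: "norm (nome z) < 1" using that by (simp add: norm_nome_less_1_iff)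
    have "((\<lambda>z. A (nome z)) has_field_derivative
        d (nome z) / (2 * of_real pi * \<i>) * (2 * of_real pi * \<i> * 1 * nome z)) (at z)"
      by (rule DERIV_chain2[of A _ "\<lambda>z. nome z", OF A[OF w]]) (auto intro!: derivative_eq_intros)
    then show ?thesis using d(2)[of "nome z"] w by (simp add: mult.commute)
  qed
  moreover have "A 0 = 0" by (simp add: A_def)
  ultimately show ?thesis by blast
qed

text \<open>Integration by parts: the power of \<open>z\<close> drops by one, while the series is
  replaced by its primitive, which again has no constant term.\<close>

lemma small_monomial_antiderivative:
  assumes "a holomorphic_on ball 0 1" "a 0 = 0"
  shows "\<exists>G. small G \<and> (\<forall>z. Im z > 0 \<longrightarrow> (G has_field_derivative z ^ j * a (nome z)) (at z))"
  using assms
proof (induction j arbitrary: a)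
  case 0
  then obtain A where A: "A holomorphic_on ball 0 1" "A 0 = 0"
     "\<And>z. Im z > 0 \<Longrightarrow> ((\<lambda>z. A (nome z)) has_field_derivative a (nome z)) (at z)"
    using holomorphic_nome_antiderivative by blast
  then show ?case using small.monomial[OF A(1,2), of 0] by (intro exI[of _ "\<lambda>z. A (nome z)"]) simp
next
  case (Suc j)
  obtain A where A: "A holomorphic_on ball 0 1" "A 0 = 0"
     "\<And>z. Im z > 0 \<Longrightarrow> ((\<lambda>z. A (nome z)) has_field_derivative a (nome z)) (at z)"
    using holomorphic_nome_antiderivative[OF Suc.prems] by blast
  obtain G where G: "small G" "\<And>z. Im z > 0 \<Longrightarrow> (G has_field_derivative z ^ j * A (nome z)) (at z)"
    using Suc.IH[OF A(1,2)] by blast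
  have "small (\<lambda>z. z ^ Suc j * A (nome z) + (- of_nat (Suc j)) * G z)"
    by (intro small.add small.monomial small_cmult A G)
  moreover have "((\<lambda>z. z ^ Suc j * A (nome z) + (- of_nat (Suc j)) * G z)
      has_field_derivative z ^ Suc j * a (nome z)) (at z)" if z: "Im z > 0" for z
    by (rule derivative_eq_intros refl A(3)[OF z] G(2)[OF z])+ (simp add: algebra_simps)
  ultimately show ?case by blast
qed

lemma small_antiderivative:
  assumes "small F"
  shows "\<exists>G. small G \<and> (\<forall>z. Im z > 0 \<longrightarrow> (G has_field_derivative F z) (at z))"
  using assms
proof induction
  case (monomial a j)
  then show ?case by (rule small_monomial_antiderivative)
next
  case (add F1 F2)
  then obtain G1 G2 where G: "small G1" "small G2"
    "\<And>z. Im z > 0 \<Longrightarrow> (G1 has_field_derivative F1 z) (at z)"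
    "\<And>z. Im z > 0 \<Longrightarrow> (G2 has_field_derivative F2 z) (at z)" by blast
  then show ?case
    by (intro exI[of _ "\<lambda>z. G1 z + G2 z"]) (auto intro!: small.add derivative_eq_intros)
qed

lemma small_bound:
  assumes "small F"
  shows "\<exists>B j. B > 0 \<and> (\<forall>z. Im z \<ge> 1 \<longrightarrow> norm (F z) \<le> B * (1 + norm z) ^ j * exp (- 2 * pi * Im z))"
  using assms
proof induction
  case (monomial a j)
  obtain d where d: "d holomorphic_on ball 0 1" "\<And>w. w \<in> ball 0 1 \<Longrightarrow> a w = w * d w"
    using holomorphic_divide_self[OF monomial] by blast
  obtain B where B: "B > 0" "\<And>z. Im z \<ge> 1 \<Longrightarrow> norm (d (nome z)) \<le> B"
    using holomorphic_bounded_nome[OF d(1), of 1 1] by auto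
  have "norm (z ^ j * a (nome z)) \<le> B * (1 + norm z) ^ j * exp (- 2 * pi * Im z)" if "Im z \<ge> 1" for z
  proof -
    have "norm (nome z) < 1" using that by (simp add: norm_nome_less_1_iff)
    then have "norm (z ^ j * a (nome z)) = norm z ^ j * norm (d (nome z)) * exp (- 2 * pi * Im z)"
      by (simp add: d(2) norm_mult norm_power norm_nome)
    also have "\<dots> \<le> (1 + norm z) ^ j * B * exp (- 2 * pi * Im z)"
      using B(2)[OF that] by (intro mult_right_mono mult_mono power_mono) auto
    finally show ?thesis by (simp add: mult_ac)
  qed
  with B(1) show ?case by blast
next
  case (add F G)
  then obtain B j B' j' where B: "B > 0" "B' > 0"
     "\<And>z. Im z \<ge> 1 \<Longrightarrow> norm (F z) \<le> B * (1 + norm z) ^ j * exp (- 2 * pi * Im z)"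
     "\<And>z. Im z \<ge> 1 \<Longrightarrow> norm (G z) \<le> B' * (1 + norm z) ^ j' * exp (- 2 * pi * Im z)" by blast
  have "norm (F z + G z) \<le> (B + B') * (1 + norm z) ^ max j j' * exp (- 2 * pi * Im z)" if "Im z \<ge> 1" for z
  proof -
    have "norm (F z + G z) \<le> norm (F z) + norm (G z)" by (rule norm_triangle_ineq)
    also have "\<dots> \<le> B * (1 + norm z) ^ j * exp (- 2 * pi * Im z) + B' * (1 + norm z) ^ j' * exp (- 2 * pi * Im z)"
      using B that by (intro add_mono) auto
    also have "\<dots> \<le> B * (1 + norm z) ^ max j j' * exp (- 2 * pi * Im z)
        + B' * (1 + norm z) ^ max j j' * exp (- 2 * pi * Im z)"
      using B(1,2) by (intro add_mono mult_right_mono mult_left_mono power_increasing) auto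
    finally show ?thesis by (simp add: distrib_right)
  qed
  with B(1,2) show ?case by (intro exI[of _ "B + B'"] exI[of _ "max j j'"]) auto
qed

lemma small_decay:
  assumes "small F"
  shows "(\<lambda>y. F (Complex x y)) \<in> o[at_top](\<lambda>y. of_real (1 / y ^ N))"
proof (rule smalloI_tendsto)
  obtain B j where B: "B > 0" "\<And>z. Im z \<ge> 1 \<Longrightarrow> norm (F z) \<le> B * (1 + norm z) ^ j * exp (- 2 * pi * Im z)"
    using small_bound[OF assms] by blast
  show "\<forall>\<^sub>F y in at_top. (of_real (1 / y ^ N) :: complex) \<noteq> 0"
    using eventually_gt_at_top[of 0] by eventually_elim auto
  have "((\<lambda>y::real. y ^ (j + N) / exp y) \<longlongrightarrow> 0) at_top" by (rule tendsto_power_div_exp_0)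
  from tendsto_mult_right_zero[OF this, of "B * 3 ^ j"]
  have lim: "((\<lambda>y. B * 3 ^ j * (y ^ (j + N) / exp y)) \<longlongrightarrow> 0) at_top" .
  \<comment> \<open>For \<open>y >= max 1 |x|\<close> one has \<open>1 + norm z <= 3 y\<close>, the
    origin of \<open>3 ^ j\<close>; of the factor exp (- 2 pi y) only exp (- y) is kept.\<close>
  have "\<forall>\<^sub>F y in at_top. norm (F (Complex x y) / of_real (1 / y ^ N)) \<le> B * 3 ^ j * (y ^ (j + N) / exp y)"
    using eventually_ge_at_top[of "max 1 \<bar>x\<bar>"]
  proof eventually_elim
    case (elim y)
    then have y: "y \<ge> 1" "\<bar>x\<bar> \<le> y" by auto
    have "norm (Complex x y) \<le> \<bar>x\<bar> + \<bar>y\<bar>" using cmod_le[of "Complex x y"] by simp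
    then have n: "1 + norm (Complex x y) \<le> 3 * y" using y by simp
    have "norm (F (Complex x y)) \<le> B * (1 + norm (Complex x y)) ^ j * exp (- 2 * pi * y)"
      using B(2)[of "Complex x y"] y by simp
    also have "\<dots> \<le> B * (3 * y) ^ j * exp (- y)"
    proof -
      have "1 * y \<le> 2 * pi * y" using y pi_ge_two by (intro mult_right_mono) auto
      then show ?thesis using n B(1) y by (intro mult_mono mult_left_mono power_mono) auto
    qed
    finally have "norm (F (Complex x y)) * y ^ N \<le> B * (3 * y) ^ j * exp (- y) * y ^ N"
      using y by (intro mult_right_mono) auto
    moreover have "norm (F (Complex x y) / of_real (1 / y ^ N)) = norm (F (Complex x y)) * y ^ N"
      using y by (simp add: norm_divide norm_mult norm_power)
    moreover have "B * (3 * y) ^ j * exp (- y) * y ^ N = B * 3 ^ j * (y ^ (j + N) / exp y)"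
      by (simp add: power_mult_distrib power_add exp_minus divide_inverse mult_ac)
    ultimately show ?case by simp
  qed
  then show "((\<lambda>y. F (Complex x y) / of_real (1 / y ^ N)) \<longlongrightarrow> 0) at_top"
    by (rule Lim_null_comparison[OF _ lim])
qed

text \<open>On the imaginary axis the difference of the two polynomials tends to 0, whereas a
  nonconstant polynomial tends to infinity. This makes the definite description in
  \<open>reg_value\<close> meaningful.\<close>

lemma regularizes_unique:
  assumes "regularizes F P" "regularizes F Q"
  shows "P = Q"
proof -
  have "(\<lambda>y. F (Complex 0 y) - poly P (Complex 0 y)) \<in> o[at_top](\<lambda>y. of_real (1 / y ^ 1))"
    "(\<lambda>y. F (Complex 0 y) - poly Q (Complex 0 y)) \<in> o[at_top](\<lambda>y. of_real (1 / y ^ 1))"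
    using assms unfolding regularizes_def by (metis order_refl)+
  from sum_in_smallo(2)[OF this(2,1)]
  have "(\<lambda>y. (F (Complex 0 y) - poly Q (Complex 0 y)) - (F (Complex 0 y) - poly P (Complex 0 y)))
      \<in> o[at_top](\<lambda>y. of_real (1 / y ^ 1))" .
  moreover have "(F (Complex 0 y) - poly Q (Complex 0 y)) - (F (Complex 0 y) - poly P (Complex 0 y))
      = poly (P - Q) (Complex 0 y)" for y by simp
  ultimately have "(\<lambda>y. poly (P - Q) (Complex 0 y)) \<in> o[at_top](\<lambda>y. of_real (1 / y ^ 1))"
    by (simp only:)
  from smalloD_tendsto[OF this]
  have lim1: "((\<lambda>y. norm (poly (P - Q) (Complex 0 y) / of_real (1 / y ^ 1))) \<longlongrightarrow> 0) at_top"
    by (rule tendsto_norm_zero)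
  have lim: "((\<lambda>y. poly (P - Q) (Complex 0 y)) \<longlongrightarrow> 0) at_top"
  proof (rule Lim_null_comparison[OF _ lim1])
    show "\<forall>\<^sub>F y in at_top. norm (poly (P - Q) (Complex 0 y))
        \<le> norm (poly (P - Q) (Complex 0 y) / of_real (1 / y ^ 1))"
      using eventually_ge_at_top[of 1]
    proof eventually_elim
      case (elim y)
      then have "norm (poly (P - Q) (Complex 0 y)) * 1 \<le> norm (poly (P - Q) (Complex 0 y)) * y"
        by (intro mult_left_mono) auto
      with elim show ?case by (simp add: norm_divide norm_mult)
    qed
  qed
  obtain a p where p: "P - Q = pCons a p" by (cases "P - Q")
  have "p = 0"
  proof (rule ccontr)
    assume "p \<noteq> 0"
    from poly_infinity[OF this, of 1 a] obtain r where r: "\<And>z. r \<le> norm z \<Longrightarrow> 1 \<le> norm (poly (P - Q) z)"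
      by (auto simp: p)
    have "\<forall>\<^sub>F y in at_top. norm (poly (P - Q) (Complex 0 y)) < 1"
      using tendstoD[OF lim, of 1] by simp
    then have "\<forall>\<^sub>F y::real in at_top. False"
      using eventually_ge_at_top[of "max 0 r"]
    proof eventually_elim
      case (elim y)
      then have "norm (Complex 0 y) = y" by (simp add: cmod_def)
      with r[of "Complex 0 y"] elim show ?case by auto
    qed
    then show False by simp
  qed
  with lim p have "((\<lambda>y::real. a) \<longlongrightarrow> 0) at_top" by simp
  then have "a = 0" by (simp add: tendsto_const_iff)
  with p \<open>p = 0\<close> show ?thesis by simp
qed

lemma reg_value_eq:
  assumes "regularizes F P"
  shows "reg_value F = poly P 0"
proof -
  have "(THE P. regularizes F P) = P"
    using assms regularizes_unique by (intro the_equality) auto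
  then show ?thesis by (simp add: reg_value_def)
qed

section \<open>Integrals of a modular form along the modular transformation at the cusp 0\<close>

lemma has_qexp_nonzero: "has_qexp h r C F \<Longrightarrow> Im z > 0 \<Longrightarrow> F z \<noteq> 0"
  by (erule has_qexpE) (simp add: norm_nome_div_less_1)

lemma has_qexp_holomorphic:
  assumes "has_qexp h r C F"
  shows "F holomorphic_on upper_half"
  using has_qexp_deriv[OF assms] by (auto simp: holomorphic_on_open open_halfspace_Im_gt)

lemma Im_minus_inverse_pos: "Im z > 0 \<Longrightarrow> Im (- 1 / z) > 0"
  by (simp add: Im_divide power2_eq_square sum_squares_gt_zero_iff)

lemma nome_upper_half_compose:
  assumes "\<phi> holomorphic_on ball 0 1" "h > 0"
  shows "(\<lambda>z. \<phi> (nome (z / of_nat h))) holomorphic_on upper_half"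
  by (intro holomorphic_intros holomorphic_on_compose_gen[OF _ assms(1), unfolded o_def])
     (use assms(2) norm_nome_div_less_1 in auto)

lemma nome_ii_tendsto: "((\<lambda>y. nome (\<i> * of_real y)) \<longlongrightarrow> 0) at_top"
proof (rule tendsto_norm_zero_cancel)
  have "filterlim (\<lambda>y. (- 2 * pi) * y) at_bot at_top"
    by (rule filterlim_tendsto_neg_mult_at_bot[OF tendsto_const _ filterlim_ident]) simp
  from filterlim_compose[OF exp_at_bot this]
  have "((\<lambda>y. exp (- 2 * pi * y)) \<longlongrightarrow> 0) at_top" .
  then show "((\<lambda>y. norm (nome (\<i> * of_real y))) \<longlongrightarrow> 0) at_top"
    by (simp add: norm_nome)
qed

text \<open>A logarithm is determined only up to multiples of 2 pi i. As \<open>L\<close> is real on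
  the imaginary axis, \<open>l 0\<close> is a limit of real numbers and hence real; with
  \<open>exp (l 0) = 1\<close> it is 0.\<close>

lemma has_qexp_real_log:
  assumes F: "has_qexp 1 r 1 F" and l: "L holomorphic_on upper_half" "\<And>z. Im z > 0 \<Longrightarrow> exp (L z) = F z"
    and L_real: "\<And>y. y > 0 \<Longrightarrow> L (\<i> * of_real y) \<in> \<real>"
  shows "\<exists>l. l holomorphic_on ball 0 1 \<and> l 0 = 0 \<and>
    (\<forall>z. Im z > 0 \<longrightarrow> L z = 2 * of_real pi * \<i> * of_real r * z + l (nome z))"
proof -
  obtain l where l: "l holomorphic_on ball 0 1" "exp (l 0) = 1"
    "\<And>z. Im z > 0 \<Longrightarrow> L z = 2 * of_real pi * \<i> * of_real r * z + l (nome z)"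
    using has_qexp_log[OF F l(1,2)] by auto
  have "isCont l 0"
    using holomorphic_on_imp_continuous_on[OF l(1)] continuous_on_eq_continuous_at[OF open_ball]
    by (metis centre_in_ball zero_less_one)
  then have "((\<lambda>y. l (nome (\<i> * of_real y))) \<longlongrightarrow> l 0) at_top"
    by (rule isCont_tendsto_compose[OF _ nome_ii_tendsto])
  moreover have "\<forall>\<^sub>F y in at_top. l (nome (\<i> * of_real y)) \<in> \<real>"
    using eventually_gt_at_top[of 0]
  proof eventually_elim
    case (elim y)
    have "l (nome (\<i> * of_real y)) = L (\<i> * of_real y) + of_real (2 * pi * r * y)"
      using l(3)[of "\<i> * of_real y"] elim by (simp add: algebra_simps)
    with L_real[OF elim] show ?case by auto
  qed
  ultimately have "l 0 \<in> \<real>"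
    by (rule Lim_in_closed_set[OF closed_complex_Reals _ trivial_limit_at_top_linorder, rotated -1])
  then obtain x where x: "l 0 = of_real x" by (auto elim: Reals_cases)
  with l(2) have "exp x = 1" by (metis exp_of_real of_real_eq_1_iff)
  with x have "l 0 = 0" by simp
  with l show ?thesis by blast
qed

text \<open>Only the two cusps joined by the path of integration enter: \<open>t\<close> has a
  simple zero at infinity and a finite nonzero value at 0, \<open>f\<close> has nonzero values at
  both. The behaviour under \<open>z / (b z + 1)\<close> is not assumed; it follows from the
  expansions in \<open>nome (z / b)\<close> at 0.\<close>

locale modular_pair =
  fixes t f :: "complex \<Rightarrow> complex" and b :: nat
  assumes t_inf: "has_qexp 1 1 1 t"
    and f_inf: "has_qexp 1 0 1 f"
    and t_0: "\<exists>C. has_qexp b 0 C (\<lambda>z. t (- 1 / z))"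
    and f_0: "\<exists>C. has_qexp b 0 C (\<lambda>z. f (- 1 / z) / z)"
    and t_pos: "\<And>y. y > 0 \<Longrightarrow> \<exists>r>0. t (\<i> * of_real y) = of_real r"
begin

definition L :: "complex \<Rightarrow> complex" where
  "L = log_branch t"

definition g :: "complex \<Rightarrow> complex" where
  "g z = 1 / (2 * of_real pi * \<i>) * (deriv t z / t z) * f z"

definition D :: "nat \<Rightarrow> complex \<Rightarrow> complex" where
  "D m z0 = contour_integral (linepath (z0 / (of_nat b * z0 + 1)) z0) (\<lambda>z. L z ^ m * g z)"

lemma b_pos: "b > 0"
  using t_0 by (auto simp: has_qexp_def)

lemma t_nonzero: "Im z > 0 \<Longrightarrow> t z \<noteq> 0"
  by (rule has_qexp_nonzero[OF t_inf])

lemma t_holomorphic: "t holomorphic_on upper_half"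
  by (rule has_qexp_holomorphic[OF t_inf])

lemma
  shows L_holomorphic: "L holomorphic_on upper_half"
    and exp_L: "Im z > 0 \<Longrightarrow> exp (L z) = t z"
    and L_real: "y > 0 \<Longrightarrow> L (\<i> * of_real y) \<in> \<real>"
  using someI_ex[OF log_branch_exists[OF t_holomorphic t_nonzero t_pos]]
  unfolding L_def log_branch_def by auto

lemma L_inf: "\<exists>l. l holomorphic_on ball 0 1 \<and> l 0 = 0 \<and>
    (\<forall>z. Im z > 0 \<longrightarrow> L z = 2 * of_real pi * \<i> * z + l (nome z))"
  using has_qexp_real_log[OF t_inf L_holomorphic exp_L L_real] by simp

lemma g_inf: "\<exists>\<gamma>. \<gamma> holomorphic_on ball 0 1 \<and> \<gamma> 0 = 1 \<and> (\<forall>z. Im z > 0 \<longrightarrow> g z = \<gamma> (nome z))"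
proof -
  obtain \<sigma> where \<sigma>: "\<sigma> holomorphic_on ball 0 1" "\<And>z. Im z > 0 \<Longrightarrow>
    (t has_field_derivative t z * (2 * of_real pi * \<i> + nome z * \<sigma> (nome z))) (at z)"
    using has_qexp_deriv[OF t_inf] by auto
  obtain \<phi> where \<phi>: "\<phi> holomorphic_on ball 0 1" "\<phi> 0 = 1" "\<And>z. Im z > 0 \<Longrightarrow> f z = \<phi> (nome z)"
    using f_inf by (rule has_qexpE) auto
  have "g z = (1 + nome z * \<sigma> (nome z) / (2 * of_real pi * \<i>)) * \<phi> (nome z)" if z: "Im z > 0" for z
    unfolding g_def DERIV_imp_deriv[OF \<sigma>(2)[OF z]] \<phi>(3)[OF z]
    using t_nonzero[OF z] by (simp add: field_simps)
  moreover have "(\<lambda>w. (1 + w * \<sigma> w / (2 * of_real pi * \<i>)) * \<phi> w) holomorphic_on ball 0 1"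
    by (intro holomorphic_intros \<sigma> \<phi>) auto
  ultimately show ?thesis
    by (intro exI[of _ "\<lambda>w. (1 + w * \<sigma> w / (2 * of_real pi * \<i>)) * \<phi> w"]) (simp add: \<phi>(2))
qed

lemma L_0: "\<exists>l. l holomorphic_on ball 0 1 \<and> (\<forall>z. Im z > 0 \<longrightarrow> L (- 1 / z) = l (nome (z / of_nat b)))"
proof -
  obtain C where C: "has_qexp b 0 C (\<lambda>z. t (- 1 / z))" using t_0 by blast
  have "(\<lambda>z. L (- 1 / z)) holomorphic_on upper_half"
    by (rule holomorphic_on_compose_gen[OF _ L_holomorphic, unfolded o_def])
       (use Im_minus_inverse_pos in \<open>auto intro!: holomorphic_intros\<close>)
  from has_qexp_log[OF C this exp_L[OF Im_minus_inverse_pos]] show ?thesis by auto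
qed

text \<open>The weight is 1 from \<open>f\<close> plus 2 from the derivative of \<open>t\<close>.
  Since \<open>t\<close> has order 0 at this cusp, its logarithmic derivative has no constant term,
  whence the factor \<open>nome (z / b)\<close>.\<close>

lemma g_0: "\<exists>\<gamma>. \<gamma> holomorphic_on ball 0 1 \<and>
    (\<forall>z. Im z > 0 \<longrightarrow> g (- 1 / z) = z ^ 3 * (nome (z / of_nat b) * \<gamma> (nome (z / of_nat b))))"
proof -
  obtain C where C: "has_qexp b 0 C (\<lambda>z. t (- 1 / z))" using t_0 by blast
  obtain \<sigma> where \<sigma>: "\<sigma> holomorphic_on ball 0 1" "\<And>z. Im z > 0 \<Longrightarrow>
    ((\<lambda>z. t (- 1 / z)) has_field_derivative t (- 1 / z) * (nome (z / of_nat b) * \<sigma> (nome (z / of_nat b)))) (at z)"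
    using has_qexp_deriv[OF C] by auto
  obtain C' where "has_qexp b 0 C' (\<lambda>z. f (- 1 / z) / z)" using f_0 by blast
  then obtain \<phi> where \<phi>: "\<phi> holomorphic_on ball 0 1"
    "\<And>z. Im z > 0 \<Longrightarrow> f (- 1 / z) / z = \<phi> (nome (z / of_nat b))"
    by (rule has_qexpE) auto
  have "g (- 1 / z) = z ^ 3 * (nome (z / of_nat b) * (\<sigma> (nome (z / of_nat b)) * \<phi> (nome (z / of_nat b)) / (2 * of_real pi * \<i>)))"
    if z: "Im z > 0" for z
  proof -
    have z0: "z \<noteq> 0" using z by auto
    have z': "Im (- 1 / z) > 0" by (rule Im_minus_inverse_pos[OF z])
    have "(t has_field_derivative deriv t (- 1 / z)) (at (- 1 / z))"
      by (rule holomorphic_derivI[OF t_holomorphic]) (use z' in \<open>auto simp: open_halfspace_Im_gt\<close>)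
    then have "((\<lambda>z. t (- 1 / z)) has_field_derivative deriv t (- 1 / z) * (1 / z\<^sup>2)) (at z)"
      by (rule DERIV_chain2) (use z0 in \<open>auto intro!: derivative_eq_intros simp: power2_eq_square\<close>)
    from DERIV_unique[OF this \<sigma>(2)[OF z]]
    have "deriv t (- 1 / z) / t (- 1 / z) = z\<^sup>2 * (nome (z / of_nat b) * \<sigma> (nome (z / of_nat b)))"
      using z0 t_nonzero[OF z'] by (simp add: field_simps)
    moreover have "f (- 1 / z) = z * \<phi> (nome (z / of_nat b))"
      using \<phi>(2)[OF z] z0 by (simp add: field_simps)
    ultimately show ?thesis by (simp add: g_def power2_eq_square power3_eq_cube)
  qed
  moreover have "(\<lambda>w. \<sigma> w * \<phi> w / (2 * of_real pi * \<i>)) holomorphic_on ball 0 1"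
    by (intro holomorphic_intros \<sigma> \<phi>) auto
  ultimately show ?thesis by (intro exI[of _ "\<lambda>w. \<sigma> w * \<phi> w / (2 * of_real pi * \<i>)"]) simp
qed

lemma g_holomorphic: "g holomorphic_on upper_half"
proof -
  obtain \<gamma> where \<gamma>: "\<gamma> holomorphic_on ball 0 1" "\<And>z. Im z > 0 \<Longrightarrow> g z = \<gamma> (nome z)"
    using g_inf by blast
  show ?thesis
    by (rule holomorphic_transform[OF nome_upper_half_compose[OF \<gamma>(1), of 1]]) (simp_all add: \<gamma>(2))
qed

lemma integrand_0: "\<exists>H. H holomorphic_on ball 0 1 \<and> (\<forall>z. Im z > 0 \<longrightarrow>
    L (- 1 / z) ^ m * g (- 1 / z) = z ^ 3 * (nome (z / of_nat b) * H (nome (z / of_nat b))))"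
proof -
  obtain l where l: "l holomorphic_on ball 0 1" "\<And>z. Im z > 0 \<Longrightarrow> L (- 1 / z) = l (nome (z / of_nat b))"
    using L_0 by blast
  obtain \<gamma> where \<gamma>: "\<gamma> holomorphic_on ball 0 1"
    "\<And>z. Im z > 0 \<Longrightarrow> g (- 1 / z) = z ^ 3 * (nome (z / of_nat b) * \<gamma> (nome (z / of_nat b)))"
    using g_0 by blast
  show ?thesis
  proof (intro exI[of _ "\<lambda>w. l w ^ m * \<gamma> w"] conjI allI impI)
    fix z :: complex assume z: "Im z > 0"
    show "L (- 1 / z) ^ m * g (- 1 / z)
        = z ^ 3 * (nome (z / of_nat b) * (l (nome (z / of_nat b)) ^ m * \<gamma> (nome (z / of_nat b))))"
      unfolding l(2)[OF z] \<gamma>(2)[OF z] by (simp only: mult_ac)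
  qed (intro holomorphic_intros l(1) \<gamma>(1))
qed

lemma cusp_0_stabilizer:
  assumes "Im z > 0"
  shows "z / (of_nat b * z + 1) = - 1 / (- 1 / z - of_nat b)" "of_nat b * z + 1 \<noteq> 0"
    "Im (z / (of_nat b * z + 1)) > 0"
proof -
  have z0: "z \<noteq> 0" using assms by auto
  show nz: "of_nat b * z + 1 \<noteq> 0"
    using int_linear_nonzero[OF assms, of "int b" 1] by simp
  moreover have "of_nat b * z + 1 = - z * (- 1 / z - of_nat b)" using z0 by (simp add: field_simps)
  ultimately have "- 1 / z - of_nat b \<noteq> 0" by (metis mult_zero_right)
  with nz z0 show eq: "z / (of_nat b * z + 1) = - 1 / (- 1 / z - of_nat b)" by (simp add: field_simps)
  have "Im (- 1 / z - of_nat b) > 0" using Im_minus_inverse_pos[OF assms] by simp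
  then show "Im (z / (of_nat b * z + 1)) > 0" unfolding eq by (rule Im_minus_inverse_pos)
qed

lemma nome_shift_b: "nome ((w - of_nat b) / of_nat b) = nome (w / of_nat b)"
  using b_pos by (simp add: diff_divide_distrib nome_diff)

text \<open>In the coordinate \<open>w = - 1 / z\<close> the map is translation by
  \<open>- b\<close>, which leaves \<open>nome (w / b)\<close> fixed; only the cube of
  \<open>w\<close> changes.\<close>

lemma integrand_stabilizer:
  assumes z: "Im z > 0"
  shows "L (z / (of_nat b * z + 1)) ^ m * g (z / (of_nat b * z + 1)) = (of_nat b * z + 1) ^ 3 * (L z ^ m * g z)"
proof -
  obtain H where H: "\<And>z. Im z > 0 \<Longrightarrow>
    L (- 1 / z) ^ m * g (- 1 / z) = z ^ 3 * (nome (z / of_nat b) * H (nome (z / of_nat b)))"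
    using integrand_0 by blast
  define w where "w = - 1 / z"
  have z0: "z \<noteq> 0" using z by auto
  have w: "Im w > 0" "z = - 1 / w" using Im_minus_inverse_pos[OF z] z0 by (simp_all add: w_def)
  have "L (z / (of_nat b * z + 1)) ^ m * g (z / (of_nat b * z + 1))
      = (w - of_nat b) ^ 3 * (nome (w / of_nat b) * H (nome (w / of_nat b)))"
    unfolding cusp_0_stabilizer(1)[OF z] using H[of "w - of_nat b"] w(1) by (simp add: w_def nome_shift_b[unfolded w_def])
  also have "w - of_nat b = (of_nat b * z + 1) * w" using z0 by (simp add: w_def field_simps)
  finally show ?thesis using H[OF w(1)] w(2) by (simp add: power_mult_distrib mult.assoc)
qed

lemma D_primitive: "\<exists>J. (\<forall>z. Im z > 0 \<longrightarrow> (J has_field_derivative L z ^ m * g z) (at z)) \<and>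
    (\<forall>z. Im z > 0 \<longrightarrow> D m z = J z - J (z / (of_nat b * z + 1)))"
proof -
  obtain J where "\<And>z. z \<in> upper_half \<Longrightarrow> (J has_field_derivative L z ^ m * g z) (at z within upper_half)"
    by (rule holomorphic_convex_primitive'[of upper_half "\<lambda>z. L z ^ m * g z"])
       (auto intro!: holomorphic_intros L_holomorphic g_holomorphic simp: convex_halfspace_Im_gt open_halfspace_Im_gt)
  then have J: "(J has_field_derivative L z ^ m * g z) (at z)" if "Im z > 0" for z
    using that by (metis at_within_open mem_Collect_eq open_halfspace_Im_gt)
  have "D m z = J z - J (z / (of_nat b * z + 1))" if z: "Im z > 0" for z
  proof -
    have "path_image (linepath (z / (of_nat b * z + 1)) z) \<subseteq> upper_half"
      using z cusp_0_stabilizer(3)[OF z] closed_segment_subset[OF _ _ convex_halfspace_Im_gt[of 0]] by simp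
    then have "((\<lambda>z. L z ^ m * g z) has_contour_integral
        J (pathfinish (linepath (z / (of_nat b * z + 1)) z)) - J (pathstart (linepath (z / (of_nat b * z + 1)) z)))
        (linepath (z / (of_nat b * z + 1)) z)"
      by (intro contour_integral_primitive[where S = upper_half]) (auto intro: has_field_derivative_at_within J)
    then show ?thesis unfolding D_def by (simp add: contour_integral_unique)
  qed
  with J show ?thesis by blast
qed

text \<open>The derivative \<open>1 / (b z + 1)^2\<close> of the moving initial point meets the
  factor \<open>(b z + 1)^3\<close> of \<open>integrand_stabilizer\<close>; what is left is
  \<open>1 - (b z + 1)\<close> times the integrand.\<close>

lemma D_deriv:
  assumes z: "Im z > 0"
  shows "(D m has_field_derivative - (of_nat b * z * (L z ^ m * g z))) (at z)"
proof -
  obtain J where J: "\<And>z. Im z > 0 \<Longrightarrow> (J has_field_derivative L z ^ m * g z) (at z)"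
    "\<And>z. Im z > 0 \<Longrightarrow> D m z = J z - J (z / (of_nat b * z + 1))"
    using D_primitive by blast
  have nz: "of_nat b * z + 1 \<noteq> 0" by (rule cusp_0_stabilizer(2)[OF z])
  have "((\<lambda>z. z / (of_nat b * z + 1)) has_field_derivative 1 / (of_nat b * z + 1) ^ 2) (at z)"
    by (rule derivative_eq_intros refl nz)+ (use nz in \<open>simp add: power2_eq_square field_simps\<close>)
  from DERIV_chain2[OF J(1)[OF cusp_0_stabilizer(3)[OF z]] this]
  have "((\<lambda>z. J (z / (of_nat b * z + 1))) has_field_derivative
      (of_nat b * z + 1) * (L z ^ m * g z)) (at z)"
    unfolding integrand_stabilizer[OF z] using nz by (simp add: power2_eq_square power3_eq_cube)
  from DERIV_diff[OF J(1)[OF z] this]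
  have "((\<lambda>z. J z - J (z / (of_nat b * z + 1))) has_field_derivative - (of_nat b * z * (L z ^ m * g z))) (at z)"
    by (simp add: algebra_simps)
  then show ?thesis
    by (rule has_field_derivative_transform_within_open[where S = upper_half])
       (use z J(2) in \<open>auto simp: open_halfspace_Im_gt\<close>)
qed

text \<open>For \<open>z = i / x\<close> the two endpoints correspond, under
  \<open>w = - 1 / z\<close>, to the ends of a horizontal segment of length \<open>b\<close> at
  height \<open>x\<close>. There the integrand, transported to \<open>w\<close>, is \<open>w\<close>
  times a function that decays exponentially in \<open>x\<close>.\<close>

lemma D_at_0: "((\<lambda>y. D m (\<i> * of_real y)) \<longlongrightarrow> 0) (at_right 0)"
proof -
  obtain J where J: "\<And>z. Im z > 0 \<Longrightarrow> (J has_field_derivative L z ^ m * g z) (at z)"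
    "\<And>z. Im z > 0 \<Longrightarrow> D m z = J z - J (z / (of_nat b * z + 1))"
    using D_primitive by blast
  obtain H where H: "H holomorphic_on ball 0 1" "\<And>z. Im z > 0 \<Longrightarrow>
    L (- 1 / z) ^ m * g (- 1 / z) = z ^ 3 * (nome (z / of_nat b) * H (nome (z / of_nat b)))"
    using integrand_0 by blast
  obtain B where B: "B > 0" "\<And>z. Im z \<ge> 1 \<Longrightarrow> norm (H (nome (z / of_nat b))) \<le> B"
    using holomorphic_bounded_nome[OF H(1), of 1 b] b_pos by auto
  have dK: "((\<lambda>w. J (- 1 / w)) has_field_derivative w * (nome (w / of_nat b) * H (nome (w / of_nat b)))) (at w)"
    if w: "Im w > 0" for w
  proof -
    have w0: "w \<noteq> 0" using w by auto
    have "((\<lambda>w. - 1 / w) has_field_derivative 1 / w\<^sup>2) (at w)"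
      using w0 by (auto intro!: derivative_eq_intros simp: power2_eq_square)
    from DERIV_chain2[OF J(1)[OF Im_minus_inverse_pos[OF w]] this] show ?thesis
      unfolding H(2)[OF w] using w0 by (simp add: power2_eq_square power3_eq_cube)
  qed
  \<comment> \<open>\<open>x + b\<close> bounds \<open>norm v\<close>, the exponential times
    \<open>B\<close> bounds the remaining factor, and the last \<open>b\<close> is the length of the
    segment.\<close>
  define M where "M x = (x + b) * (exp (- 2 * pi * x / b) * B) * b" for x :: real
  have bound: "norm (D m (\<i> * of_real (1 / x))) \<le> M x" if x: "x \<ge> 1" for x :: real
  proof -
    define w where "w = \<i> * of_real x"
    have w: "\<i> * of_real (1 / x) = - 1 / w" using x by (simp add: w_def field_simps)
    have Imw: "Im (- 1 / w) > 0" using x by (intro Im_minus_inverse_pos) (simp add: w_def)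
    have "D m (- 1 / w) = J (- 1 / w) - J (- 1 / (w - of_nat b))"
      using J(2)[OF Imw] cusp_0_stabilizer(1)[OF Imw] x by (simp add: w_def)
    also have "norm \<dots> \<le> ((x + b) * (exp (- 2 * pi * x / b) * B)) * norm (w - (w - of_nat b))"
    proof (rule field_differentiable_bound[where S = "closed_segment w (w - of_nat b)"])
      fix v assume "v \<in> closed_segment w (w - of_nat b)"
      then obtain u where u: "0 \<le> u" "u \<le> 1" "v = (1 - u) *\<^sub>R w + u *\<^sub>R (w - of_nat b)"
        by (auto simp: in_segment)
      have v: "v = w - of_real (u * b)" by (simp add: u(3) algebra_simps scaleR_conv_of_real)
      have Imv: "Im v = x" by (simp add: v w_def)
      show "((\<lambda>w. J (- 1 / w)) has_field_derivative v * (nome (v / of_nat b) * H (nome (v / of_nat b))))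
          (at v within closed_segment w (w - of_nat b))"
        by (rule has_field_derivative_at_within[OF dK]) (use Imv x in simp)
      have "norm v \<le> norm w + norm (complex_of_real (u * b))" unfolding v by (rule norm_triangle_ineq4)
      also have "\<dots> = x + u * real b" using x u by (simp add: w_def norm_mult)
      also have "u * real b \<le> 1 * real b" using u by (intro mult_right_mono) auto
      finally have "norm v \<le> x + b" by simp
      then show "norm (v * (nome (v / of_nat b) * H (nome (v / of_nat b)))) \<le> (x + b) * (exp (- 2 * pi * x / b) * B)"
        unfolding norm_mult using B(2)[of v] B(1) x Imv by (intro mult_mono) (auto simp: norm_nome)
    qed auto
    finally show ?thesis unfolding w M_def by simp
  qed
  have "(M \<longlongrightarrow> 0) at_top"
  proof -
    define c where "c = 2 * pi / b"
    have c: "c > 0" using b_pos by (simp add: c_def)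
    have "filterlim (\<lambda>x. c * x) at_top at_top"
      by (rule filterlim_tendsto_pos_mult_at_top[OF tendsto_const c filterlim_ident])
    then have "((\<lambda>x. (c * x) ^ k / exp (c * x)) \<longlongrightarrow> 0) at_top" for k
      by (rule filterlim_compose[OF tendsto_power_div_exp_0])
    from tendsto_add[OF tendsto_mult_right_zero[OF this[of 1], of "b * B / c"]
        tendsto_mult_right_zero[OF this[of 0], of "b * b * B"]]
    have "((\<lambda>x. b * B / c * ((c * x) ^ 1 / exp (c * x)) + b * b * B * ((c * x) ^ 0 / exp (c * x))) \<longlongrightarrow> 0) at_top"
      by simp
    moreover have "b * B / c * ((c * x) ^ 1 / exp (c * x)) + b * b * B * ((c * x) ^ 0 / exp (c * x)) = M x" for x
    proof -
      have "- 2 * pi * x / b = - (c * x)" by (simp add: c_def)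
      then have "M x = (x + b) * (inverse (exp (c * x)) * B) * b" by (simp only: M_def exp_minus)
      then show ?thesis using c by (simp add: field_simps)
    qed
    ultimately show ?thesis by (simp only:)
  qed
  from filterlim_compose[OF this filterlim_inverse_at_top_right]
  have lim: "((\<lambda>y. M (inverse y)) \<longlongrightarrow> 0) (at_right 0)" .
  show ?thesis
  proof (rule Lim_null_comparison[OF _ lim])
    have "\<forall>\<^sub>F y::real in at_right 0. y \<in> {0<..<1}" by (rule eventually_at_right_real) simp
    then show "\<forall>\<^sub>F y in at_right 0. norm (D m (\<i> * of_real y)) \<le> M (inverse y)"
    proof eventually_elim
      case (elim y)
      then have "inverse y \<ge> 1" by (simp add: one_le_inverse)
      from bound[OF this] show ?case by (simp add: field_simps)
    qed
  qed
qed

text \<open>Integrate the derivative found in \<open>D_deriv\<close>: its part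
  \<open>- b z (2 pi i z)^m\<close> gives the monomial, the rest is small and has a small primitive,
  and \<open>c0\<close> is the constant of integration.\<close>

lemma D_expansion:
  "\<exists>c0 G. small G \<and> (\<forall>z. Im z > 0 \<longrightarrow>
     D m z = - (of_nat b * (2 * of_real pi * \<i>) ^ m / of_nat (m + 2)) * z ^ (m + 2) + c0 + G z)"
proof -
  obtain l where l: "l holomorphic_on ball 0 1" "l 0 = 0"
    "\<And>z. Im z > 0 \<Longrightarrow> L z = 2 * of_real pi * \<i> * z + l (nome z)" using L_inf by blast
  obtain \<gamma> where \<gamma>: "\<gamma> holomorphic_on ball 0 1" "\<gamma> 0 = 1" "\<And>z. Im z > 0 \<Longrightarrow> g z = \<gamma> (nome z)"
    using g_inf by blast
  define p where "p = 2 * of_real pi * \<i>"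
  \<comment> \<open>The binomial expansion of \<open>z (L^m g - (p z)^m)\<close>, arranged so that
    every summand contains a positive power of \<open>l\<close> or the difference
    \<open>\<gamma> - 1\<close>, both without constant term.\<close>
  define R where "R z = z * ((\<Sum>k<m. (of_nat (m choose k) * p ^ k) * (z ^ k * (l (nome z) ^ (m - k) * \<gamma> (nome z))))
      + p ^ m * (z ^ m * (\<gamma> (nome z) - 1)))" for z
  have "small (\<lambda>z. z ^ k * (l (nome z) ^ (m - k) * \<gamma> (nome z)))" if "k < m" for k
  proof (rule small.monomial[of "\<lambda>w. l w ^ (m - k) * \<gamma> w"])
    show "(\<lambda>w. l w ^ (m - k) * \<gamma> w) holomorphic_on ball 0 1" by (intro holomorphic_intros l(1) \<gamma>(1))
  qed (use l(2) that in \<open>simp add: zero_power\<close>)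
  moreover have "small (\<lambda>z. z ^ m * (\<gamma> (nome z) - 1))"
    using small.monomial[of "\<lambda>w. \<gamma> w - 1" m] holomorphic_on_diff[OF \<gamma>(1) holomorphic_on_const[of 1]] \<gamma>(2) by simp
  ultimately have "small R"
    unfolding R_def by (intro small_times_z small.add small_sum small_cmult) auto
  then obtain G where G: "small G" "\<And>z. Im z > 0 \<Longrightarrow> (G has_field_derivative - of_nat b * R z) (at z)"
    using small_antiderivative[OF small_cmult[of R "- of_nat b"]] by blast
  have R: "R z = z * (L z ^ m * g z - (p * z) ^ m)" if z: "Im z > 0" for z
  proof -
    have "L z ^ m = (\<Sum>k\<le>m. of_nat (m choose k) * (p * z) ^ k * l (nome z) ^ (m - k))"
      unfolding l(3)[OF z] p_def[symmetric] by (rule binomial_ring)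
    also have "\<dots> = (\<Sum>k<m. of_nat (m choose k) * (p * z) ^ k * l (nome z) ^ (m - k)) + (p * z) ^ m"
      by (simp add: lessThan_Suc_atMost[symmetric])
    finally show ?thesis
      by (simp add: R_def \<gamma>(3)[OF z] power_mult_distrib sum_distrib_left sum_distrib_right algebra_simps)
  qed
  define E where "E z = D m z + (of_nat b * p ^ m / of_nat (m + 2)) * z ^ (m + 2) - G z" for z
  have "(E has_field_derivative 0) (at z)" if z: "Im z > 0" for z
  proof -
    have "((\<lambda>z. (of_nat b * p ^ m / of_nat (m + 2)) * z ^ (m + 2)) has_field_derivative
        of_nat b * p ^ m * z ^ (m + 1)) (at z)"
      by (rule derivative_eq_intros refl)+ (simp add: field_simps del: of_nat_add of_nat_Suc)
    from DERIV_diff[OF DERIV_add[OF D_deriv[OF z, of m] this] G(2)[OF z]]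
    have "(E has_field_derivative - (of_nat b * z * (L z ^ m * g z)) + of_nat b * p ^ m * z ^ (m + 1)
       - (- of_nat b * R z)) (at z)"
      unfolding E_def[abs_def] .
    moreover have "- (of_nat b * z * (L z ^ m * g z)) + of_nat b * p ^ m * z ^ (m + 1)
       - (- of_nat b * R z) = 0"
      unfolding R[OF z] by (simp add: algebra_simps power_mult_distrib)
    ultimately show ?thesis by (simp only:)
  qed
  then have "\<exists>c. \<forall>z\<in>upper_half. E z = c"
    by (intro has_field_derivative_zero_constant convex_halfspace_Im_gt)
       (auto intro: has_field_derivative_at_within)
  then obtain c0 where c0: "\<And>z. Im z > 0 \<Longrightarrow> E z = c0" by auto
  have "D m z = - (of_nat b * p ^ m / of_nat (m + 2)) * z ^ (m + 2) + c0 + G z" if "Im z > 0" for z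
    using c0[OF that] by (simp add: E_def algebra_simps del: of_nat_add)
  with G(1) show ?thesis unfolding p_def by blast
qed

lemma D_regularizes: "\<exists>P. regularizes (D m) P \<and> poly P 0 = reg_value (D m)"
  and D_reg_value: "\<exists>G. small G \<and> (\<forall>z. Im z > 0 \<longrightarrow>
     D m z = - (of_nat b * (2 * of_real pi * \<i>) ^ m / of_nat (m + 2)) * z ^ (m + 2) + reg_value (D m) + G z)"
proof -
  obtain c0 G where G: "small G" "\<And>z. Im z > 0 \<Longrightarrow>
     D m z = - (of_nat b * (2 * of_real pi * \<i>) ^ m / of_nat (m + 2)) * z ^ (m + 2) + c0 + G z"
    using D_expansion by blast
  define P where "P = Polynomial.monom (- (of_nat b * (2 * of_real pi * \<i>) ^ m / of_nat (m + 2))) (m + 2) + [:c0:]"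
  have reg: "regularizes (D m) P"
    unfolding regularizes_def
  proof (intro allI impI)
    fix N :: nat and x :: real
    have "\<forall>\<^sub>F y in at_top. D m (Complex x y) - poly P (Complex x y) = G (Complex x y)"
      using eventually_gt_at_top[of 0] by eventually_elim (simp add: G(2) P_def poly_monom del: of_nat_add)
    then show "(\<lambda>y. D m (Complex x y) - poly P (Complex x y)) \<in> o[at_top](\<lambda>y. of_real (1 / y ^ N))"
      using small_decay[OF G(1), of x N] by (simp only: landau_o.small.in_cong)
  qed
  have P0: "poly P 0 = c0" by (simp add: P_def poly_monom)
  with reg_value_eq[OF reg] have c0: "reg_value (D m) = c0" by simp
  show "\<exists>P. regularizes (D m) P \<and> poly P 0 = reg_value (D m)"
    by (intro exI[of _ P] conjI reg) (simp only: P0 c0)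
  show "\<exists>G. small G \<and> (\<forall>z. Im z > 0 \<longrightarrow>
     D m z = - (of_nat b * (2 * of_real pi * \<i>) ^ m / of_nat (m + 2)) * z ^ (m + 2) + reg_value (D m) + G z)"
    unfolding c0 by (intro exI[of _ G] conjI allI impI G)
qed

text \<open>The part of \<open>y L^m g\<close> left after removing its polynomial growth at
  infinity; the subtraction makes it integrable over the half-line.\<close>

definition w :: "nat \<Rightarrow> real \<Rightarrow> complex" where
  "w m y = of_real y * (L (\<i> * of_real y) ^ m * g (\<i> * of_real y) - of_real (- 2 * pi * y) ^ m)"

text \<open>Adding a monomial to \<open>D m / b\<close> cancels its growth and leaves the
  regularized value at infinity; at 0 both summands vanish. The minus sign of \<open>D_deriv\<close>
  is absorbed by \<open>z dz = - y dy\<close>.\<close>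

lemma w_primitive: "\<exists>W. (\<forall>y>0. (W has_vector_derivative w m y) (at y)) \<and>
    (W \<longlongrightarrow> 0) (at_right 0) \<and> (W \<longlongrightarrow> reg_value (D m) / of_nat b) at_top"
proof -
  obtain G where G: "small G" "\<And>z. Im z > 0 \<Longrightarrow>
     D m z = - (of_nat b * (2 * of_real pi * \<i>) ^ m / of_nat (m + 2)) * z ^ (m + 2) + reg_value (D m) + G z"
    using D_reg_value by blast
  define K where "K z = D m z / of_nat b + (2 * of_real pi * \<i>) ^ m / of_nat (m + 2) * z ^ (m + 2)" for z
  define W where "W y = K (\<i> * of_real y)" for y :: real
  have b0: "of_nat b \<noteq> (0 :: complex)" using b_pos by simp
  have K': "(K has_field_derivative - (z * (L z ^ m * g z - (2 * of_real pi * \<i> * z) ^ m))) (at z)" if z: "Im z > 0" for z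
  proof -
    have "((\<lambda>z. (2 * of_real pi * \<i>) ^ m / of_nat (m + 2) * z ^ (m + 2)) has_field_derivative
        (2 * of_real pi * \<i>) ^ m * z ^ (m + 1)) (at z)"
      by (rule derivative_eq_intros refl)+ (simp add: field_simps del: of_nat_add of_nat_Suc)
    from DERIV_add[OF DERIV_cdivide[OF D_deriv[OF z, of m], of "of_nat b"] this]
    have "(K has_field_derivative - (of_nat b * z * (L z ^ m * g z)) / of_nat b
        + (2 * of_real pi * \<i>) ^ m * z ^ (m + 1)) (at z)"
      unfolding K_def[abs_def] .
    moreover have "- (of_nat b * z * (L z ^ m * g z)) / of_nat b + (2 * of_real pi * \<i>) ^ m * z ^ (m + 1)
       = - (z * (L z ^ m * g z - (2 * of_real pi * \<i> * z) ^ m))"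
      using b0 by (simp add: right_diff_distrib power_mult_distrib mult_ac)
    ultimately show ?thesis by (simp only:)
  qed
  have "(W has_vector_derivative w m y) (at y)" if y: "y > 0" for y
  proof -
    have "((\<lambda>y. \<i> * of_real y) has_vector_derivative \<i>) (at y)"
      by (auto intro!: derivative_eq_intros simp: has_vector_derivative_def scaleR_conv_of_real mult.commute)
    from field_vector_diff_chain_at[OF this K'[of "\<i> * of_real y"]] y
    have "(W has_vector_derivative \<i> * - (\<i> * of_real y * (L (\<i> * of_real y) ^ m * g (\<i> * of_real y)
        - (2 * of_real pi * \<i> * (\<i> * of_real y)) ^ m))) (at y)"
      by (simp add: W_def[abs_def] o_def)
    moreover have "2 * of_real pi * \<i> * (\<i> * of_real y) = complex_of_real (- 2 * pi * y)" by simp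
    ultimately show ?thesis unfolding w_def by (simp del: of_real_mult of_real_minus add: mult.assoc [symmetric])
  qed
  moreover have "(W \<longlongrightarrow> 0) (at_right 0)"
  proof -
    have "((\<lambda>y. D m (\<i> * of_real y) / of_nat b
        + (2 * of_real pi * \<i>) ^ m / of_nat (m + 2) * (\<i> * of_real y) ^ (m + 2)) \<longlongrightarrow>
        0 / of_nat b + (2 * of_real pi * \<i>) ^ m / of_nat (m + 2) * (\<i> * of_real 0) ^ (m + 2)) (at_right 0)"
      by (intro tendsto_intros D_at_0) (use b0 in auto)
    then show ?thesis unfolding W_def K_def by simp
  qed
  moreover have "(W \<longlongrightarrow> reg_value (D m) / of_nat b) at_top"
  proof -
    have "((\<lambda>y. G (Complex 0 y)) \<longlongrightarrow> 0) at_top"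
      using smalloD_tendsto[OF small_decay[OF G(1), of 0 0]] by simp
    then have "((\<lambda>y. reg_value (D m) / of_nat b + G (Complex 0 y) / of_nat b) \<longlongrightarrow> reg_value (D m) / of_nat b + 0 / of_nat b) at_top"
      by (intro tendsto_intros) (use b0 in auto)
    then have lim: "((\<lambda>y. reg_value (D m) / of_nat b + G (Complex 0 y) / of_nat b) \<longlongrightarrow> reg_value (D m) / of_nat b) at_top"
      by simp
    show ?thesis
    proof (rule Lim_transform_eventually[OF lim])
      show "\<forall>\<^sub>F y in at_top. reg_value (D m) / of_nat b + G (Complex 0 y) / of_nat b = W y"
        using eventually_gt_at_top[of 0]
      proof eventually_elim
        case (elim y)
        have "Complex 0 y = \<i> * of_real y" by (simp add: Complex_eq)
        moreover have "(- (B * A / n) * x + c + d) / B + A / n * x = c / B + d / B" if "B \<noteq> 0" for A B n x c d :: complex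
          using that by (cases "n = 0") (simp_all add: field_simps)
        ultimately show ?case using elim b0 by (simp add: W_def K_def G(2) del: of_nat_add power_Suc power_add_numeral add_2_eq_Suc')
      qed
    qed
  qed
  ultimately show ?thesis by blast
qed

end

section \<open>Integrals over the positive half-line\<close>

lemma integrable_times_exp:
  assumes "a > 0"
  shows "(\<lambda>y::real. y * exp (- a * y)) integrable_on {0<..}"
proof -
  have "(\<lambda>t. norm (complex_of_real t powr (2 - 1) / of_real (exp (a * t)))) integrable_on {0<..}"
    using absolutely_integrable_Gamma_integral[of 2 a] assms
    unfolding absolutely_integrable_on_def by simp
  moreover have "norm (complex_of_real t powr (2 - 1) / of_real (exp (a * t))) = t * exp (- a * t)"
    if "t \<in> {0<..}" for t
    using that by (simp add: norm_mult norm_inverse exp_minus divide_inverse)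
  ultimately show ?thesis by (rule integrable_eq)
qed

lemma absolutely_integrable_exp_bound:
  fixes h :: "real \<Rightarrow> complex"
  assumes "continuous_on {0<..} h" "a > 0" "\<And>y. y > 0 \<Longrightarrow> norm (h y) \<le> K * (y * exp (- a * y))"
  shows "h absolutely_integrable_on {0<..}"
proof (rule measurable_bounded_by_integrable_imp_absolutely_integrable)
  show "h \<in> borel_measurable (lebesgue_on {0<..})"
    by (rule continuous_imp_measurable_on_sets_lebesgue[OF assms(1)]) simp
  show "(\<lambda>y. K * (y * exp (- a * y))) integrable_on {0<..}"
    using integrable_on_cmult_left[OF integrable_times_exp[OF assms(2)], of K] by simp
qed (use assms(3) in auto)

lemma integral_positive_half_line:
  fixes h W :: "real \<Rightarrow> complex"
  assumes W: "\<And>y. y > 0 \<Longrightarrow> (W has_vector_derivative h y) (at y)"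
    and h: "continuous_on {0<..} h" "h absolutely_integrable_on {0<..}"
    and lim: "(W \<longlongrightarrow> A) (at_right 0)" "(W \<longlongrightarrow> B) at_top"
  shows "integral {0<..} h = B - A"
proof -
  have E: "einterval 0 \<infinity> = {0<..}" by (auto simp: einterval_def)
  have "(\<lambda>x. indicator {0<..} x *\<^sub>R h x) \<in> borel_measurable borel"
    by (rule borel_measurable_continuous_on_indicator[OF _ h(1)]) simp
  then have int: "set_integrable lborel {0<..} h"
    using h(2) unfolding set_integrable_def by (simp add: integrable_completion)
  have "(LBINT x=0..\<infinity>. h x) = B - A"
  proof (rule interval_integral_FTC_integrable)
    show "isCont h x" if "0 < ereal x" for x
      using h(1) that by (simp add: continuous_on_eq_continuous_at)
    show "((W \<circ> real_of_ereal) \<longlongrightarrow> A) (at_right 0)" "((W \<circ> real_of_ereal) \<longlongrightarrow> B) (at_left \<infinity>)"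
      using lim by (simp_all add: zero_ereal_def ereal_tendsto_simps)
  qed (use W int in \<open>auto simp: E\<close>)
  also have "(LBINT x=0..\<infinity>. h x) = integral {0<..} h"
    by (simp add: interval_lebesgue_integral_def E set_borel_integral_eq_integral(2)[OF int])
  finally show ?thesis .
qed

text \<open>The main term: with \<open>a = 2 pi s\<close> the value \<open>1 / a^2\<close> cancels
  against \<open>4 pi^2 s^2\<close> and gives the constant coefficient 1.\<close>

lemma integral_times_exp:
  fixes a :: complex
  assumes "Re a > 0"
  shows "(\<lambda>y. of_real y * exp (- a * of_real y)) absolutely_integrable_on {0<..}" (is ?int)
    and "integral {0<..} (\<lambda>y. of_real y * exp (- a * of_real y)) = 1 / a\<^sup>2"
proof -
  have a0: "a \<noteq> 0" using assms by auto
  have cont: "continuous_on {0<..} (\<lambda>y. complex_of_real y * exp (- a * of_real y))"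
    by (intro continuous_intros)
  show int: ?int
    by (rule absolutely_integrable_exp_bound[OF cont assms, of 1]) (simp add: norm_mult)
  define W where "W y = - (of_real y / a + 1 / a\<^sup>2) * exp (- a * of_real y)" for y :: real
  have "(W has_vector_derivative of_real y * exp (- a * of_real y)) (at y)" for y
  proof -
    have "((\<lambda>z. - (z / a + 1 / a\<^sup>2) * exp (- a * z)) has_field_derivative z * exp (- a * z)) (at z)" for z
      using a0 by (auto intro!: derivative_eq_intros simp: field_simps power2_eq_square)
    from has_vector_derivative_real_field[OF this[of "of_real y"]] show ?thesis
      by (simp add: W_def[abs_def] o_def)
  qed
  moreover have "(W \<longlongrightarrow> - (1 / a\<^sup>2)) (at_right 0)"
  proof -
    have "(W \<longlongrightarrow> - (of_real 0 / a + 1 / a\<^sup>2) * exp (- a * of_real 0)) (at_right 0)"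
      unfolding W_def using a0 by (intro tendsto_intros) auto
    then show ?thesis by simp
  qed
  moreover have "(W \<longlongrightarrow> 0) at_top"
  proof -
    define c where "c = Re a"
    have "filterlim (\<lambda>x. c * x) at_top at_top"
      by (rule filterlim_tendsto_pos_mult_at_top[OF tendsto_const _ filterlim_ident]) (simp add: c_def assms)
    then have "((\<lambda>x. (c * x) ^ k / exp (c * x)) \<longlongrightarrow> 0) at_top" for k
      by (rule filterlim_compose[OF tendsto_power_div_exp_0])
    from tendsto_add[OF tendsto_mult_right_zero[OF this[of 1], of "1 / (c * norm a)"]
        tendsto_mult_right_zero[OF this[of 0], of "1 / norm a ^ 2"]]
    have lim: "((\<lambda>x. 1 / (c * norm a) * ((c * x) ^ 1 / exp (c * x)) + 1 / norm a ^ 2 * ((c * x) ^ 0 / exp (c * x))) \<longlongrightarrow> 0) at_top"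
      by simp
    show ?thesis
    proof (rule Lim_null_comparison[OF _ lim])
      show "\<forall>\<^sub>F x in at_top. norm (W x) \<le> 1 / (c * norm a) * ((c * x) ^ 1 / exp (c * x)) + 1 / norm a ^ 2 * ((c * x) ^ 0 / exp (c * x))"
        using eventually_gt_at_top[of 0]
      proof eventually_elim
        case (elim x)
        have "norm (W x) = norm (of_real x / a + 1 / a\<^sup>2) * exp (- c * x)"
          unfolding W_def norm_mult norm_minus_cancel by (simp add: c_def)
        also have "\<dots> \<le> (norm (of_real x / a) + norm (1 / a\<^sup>2)) * exp (- c * x)"
          by (intro mult_right_mono norm_triangle_ineq) auto
        also have "norm (of_real x / a) = x / norm a" using elim by (simp add: norm_divide)
        also have "norm (1 / a\<^sup>2) = 1 / norm a ^ 2" by (simp add: norm_divide norm_power)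
        also have "(x / norm a + 1 / norm a ^ 2) * exp (- c * x)
            = 1 / (c * norm a) * ((c * x) ^ 1 / exp (c * x)) + 1 / norm a ^ 2 * ((c * x) ^ 0 / exp (c * x))"
          using assms by (simp add: c_def exp_minus field_simps)
        finally show ?case .
      qed
    qed
  qed
  ultimately show "integral {0<..} (\<lambda>y. of_real y * exp (- a * of_real y)) = 1 / a\<^sup>2"
    using integral_positive_half_line[OF _ cont int, of W] by simp
qed

text \<open>Telescoping of \<open>a^m - b^m\<close>. For \<open>M >= 1\<close> the exponent
  \<open>m - 1\<close> may be raised to \<open>m\<close>, which spares a separate case
  \<open>m = 0\<close>.\<close>

lemma norm_power_diff_bound:
  fixes a b :: complex
  assumes "norm a \<le> M" "norm b \<le> M" "M \<ge> 1"
  shows "norm (a ^ m - b ^ m) \<le> real m * M ^ m * norm (a - b)"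
proof (induction m)
  case (Suc m)
  have "a ^ Suc m - b ^ Suc m = a * (a ^ m - b ^ m) + (a - b) * b ^ m" by (simp add: algebra_simps)
  then have "norm (a ^ Suc m - b ^ Suc m) \<le> norm a * norm (a ^ m - b ^ m) + norm (a - b) * norm b ^ m"
    by (metis norm_triangle_ineq norm_mult norm_power)
  also have "\<dots> \<le> M * (real m * M ^ m * norm (a - b)) + norm (a - b) * M ^ m"
    using assms Suc by (intro add_mono mult_mono power_mono) auto
  also have "\<dots> \<le> M * (real m * M ^ m * norm (a - b)) + M * (norm (a - b) * M ^ m)"
    using assms(3) mult_right_mono[of 1 M "norm (a - b) * M ^ m"] by (intro add_left_mono) auto
  finally show ?case by (simp add: algebra_simps)
qed simp

lemma sum_power_over_fact_le_exp:
  fixes x :: real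
  assumes "x \<ge> 0"
  shows "(\<Sum>m<n. x ^ m / fact m) \<le> exp x"
proof -
  have "(\<lambda>m. x ^ m / fact m) sums exp x" using exp_converges[of x] by (simp add: divide_inverse mult.commute)
  then show ?thesis
    using sum_le_suminf[of "\<lambda>m. x ^ m / fact m" "{..<n}"] assms
    by (auto simp: sums_iff)
qed

lemma cube_le_exp:
  fixes x :: real
  assumes "x \<ge> 0"
  shows "x ^ 3 \<le> 27 * exp x"
proof -
  have "x / 3 \<le> exp (x / 3)" using exp_ge_add_one_self[of "x / 3"] by linarith
  then have "(x / 3) ^ 3 \<le> exp (x / 3) ^ 3" using assms by (intro power_mono) auto
  also have "exp (x / 3) ^ 3 = exp x" by (simp flip: exp_of_nat_mult)
  finally show ?thesis by (simp add: power_divide)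
qed

section \<open>Estimates on the imaginary axis and the power series of kappa\<close>

context modular_pair
begin

text \<open>One constant for the whole half-line: for \<open>y >= 1\<close> the expansion at
  infinity gives the decay; for \<open>y < 1\<close> the expansion at 0 gives boundedness, and there
  exp (- 2 pi y) is bounded below.\<close>

lemma bounds: "\<exists>C\<ge>1. \<forall>y>0. norm (L (\<i> * of_real y) + of_real (2 * pi * y)) \<le> C * exp (- 2 * pi * y) \<and>
    norm (g (\<i> * of_real y)) \<le> C \<and> norm (g (\<i> * of_real y) - 1) \<le> C * exp (- 2 * pi * y)"
proof -
  obtain l where l: "l holomorphic_on ball 0 1" "l 0 = 0"
    "\<And>z. Im z > 0 \<Longrightarrow> L z = 2 * of_real pi * \<i> * z + l (nome z)" using L_inf by blast
  obtain \<gamma> where \<gamma>: "\<gamma> holomorphic_on ball 0 1" "\<gamma> 0 = 1" "\<And>z. Im z > 0 \<Longrightarrow> g z = \<gamma> (nome z)"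
    using g_inf by blast
  obtain l0 where l0: "l0 holomorphic_on ball 0 1" "\<And>z. Im z > 0 \<Longrightarrow> L (- 1 / z) = l0 (nome (z / of_nat b))"
    using L_0 by blast
  obtain \<gamma>0 where \<gamma>0: "\<gamma>0 holomorphic_on ball 0 1"
    "\<And>z. Im z > 0 \<Longrightarrow> g (- 1 / z) = z ^ 3 * (nome (z / of_nat b) * \<gamma>0 (nome (z / of_nat b)))"
    using g_0 by blast
  obtain d where d: "d holomorphic_on ball 0 1" "\<And>w. w \<in> ball 0 1 \<Longrightarrow> l w = w * d w"
    using holomorphic_divide_self[OF l(1,2)] by blast
  obtain e where e: "e holomorphic_on ball 0 1" "\<And>w. w \<in> ball 0 1 \<Longrightarrow> \<gamma> w - 1 = w * e w"
    using holomorphic_divide_self[of "\<lambda>w. \<gamma> w - 1"]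
      holomorphic_on_diff[OF \<gamma>(1) holomorphic_on_const[of 1]] \<gamma>(2) by auto
  obtain B1 where B1: "B1 > 0" "\<And>z. Im z \<ge> 1 \<Longrightarrow> norm (d (nome z)) \<le> B1"
    using holomorphic_bounded_nome[OF d(1), of 1 1] by auto
  obtain B2 where B2: "B2 > 0" "\<And>z. Im z \<ge> 1 \<Longrightarrow> norm (e (nome z)) \<le> B2"
    using holomorphic_bounded_nome[OF e(1), of 1 1] by auto
  obtain B3 where B3: "B3 > 0" "\<And>z. Im z \<ge> 1 \<Longrightarrow> norm (l0 (nome (z / of_nat b))) \<le> B3"
    using holomorphic_bounded_nome[OF l0(1), of 1 b] b_pos by auto
  obtain B4 where B4: "B4 > 0" "\<And>z. Im z \<ge> 1 \<Longrightarrow> norm (\<gamma>0 (nome (z / of_nat b))) \<le> B4"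
    using holomorphic_bounded_nome[OF \<gamma>0(1), of 1 b] b_pos by auto
  define B5 where "B5 = 27 * real b ^ 3 * B4"
  have B5: "B5 > 0" using B4(1) b_pos by (simp add: B5_def)
  \<comment> \<open>The factors \<open>exp (2 * pi)\<close> compensate the lower bound exp (- 2 pi)
    of exp (- 2 pi y) on \<open>y < 1\<close>; \<open>1 + B1 + B2\<close> covers
    \<open>y >= 1\<close>.\<close>
  define C where "C = 1 + B1 + B2 + (B3 + 2 * pi) * exp (2 * pi) + (B5 + 1) * exp (2 * pi)"
  have e1: "exp (2 * pi) \<ge> 1" by simp
  have nn: "(B3 + 2 * pi) * exp (2 * pi) \<ge> 0" "(B5 + 1) * exp (2 * pi) \<ge> 0" using B3(1) B5 by auto
  have B5C: "B5 \<le> C"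
  proof -
    have "B5 * 1 \<le> (B5 + 1) * exp (2 * pi)" using B5 e1 by (intro mult_mono) auto
    then show ?thesis using B1(1) B2(1) nn by (simp add: C_def)
  qed
  have "norm (L (\<i> * of_real y) + of_real (2 * pi * y)) \<le> C * exp (- 2 * pi * y) \<and>
    norm (g (\<i> * of_real y)) \<le> C \<and> norm (g (\<i> * of_real y) - 1) \<le> C * exp (- 2 * pi * y)"
    if y: "y > 0" for y
  proof (cases "y \<ge> 1")
    case True
    let ?z = "\<i> * of_real y"
    have z: "Im ?z > 0" "nome ?z \<in> ball 0 1" using y by (simp_all add: norm_nome_less_1_iff)
    have "L ?z + of_real (2 * pi * y) = nome ?z * d (nome ?z)"
      using l(3)[OF z(1)] d(2)[OF z(2)] by (simp add: algebra_simps)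
    then have "norm (L ?z + of_real (2 * pi * y)) \<le> exp (- 2 * pi * y) * B1"
      using B1(2)[of ?z] True by (simp add: norm_mult norm_nome)
    also have "\<dots> \<le> exp (- 2 * pi * y) * C"
      using nn B2(1) by (intro mult_left_mono) (auto simp: C_def)
    finally have 1: "norm (L ?z + of_real (2 * pi * y)) \<le> C * exp (- 2 * pi * y)" by (simp add: mult.commute)
    have g1: "norm (g ?z - 1) \<le> exp (- 2 * pi * y) * B2"
      using \<gamma>(3)[OF z(1)] e(2)[OF z(2)] B2(2)[of ?z] True by (simp add: norm_mult norm_nome)
    also have "\<dots> \<le> exp (- 2 * pi * y) * C"
      using nn B1(1) by (intro mult_left_mono) (auto simp: C_def)
    finally have 2: "norm (g ?z - 1) \<le> C * exp (- 2 * pi * y)" by (simp add: mult.commute)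
    have "exp (- 2 * pi * y) * B2 \<le> 1 * B2" using y B2(1) by (intro mult_right_mono) auto
    then have "norm (g ?z) \<le> 1 + B2"
      using g1 norm_triangle_ineq[of "g ?z - 1" 1] by simp
    also have "\<dots> \<le> C" using nn B1(1) by (simp add: C_def)
    finally show ?thesis using 1 2 by simp
  next
    case False
    define v where "v = \<i> * of_real (1 / y)"
    have v: "Im v \<ge> 1" "Im v > 0" "\<i> * of_real y = - 1 / v" using False y by (simp_all add: v_def field_simps)
    have ey: "1 \<le> exp (2 * pi) * exp (- 2 * pi * y)"
      unfolding exp_add[symmetric] using False by simp
    have L1: "norm (L (- 1 / v)) \<le> B3" using l0(2)[OF v(2)] B3(2)[OF v(1)] by simp
    have "norm (L (- 1 / v) + of_real (2 * pi * y)) \<le> norm (L (- 1 / v)) + norm (complex_of_real (2 * pi * y))"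
      by (rule norm_triangle_ineq)
    also have "norm (complex_of_real (2 * pi * y)) = 2 * pi * y"
      unfolding norm_of_real using y by simp
    also have "norm (L (- 1 / v)) + 2 * pi * y \<le> B3 + 2 * pi"
    proof -
      have "2 * pi * y \<le> 2 * pi * 1" using False by (intro mult_left_mono) auto
      with L1 show ?thesis by linarith
    qed
    also have "\<dots> \<le> (B3 + 2 * pi) * (exp (2 * pi) * exp (- 2 * pi * y))"
      using mult_left_mono[OF ey, of "B3 + 2 * pi"] B3(1) by simp
    also have "\<dots> = ((B3 + 2 * pi) * exp (2 * pi)) * exp (- 2 * pi * y)" by (simp only: mult.assoc)
    also have "\<dots> \<le> C * exp (- 2 * pi * y)"
      using nn B1(1) B2(1) by (intro mult_right_mono) (auto simp: C_def)
    finally have 1: "norm (L (- 1 / v) + of_real (2 * pi * y)) \<le> C * exp (- 2 * pi * y)" .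
    have "norm (g (- 1 / v)) \<le> B5"
    proof -
      \<comment> \<open>The factor \<open>v ^ 3\<close> of weight 3 has norm
        \<open>1 / y ^ 3\<close>; the decay of \<open>nome (v / b)\<close> absorbs it.\<close>
      have "(1 / y / b) ^ 3 \<le> 27 * exp (1 / y / b)" using y b_pos by (intro cube_le_exp) simp
      also have "1 / y / b \<le> 2 * pi * (1 / y) / b"
        using y b_pos pi_ge_two by (simp add: field_simps)
      finally have "(1 / y / b) ^ 3 \<le> 27 * exp (2 * pi * (1 / y) / b)" by simp
      then have "(1 / y / b) ^ 3 * b ^ 3 * exp (- (2 * pi * (1 / y) / b))
          \<le> 27 * exp (2 * pi * (1 / y) / b) * b ^ 3 * exp (- (2 * pi * (1 / y) / b))"
        by (intro mult_right_mono) auto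
      also have "\<dots> = 27 * b ^ 3" by (simp add: exp_minus field_simps)
      also have "(1 / y / b) ^ 3 * b ^ 3 = (1 / y) ^ 3" using b_pos by (simp flip: power_mult_distrib)
      finally have x: "(1 / y) ^ 3 * exp (- (2 * pi * (1 / y) / b)) \<le> 27 * b ^ 3" .
      have "norm (g (- 1 / v)) = norm v ^ 3 * (exp (- 2 * pi * Im (v / of_nat b)) * norm (\<gamma>0 (nome (v / of_nat b))))"
        unfolding \<gamma>0(2)[OF v(2)] by (simp only: norm_mult norm_power norm_nome)
      also have "\<dots> = ((1 / y) ^ 3 * exp (- (2 * pi * (1 / y) / b))) * norm (\<gamma>0 (nome (v / of_nat b)))"
        using y by (simp add: v_def norm_divide)
      also have "\<dots> \<le> (27 * b ^ 3) * B4"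
        using x B4(2)[OF v(1)] by (intro mult_mono) auto
      finally show ?thesis by (simp add: B5_def)
    qed
    then have g1: "norm (g (- 1 / v)) \<le> B5" .
    have "norm (g (- 1 / v) - 1) \<le> norm (g (- 1 / v)) + norm (1 :: complex)" by (rule norm_triangle_ineq4)
    also have "\<dots> \<le> B5 + 1" using g1 by simp
    also have "\<dots> \<le> (B5 + 1) * (exp (2 * pi) * exp (- 2 * pi * y))"
      using mult_left_mono[OF ey, of "B5 + 1"] B5 by simp
    also have "\<dots> = ((B5 + 1) * exp (2 * pi)) * exp (- 2 * pi * y)" by (simp only: mult.assoc)
    also have "\<dots> \<le> C * exp (- 2 * pi * y)"
      using nn B1(1) B2(1) by (intro mult_right_mono) (auto simp: C_def)
    finally have "norm (g (- 1 / v) - 1) \<le> C * exp (- 2 * pi * y)" .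
    with 1 g1 B5C show ?thesis unfolding v(3) by simp
  qed
  moreover have "C \<ge> 1" using nn B1(1) B2(1) by (simp add: C_def)
  ultimately show ?thesis by blast
qed

lemma continuous_on_ii:
  assumes "h holomorphic_on upper_half"
  shows "continuous_on {0<..} (\<lambda>y. h (\<i> * of_real y))"
  by (rule continuous_on_compose2[OF holomorphic_on_imp_continuous_on[OF assms]]) (auto intro!: continuous_intros)

lemma w_continuous: "continuous_on {0<..} (w m)"
  unfolding w_def by (intro continuous_intros continuous_on_ii L_holomorphic g_holomorphic)

text \<open>Up to the factor \<open>C^2 y exp (- 2 pi y)\<close> the terms are at most
  \<open>(2 x A)^m / m!\<close> with \<open>A = 2 pi y + C\<close>. For \<open>x <= 1/8\<close> they
  sum to at most \<open>exp (A / 4)\<close>, which grows like exp (pi y / 2), so exp (- 3 pi y / 2)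
  remains. The bound is uniform in \<open>n\<close> and \<open>x\<close>, as dominated summation
  requires.\<close>

lemma w_sum_bound: "\<exists>K. \<forall>y>0. \<forall>x. 0 \<le> x \<and> x \<le> 1 / 8 \<longrightarrow>
    (\<forall>n. (\<Sum>m<n. x ^ m / fact m * norm (w m y)) \<le> K * (y * exp (- 1 * y)))"
proof -
  obtain C where C: "C \<ge> 1" and C1: "\<And>y. y > 0 \<Longrightarrow> norm (L (\<i> * of_real y) + of_real (2 * pi * y)) \<le> C * exp (- 2 * pi * y)"
    and C2: "\<And>y. y > 0 \<Longrightarrow> norm (g (\<i> * of_real y)) \<le> C"
    and C3: "\<And>y. y > 0 \<Longrightarrow> norm (g (\<i> * of_real y) - 1) \<le> C * exp (- 2 * pi * y)"
    using bounds by blast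
  have "(\<Sum>m<n. x ^ m / fact m * norm (w m y)) \<le> C\<^sup>2 * exp (C / 4) * (y * exp (- 1 * y))"
    if y: "y > 0" and x: "0 \<le> x" "x \<le> 1 / 8" for x y n
  proof -
    define A where "A = 2 * pi * y + C"
    define E where "E = exp (- 2 * pi * y)"
    have E: "0 \<le> E" "E \<le> 1" using y by (simp_all add: E_def)
    have "0 < 2 * pi * y" using y by simp
    then have A: "A \<ge> 1" unfolding A_def using C by linarith
    let ?l = "L (\<i> * of_real y)" and ?g = "g (\<i> * of_real y)" and ?p = "complex_of_real (- 2 * pi * y)"
    have lp: "norm (?l - ?p) \<le> C * E" using C1[OF y] by (simp add: E_def)
    have np: "norm ?p = 2 * pi * y" unfolding norm_of_real using y by simp
    then have p: "norm ?p \<le> A" unfolding A_def using C by linarith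
    have CE: "C * E \<le> C" using C E mult_left_mono[of E 1 C] by simp
    have l: "norm ?l \<le> A"
      using norm_triangle_ineq[of "?l - ?p" ?p] lp CE np unfolding A_def diff_add_cancel by linarith
    have wm: "norm (w m y) \<le> C\<^sup>2 * y * E * (real (m + 1) * A ^ m)" for m
    proof -
      \<comment> \<open>This separates the deviation of \<open>L\<close> from its linear part and
        that of \<open>g\<close> from 1; each contributes a factor \<open>C * E\<close>.\<close>
      have "w m y = of_real y * ((?l ^ m - ?p ^ m) * ?g + ?p ^ m * (?g - 1))"
        by (simp add: w_def algebra_simps)
      then have "norm (w m y) = y * norm ((?l ^ m - ?p ^ m) * ?g + ?p ^ m * (?g - 1))"
        using y by (simp only: norm_mult norm_of_real abs_of_pos)
      also have "\<dots> \<le> y * (norm (?l ^ m - ?p ^ m) * norm ?g + norm ?p ^ m * norm (?g - 1))"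
      proof (rule mult_left_mono)
        show "norm ((?l ^ m - ?p ^ m) * ?g + ?p ^ m * (?g - 1))
            \<le> norm (?l ^ m - ?p ^ m) * norm ?g + norm ?p ^ m * norm (?g - 1)"
          using norm_triangle_ineq[of "(?l ^ m - ?p ^ m) * ?g" "?p ^ m * (?g - 1)"] unfolding norm_mult norm_power .
      qed (use y in simp)
      also have "\<dots> \<le> y * ((real m * A ^ m * (C * E)) * C + A ^ m * (C * E))"
      proof (intro mult_left_mono add_mono mult_mono power_mono)
        show "norm (?l ^ m - ?p ^ m) \<le> real m * A ^ m * (C * E)"
        proof (rule order.trans[OF norm_power_diff_bound[OF l p A]])
          show "real m * A ^ m * norm (?l - ?p) \<le> real m * A ^ m * (C * E)"
            by (rule mult_left_mono[OF lp]) (use A in simp)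
        qed
      qed (use C2[OF y] C3[OF y] p A C E y in \<open>auto simp: E_def\<close>)
      also have "\<dots> \<le> y * ((real m * A ^ m * (C * E)) * C + A ^ m * (C * E) * C)"
        using C E A y mult_left_mono[of 1 C "A ^ m * (C * E)"] by (intro mult_left_mono add_left_mono) auto
      also have "\<dots> = C\<^sup>2 * y * E * (real (m + 1) * A ^ m)" by (simp add: power2_eq_square algebra_simps)
      finally show ?thesis .
    qed
    have "(\<Sum>m<n. x ^ m / fact m * norm (w m y))
        \<le> (\<Sum>m<n. C\<^sup>2 * y * E * ((2 * x * A) ^ m / fact m))"
    proof (rule sum_mono)
      fix m
      \<comment> \<open>The source of the factor 2 in \<open>2 * x * A\<close>.\<close>
      have m: "real (m + 1) \<le> 2 ^ m" by (induction m) auto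
      have "x ^ m / fact m * norm (w m y) \<le> x ^ m / fact m * (C\<^sup>2 * y * E * (2 ^ m * A ^ m))"
      proof (rule mult_left_mono)
        have "C\<^sup>2 * y * E * (real (m + 1) * A ^ m) \<le> C\<^sup>2 * y * E * (2 ^ m * A ^ m)"
          using m C y E A by (intro mult_left_mono mult_right_mono) auto
        then show "norm (w m y) \<le> C\<^sup>2 * y * E * (2 ^ m * A ^ m)" using wm[of m] by linarith
      qed (use x in simp)
      also have "\<dots> = C\<^sup>2 * y * E * ((2 * x * A) ^ m / fact m)" by (simp add: power_mult_distrib)
      finally show "x ^ m / fact m * norm (w m y) \<le> C\<^sup>2 * y * E * ((2 * x * A) ^ m / fact m)" .
    qed
    also have "\<dots> = C\<^sup>2 * y * E * (\<Sum>m<n. (2 * x * A) ^ m / fact m)" by (simp add: sum_distrib_left)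
    also have "\<dots> \<le> C\<^sup>2 * y * E * exp (A / 4)"
    proof (intro mult_left_mono)
      have "2 * x * A \<le> A / 4" using x A mult_right_mono[of x "1/8" A] by simp
      then show "(\<Sum>m<n. (2 * x * A) ^ m / fact m) \<le> exp (A / 4)"
        using sum_power_over_fact_le_exp[of "2 * x * A" n] x A by (smt (verit) exp_le_cancel_iff mult_nonneg_nonneg)
    qed (use y E in auto)
    also have "\<dots> = C\<^sup>2 * exp (C / 4) * (y * exp (- (3 / 2) * pi * y))"
    proof -
      have "E * exp (A / 4) = exp (C / 4) * exp (- (3 / 2) * pi * y)"
        unfolding E_def exp_add[symmetric] by (rule arg_cong[of _ _ exp]) (simp add: A_def field_simps)
      then show ?thesis by (simp add: mult_ac)
    qed
    also have "\<dots> \<le> C\<^sup>2 * exp (C / 4) * (y * exp (- 1 * y))"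
    proof -
      have "1 * y \<le> (3 / 2 * pi) * y" using y pi_ge_two by (intro mult_right_mono) auto
      then show ?thesis using y by (intro mult_left_mono) auto
    qed
    finally show ?thesis .
  qed
  then show ?thesis by blast
qed

text \<open>One term of the sum in \<open>w_sum_bound\<close> at \<open>x = 1/8\<close>; here the
  constant may depend on \<open>m\<close>.\<close>

lemma w_bound: "\<exists>K. \<forall>y>0. norm (w m y) \<le> K * (y * exp (- 1 * y))"
proof -
  obtain K where K: "\<And>y x n. y > 0 \<Longrightarrow> 0 \<le> x \<Longrightarrow> x \<le> 1 / 8 \<Longrightarrow>
    (\<Sum>m<n. x ^ m / fact m * norm (w m y)) \<le> K * (y * exp (- 1 * y))"
    using w_sum_bound by blast
  have "norm (w m y) \<le> (8 ^ m * fact m * K) * (y * exp (- 1 * y))" if y: "y > 0" for y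
  proof -
    have "(1 / 8) ^ m / fact m * norm (w m y) \<le> (\<Sum>m<Suc m. (1 / 8) ^ m / fact m * norm (w m y))"
      by (simp add: sum_nonneg)
    also have "\<dots> \<le> K * (y * exp (- 1 * y))" by (rule K[OF y]) auto
    finally have "8 ^ m * fact m * ((1 / 8) ^ m / fact m * norm (w m y)) \<le> 8 ^ m * fact m * (K * (y * exp (- 1 * y)))"
      by (intro mult_left_mono) auto
    then show ?thesis by (simp add: power_divide mult.assoc)
  qed
  then show ?thesis by blast
qed

lemma w_integrable: "w m absolutely_integrable_on {0<..}"
proof -
  obtain K where K: "\<And>y. y > 0 \<Longrightarrow> norm (w m y) \<le> K * (y * exp (- 1 * y))" using w_bound by blast
  show ?thesis by (rule absolutely_integrable_exp_bound[OF w_continuous _ K]) simp_all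
qed

lemma w_integral: "integral {0<..} (w m) = reg_value (D m) / of_nat b"
proof -
  obtain W where "\<And>y. y > 0 \<Longrightarrow> (W has_vector_derivative w m y) (at y)"
    "(W \<longlongrightarrow> 0) (at_right 0)" "(W \<longlongrightarrow> reg_value (D m) / of_nat b) at_top"
    using w_primitive by blast
  from integral_positive_half_line[OF this(1) w_continuous w_integrable this(2,3)] show ?thesis by simp
qed

lemma w_series:
  "(\<lambda>m. s ^ m / fact m * w m y) sums
     (of_real y * (exp (s * L (\<i> * of_real y)) * g (\<i> * of_real y) - exp (s * of_real (- 2 * pi * y))))"
proof -
  let ?l = "L (\<i> * of_real y)" and ?p = "complex_of_real (- 2 * pi * y)"
  have ex: "(\<lambda>m. (s * z) ^ m / fact m) sums exp (s * z)" for z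
    using exp_converges[of "s * z"] by (simp add: scaleR_conv_of_real divide_inverse mult.commute)
  have "(\<lambda>m. of_real y * ((s * ?l) ^ m / fact m * g (\<i> * of_real y) - (s * ?p) ^ m / fact m)) sums
    (of_real y * (exp (s * ?l) * g (\<i> * of_real y) - exp (s * ?p)))"
    by (intro sums_mult sums_diff sums_mult2 ex)
  moreover have "of_real y * ((s * ?l) ^ m / fact m * g (\<i> * of_real y) - (s * ?p) ^ m / fact m) = s ^ m / fact m * w m y" for m
    by (simp add: w_def power_mult_distrib right_diff_distrib mult_ac del: of_real_mult of_real_minus)
  ultimately show ?thesis by (simp only:)
qed

definition kint :: "complex \<Rightarrow> real \<Rightarrow> complex" where
  "kint s y = (let z = \<i> * of_real y in t z powr (s - 1) * z * f z * deriv t z * \<i>)"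

text \<open>On the imaginary axis \<open>L\<close> is real and so coincides with the principal
  logarithm used by \<open>powr\<close>. The factor \<open>1 / t\<close> left by the exponent
  \<open>s - 1\<close> completes the logarithmic derivative of \<open>t\<close>, and
  \<open>z * i = - y\<close>.\<close>

lemma kint_eq:
  assumes y: "y > 0"
  shows "kint s y = - (2 * of_real pi * \<i>) * (of_real y * (exp (s * L (\<i> * of_real y)) * g (\<i> * of_real y)))"
proof -
  let ?z = "\<i> * of_real y"
  have z: "Im ?z > 0" using y by simp
  have "Im (L ?z) = 0" using L_real[OF y] by (simp add: complex_is_Real_iff)
  then have "Ln (t ?z) = L ?z" unfolding exp_L[OF z, symmetric] by (intro Ln_exp) auto
  then have "t ?z powr (s - 1) = exp (s * L ?z) / t ?z"
    using t_nonzero[OF z] exp_L[OF z] by (simp add: powr_def left_diff_distrib exp_diff)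
  moreover have "deriv t ?z * f ?z / t ?z = 2 * of_real pi * \<i> * g ?z" by (simp add: g_def)
  moreover have "kint s y = (t ?z powr (s - 1) * t ?z) * (deriv t ?z * f ?z / t ?z) * ?z * \<i>"
    using t_nonzero[OF z] by (simp add: kint_def Let_def)
  ultimately show ?thesis using t_nonzero[OF z] by (simp add: algebra_simps)
qed

text \<open>Here \<open>s\<close> is arbitrary in the right half-plane: on the axis
  \<open>Re L <= C - 2 pi y\<close>, which gives decay of rate \<open>2 pi Re s\<close>.\<close>

lemma main_integrable:
  assumes s: "Re s > 0"
  shows "(\<lambda>y. of_real y * (exp (s * L (\<i> * of_real y)) * g (\<i> * of_real y))) absolutely_integrable_on {0<..}"
proof -
  obtain C where C: "C \<ge> 1" and C1: "\<And>y. y > 0 \<Longrightarrow> norm (L (\<i> * of_real y) + of_real (2 * pi * y)) \<le> C * exp (- 2 * pi * y)"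
    and C2: "\<And>y. y > 0 \<Longrightarrow> norm (g (\<i> * of_real y)) \<le> C"
    using bounds by blast
  show ?thesis
  proof (rule absolutely_integrable_exp_bound)
    show "continuous_on {0<..} (\<lambda>y. of_real y * (exp (s * L (\<i> * of_real y)) * g (\<i> * of_real y)))"
      by (intro continuous_intros continuous_on_ii L_holomorphic g_holomorphic)
    show "Re s * (2 * pi) > 0" using s by simp
    fix y :: real assume y: "y > 0"
    let ?l = "L (\<i> * of_real y)"
    have "Im ?l = 0" using L_real[OF y] by (simp add: complex_is_Real_iff)
    then have n: "norm (exp (s * ?l)) = exp (Re s * Re ?l)" by simp
    have "Re ?l + 2 * pi * y \<le> norm (?l + of_real (2 * pi * y))" using complex_Re_le_cmod[of "?l + of_real (2 * pi * y)"] by simp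
    also have "\<dots> \<le> C * exp (- 2 * pi * y)" by (rule C1[OF y])
    also have "\<dots> \<le> C * 1" using C y by (intro mult_left_mono) auto
    finally have "Re s * Re ?l \<le> Re s * (C - 2 * pi * y)" using s by (intro mult_left_mono) auto
    then have "norm (exp (s * ?l)) \<le> exp (Re s * C) * exp (- (Re s * (2 * pi)) * y)"
      unfolding n exp_add[symmetric] by (simp add: algebra_simps)
    then have "y * (norm (exp (s * ?l)) * norm (g (\<i> * of_real y)))
        \<le> y * (exp (Re s * C) * exp (- (Re s * (2 * pi)) * y) * C)"
      using C2[OF y] y by (intro mult_left_mono mult_mono) auto
    then show "norm (of_real y * (exp (s * ?l) * g (\<i> * of_real y)))
        \<le> exp (Re s * C) * C * (y * exp (- (Re s * (2 * pi)) * y))"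
      using y by (simp add: norm_mult mult_ac)
  qed
qed

lemma kint_integrable:
  assumes "Re s > 0"
  shows "kint s absolutely_integrable_on {0<..}"
proof (rule absolutely_integrable_spike[OF _ negligible_empty])
  show "(\<lambda>y. - (2 * of_real pi * \<i>) * (of_real y * (exp (s * L (\<i> * of_real y)) * g (\<i> * of_real y))))
      absolutely_integrable_on {0<..}"
    by (rule set_integrable_mult_right) (rule main_integrable[OF assms])
qed (simp add: kint_eq)

text \<open>\<open>Re s > 0\<close> makes the main integral and \<open>1 / (2 pi s)^2\<close>
  converge separately; \<open>norm s < 1/8\<close> serves the interchange of sum and integral, where
  \<open>w_sum_bound\<close> dominates the partial sums of norms.\<close>

lemma kint_integral:
  assumes s: "Re s > 0" "norm s < 1 / 8"
  shows "(\<lambda>m. s ^ m / fact m * (reg_value (D m) / of_nat b)) sums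
    (integral {0<..} (\<lambda>y. of_real y * (exp (s * L (\<i> * of_real y)) * g (\<i> * of_real y))) - 1 / (2 * of_real pi * s)\<^sup>2)"
proof -
  obtain K where K: "\<And>y x n. y > 0 \<Longrightarrow> 0 \<le> x \<Longrightarrow> x \<le> 1 / 8 \<Longrightarrow>
    (\<Sum>m<n. x ^ m / fact m * norm (w m y)) \<le> K * (y * exp (- 1 * y))"
    using w_sum_bound by blast
  define F where "F m y = indicator {0<..} y *\<^sub>R (s ^ m / fact m * w m y)" for m and y :: real
  define G where "G y = of_real y * (exp (s * L (\<i> * of_real y)) * g (\<i> * of_real y) - exp (s * of_real (- 2 * pi * y)))" for y :: real
  have intF: "(\<lambda>y. s ^ m / fact m * w m y) absolutely_integrable_on {0<..}" for m
    by (rule set_integrable_mult_right) (rule w_integrable)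
  then have F: "integrable lebesgue (F m)" for m unfolding F_def[abs_def] set_integrable_def .
  have normF: "norm (F m y) = indicator {0<..} y * (norm s ^ m / fact m * norm (w m y))" for m y
    by (simp add: F_def norm_mult norm_divide norm_power)
  have sumF: "(\<Sum>m<n. norm (F m y)) \<le> indicator {0<..} y * (K * (y * exp (- 1 * y)))" for n y
    using K[of y "norm s" n] s(2) by (cases "y > 0") (simp_all add: normF)
  have 1: "AE y in lebesgue. summable (\<lambda>m. norm (F m y))"
    by (intro AE_I2 summableI_nonneg_bounded[OF _ sumF]) simp
  have dom: "integrable lebesgue (\<lambda>y. indicator {0<..} y * (K * (y * exp (- 1 * y))))"
  proof -
    have "(\<lambda>y. K * (y * exp (- 1 * y))) absolutely_integrable_on {0<..}"
    proof (rule set_integrable_mult_right)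
      show "(\<lambda>y::real. y * exp (- 1 * y)) absolutely_integrable_on {0<..}"
        by (rule nonnegative_absolutely_integrable_1[OF integrable_times_exp]) auto
    qed
    then show ?thesis by (simp add: set_integrable_def)
  qed
  have 2: "summable (\<lambda>m. \<integral>y. norm (F m y) \<partial>lebesgue)"
  proof (rule summableI_nonneg_bounded)
    fix n
    have "(\<Sum>m<n. \<integral>y. norm (F m y) \<partial>lebesgue) = (\<integral>y. (\<Sum>m<n. norm (F m y)) \<partial>lebesgue)"
      by (rule Bochner_Integration.integral_sum[symmetric]) (use F in auto)
    also have "\<dots> \<le> (\<integral>y. indicator {0<..} y * (K * (y * exp (- 1 * y))) \<partial>lebesgue)"
      by (rule integral_mono[OF _ dom sumF]) (use F in auto)
    finally show "(\<Sum>m<n. \<integral>y. norm (F m y) \<partial>lebesgue) \<le> (\<integral>y. indicator {0<..} y * (K * (y * exp (- 1 * y))) \<partial>lebesgue)" .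
  qed simp
  have sF: "(\<Sum>m. F m y) = indicator {0<..} y *\<^sub>R G y" for y
    using sums_unique[OF w_series[of s y]] by (cases "y > 0") (simp_all add: F_def G_def)
  have IF: "(\<integral>y. F m y \<partial>lebesgue) = s ^ m / fact m * (reg_value (D m) / of_nat b)" for m
  proof -
    have "(\<integral>y. F m y \<partial>lebesgue) = integral {0<..} (\<lambda>y. s ^ m / fact m * w m y)"
      using set_lebesgue_integral_eq_integral(2)[OF intF[of m]] unfolding F_def set_lebesgue_integral_def .
    then show ?thesis by (simp add: w_integral)
  qed
  have intE: "(\<lambda>y. of_real y * exp (- (2 * of_real pi * s) * of_real y)) absolutely_integrable_on {0<..}"
    "integral {0<..} (\<lambda>y. of_real y * exp (- (2 * of_real pi * s) * of_real y)) = 1 / (2 * of_real pi * s)\<^sup>2"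
    using integral_times_exp[of "2 * of_real pi * s"] s(1) by simp_all
  have G_eq: "G = (\<lambda>y. of_real y * (exp (s * L (\<i> * of_real y)) * g (\<i> * of_real y))
      - of_real y * exp (- (2 * of_real pi * s) * of_real y))"
    by (simp add: G_def[abs_def] right_diff_distrib mult_ac)
  have intG: "G absolutely_integrable_on {0<..}"
    unfolding G_eq by (rule set_integral_diff(1)[OF main_integrable[OF s(1)] intE(1)])
  have "integral {0<..} G = integral {0<..} (\<lambda>y. of_real y * (exp (s * L (\<i> * of_real y)) * g (\<i> * of_real y))) - 1 / (2 * of_real pi * s)\<^sup>2"
    unfolding G_eq intE(2)[symmetric]
    by (intro integral_diff set_lebesgue_integral_eq_integral(1) main_integrable[OF s(1)] intE(1))
  moreover have "(\<integral>y. (\<Sum>m. F m y) \<partial>lebesgue) = integral {0<..} G"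
    using set_lebesgue_integral_eq_integral(2)[OF intG] by (simp add: sF set_lebesgue_integral_def)
  ultimately show ?thesis
    using sums_integral[OF F 1 2] by (simp only: IF)
qed

text \<open>The prefactor \<open>2 pi i s^2 * (- 2 pi i) = 4 pi^2 s^2\<close> shifts the series by
  two places and turns the subtracted \<open>1 / (2 pi s)^2\<close> into the constant term 1; no
  linear term arises.\<close>

theorem kappa_expansion:
  assumes s: "Re s > 0" "norm s < 1 / 8"
    and k: "k 0 = 1" "k 1 = 0" "\<And>m. k (2 + m) = 4 * of_real pi ^ 2 / (of_nat b * fact m) * reg_value (D m)"
  shows "(\<lambda>n. k n * s ^ n) sums (2 * of_real pi * \<i> * s\<^sup>2 * integral {0<..} (kint s))"
proof -
  define I where "I = integral {0<..} (\<lambda>y. of_real y * (exp (s * L (\<i> * of_real y)) * g (\<i> * of_real y)))"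
  have s0: "s \<noteq> 0" using s(1) by auto
  have "integral {0<..} (kint s) = integral {0<..} (\<lambda>y. - (2 * of_real pi * \<i>) * (of_real y * (exp (s * L (\<i> * of_real y)) * g (\<i> * of_real y))))"
    by (rule integral_cong) (simp add: kint_eq)
  then have int: "integral {0<..} (kint s) = - (2 * of_real pi * \<i>) * I"
    by (simp add: I_def)
  have "(\<lambda>m. 4 * of_real pi ^ 2 * s\<^sup>2 * (s ^ m / fact m * (reg_value (D m) / of_nat b))) sums
     (4 * of_real pi ^ 2 * s\<^sup>2 * (I - 1 / (2 * of_real pi * s)\<^sup>2))"
    unfolding I_def by (rule sums_mult[OF kint_integral[OF s]])
  moreover have "4 * of_real pi ^ 2 * s\<^sup>2 * (s ^ m / fact m * (reg_value (D m) / of_nat b)) = k (m + 2) * s ^ (m + 2)" for m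
    using k(3)[of m] by (simp add: add.commute[of m 2] power_add power2_eq_square mult_ac)
  ultimately have "(\<lambda>m. k (m + 2) * s ^ (m + 2)) sums (4 * of_real pi ^ 2 * s\<^sup>2 * (I - 1 / (2 * of_real pi * s)\<^sup>2))"
    by (simp only:)
  then have "(\<lambda>n. k n * s ^ n) sums (4 * of_real pi ^ 2 * s\<^sup>2 * (I - 1 / (2 * of_real pi * s)\<^sup>2) + (\<Sum>n<2. k n * s ^ n))"
    by (subst (asm) sums_iff_shift)
  moreover have "4 * of_real pi ^ 2 * s\<^sup>2 * (I - 1 / (2 * of_real pi * s)\<^sup>2) + (\<Sum>n<2. k n * s ^ n)
      = 2 * of_real pi * \<i> * s\<^sup>2 * integral {0<..} (kint s)"
    unfolding int using s0 k(1,2) by (simp add: numeral_2_eq_2 field_simps power2_eq_square)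
  ultimately show ?thesis by simp
qed

end

section \<open>The quadratic characters modulo 3 and 4\<close>

text \<open>\<open>kronecker\<close> is computed from prime factors and does not show its
  periodicity; \<open>chi3\<close> and \<open>chi4\<close> are the periodic forms that the descent
  can follow.\<close>

definition chi3 :: "int \<Rightarrow> int" where
  "chi3 n = (if n mod 3 = 1 then 1 else if n mod 3 = 2 then -1 else 0)"

definition chi4 :: "int \<Rightarrow> int" where
  "chi4 n = (if n mod 4 = 1 then 1 else if n mod 4 = 3 then -1 else 0)"

lemma chi3_mult: "chi3 (x * y) = chi3 x * chi3 y"
proof -
  have "chi3 (x * y) = chi3 ((x mod 3) * (y mod 3))" by (simp add: chi3_def mod_mult_eq)
  moreover have "x mod 3 = 0 \<or> x mod 3 = 1 \<or> x mod 3 = 2" "y mod 3 = 0 \<or> y mod 3 = 1 \<or> y mod 3 = 2" by presburger+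
  then have "chi3 ((x mod 3) * (y mod 3)) = chi3 x * chi3 y"
    by (elim disjE) (simp_all add: chi3_def)
  ultimately show ?thesis by simp
qed

lemma chi4_mult: "chi4 (x * y) = chi4 x * chi4 y"
proof -
  have "chi4 (x * y) = chi4 ((x mod 4) * (y mod 4))" by (simp add: chi4_def mod_mult_eq)
  moreover have "x mod 4 = 0 \<or> x mod 4 = 1 \<or> x mod 4 = 2 \<or> x mod 4 = 3" "y mod 4 = 0 \<or> y mod 4 = 1 \<or> y mod 4 = 2 \<or> y mod 4 = 3" by presburger+
  then have "chi4 ((x mod 4) * (y mod 4)) = chi4 x * chi4 y"
    by (elim disjE) (simp_all add: chi4_def)
  ultimately show ?thesis by simp
qed

lemma chi3_minus: "chi3 (- x) = - chi3 x"
  using chi3_mult[of "-1" x] by (simp add: chi3_def)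

lemma chi4_minus: "chi4 (- x) = - chi4 x"
  using chi4_mult[of "-1" x] by (simp add: chi4_def)

lemma chi3_cong: "[x = y] (mod 3) \<Longrightarrow> chi3 x = chi3 y"
  by (simp add: chi3_def cong_def)

lemma chi4_cong: "[x = y] (mod 4) \<Longrightarrow> chi4 x = chi4 y"
  by (simp add: chi4_def cong_def)

text \<open>Both sides are multiplicative, so the primes dividing \<open>n\<close> decide; the sign
  convention of \<open>kronecker\<close> for \<open>a < 0\<close> matches the oddness of
  \<open>\<chi>'\<close>.\<close>

lemma kronecker_eq_character:
  fixes \<chi>' :: "int \<Rightarrow> int"
  assumes "a < 0" "n \<noteq> 0" and one: "\<chi>' 1 = 1" and mult: "\<And>x y. \<chi>' (x * y) = \<chi>' x * \<chi>' y"
    and minus: "\<And>x. \<chi>' (- x) = - \<chi>' x"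
    and pr: "\<And>p. prime p \<Longrightarrow> int p dvd n \<Longrightarrow> kronecker_prime a p = \<chi>' (int p)"
  shows "kronecker a n = \<chi>' n"
proof -
  define k where "k = nat \<bar>n\<bar>"
  have k: "k > 0" using assms(2) by (simp add: k_def)
  have pow: "\<chi>' (x ^ m) = \<chi>' x ^ m" for x m by (induction m) (simp_all add: one mult)
  have prod: "finite A \<Longrightarrow> \<chi>' (\<Prod>p\<in>A. F p) = (\<Prod>p\<in>A. \<chi>' (F p))" for A :: "nat set" and F
    by (induction A rule: finite_induct) (simp_all add: one mult)
  have "(\<Prod>p\<in>prime_factors k. kronecker_prime a p ^ multiplicity p k)
      = (\<Prod>p\<in>prime_factors k. \<chi>' (int p ^ multiplicity p k))"
  proof (rule prod.cong)
    fix p assume "p \<in> prime_factors k"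
    then have "prime p" "int p dvd n"
      using zdvd1_eq by (auto simp: k_def in_prime_factors_iff int_dvd_int_iff[symmetric])
    then show "kronecker_prime a p ^ multiplicity p k = \<chi>' (int p ^ multiplicity p k)"
      by (simp add: pow pr)
  qed simp
  also have "\<dots> = \<chi>' (\<Prod>p\<in>prime_factors k. int p ^ multiplicity p k)"
    by (simp add: prod)
  also have "(\<Prod>p\<in>prime_factors k. int p ^ multiplicity p k) = int k"
    using prime_factorization_nat[OF k] by (metis (mono_tags, lifting) of_nat_power of_nat_prod prod.cong)
  also have "int k = \<bar>n\<bar>" by (simp add: k_def)
  finally have "kronecker a n = (if n < 0 \<and> a < 0 then -1 else 1) * \<chi>' \<bar>n\<bar>"
    using assms(2) by (simp add: kronecker_def k_def)
  then show ?thesis using assms(1) minus[of n] by (simp add: abs_if)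
qed

lemma Legendre_cases: "Legendre a p = -1 \<or> Legendre a p = 0 \<or> Legendre a p = 1"
  by (simp add: Legendre_def)

lemma small_cong_eq:
  fixes x y p :: int
  assumes "[x = y] (mod p)" "x = -1 \<or> x = 0 \<or> x = 1" "y = -1 \<or> y = 0 \<or> y = 1" "p > 2"
  shows "x = y"
proof -
  have "p dvd x - y" using assms(1) by (simp add: cong_iff_dvd_diff)
  moreover have "\<bar>x - y\<bar> < p" using assms by auto
  ultimately show ?thesis using dvd_imp_le_int[of "x - y" p] by auto
qed

lemma Legendre_mod_3:
  assumes "chi3 x \<noteq> 0"
  shows "Legendre x 3 = chi3 x"
proof -
  have "x mod 3 \<in> {0, 1, 2}" by auto
  with assms consider "x mod 3 = 1" | "x mod 3 = 2" by (auto simp: chi3_def)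
  then show ?thesis
  proof cases
    case 1
    then have "[1\<^sup>2 = x] (mod 3)" by (simp add: cong_def)
    then have "QuadRes 3 x" unfolding QuadRes_def by blast
    with 1 show ?thesis by (simp add: Legendre_def chi3_def cong_def)
  next
    case 2
    have "\<not> QuadRes 3 x"
    proof
      assume "QuadRes 3 x"
      then obtain y where y: "y\<^sup>2 mod 3 = x mod 3" by (auto simp: QuadRes_def cong_def)
      have "y mod 3 \<in> {0, 1, 2}" by auto
      moreover have "y\<^sup>2 mod 3 = ((y mod 3) * (y mod 3)) mod 3" by (simp add: power2_eq_square mod_mult_eq)
      ultimately show False using y 2 by auto
    qed
    with 2 show ?thesis by (simp add: Legendre_def chi3_def cong_def)
  qed
qed

text \<open>Quadratic reciprocity for 3 and \<open>p\<close> and Euler's criterion for -1 contribute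
  the same sign \<open>(-1)^k\<close>, which cancels. The congruence modulo \<open>p\<close> is an
  equality because both sides lie in {-1, 0, 1}.\<close>

lemma Legendre_minus_3:
  assumes p: "prime p" "p > 3"
  shows "Legendre (-3) (int p) = chi3 (int p)"
proof -
  define k where "k = (p - 1) div 2"
  have "\<not> 3 dvd p" using p primes_dvd_imp_eq[of 3 p] by auto
  then have nz: "chi3 (int p) \<noteq> 0"
  proof -
    have "int p mod 3 \<noteq> 0" using \<open>\<not> 3 dvd p\<close> by (metis int_dvd_int_iff mod_0_imp_dvd of_nat_numeral)
    moreover have "int p mod 3 \<in> {0, 1, 2}" by auto
    ultimately show ?thesis by (auto simp: chi3_def)
  qed
  have chi: "chi3 (int p) = 1 \<or> chi3 (int p) = -1" using nz by (auto simp: chi3_def split: if_splits)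
  have "Legendre (int p) (int 3) * Legendre (int 3) (int p) = (-1) ^ (k * ((3 - 1) div 2))"
    unfolding k_def by (rule Quadratic_Reciprocity) (use p in auto)
  then have QR: "chi3 (int p) * Legendre 3 (int p) = (-1) ^ k"
    using Legendre_mod_3[OF nz] by simp
  have "[Legendre (-3) (int p) = (-3) ^ k] (mod int p)"
    unfolding k_def using p euler_criterion by simp
  also have "(-3) ^ k = (-1) ^ k * (3::int) ^ k" by (rule power_minus)
  also have "[(-1) ^ k * 3 ^ k = (-1) ^ k * Legendre 3 (int p)] (mod int p)"
  proof -
    have "[Legendre 3 (int p) = 3 ^ k] (mod int p)" unfolding k_def using p euler_criterion[of p 3] by simp
    from cong_mult[OF cong_refl cong_sym[OF this]] show ?thesis .
  qed
  also have "(-1) ^ k * Legendre 3 (int p) = chi3 (int p)"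
  proof -
    have "Legendre 3 (int p) \<noteq> 0"
    proof
      assume "Legendre 3 (int p) = 0"
      with QR have "(-1 :: int) ^ k = 0" by simp
      then show False by simp
    qed
    then have "Legendre 3 (int p) * Legendre 3 (int p) = 1"
      using Legendre_cases[of 3 "int p"] by (elim disjE) simp_all
    then show ?thesis unfolding QR[symmetric] mult.assoc by simp
  qed
  finally show ?thesis
    by (rule small_cong_eq) (use Legendre_cases chi p in auto)
qed

lemma kronecker_minus_3:
  assumes "coprime d 6"
  shows "kronecker (-3) d = chi3 d"
proof (rule kronecker_eq_character)
  fix p :: nat assume p: "prime p" "int p dvd d"
  have "p \<noteq> 2" "p \<noteq> 3"
    using coprime_common_divisor[OF assms p(2)] by auto
  with p(1) have "p > 3" using prime_ge_2_nat[OF p(1)] by linarith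
  with p(1) \<open>p \<noteq> 2\<close> show "kronecker_prime (-3) p = chi3 (int p)"
    by (simp add: kronecker_prime_def Legendre_minus_3)
qed (use assms in \<open>auto simp: chi3_mult chi3_minus, simp add: chi3_def\<close>)

text \<open>Since -4 = (-1) 2^2 and 2^(p-1) is 1 modulo \<open>p\<close>, Euler's criterion leaves
  only \<open>(-1)^k\<close>.\<close>

lemma Legendre_minus_4:
  assumes p: "prime p" "p > 2"
  shows "Legendre (-4) (int p) = chi4 (int p)"
proof -
  define k where "k = (p - 1) div 2"
  have odd: "odd p" using p prime_odd_nat by blast
  then have pk: "p = 2 * k + 1" by (auto simp: k_def elim: oddE)
  have chi: "chi4 (int p) = (-1) ^ k"
  proof (cases "even k")
    case True
    then obtain j where "k = 2 * j" by blast
    then have "int p = 1 + 4 * int j" using pk by simp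
    then show ?thesis using True by (simp add: chi4_def)
  next
    case False
    then obtain j where "k = 2 * j + 1" by (auto elim: oddE)
    then have "int p = 3 + 4 * int j" using pk by simp
    then show ?thesis using False by (simp add: chi4_def)
  qed
  have "\<not> p dvd 2" using p by (auto dest: dvd_imp_le)
  from fermat_theorem[OF p(1) this] have "[2 ^ (2 * k) = 1] (mod p)" by (simp add: pk)
  then have f: "[(2::int) ^ (2 * k) = 1] (mod int p)"
    by (metis cong_int_iff of_nat_1 of_nat_numeral of_nat_power)
  have "[Legendre (-4) (int p) = (-4) ^ k] (mod int p)"
    unfolding k_def using p euler_criterion by simp
  also have "(-4) ^ k = (-1) ^ k * (2::int) ^ (2 * k)"
    using power_minus[of "4::int" k] by (simp add: power_mult)
  also have "[(-1) ^ k * (2::int) ^ (2 * k) = (-1) ^ k * 1] (mod int p)"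
    by (intro cong_mult cong_refl f)
  finally have "[Legendre (-4) (int p) = chi4 (int p)] (mod int p)" by (simp add: chi)
  then show ?thesis
    by (rule small_cong_eq) (use Legendre_cases p in \<open>auto simp: chi4_def\<close>)
qed

lemma kronecker_minus_4:
  assumes "odd d"
  shows "kronecker (-4) d = chi4 d"
proof (rule kronecker_eq_character)
  fix p :: nat assume p: "prime p" "int p dvd d"
  have "p \<noteq> 2" using assms p(2) by auto
  with p(1) have "p > 2" using prime_ge_2_nat[OF p(1)] by linarith
  with p(1) show "kronecker_prime (-4) p = chi4 (int p)"
    by (simp add: kronecker_prime_def Legendre_minus_4)
qed (use assms in \<open>auto simp: chi4_mult chi4_minus, simp add: chi4_def\<close>)

section \<open>Modularity on congruence subgroups with three parabolic generators\<close>

text \<open>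
  For \<open>(N, h) = (6, 3), (8, 2), (5, 5)\<close> the relation \<open>N (h - 1) = 4 h\<close> says that the isometric
  circles of \<open>\<plusminus>1\<close>-translates of the generators \<open>[[1, 0], [N, 1]]\<close> and \<open>[[1 + 2 h, h], [- 4 h, 1 - 2 h]]\<close>
  cover the interval \<open>[- 1/2, 1/2]\<close> up to finitely many points.
\<close>

lemma congruence_descent:
  fixes N h :: int and Q I :: "int \<Rightarrow> int \<Rightarrow> int \<Rightarrow> int \<Rightarrow> bool"
  assumes N: "N > 0" "h > 0" "N * (h - 1) = 4 * h"
    and I_det: "\<And>a b c d. I a b c d \<Longrightarrow> a * d - b * c = 1"
    and I_T: "\<And>a b c d n. I a b c d \<Longrightarrow> I (a + n * c) (b + n * d) c d"
    and I_U: "\<And>a b c d n. I a b c d \<Longrightarrow> I a b (c + n * N * a) (d + n * N * b)"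
    and I_P: "\<And>a b c d e. I a b c d \<Longrightarrow> e = h \<or> e = - h \<Longrightarrow>
        I ((1 + 2 * e) * a + e * c) ((1 + 2 * e) * b + e * d) (- 4 * e * a + (1 - 2 * e) * c) (- 4 * e * b + (1 - 2 * e) * d)"
    and I_irr: "\<And>a b c d. I a b c d \<Longrightarrow> c \<noteq> 0 \<Longrightarrow> a \<noteq> 0 \<and> N * \<bar>a\<bar> \<noteq> 2 * \<bar>c\<bar> \<and> 2 * \<bar>a\<bar> \<noteq> \<bar>c\<bar>"
    and Q_T: "\<And>a b c d n. I a b c d \<Longrightarrow> Q a b c d \<Longrightarrow> Q (a + n * c) (b + n * d) c d"
    and Q_U: "\<And>a b c d n. I a b c d \<Longrightarrow> n = 1 \<or> n = -1 \<Longrightarrow> Q a b c d \<Longrightarrow> Q a b (c + n * N * a) (d + n * N * b)"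
    and Q_P: "\<And>a b c d e. I a b c d \<Longrightarrow> e = h \<or> e = - h \<Longrightarrow> Q a b c d \<Longrightarrow>
        Q ((1 + 2 * e) * a + e * c) ((1 + 2 * e) * b + e * d) (- 4 * e * a + (1 - 2 * e) * c) (- 4 * e * b + (1 - 2 * e) * d)"
    and base: "Q 1 0 0 1" "Q (-1) 0 0 (-1)"
  shows "I a b c d \<Longrightarrow> Q a b c d"
proof (rule translation_descent[of I Q])
  fix a b c d :: int
  assume I: "I a b c d" and c: "c \<noteq> 0" and ac: "2 * \<bar>a\<bar> \<le> \<bar>c\<bar>"
  have irr: "a \<noteq> 0" "N * \<bar>a\<bar> \<noteq> 2 * \<bar>c\<bar>" "2 * \<bar>a\<bar> \<noteq> \<bar>c\<bar>" using I_irr[OF I c] by auto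
  \<comment> \<open>The parabolic steps for \<open>e\<close> and \<open>- e\<close> are inverse to
    each other, so \<open>Q\<close> can be pulled back along a step.\<close>
  have back_P: "Q a' b' c' d' \<longrightarrow> Q a b c d"
    if I: "I a b c d" and e: "e = h \<or> e = - h" and
      "a' = (1 + 2 * e) * a + e * c" "b' = (1 + 2 * e) * b + e * d"
      "c' = - 4 * e * a + (1 - 2 * e) * c" "d' = - 4 * e * b + (1 - 2 * e) * d" for a b c d a' b' c' d' e
  proof
    assume "Q a' b' c' d'"
    moreover have "I a' b' c' d'" unfolding that(3-) by (rule I_P[OF I e])
    moreover have e': "- e = h \<or> - e = - h" using e by auto
    ultimately have "Q ((1 + 2 * - e) * a' + - e * c') ((1 + 2 * - e) * b' + - e * d')
        (- 4 * - e * a' + (1 - 2 * - e) * c') (- 4 * - e * b' + (1 - 2 * - e) * d')" by (intro Q_P)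
    moreover have "(1 + 2 * - e) * a' + - e * c' = a" "(1 + 2 * - e) * b' + - e * d' = b"
        "- 4 * - e * a' + (1 - 2 * - e) * c' = c" "- 4 * - e * b' + (1 - 2 * - e) * d' = d"
      unfolding that(3-) by (simp_all add: algebra_simps)
    ultimately show "Q a b c d" by simp
  qed
  show "\<exists>a' b' c' d'. I a' b' c' d' \<and> \<bar>c'\<bar> < \<bar>c\<bar> \<and> (Q a' b' c' d' \<longrightarrow> Q a b c d)"
  proof (cases "N * \<bar>a\<bar> < 2 * \<bar>c\<bar>")
    case True
    \<comment> \<open>The sign makes \<open>n * N * a\<close> opposite to \<open>c\<close>, so the
      two partially cancel.\<close>
    define n where "n = - (sgn a * sgn c)"
    have n: "n = 1 \<or> n = -1" "- n = 1 \<or> - n = -1" using irr(1) c by (auto simp: n_def sgn_if)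
    have I': "I a b (c + n * N * a) (d + n * N * b)" by (rule I_U[OF I])
    have "c + n * N * a = sgn c * (\<bar>c\<bar> - N * \<bar>a\<bar>)"
      using c irr(1) by (cases "a > 0"; cases "c > 0") (simp_all add: n_def algebra_simps)
    then have "\<bar>c + n * N * a\<bar> = \<bar>\<bar>c\<bar> - N * \<bar>a\<bar>\<bar>" using c by (simp add: abs_mult)
    moreover have "N * \<bar>a\<bar> > 0" using N irr by simp
    ultimately have "\<bar>c + n * N * a\<bar> < \<bar>c\<bar>" using True by linarith
    moreover have "Q a b (c + n * N * a) (d + n * N * b) \<longrightarrow> Q a b c d"
      using Q_U[OF I' n(2)] by simp
    ultimately show ?thesis using I' by blast
  next
    case False
    \<comment> \<open>For \<open>|a| / |c|\<close> between \<open>2 / N\<close> and 1/2 the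
      parabolic element fixing -1/2 is used; the relation between \<open>N\<close> and
      \<open>h\<close> turns the lower bound into \<open>(2 h - 2) |c| < 4 h |a|\<close>.\<close>
    with irr(2) have lb: "N * \<bar>a\<bar> > 2 * \<bar>c\<bar>" by simp
    have ub: "2 * \<bar>a\<bar> < \<bar>c\<bar>" using irr(3) ac by simp
    have h1: "h > 1" using N by (cases "h = 1") auto
    have "(h - 1) * (2 * \<bar>c\<bar>) < (h - 1) * (N * \<bar>a\<bar>)" using lb h1 by (intro mult_strict_left_mono) auto
    also have "\<dots> = 4 * h * \<bar>a\<bar>" using N(3) by (metis mult.assoc mult.commute)
    finally have lb': "2 * h * \<bar>c\<bar> - 2 * \<bar>c\<bar> < 4 * h * \<bar>a\<bar>" by (simp add: algebra_simps)
    have "2 * h * (2 * \<bar>a\<bar>) < 2 * h * \<bar>c\<bar>" using ub N(2) by (intro mult_strict_left_mono) auto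
    then have ub': "4 * h * \<bar>a\<bar> < 2 * h * \<bar>c\<bar>" by simp
    have main: "\<bar>4 * h * \<bar>a\<bar> + (1 - 2 * h) * \<bar>c\<bar>\<bar> < \<bar>c\<bar>"
      using lb' ub' by (simp add: left_diff_distrib abs_less_iff)
    show ?thesis
    proof (cases "sgn a = sgn c")
      case True
      \<comment> \<open>A positive quotient \<open>a / c\<close> near 1/2 is first translated by -1
        to the neighbourhood of -1/2; then the step with \<open>- h\<close> applies.\<close>
      have I1: "I (a - c) (b - d) c d" using I_T[OF I, of "-1"] by simp
      let ?a = "(1 + 2 * - h) * (a - c) + - h * c" and ?b = "(1 + 2 * - h) * (b - d) + - h * d"
        and ?c = "- 4 * - h * (a - c) + (1 - 2 * - h) * c" and ?d = "- 4 * - h * (b - d) + (1 - 2 * - h) * d"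
      have I2: "I ?a ?b ?c ?d" by (rule I_P[OF I1]) simp
      have "?c = sgn c * (4 * h * \<bar>a\<bar> + (1 - 2 * h) * \<bar>c\<bar>)"
      proof -
        have "a = sgn c * \<bar>a\<bar>" "c = sgn c * \<bar>c\<bar>" using True by (metis mult.commute abs_mult_sgn)+
        then have "4 * h * a + (1 - 2 * h) * c = sgn c * (4 * h * \<bar>a\<bar> + (1 - 2 * h) * \<bar>c\<bar>)"
          by (metis distrib_left mult.left_commute)
        then show ?thesis by (simp add: algebra_simps)
      qed
      then have "\<bar>?c\<bar> < \<bar>c\<bar>" using main c by (simp add: abs_mult)
      moreover have "Q ?a ?b ?c ?d \<longrightarrow> Q (a - c) (b - d) c d"
        by (rule back_P[OF I1, of "- h"]) simp_all
      moreover have "Q (a - c) (b - d) c d \<Longrightarrow> Q a b c d" using Q_T[OF I1, of 1] by simp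
      ultimately show ?thesis using I2 by blast
    next
      case False
      let ?a = "(1 + 2 * h) * a + h * c" and ?b = "(1 + 2 * h) * b + h * d"
        and ?c = "- 4 * h * a + (1 - 2 * h) * c" and ?d = "- 4 * h * b + (1 - 2 * h) * d"
      have I2: "I ?a ?b ?c ?d" by (rule I_P[OF I]) simp
      have "?c = sgn c * (4 * h * \<bar>a\<bar> + (1 - 2 * h) * \<bar>c\<bar>)"
      proof -
        have "sgn a = - sgn c" using False irr(1) c by (auto simp: sgn_if split: if_splits)
        then have "a = - sgn c * \<bar>a\<bar>" "c = sgn c * \<bar>c\<bar>" by (metis mult.commute abs_mult_sgn)+
        then have "- a = sgn c * \<bar>a\<bar>" by simp
        then have "4 * h * (- a) + (1 - 2 * h) * c = sgn c * (4 * h * \<bar>a\<bar> + (1 - 2 * h) * \<bar>c\<bar>)"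
          using \<open>c = sgn c * \<bar>c\<bar>\<close> by (metis distrib_left mult.left_commute)
        then show ?thesis by simp
      qed
      then have "\<bar>?c\<bar> < \<bar>c\<bar>" using main c by (simp add: abs_mult)
      moreover have "Q ?a ?b ?c ?d \<longrightarrow> Q a b c d"
        by (rule back_P[OF I, of h]) simp_all
      ultimately show ?thesis using I2 by blast
    qed
  qed
qed (use assms in auto)

text \<open>The matrix is translation by \<open>e\<close> conjugated by \<open>(a, b; c, d)\<close>,
  a parabolic element fixing the cusp \<open>a / c\<close>. \<open>F\<close> slashed with the
  conjugating matrix has period \<open>h\<close>, and conjugating back gives a law without
  character.\<close>

lemma parabolic_law:
  fixes a b c d e :: int and h :: nat and F :: "complex \<Rightarrow> complex"
  assumes det: "a * d - b * c = 1"
    and F: "has_qexp h r C (\<lambda>z. F (moebius_int a b c d z) / (of_int c * z + of_int d) ^ k)"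
    and r: "nome (of_real r * of_nat h) = 1" and e: "e = int h \<or> e = - int h" and z: "Im z > 0"
  shows "F (moebius_int (1 - a * c * e) (a\<^sup>2 * e) (- c\<^sup>2 * e) (1 + a * c * e) z)
     = (of_int (- c\<^sup>2 * e) * z + of_int (1 + a * c * e)) ^ k * F z"
proof -
  define G where "G z = F (moebius_int a b c d z) / (of_int c * z + of_int d) ^ k" for z
  have per1: "G (w + of_nat h) = G w" if "Im w > 0" for w
    using has_qexp_shift[OF F that] r by (simp add: G_def)
  have per: "G (w + of_int e) = G w" if "Im w > 0" for w
    using e per1[OF that] per1[of "w - of_nat h"] that by auto
  define w where "w = moebius_int d (- b) (- c) a z"
  have det': "d * a - (- b) * (- c) = 1" using det by (simp add: algebra_simps)
  have w: "Im w > 0" unfolding w_def by (rule Im_moebius_int_pos[OF z det'])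
  have zw: "z = moebius_int a b c d w"
    unfolding w_def moebius_int_compose(1)[OF z det'] using det by (simp add: moebius_int_def algebra_simps)
  have ent: "(1 - a * c * e) * a + (a\<^sup>2 * e) * c = a" "(1 - a * c * e) * b + (a\<^sup>2 * e) * d = b + a * e"
    "(- c\<^sup>2 * e) * a + (1 + a * c * e) * c = c" "(- c\<^sup>2 * e) * b + (1 + a * c * e) * d = d + c * e"
  proof -
    show "(1 - a * c * e) * a + (a\<^sup>2 * e) * c = a" "(- c\<^sup>2 * e) * a + (1 + a * c * e) * c = c"
      by (simp_all add: algebra_simps power2_eq_square)
    have "(1 - a * c * e) * b + (a\<^sup>2 * e) * d = b + a * e * (a * d - b * c)"
      by (simp add: algebra_simps power2_eq_square)
    then show "(1 - a * c * e) * b + (a\<^sup>2 * e) * d = b + a * e" by (simp add: det)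
    have "(- c\<^sup>2 * e) * b + (1 + a * c * e) * d = d + c * e * (a * d - b * c)"
      by (simp add: algebra_simps power2_eq_square)
    then show "(- c\<^sup>2 * e) * b + (1 + a * c * e) * d = d + c * e" by (simp add: det)
  qed
  have jnz: "of_int c * w + of_int d \<noteq> 0" "of_int c * (w + of_int e) + of_int d \<noteq> 0"
    using int_linear_nonzero[OF w det_1_nonzero(1)[OF det]]
      int_linear_nonzero[of "w + of_int e", OF _ det_1_nonzero(1)[OF det]] w by auto
  have M: "moebius_int (1 - a * c * e) (a\<^sup>2 * e) (- c\<^sup>2 * e) (1 + a * c * e) z = moebius_int a b c d (w + of_int e)"
    unfolding zw moebius_int_compose(1)[OF w det] ent by (simp add: moebius_int_def algebra_simps)
  have J: "(of_int (- c\<^sup>2 * e) * z + of_int (1 + a * c * e)) * (of_int c * w + of_int d) = of_int c * (w + of_int e) + of_int d"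
    unfolding zw moebius_int_compose(2)[OF w det] ent by (simp add: algebra_simps)
  have "F (moebius_int a b c d (w + of_int e)) = (of_int c * (w + of_int e) + of_int d) ^ k * G (w + of_int e)"
    using jnz by (simp add: G_def)
  also have "\<dots> = (of_int (- c\<^sup>2 * e) * z + of_int (1 + a * c * e)) ^ k * ((of_int c * w + of_int d) ^ k * G w)"
    unfolding per[OF w] J[symmetric] by (simp add: power_mult_distrib)
  also have "(of_int c * w + of_int d) ^ k * G w = F z" using jnz by (simp add: G_def zw)
  finally show ?thesis unfolding M .
qed

text \<open>\<epsilon> sees only the lower right entry, as a Dirichlet character does on
  \<open>Gamma0\<close>, and is integer valued because all characters here are real.\<close>

definition transforms :: "(complex \<Rightarrow> complex) \<Rightarrow> nat \<Rightarrow> (int \<Rightarrow> int) \<Rightarrow> int \<Rightarrow> int \<Rightarrow> int \<Rightarrow> int \<Rightarrow> bool" where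
  "transforms F k \<epsilon> a b c d \<longleftrightarrow> (\<forall>z. Im z > 0 \<longrightarrow>
     F (moebius_int a b c d z) = of_int (\<epsilon> d) * (of_int c * z + of_int d) ^ k * F z)"

lemma transforms_compose:
  assumes X: "\<And>z. Im z > 0 \<Longrightarrow> F (moebius_int a' b' c' d' z) = (of_int c' * z + of_int d') ^ k * F z"
    and M: "transforms F k \<epsilon> a b c d" and det: "a * d - b * c = 1"
    and \<epsilon>: "\<epsilon> (c' * b + d' * d) = \<epsilon> d"
  shows "transforms F k \<epsilon> (a' * a + b' * c) (a' * b + b' * d) (c' * a + d' * c) (c' * b + d' * d)"
  unfolding transforms_def
proof (intro allI impI)
  fix z :: complex assume z: "Im z > 0"
  have "F (moebius_int (a' * a + b' * c) (a' * b + b' * d) (c' * a + d' * c) (c' * b + d' * d) z)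
      = F (moebius_int a' b' c' d' (moebius_int a b c d z))"
    by (simp only: moebius_int_compose(1)[OF z det])
  also have "\<dots> = (of_int c' * moebius_int a b c d z + of_int d') ^ k * F (moebius_int a b c d z)"
    by (rule X[OF Im_moebius_int_pos[OF z det]])
  also have "F (moebius_int a b c d z) = of_int (\<epsilon> d) * (of_int c * z + of_int d) ^ k * F z"
    using M z by (simp add: transforms_def)
  also have "(of_int c' * moebius_int a b c d z + of_int d') ^ k * (of_int (\<epsilon> d) * (of_int c * z + of_int d) ^ k * F z)
     = of_int (\<epsilon> d) * ((of_int c' * moebius_int a b c d z + of_int d') * (of_int c * z + of_int d)) ^ k * F z"
    by (simp add: power_mult_distrib)
  finally show "F (moebius_int (a' * a + b' * c) (a' * b + b' * d) (c' * a + d' * c) (c' * b + d' * d) z)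
     = of_int (\<epsilon> (c' * b + d' * d)) * (of_int (c' * a + d' * c) * z + of_int (c' * b + d' * d)) ^ k * F z"
    by (simp only: moebius_int_compose(2)[OF z det] \<epsilon>)
qed

text \<open>The two parabolic families fix the cusps 0, of width \<open>N\<close>, and -1/2, of
  width \<open>h\<close>; \<open>moebius_int 1 0 (-2) 1\<close> sends infinity to -1/2. Both act
  without character, and they change \<open>d\<close> by multiples of \<open>N\<close> and
  \<open>2 h\<close>, which \<epsilon> does not notice. The sign of \<epsilon> is therefore governed
  by its value at -1 alone.\<close>

theorem congruence_transforms:
  fixes N h :: nat and I :: "int \<Rightarrow> int \<Rightarrow> int \<Rightarrow> int \<Rightarrow> bool" and \<epsilon> :: "int \<Rightarrow> int"
  assumes N: "N > 0" "h > 0" "int N * (int h - 1) = 4 * int h"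
    and I_det: "\<And>a b c d. I a b c d \<Longrightarrow> a * d - b * c = 1"
    and I_T: "\<And>a b c d n. I a b c d \<Longrightarrow> I (a + n * c) (b + n * d) c d"
    and I_U: "\<And>a b c d n. I a b c d \<Longrightarrow> I a b (c + n * int N * a) (d + n * int N * b)"
    and I_P: "\<And>a b c d e. I a b c d \<Longrightarrow> e = int h \<or> e = - int h \<Longrightarrow>
        I ((1 + 2 * e) * a + e * c) ((1 + 2 * e) * b + e * d) (- 4 * e * a + (1 - 2 * e) * c) (- 4 * e * b + (1 - 2 * e) * d)"
    and I_irr: "\<And>a b c d. I a b c d \<Longrightarrow> c \<noteq> 0 \<Longrightarrow> a \<noteq> 0 \<and> int N * \<bar>a\<bar> \<noteq> 2 * \<bar>c\<bar> \<and> 2 * \<bar>a\<bar> \<noteq> \<bar>c\<bar>"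
    and \<epsilon>: "\<epsilon> 1 = 1" "\<epsilon> (-1) = (-1) ^ k" "\<And>x y. [x = y] (mod n0) \<Longrightarrow> \<epsilon> x = \<epsilon> y" "n0 dvd int N" "n0 dvd 2 * int h"
    and F_T: "\<And>z. Im z > 0 \<Longrightarrow> F (z + 1) = F z"
    and F_U: "has_qexp N r C (\<lambda>z. F (- 1 / z) / z ^ k)" "nome (of_real r * of_nat N) = 1"
    and F_P: "has_qexp h r' C' (\<lambda>z. F (moebius_int 1 0 (-2) 1 z) / (1 - 2 * z) ^ k)" "nome (of_real r' * of_nat h) = 1"
  shows "I a b c d \<Longrightarrow> transforms F k \<epsilon> a b c d"
proof (rule congruence_descent[of "int N" "int h" I "transforms F k \<epsilon>",
      OF _ _ N(3) I_det I_T I_U I_P I_irr])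
  have T: "F (z + of_int n) = F z" if "Im z > 0" for z n
  proof (induction n rule: int_induct[of _ 0])
    case (step1 i)
    then show ?case using F_T[of "z + of_int i"] that by (simp add: add_ac)
  next
    case (step2 i)
    then show ?case using F_T[of "z + of_int (i - 1)"] that by simp
  qed simp
  show "transforms F k \<epsilon> (a + n * c) (b + n * d) c d" if "I a b c d" "transforms F k \<epsilon> a b c d" for a b c d n
    using transforms_compose[of F 1 n 0 1 k \<epsilon> a b c d] that I_det[OF that(1)] T
    by (simp add: moebius_int_def)
  have U: "has_qexp N r C (\<lambda>z. F (moebius_int 0 (-1) 1 0 z) / (of_int 1 * z + of_int 0) ^ k)"
    using F_U(1) by (simp add: moebius_int_def)
  show "transforms F k \<epsilon> a b (c + n * int N * a) (d + n * int N * b)"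
    if "I a b c d" "n = 1 \<or> n = -1" "transforms F k \<epsilon> a b c d" for a b c d n
  proof -
    have e: "- n * int N = int N \<or> - n * int N = - int N" using that(2) by auto
    have 1: "F (moebius_int 1 0 (n * int N) 1 z) = (of_int (n * int N) * z + of_int 1) ^ k * F z" if "Im z > 0" for z
      using parabolic_law[OF _ U F_U(2) e that] by simp
    have "n0 dvd (n * int N * b + 1 * d) - d" using \<epsilon>(4) by (simp add: dvd_mult2 dvd_mult)
    then have 2: "\<epsilon> (n * int N * b + 1 * d) = \<epsilon> d" by (intro \<epsilon>(3)) (simp add: cong_iff_dvd_diff)
    from transforms_compose[OF 1 that(3) I_det[OF that(1)] 2] show ?thesis by (simp add: add.commute)
  qed
  have P: "has_qexp h r' C' (\<lambda>z. F (moebius_int 1 0 (-2) 1 z) / (of_int (-2) * z + of_int 1) ^ k)"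
    using F_P(1) by simp
  show "transforms F k \<epsilon> ((1 + 2 * e) * a + e * c) ((1 + 2 * e) * b + e * d)
      (- 4 * e * a + (1 - 2 * e) * c) (- 4 * e * b + (1 - 2 * e) * d)"
    if "I a b c d" "e = int h \<or> e = - int h" "transforms F k \<epsilon> a b c d" for a b c d e
  proof -
    have 1: "F (moebius_int (1 + 2 * e) e (- 4 * e) (1 - 2 * e) z) = (of_int (- 4 * e) * z + of_int (1 - 2 * e)) ^ k * F z"
      if "Im z > 0" for z
      using parabolic_law[OF _ P F_P(2) \<open>e = int h \<or> e = - int h\<close> that] by simp
    have "n0 dvd 2 * e" using that(2) \<epsilon>(5) by auto
    then have "n0 dvd 2 * e * (- 2 * b - d)" by (rule dvd_mult2)
    also have "2 * e * (- 2 * b - d) = (- 4 * e * b + (1 - 2 * e) * d) - d" by (simp add: algebra_simps)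
    finally have 2: "\<epsilon> (- 4 * e * b + (1 - 2 * e) * d) = \<epsilon> d" by (intro \<epsilon>(3)) (simp add: cong_iff_dvd_diff)
    from transforms_compose[OF 1 that(3) I_det[OF that(1)] 2] show ?thesis .
  qed
  show "transforms F k \<epsilon> 1 0 0 1" "transforms F k \<epsilon> (-1) 0 0 (-1)"
  proof -
    have "(-1) ^ k * (-1) ^ k = (1 :: complex)" by (simp flip: power_mult_distrib)
    then show "transforms F k \<epsilon> (-1) 0 0 (-1)"
      using \<epsilon>(2) by (simp add: transforms_def moebius_int_def)
  qed (use \<epsilon>(1) in \<open>simp add: transforms_def moebius_int_def\<close>)
qed (use N(1,2) in simp_all)

section \<open>The weight 3 form of a pair of weights 0 and 1\<close>

definition theta_form :: "(complex \<Rightarrow> complex) \<Rightarrow> (complex \<Rightarrow> complex) \<Rightarrow> complex \<Rightarrow> complex" where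
  "theta_form t f z = 1 / (2 * of_real pi * \<i>) * (deriv t z / t z) * f z"

lemma moebius_int_deriv:
  assumes "Im z > 0" "a * d - b * c = 1"
  shows "(moebius_int a b c d has_field_derivative 1 / (of_int c * z + of_int d) ^ 2) (at z)"
proof -
  have nz: "of_int c * z + of_int d \<noteq> 0" by (rule int_linear_nonzero[OF assms(1) det_1_nonzero(1)[OF assms(2)]])
  have "of_int a * (of_int c * z + of_int d) - (of_int a * z + of_int b) * of_int c = (of_int (a * d - b * c) :: complex)"
    by (simp add: algebra_simps)
  also have "\<dots> = 1" by (simp add: assms(2))
  finally have eq: "of_int a * (of_int c * z + of_int d) - (of_int a * z + of_int b) * of_int c = (1 :: complex)" .
  have "((\<lambda>z. (of_int a * z + of_int b) / (of_int c * z + of_int d)) has_field_derivative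
      (of_int a * (of_int c * z + of_int d) - (of_int a * z + of_int b) * of_int c)
        / ((of_int c * z + of_int d) * (of_int c * z + of_int d))) (at z)"
    by (rule derivative_eq_intros refl nz)+ simp
  then show ?thesis unfolding eq moebius_int_def[abs_def] by (simp add: power2_eq_square)
qed

lemma deriv_compose_moebius_int:
  assumes t: "t holomorphic_on upper_half" and z: "Im z > 0" and det: "a * d - b * c = 1"
  shows "((\<lambda>z. t (moebius_int a b c d z)) has_field_derivative
    deriv t (moebius_int a b c d z) * (1 / (of_int c * z + of_int d) ^ 2)) (at z)"
proof (rule DERIV_chain2[OF _ moebius_int_deriv[OF z det]])
  show "(t has_field_derivative deriv t (moebius_int a b c d z)) (at (moebius_int a b c d z))"
    by (rule holomorphic_derivI[OF t])
       (use Im_moebius_int_pos[OF z det] in \<open>auto simp: open_halfspace_Im_gt\<close>)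
qed

text \<open>Differentiating the invariance of \<open>t\<close> gives weight 2 for its derivative;
  \<open>f\<close> contributes weight 1 and the character.\<close>

lemma theta_form_transforms:
  assumes t: "t holomorphic_on upper_half" and det: "a * d - b * c = 1"
    and tM: "transforms t 0 (\<lambda>_. 1) a b c d" and fM: "transforms f 1 \<epsilon> a b c d"
  shows "transforms (theta_form t f) 3 \<epsilon> a b c d"
  unfolding transforms_def
proof (intro allI impI)
  fix z :: complex assume z: "Im z > 0"
  let ?j = "of_int c * z + of_int d" and ?M = "moebius_int a b c d z"
  have j: "?j \<noteq> 0" by (rule int_linear_nonzero[OF z det_1_nonzero(1)[OF det]])
  have "(t has_field_derivative deriv t z) (at z)"
    by (rule holomorphic_derivI[OF t]) (use z in \<open>auto simp: open_halfspace_Im_gt\<close>)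
  then have "((\<lambda>z. t (moebius_int a b c d z)) has_field_derivative deriv t z) (at z)"
    by (rule has_field_derivative_transform_within_open[where S = upper_half])
       (use z tM in \<open>auto simp: transforms_def open_halfspace_Im_gt\<close>)
  from DERIV_unique[OF this deriv_compose_moebius_int[OF t z det]]
  have "deriv t ?M = ?j ^ 2 * deriv t z" using j by (simp add: field_simps)
  moreover have "t ?M = t z" "f ?M = of_int (\<epsilon> d) * ?j * f z"
    using tM fM z by (auto simp: transforms_def)
  ultimately show "theta_form t f ?M = of_int (\<epsilon> d) * ?j ^ 3 * theta_form t f z"
    by (simp add: theta_form_def power2_eq_square power3_eq_cube)
qed

text \<open>The logarithmic derivative of \<open>t\<close> is bounded at a cusp whether
  \<open>t\<close> has a zero or a pole there, so a nonnegative order of \<open>f\<close> is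
  enough.\<close>

lemma theta_form_cusp_bounded:
  assumes t: "t holomorphic_on upper_half" and det: "a * d - b * c = 1"
    and tM: "has_qexp h r C (\<lambda>z. t (moebius_int a b c d z))"
    and fM: "has_qexp h' r' C' (\<lambda>z. f (moebius_int a b c d z) / (of_int c * z + of_int d))" "r' \<ge> 0"
  shows "\<exists>Y>0. \<exists>C. \<forall>z. Im z \<ge> Y \<longrightarrow>
    norm (theta_form t f (moebius_int a b c d z) / (of_int c * z + of_int d) ^ 3) \<le> C"
proof -
  obtain \<sigma> where \<sigma>: "\<sigma> holomorphic_on ball 0 1" "\<And>z. Im z > 0 \<Longrightarrow>
    ((\<lambda>z. t (moebius_int a b c d z)) has_field_derivative t (moebius_int a b c d z) *
      (2 * of_real pi * \<i> * of_real r + nome (z / of_nat h) * \<sigma> (nome (z / of_nat h)))) (at z)"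
    using has_qexp_deriv[OF tM] by auto
  have h: "h > 0" using tM by (simp add: has_qexp_def)
  have "(\<lambda>w. 2 * of_real pi * \<i> * of_real r + w * \<sigma> w) holomorphic_on ball 0 1"
    by (intro holomorphic_intros \<sigma>(1))
  from holomorphic_bounded_nome[OF this, of 1 h] h
  obtain B where B: "B > 0" "\<And>z. Im z \<ge> 1 \<Longrightarrow>
      norm (2 * of_real pi * \<i> * of_real r + nome (z / of_nat h) * \<sigma> (nome (z / of_nat h))) \<le> B" by auto
  obtain B' where B': "B' > 0" "\<And>z. Im z \<ge> 1 \<Longrightarrow> norm (f (moebius_int a b c d z) / (of_int c * z + of_int d)) \<le> B'"
    using has_qexp_bounded[OF fM, of 1] by auto
  have "norm (theta_form t f (moebius_int a b c d z) / (of_int c * z + of_int d) ^ 3) \<le> norm (1 / (2 * of_real pi * \<i>)) * B * B'"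
    if z1: "Im z \<ge> 1" for z
  proof -
    let ?j = "of_int c * z + of_int d" and ?M = "moebius_int a b c d z"
    have z: "Im z > 0" using z1 by simp
    have j: "?j \<noteq> 0" by (rule int_linear_nonzero[OF z det_1_nonzero(1)[OF det]])
    have t0: "t ?M \<noteq> 0" using has_qexp_nonzero[OF tM z] .
    let ?s = "2 * of_real pi * \<i> * of_real r + nome (z / of_nat h) * \<sigma> (nome (z / of_nat h))"
    have "deriv t ?M * (1 / ?j ^ 2) = t ?M * ?s"
      by (rule DERIV_unique[OF deriv_compose_moebius_int[OF t z det] \<sigma>(2)[OF z]])
    then have "deriv t ?M / t ?M = ?s * ?j ^ 2" using j t0 by (simp add: field_simps)
    then have "theta_form t f ?M / ?j ^ 3 = 1 / (2 * of_real pi * \<i>) * ?s * (f ?M / ?j)"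
      using j by (simp add: theta_form_def power2_eq_square power3_eq_cube)
    then have "norm (theta_form t f ?M / ?j ^ 3) = norm (1 / (2 * of_real pi * \<i>)) * norm ?s * norm (f ?M / ?j)"
      by (simp only: norm_mult)
    also have "\<dots> \<le> norm (1 / (2 * of_real pi * \<i>)) * B * B'"
      using B(1) by (intro mult_mono B(2)[OF z1] B'(2)[OF z1]) auto
    finally show ?thesis .
  qed
  then show ?thesis by (intro exI[of _ 1]) auto
qed

section \<open>Matrices\<close>

lemma mat2_nth [simp]:
  "mat2 a b c d $ 1 $ 1 = a" "mat2 a b c d $ 1 $ 2 = b" "mat2 a b c d $ 2 $ 1 = c" "mat2 a b c d $ 2 $ 2 = d"
  by (simp_all add: mat2_def)

lemma mat2_eq_iff: "mat2 a b c d = mat2 a' b' c' d' \<longleftrightarrow> a = a' \<and> b = b' \<and> c = c' \<and> d = d'"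
  by (metis mat2_nth)

lemma mat2_mult: "mat2 a b c d ** mat2 a' b' c' d' = mat2 (a * a' + b * c') (a * b' + b * d') (c * a' + d * c') (c * b' + d * d')"
  by (simp add: vec_eq_iff forall_2 matrix_matrix_mult_def sum_2)

lemma mat2_one: "mat 1 = mat2 1 0 0 1"
  by (simp add: vec_eq_iff forall_2 mat_def)

lemma matrix_inv_shift_mat: "matrix_inv shift_mat = mat2 1 (-1/2) 0 1"
proof -
  let ?B = "mat2 1 (-1/2) 0 1"
  have AB: "shift_mat ** ?B = mat 1" "?B ** shift_mat = mat 1"
    by (simp_all add: shift_mat_def mat2_mult mat2_one)
  then have "matrix_inv shift_mat ** shift_mat = mat 1"
    unfolding matrix_inv_def by (metis (mono_tags, lifting) someI_ex)
  then have "matrix_inv shift_mat ** (shift_mat ** ?B) = ?B"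
    by (simp add: matrix_mul_assoc)
  then show ?thesis by (simp only: AB matrix_mul_rid)
qed

lemma moebius_action_mat2:
  "moebius_action (mat2 (of_int a) (of_int b) (of_int c) (of_int d)) z = moebius_int a b c d z"
  by (simp add: moebius_action_def automorphy_def moebius_int_def)

lemma automorphy_mat2: "automorphy (mat2 (of_int a) (of_int b) (of_int c) (of_int d)) z = of_int c * z + of_int d"
  by (simp add: automorphy_def)

lemma cusp_bounded_SL2Z:
  assumes "\<And>a b c d. a * d - b * c = 1 \<Longrightarrow> \<exists>Y>0. \<exists>C. \<forall>z. Im z \<ge> Y \<longrightarrow>
     norm (g (moebius_int a b c d z) / (of_int c * z + of_int d) ^ k) \<le> C"
  shows "\<forall>M\<in>SL2Z. \<exists>Y>0. \<exists>C. \<forall>z. Im z \<ge> Y \<longrightarrow> norm (g (moebius_action M z) / automorphy M z ^ k) \<le> C"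
  unfolding SL2Z_def using assms by (auto simp: moebius_action_mat2 automorphy_mat2)

section \<open>Pairs of eta quotients\<close>

text \<open>At infinity the leading coefficient is exactly 1, a normalization that
  \<open>modular_pair\<close> demands and that \<open>eta_quotient_cusp\<close> leaves open.\<close>

lemma eta_quotient_inf:
  assumes "\<And>\<delta>. \<delta> \<in> fst ` set ds \<Longrightarrow> \<delta> > 0"
  shows "has_qexp 1 (eta_order 0 ds) 1 (eta_quotient ds)"
  using assms
proof (induction ds)
  case Nil
  then show ?case using has_qexp_const[of 1 1] by (simp add: eta_order_def eta_quotient_def[abs_def])
next
  case (Cons p ds)
  obtain \<delta> r where p: "p = (\<delta>, r)" by force
  have \<delta>: "\<delta> > 0" using Cons.prems[of \<delta>] by (simp add: p)
  have lt: "norm (w ^ \<delta>) < 1" if "norm w < 1" for w :: complex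
    using that \<delta> by (simp add: norm_power power_less_one_iff)
  have "has_qexp 1 (real \<delta> / 24) 1 (\<lambda>z. dedekind_eta (of_nat \<delta> * z))"
  proof (rule has_qexpI[where \<phi> = "\<lambda>w. qprod (w ^ \<delta>) (w ^ \<delta>)"])
    show "(\<lambda>w. qprod (w ^ \<delta>) (w ^ \<delta>)) holomorphic_on ball 0 1"
      by (intro holomorphic_intros) (use lt in auto)
    show "qprod (w ^ \<delta>) (w ^ \<delta>) \<noteq> 0" if "norm w < 1" for w
      using qprod_nonzero[OF lt lt] that by simp
    show "dedekind_eta (of_nat \<delta> * z) = nome (of_real (real \<delta> / 24) * z) *
        qprod (nome (z / of_nat 1) ^ \<delta>) (nome (z / of_nat 1) ^ \<delta>)" for z
      by (simp add: dedekind_eta_eq nome_power)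
  qed (use \<delta> in \<open>simp_all add: zero_power\<close>)
  from has_qexp_mult[OF has_qexp_powi[OF this, of r] Cons.IH] Cons.prems
  have "has_qexp 1 (of_int r * (real \<delta> / 24) + eta_order 0 ds) (1 powi r * 1)
      (\<lambda>z. dedekind_eta (of_nat \<delta> * z) powi r * eta_quotient ds z)" by auto
  moreover have "eta_order 0 (p # ds) = of_int r * (real \<delta> / 24) + eta_order 0 ds"
    using \<delta> by (simp add: p eta_order_def power2_eq_square)
  ultimately show ?case by (simp only: p eta_quotient_Cons[abs_def] power_int_1_left mult_1_left)
qed

lemma dedekind_eta_pos:
  assumes "y > 0"
  shows "\<exists>r>0. dedekind_eta (\<i> * of_real y) = of_real r"
proof -
  define q where "q = exp (- 2 * pi * y)"
  have q: "q > 0" "q < 1" using assms by (simp_all add: q_def)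
  have "2 * of_real pi * \<i> * (\<i> * of_real y) = complex_of_real (- 2 * pi * y)"
    "2 * of_real pi * \<i> * (\<i> * of_real y / 24) = complex_of_real (- 2 * pi * y / 24)"
    by (simp_all add: complex_eq_iff)
  then have "nome (\<i> * of_real y) = of_real q" and e: "nome (\<i> * of_real y / 24) = of_real (exp (- 2 * pi * y / 24))"
    by (simp_all only: nome_def q_def exp_of_real)
  moreover obtain r where "r > 0" "qprod (of_real q) (of_real q) = of_real r"
    using qprod_pos[of q q] q by auto
  ultimately show ?thesis
    by (intro exI[of _ "exp (- 2 * pi * y / 24) * r"]) (simp add: dedekind_eta_eq)
qed

lemma eta_quotient_pos:
  assumes "\<And>\<delta>. \<delta> \<in> fst ` set ds \<Longrightarrow> \<delta> > 0" "y > 0"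
  shows "\<exists>r>0. eta_quotient ds (\<i> * of_real y) = of_real r"
  using assms(1)
proof (induction ds)
  case Nil
  then show ?case by (intro exI[of _ 1]) simp
next
  case (Cons p ds)
  obtain \<delta> r where p: "p = (\<delta>, r)" by force
  have "\<delta> > 0" using Cons.prems[of \<delta>] by (simp add: p)
  then obtain x where x: "x > 0" "dedekind_eta (\<i> * of_real (real \<delta> * y)) = of_real x"
    using dedekind_eta_pos[of "real \<delta> * y"] assms(2) by auto
  obtain x' where x': "x' > 0" "eta_quotient ds (\<i> * of_real y) = of_real x'" using Cons by auto
  have "dedekind_eta (of_nat \<delta> * (\<i> * of_real y)) = of_real x" using x(2) by (simp add: mult_ac)
  then have "eta_quotient (p # ds) (\<i> * of_real y) = of_real (x powi r * x')"
    using x' by (simp add: p)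
  then show ?case using x(1) x'(1) by (intro exI[of _ "x powi r * x'"]) simp
qed

text \<open>Every \<delta> divides \<open>N\<close>, so \<open>c\<close> enters only through its gcd
  with \<open>N\<close>; this leaves one numerical check per divisor of the level.\<close>

lemma eta_order_gcd:
  assumes "\<And>\<delta>. \<delta> \<in> fst ` set ds \<Longrightarrow> \<delta> dvd N"
  shows "eta_order c ds = eta_order (int (gcd N (nat \<bar>c\<bar>))) ds"
  unfolding eta_order_def
proof (intro arg_cong[of _ _ sum_list] map_cong refl)
  fix x assume x: "x \<in> set ds"
  obtain \<delta> r where \<delta>: "x = (\<delta>, r)" by force
  have "\<delta> dvd N" using assms[of \<delta>] x \<delta> by force
  then have "gcd \<delta> (nat \<bar>c\<bar>) = gcd \<delta> (nat \<bar>int (gcd N (nat \<bar>c\<bar>))\<bar>)"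
    unfolding abs_of_nat nat_int by (metis gcd.assoc gcd_nat.absorb1)
  then show "(case x of (\<delta>, r) \<Rightarrow> of_int r * (real (gcd \<delta> (nat \<bar>c\<bar>)))\<^sup>2 / (24 * real \<delta>)) =
      (case x of (\<delta>, r) \<Rightarrow> of_int r * (real (gcd \<delta> (nat \<bar>int (gcd N (nat \<bar>c\<bar>))\<bar>)))\<^sup>2 / (24 * real \<delta>))"
    by (simp only: \<delta> prod.case)
qed

lemma eta_quotient_S:
  assumes "N > 0" "\<And>\<delta>. \<delta> \<in> fst ` set ds \<Longrightarrow> \<delta> > 0 \<and> \<delta> dvd N" "sum_list (map snd ds) = 2 * int k"
  shows "\<exists>C. has_qexp N (eta_order 1 ds) C (\<lambda>z. eta_quotient ds (- 1 / z) / z ^ k)"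
  using eta_quotient_cusp[of 0 0 "-1" 1 N ds k] assms by (simp add: moebius_int_def)

lemma eta_modular_pair:
  assumes N: "N > 0" and dvd: "\<And>\<delta>. \<delta> \<in> fst ` set (ts @ fs) \<Longrightarrow> \<delta> > 0 \<and> \<delta> dvd N"
    and sums: "sum_list (map snd ts) = 0" "sum_list (map snd fs) = 2"
    and ords: "eta_order 0 ts = 1" "eta_order 0 fs = 0" "eta_order 1 ts = 0" "eta_order 1 fs = 0"
  shows "modular_pair (eta_quotient ts) (eta_quotient fs) N"
proof
  show "has_qexp 1 1 1 (eta_quotient ts)" "has_qexp 1 0 1 (eta_quotient fs)"
    using eta_quotient_inf[of ts] eta_quotient_inf[of fs] dvd ords by auto
  show "\<exists>C. has_qexp N 0 C (\<lambda>z. eta_quotient ts (- 1 / z))"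
    using eta_quotient_S[OF N, of ts 0] dvd sums ords by auto
  show "\<exists>C. has_qexp N 0 C (\<lambda>z. eta_quotient fs (- 1 / z) / z)"
    using eta_quotient_S[OF N, of fs 1] dvd sums ords by auto
  show "\<exists>r>0. eta_quotient ts (\<i> * of_real y) = of_real r" if "y > 0" for y
    by (rule eta_quotient_pos[OF _ that]) (use dvd in auto)
qed

lemma eta_pair_cusp_bounded:
  assumes N: "N > 0" and dvd: "\<And>\<delta>. \<delta> \<in> fst ` set (ts @ fs) \<Longrightarrow> \<delta> > 0 \<and> \<delta> dvd N"
    and sums: "sum_list (map snd ts) = 0" "sum_list (map snd fs) = 2"
    and ord: "\<And>m. m dvd N \<Longrightarrow> eta_order (int m) fs \<ge> 0" and det: "a * d - b * c = 1"
  shows "\<exists>Y>0. \<exists>C. \<forall>z. Im z \<ge> Y \<longrightarrow>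
    norm (theta_form (eta_quotient ts) (eta_quotient fs) (moebius_int a b c d z) / (of_int c * z + of_int d) ^ 3) \<le> C"
proof -
  have hol: "eta_quotient ts holomorphic_on upper_half"
    by (rule eta_quotient_holomorphic) (use dvd in auto)
  \<comment> \<open>\<open>N\<close> is a multiple of the width of every cusp, so
    \<open>h = N\<close> can be used throughout.\<close>
  have dvd': "\<delta> > 0 \<and> \<delta> dvd (gcd \<delta> (nat \<bar>c\<bar>))\<^sup>2 * N" if "\<delta> \<in> fst ` set (ts @ fs)" for \<delta>
    using dvd[OF that] dvd_mult by blast
  have "\<exists>C. has_qexp N (eta_order c ts) C (\<lambda>z. eta_quotient ts (moebius_int a b c d z) / (of_int c * z + of_int d) ^ 0)"
    by (rule eta_quotient_cusp[OF det N dvd']) (use sums in auto)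
  then obtain C where "has_qexp N (eta_order c ts) C (\<lambda>z. eta_quotient ts (moebius_int a b c d z))"
    by auto
  moreover have "\<exists>C. has_qexp N (eta_order c fs) C (\<lambda>z. eta_quotient fs (moebius_int a b c d z) / (of_int c * z + of_int d) ^ 1)"
    by (rule eta_quotient_cusp[OF det N dvd']) (use sums in auto)
  then obtain C' where "has_qexp N (eta_order c fs) C' (\<lambda>z. eta_quotient fs (moebius_int a b c d z) / (of_int c * z + of_int d))"
    by auto
  moreover have "eta_order c fs \<ge> 0"
  proof -
    have "eta_order c fs = eta_order (int (gcd N (nat \<bar>c\<bar>))) fs"
      by (rule eta_order_gcd) (use dvd in auto)
    moreover have "eta_order (int (gcd N (nat \<bar>c\<bar>))) fs \<ge> 0" by (rule ord) (rule gcd_dvd1)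
    ultimately show ?thesis by (simp only:)
  qed
  ultimately show ?thesis by (rule theta_form_cusp_bounded[OF hol det])
qed

lemma nome_int_eq_1: "x \<in> \<int> \<Longrightarrow> nome (of_real x) = 1"
  by (auto elim!: Ints_cases)

lemma int_dvd_coprime_cases:
  fixes a c :: int
  assumes "a * d - b * c = 1" "c = m * a"
  shows "a = 1 \<or> a = -1"
proof -
  have "a * (d - b * m) = 1" using assms by (simp add: algebra_simps)
  then show ?thesis using zmult_eq_1_iff by blast
qed

text \<open>The boundary cases in which a descent step fails to lower \<open>|c|\<close>. Either
  equality would make \<open>c\<close> a multiple of \<open>a\<close>; being coprime to
  \<open>c\<close>, \<open>a\<close> is then 1 or -1 and \<open>|c|\<close> is \<open>N / 2\<close>
  or 2, against \<open>N dvd c\<close>.\<close>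

lemma Gamma0_irregular:
  fixes a b c d N :: int
  assumes det: "a * d - b * c = 1" and N: "N dvd c" "N > 3" "even N" and c: "c \<noteq> 0"
  shows "a \<noteq> 0 \<and> N * \<bar>a\<bar> \<noteq> 2 * \<bar>c\<bar> \<and> 2 * \<bar>a\<bar> \<noteq> \<bar>c\<bar>"
proof (intro conjI notI)
  assume "a = 0"
  with det have "1 = c * (- b)" by (simp add: algebra_simps)
  then have "c dvd 1" by (rule dvdI)
  with N(1) have "N dvd 1" by (rule dvd_trans)
  with N(2) show False by simp
next
  assume "N * \<bar>a\<bar> = 2 * \<bar>c\<bar>"
  moreover obtain K where K: "N = 2 * K" using N(3) by blast
  ultimately have eq: "\<bar>c\<bar> = K * \<bar>a\<bar>" by simp
  then have "c = K * a \<or> c = (- K) * a" by (cases "a > 0"; cases "c > 0") auto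
  then have "a = 1 \<or> a = -1" using int_dvd_coprime_cases[OF det] by blast
  with eq have "\<bar>c\<bar> = K" by auto
  with N(1) have "N dvd K" by auto
  then have "N \<le> K" using N(2) K by (intro zdvd_imp_le) auto
  with N(2) K show False by simp
next
  assume eq: "2 * \<bar>a\<bar> = \<bar>c\<bar>"
  then have "c = 2 * a \<or> c = (- 2) * a" by (cases "a > 0"; cases "c > 0") auto
  then have "a = 1 \<or> a = -1" using int_dvd_coprime_cases[OF det] by blast
  with eq have "\<bar>c\<bar> = 2" by auto
  with N(1) have "N dvd 2" by (metis dvd_abs_iff)
  then have "N \<le> 2" by (intro zdvd_imp_le) auto
  with N(2) show False by simp
qed

text \<open>The three integrality conditions belong to the cusps infinity (width 1), 0 (width
  \<open>N\<close>) and -1/2 (width \<open>h\<close>). The divisibility by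
  \<open>(gcd \<delta> 2)^2 * h\<close> says that \<open>h\<close> suffices at the last one.\<close>

lemma eta_Gamma0_transforms:
  fixes N h :: nat
  assumes N: "N > 3" "even N" "int N * (int h - 1) = 4 * int h"
    and dvd: "\<And>\<delta>. \<delta> \<in> fst ` set ds \<Longrightarrow> \<delta> > 0 \<and> \<delta> dvd N \<and> \<delta> dvd (gcd \<delta> 2)\<^sup>2 * h"
    and k: "sum_list (map snd ds) = 2 * int k"
    and ords: "eta_order 0 ds \<in> \<int>" "eta_order 1 ds * real N \<in> \<int>" "eta_order 2 ds * real h \<in> \<int>"
    and \<epsilon>: "\<epsilon> 1 = 1" "\<epsilon> (-1) = (-1) ^ k" "\<And>x y. [x = y] (mod n0) \<Longrightarrow> \<epsilon> x = \<epsilon> y" "n0 dvd int N" "n0 dvd 2 * int h"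
    and M: "a * d - b * c = 1" "int N dvd c"
  shows "transforms (eta_quotient ds) k \<epsilon> a b c d"
proof -
  have h: "h > 0"
  proof (rule Nat.gr0I)
    assume "h = 0"
    with N(1,3) show False by simp
  qed
  have N4: "int N dvd 4 * int h" by (rule dvdI[OF N(3)[symmetric]])
  have N0: "N > 0" using N(1) by simp
  have "has_qexp 1 (eta_order 0 ds) 1 (eta_quotient ds)"
    by (rule eta_quotient_inf) (use dvd in auto)
  from has_qexp_shift[OF this] nome_int_eq_1[OF ords(1)]
  have T: "eta_quotient ds (z + 1) = eta_quotient ds z" if "Im z > 0" for z using that by simp
  obtain C where U: "has_qexp N (eta_order 1 ds) C (\<lambda>z. eta_quotient ds (- 1 / z) / z ^ k)"
    using eta_quotient_S[OF N0 _ k] dvd by auto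
  have "eta_order (-2) ds = eta_order 2 ds" by (simp add: eta_order_def)
  moreover have "\<exists>C. has_qexp h (eta_order (-2) ds) C
      (\<lambda>z. eta_quotient ds (moebius_int 1 0 (-2) 1 z) / (of_int (-2) * z + of_int 1) ^ k)"
    by (rule eta_quotient_cusp[OF _ h _ k]) (use dvd in \<open>auto simp: nat_numeral\<close>)
  ultimately obtain C' where P: "has_qexp h (eta_order 2 ds) C'
      (\<lambda>z. eta_quotient ds (moebius_int 1 0 (-2) 1 z) / (1 - 2 * z) ^ k)" by auto
  have e1: "nome (of_real (eta_order 1 ds) * of_nat N) = 1" and e2: "nome (of_real (eta_order 2 ds) * of_nat h) = 1"
    using nome_int_eq_1[OF ords(2)] nome_int_eq_1[OF ords(3)] by simp_all
  define I where "I a b c d \<longleftrightarrow> a * d - b * c = 1 \<and> int N dvd c" for a b c d :: int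
  show ?thesis
  proof (rule congruence_transforms[of N h I \<epsilon> k n0, OF N0 h N(3) _ _ _ _ _ \<epsilon> T U e1 P e2])
    show "I a b c d" using M by (simp add: I_def)
    show "a * d - b * c = 1" if "I a b c d" for a b c d using that by (simp add: I_def)
    show "I (a + n * c) (b + n * d) c d" if "I a b c d" for a b c d n
      using that by (simp add: I_def algebra_simps)
    show "I a b (c + n * int N * a) (d + n * int N * b)" if "I a b c d" for a b c d n
      using that by (simp add: I_def algebra_simps)
    show "I ((1 + 2 * e) * a + e * c) ((1 + 2 * e) * b + e * d) (- 4 * e * a + (1 - 2 * e) * c) (- 4 * e * b + (1 - 2 * e) * d)"
      if I: "I a b c d" and e: "e = int h \<or> e = - int h" for a b c d e
    proof -
      have "int N dvd 4 * e" using e N4 by auto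
      then have "int N dvd - 4 * e * a" by simp
      moreover have "int N dvd (1 - 2 * e) * c" using I by (simp add: I_def)
      ultimately have "int N dvd - 4 * e * a + (1 - 2 * e) * c" by (rule dvd_add)
      moreover have "((1 + 2 * e) * a + e * c) * (- 4 * e * b + (1 - 2 * e) * d)
          - ((1 + 2 * e) * b + e * d) * (- 4 * e * a + (1 - 2 * e) * c) = a * d - b * c" by (simp add: algebra_simps)
      ultimately show ?thesis using I unfolding I_def by simp
    qed
    show "a \<noteq> 0 \<and> int N * \<bar>a\<bar> \<noteq> 2 * \<bar>c\<bar> \<and> 2 * \<bar>a\<bar> \<noteq> \<bar>c\<bar>" if "I a b c d" "c \<noteq> 0" for a b c d
      using Gamma0_irregular[of a d b c "int N"] that N(1,2) by (auto simp: I_def)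
  qed
qed

section \<open>The cases with eta quotients\<close>

lemma case_g_eq: "case_g c = theta_form (case_t c) (case_f c)"
  by (simp add: case_g_def[abs_def] theta_form_def[abs_def])

lemma case_pairs:
  "modular_pair (case_t CaseA) (case_f CaseA) 6" "modular_pair (case_t CaseC) (case_f CaseC) 6"
  "modular_pair (case_t CaseE) (case_f CaseE) 8" "modular_pair (case_t CaseG) (case_f CaseG) 8"
  "modular_pair (case_t CaseF) (case_f CaseF) 12"
  unfolding case_t.simps case_f.simps
  by (rule eta_modular_pair; auto simp: eta_order_def)+

lemma dvd_6_cases:
  assumes "m dvd 6"
  shows "m = (1::nat) \<or> m = (2::nat) \<or> m = (3::nat) \<or> m = (6::nat)"
proof -
  have "m \<le> 6" using assms by (intro dvd_imp_le) auto
  then have "m = 0 \<or> m = 1 \<or> m = 2 \<or> m = 3 \<or> m = 4 \<or> m = 5 \<or> m = 6" by presburger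
  then show ?thesis by (elim disjE) (use assms in simp_all)
qed

lemma dvd_8_cases:
  assumes "m dvd 8"
  shows "m = (1::nat) \<or> m = (2::nat) \<or> m = (4::nat) \<or> m = (8::nat)"
proof -
  have "m \<le> 8" using assms by (intro dvd_imp_le) auto
  then have "m = 0 \<or> m = 1 \<or> m = 2 \<or> m = 3 \<or> m = 4 \<or> m = 5 \<or> m = 6 \<or> m = 7 \<or> m = 8" by presburger
  then show ?thesis by (elim disjE) (use assms in simp_all)
qed

lemma dvd_12_cases:
  assumes "m dvd 12"
  shows "m = (1::nat) \<or> m = (2::nat) \<or> m = (3::nat) \<or> m = (4::nat) \<or> m = (6::nat) \<or> m = (12::nat)"
proof -
  have "m \<le> 12" using assms by (intro dvd_imp_le) auto
  then have "m = 0 \<or> m = 1 \<or> m = 2 \<or> m = 3 \<or> m = 4 \<or> m = 5 \<or> m = 6 \<or> m = 7 \<or> m = 8 \<or> m = 9 \<or> m = 10 \<or> m = 11 \<or> m = 12" by presburger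
  then show ?thesis by (elim disjE) (use assms in simp_all)
qed

lemma case_cusp_bounded:
  assumes "c \<noteq> CaseD"
  shows "\<forall>M\<in>SL2Z. \<exists>Y>0. \<exists>C. \<forall>z. Im z \<ge> Y \<longrightarrow>
           norm (case_g c (moebius_action M z) / automorphy M z ^ 3) \<le> C"
  unfolding case_g_eq
proof (rule cusp_bounded_SL2Z)
  fix a b d c' :: int assume det: "a * d - b * c' = 1"
  show "\<exists>Y>0. \<exists>C. \<forall>z. Im z \<ge> Y \<longrightarrow>
     norm (theta_form (case_t c) (case_f c) (moebius_int a b c' d z) / (of_int c' * z + of_int d) ^ 3) \<le> C"
  proof (cases c)
    case CaseA
    show ?thesis unfolding CaseA case_t.simps case_f.simps
      by (rule eta_pair_cusp_bounded[of 6, OF _ _ _ _ _ det]; (force simp: eta_order_def dest: dvd_6_cases)?)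
  next
    case CaseC
    show ?thesis unfolding CaseC case_t.simps case_f.simps
      by (rule eta_pair_cusp_bounded[of 6, OF _ _ _ _ _ det]; (force simp: eta_order_def dest: dvd_6_cases)?)
  next
    case CaseE
    show ?thesis unfolding CaseE case_t.simps case_f.simps
      by (rule eta_pair_cusp_bounded[of 8, OF _ _ _ _ _ det]; (force simp: eta_order_def dest: dvd_8_cases)?)
  next
    case CaseG
    show ?thesis unfolding CaseG case_t.simps case_f.simps
      by (rule eta_pair_cusp_bounded[of 8, OF _ _ _ _ _ det]; (force simp: eta_order_def dest: dvd_8_cases)?)
  next
    case CaseF
    show ?thesis unfolding CaseF case_t.simps case_f.simps
      by (rule eta_pair_cusp_bounded[of 12, OF _ _ _ _ _ det];
          (force | (drule dvd_12_cases, elim disjE; simp add: eta_order_def gcd_non_0_nat))?)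
  qed (use assms in simp)
qed

text \<open>The third pair is the level 6 form of case F: translated by 1/2, it becomes the pair of
  that case up to constants.\<close>

lemma Gamma0_6_transforms:
  assumes M: "a * d - b * c = 1" "6 dvd c"
  shows "transforms (case_g CaseA) 3 chi3 a b c d" "transforms (case_g CaseC) 3 chi3 a b c d"
    and "transforms (theta_form (eta_quotient [(2, 1), (6, 5), (1, -5), (3, -1)])
           (eta_quotient [(1, 6), (6, 1), (2, -3), (3, -2)])) 3 chi3 a b c d"
proof -
  have t: "transforms (eta_quotient ds) 0 (\<lambda>_. 1) a b c d"
    if "fst ` set ds \<subseteq> {1, 2, 3, 6}" "sum_list (map snd ds) = 0" "eta_order 0 ds \<in> \<int>"
      "eta_order 1 ds * 6 \<in> \<int>" "eta_order 2 ds * 3 \<in> \<int>" for ds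
    by (rule eta_Gamma0_transforms[of 6 3 ds 0 _ 1]) (use that M in auto)
  have f: "transforms (eta_quotient ds) 1 chi3 a b c d"
    if "fst ` set ds \<subseteq> {1, 2, 3, 6}" "sum_list (map snd ds) = 2" "eta_order 0 ds \<in> \<int>"
      "eta_order 1 ds * 6 \<in> \<int>" "eta_order 2 ds * 3 \<in> \<int>" for ds
    by (rule eta_Gamma0_transforms[of 6 3 ds 1 _ 3]) (use that M chi3_cong in \<open>auto simp: chi3_def\<close>)
  have g: "transforms (theta_form (eta_quotient ts) (eta_quotient fs)) 3 chi3 a b c d"
    if "fst ` set ts \<subseteq> {1, 2, 3, 6}" "sum_list (map snd ts) = 0" "eta_order 0 ts \<in> \<int>"
      "eta_order 1 ts * 6 \<in> \<int>" "eta_order 2 ts * 3 \<in> \<int>"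
      "fst ` set fs \<subseteq> {1, 2, 3, 6}" "sum_list (map snd fs) = 2" "eta_order 0 fs \<in> \<int>"
      "eta_order 1 fs * 6 \<in> \<int>" "eta_order 2 fs * 3 \<in> \<int>" for ts fs
    by (rule theta_form_transforms[OF eta_quotient_holomorphic M(1) t f]) (use that in auto)
  show "transforms (case_g CaseA) 3 chi3 a b c d" "transforms (case_g CaseC) 3 chi3 a b c d"
    "transforms (theta_form (eta_quotient [(2, 1), (6, 5), (1, -5), (3, -1)])
           (eta_quotient [(1, 6), (6, 1), (2, -3), (3, -2)])) 3 chi3 a b c d"
    unfolding case_g_eq case_t.simps case_f.simps by (rule g; simp add: eta_order_def)+
qed

lemma Gamma0_8_transforms:
  assumes M: "a * d - b * c = 1" "8 dvd c"
  shows "transforms (case_g CaseE) 3 chi4 a b c d" "transforms (case_g CaseG) 3 chi4 a b c d"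
proof -
  have t: "transforms (eta_quotient ds) 0 (\<lambda>_. 1) a b c d"
    if "fst ` set ds \<subseteq> {1, 2, 4, 8}" "sum_list (map snd ds) = 0" "eta_order 0 ds \<in> \<int>"
      "eta_order 1 ds * 8 \<in> \<int>" "eta_order 2 ds * 2 \<in> \<int>" for ds
    by (rule eta_Gamma0_transforms[of 8 2 ds 0 _ 1]) (use that M in auto)
  have f: "transforms (eta_quotient ds) 1 chi4 a b c d"
    if "fst ` set ds \<subseteq> {1, 2, 4, 8}" "sum_list (map snd ds) = 2" "eta_order 0 ds \<in> \<int>"
      "eta_order 1 ds * 8 \<in> \<int>" "eta_order 2 ds * 2 \<in> \<int>" for ds
    by (rule eta_Gamma0_transforms[of 8 2 ds 1 _ 4]) (use that M chi4_cong in \<open>auto simp: chi4_def\<close>)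
  have g: "transforms (theta_form (eta_quotient ts) (eta_quotient fs)) 3 chi4 a b c d"
    if "fst ` set ts \<subseteq> {1, 2, 4, 8}" "sum_list (map snd ts) = 0" "eta_order 0 ts \<in> \<int>"
      "eta_order 1 ts * 8 \<in> \<int>" "eta_order 2 ts * 2 \<in> \<int>"
      "fst ` set fs \<subseteq> {1, 2, 4, 8}" "sum_list (map snd fs) = 2" "eta_order 0 fs \<in> \<int>"
      "eta_order 1 fs * 8 \<in> \<int>" "eta_order 2 fs * 2 \<in> \<int>" for ts fs
    by (rule theta_form_transforms[OF eta_quotient_holomorphic M(1) t f]) (use that in auto)
  show "transforms (case_g CaseE) 3 chi4 a b c d" "transforms (case_g CaseG) 3 chi4 a b c d"
    unfolding case_g_eq case_t.simps case_f.simps by (rule g; simp add: eta_order_def)+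
qed

lemma odd_of_det_1:
  fixes a b c d :: int
  assumes "a * d - b * c = 1" "p dvd c"
  shows "coprime d p"
proof (rule coprimeI)
  fix l assume "l dvd d" "l dvd p"
  then have "l dvd a * d - b * c" using assms(2) by (meson dvd_diff dvd_mult dvd_trans)
  with assms(1) show "is_unit l" by simp
qed

lemma transforms_group:
  assumes "\<And>a b c d. a * d - b * c = 1 \<Longrightarrow> int N dvd c \<Longrightarrow> transforms g k \<epsilon> a b c d \<and> kronecker D d = \<epsilon> d"
  shows "\<forall>M\<in>Gamma0 N. \<forall>z\<in>upper_half. g (moebius_action M z) = kronecker_char D M * automorphy M z ^ k * g z"
proof (intro ballI)
  fix M z assume "M \<in> Gamma0 N" and z: "z \<in> upper_half"
  then obtain a b c d :: int where M: "M = mat2 (of_int a) (of_int b) (of_int c) (of_int d)"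
    "a * d - b * c = 1" "int N dvd c"
    by (auto simp: Gamma0_def cong_0_iff)
  from assms[OF M(2,3)] z show "g (moebius_action M z) = kronecker_char D M * automorphy M z ^ k * g z"
    by (simp add: M(1) transforms_def moebius_action_mat2 automorphy_mat2 kronecker_char_def)
qed

lemma eta_cases_transform:
  assumes "c \<in> {CaseA, CaseC, CaseE, CaseG}"
  shows "\<forall>M\<in>case_group c. \<forall>z\<in>upper_half.
           case_g c (moebius_action M z) = case_chi c M * automorphy M z ^ 3 * case_g c z"
proof -
  have K3: "kronecker (-3) d = chi3 d" if "a * d - b * c = 1" "6 dvd c" for a b c d
    using odd_of_det_1[OF that] by (rule kronecker_minus_3)
  have K4: "kronecker (-4) d = chi4 d" if "a * d - b * c = 1" "8 dvd c" for a b c d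
  proof (rule kronecker_minus_4)
    have "2 dvd c" using that(2) by (rule dvd_trans[rotated]) simp
    from odd_of_det_1[OF that(1) this] show "odd d" by simp
  qed
  from assms consider "c = CaseA" | "c = CaseC" | "c = CaseE" | "c = CaseG" by auto
  then show ?thesis
  proof cases
  case 1
    show ?thesis unfolding 1 case_group.simps case_chi.simps
    proof (rule transforms_group)
      fix a b c d :: int assume M: "a * d - b * c = 1" "int 6 dvd c"
      then show "transforms (case_g CaseA) 3 chi3 a b c d \<and> kronecker (-3) d = chi3 d"
        using Gamma0_6_transforms(1)[of a d b c] K3[of a d b c] by simp
    qed
  next
  case 2
    show ?thesis unfolding 2 case_group.simps case_chi.simps
    proof (rule transforms_group)
      fix a b c d :: int assume M: "a * d - b * c = 1" "int 6 dvd c"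
      then show "transforms (case_g CaseC) 3 chi3 a b c d \<and> kronecker (-3) d = chi3 d"
        using Gamma0_6_transforms(2)[of a d b c] K3[of a d b c] by simp
    qed
  next
  case 3
    show ?thesis unfolding 3 case_group.simps case_chi.simps
    proof (rule transforms_group)
      fix a b c d :: int assume M: "a * d - b * c = 1" "int 8 dvd c"
      then show "transforms (case_g CaseE) 3 chi4 a b c d \<and> kronecker (-4) d = chi4 d"
        using Gamma0_8_transforms(1)[of a d b c] K4[of a d b c] by simp
    qed
  next
  case 4
    show ?thesis unfolding 4 case_group.simps case_chi.simps
    proof (rule transforms_group)
      fix a b c d :: int assume M: "a * d - b * c = 1" "int 8 dvd c"
      then show "transforms (case_g CaseG) 3 chi4 a b c d \<and> kronecker (-4) d = chi4 d"
        using Gamma0_8_transforms(2)[of a d b c] K4[of a d b c] by simp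
    qed
  qed
qed

section \<open>Case F as a translate of a pair of level 6\<close>

lemma dedekind_eta_half:
  assumes "Im z > 0"
  shows "dedekind_eta (z + 1 / 2) = nome (1 / 48) * dedekind_eta (2 * z) ^ 3 / (dedekind_eta z * dedekind_eta (4 * z))"
proof -
  have q: "norm (nome z) < 1" using assms by (simp add: norm_nome_less_1_iff)
  then have q2: "norm ((nome z)\<^sup>2) < 1" "norm (nome z ^ 4) < 1" by (simp_all add: norm_power power_less_one_iff)
  have h: "nome (z + 1 / 2) = - nome z" by (simp add: nome_add nome_half)
  have e: "nome ((z + 1 / 2) / 24) * nome (z / 24) * nome (4 * z / 24) = nome (1 / 48) * nome (2 * z / 24) ^ 3"
    unfolding nome_power nome_add[symmetric] by (intro arg_cong[of _ _ nome]) (simp add: field_simps)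
  have n: "nome (2 * z) = nome z ^ 2" "nome (4 * z) = nome z ^ 4" by (simp_all add: nome_power)
  have "dedekind_eta (z + 1 / 2) * (dedekind_eta z * dedekind_eta (4 * z))
      = (nome ((z + 1 / 2) / 24) * nome (z / 24) * nome (4 * z / 24)) *
        (qprod (- nome z) (- nome z) * qprod (nome z) (nome z) * qprod (nome z ^ 4) (nome z ^ 4))"
    by (simp add: dedekind_eta_eq h n)
  also have "\<dots> = nome (1 / 48) * dedekind_eta (2 * z) ^ 3"
    unfolding e qprod_minus_self[OF q] by (simp add: dedekind_eta_eq n power_mult_distrib)
  finally show ?thesis
    using assms dedekind_eta_nonzero[of z] dedekind_eta_nonzero[of "4 * z"] by (simp add: field_simps)
qed

lemma dedekind_eta_add_1: "dedekind_eta (z + 1) = nome (1 / 24) * dedekind_eta z"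
proof -
  have "nome ((z + 1) / 24) = nome (1 / 24) * nome (z / 24)"
    by (simp add: add_divide_distrib nome_add)
  then show ?thesis by (simp add: dedekind_eta_eq nome_add[of z])
qed

text \<open>The constants are -1 and 1, but only their being nonzero matters: the first drops out of
  the logarithmic derivative, the second out of the transformation law, which is linear in the
  form.\<close>

lemma case_F_half_shift:
  shows "\<exists>C. C \<noteq> 0 \<and> (\<forall>z. Im z > 0 \<longrightarrow> eta_quotient [(2, 1), (6, 5), (1, -5), (3, -1)] (z + 1 / 2) = C * case_t CaseF z)"
    and "\<exists>C. C \<noteq> 0 \<and> (\<forall>z. Im z > 0 \<longrightarrow> eta_quotient [(1, 6), (6, 1), (2, -3), (3, -2)] (z + 1 / 2) = C * case_f CaseF z)"
proof -
  define c1 where "c1 = nome (1 / 48)"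
  define c2 where "c2 = nome (1 / 24)"
  have c: "c1 \<noteq> 0" "c2 \<noteq> 0" by (simp_all add: c1_def c2_def)
  have e2: "dedekind_eta (2 * (z + 1 / 2)) = c2 * dedekind_eta (2 * z)" for z
    using dedekind_eta_add_1[of "2 * z"] by (simp add: distrib_left c2_def)
  have e6: "dedekind_eta (6 * (z + 1 / 2)) = c2 ^ 3 * dedekind_eta (6 * z)" for z
  proof -
    have "6 * (z + 1 / 2) = 6 * z + 1 + 1 + 1" by simp
    then show ?thesis using dedekind_eta_add_1[of "6 * z"] dedekind_eta_add_1[of "6 * z + 1"] dedekind_eta_add_1[of "6 * z + 1 + 1"]
      by (simp only: c2_def power3_eq_cube mult.assoc)
  qed
  have e1: "dedekind_eta (z + 1 / 2) = c1 * dedekind_eta (2 * z) ^ 3 / (dedekind_eta z * dedekind_eta (4 * z))" if "Im z > 0" for z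
    using dedekind_eta_half[OF that] by (simp add: c1_def)
  have e3: "dedekind_eta (3 * (z + 1 / 2)) = c2 * c1 * dedekind_eta (6 * z) ^ 3 / (dedekind_eta (3 * z) * dedekind_eta (12 * z))"
    if "Im z > 0" for z
  proof -
    have 3: "3 * (z + 1 / 2) = (3 * z + 1 / 2) + 1" by simp
    have "dedekind_eta (3 * z + 1 / 2) = c1 * dedekind_eta (6 * z) ^ 3 / (dedekind_eta (3 * z) * dedekind_eta (12 * z))"
      using dedekind_eta_half[of "3 * z"] that by (simp add: c1_def)
    then show ?thesis unfolding 3 dedekind_eta_add_1 by (simp add: c2_def)
  qed
  have nz: "dedekind_eta z \<noteq> 0" "dedekind_eta (2 * z) \<noteq> 0" "dedekind_eta (3 * z) \<noteq> 0" "dedekind_eta (4 * z) \<noteq> 0"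
    "dedekind_eta (6 * z) \<noteq> 0" "dedekind_eta (12 * z) \<noteq> 0" if "Im z > 0" for z
    using that by (auto intro!: dedekind_eta_nonzero)
  have pw: "x powi (-5) = inverse (x ^ 5)" "x powi (-1) = inverse x" "x powi (-14) = inverse (x ^ 14)"
     "x powi (-3) = inverse (x ^ 3)" "x powi (-2) = inverse (x ^ 2)" "x powi (-6) = inverse (x ^ 6)" for x :: complex
    by (simp_all add: power_int_minus)
  show "\<exists>C. C \<noteq> 0 \<and> (\<forall>z. Im z > 0 \<longrightarrow> eta_quotient [(2, 1), (6, 5), (1, -5), (3, -1)] (z + 1 / 2) = C * case_t CaseF z)"
  proof (intro exI[of _ "c2 ^ 15 / c1 ^ 6"] conjI allI impI)
    fix z :: complex assume z: "Im z > 0"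
    have 1: "eta_quotient [(2, 1), (6, 5), (1, -5), (3, -1)] w = dedekind_eta (2 * w) * dedekind_eta (6 * w) ^ 5
        * inverse (dedekind_eta w ^ 5) * inverse (dedekind_eta (3 * w))" for w
      by (simp add: pw)
    have 2: "case_t CaseF z = dedekind_eta z ^ 5 * dedekind_eta (3 * z) * dedekind_eta (4 * z) ^ 5
        * dedekind_eta (6 * z) ^ 2 * dedekind_eta (12 * z) * inverse (dedekind_eta (2 * z) ^ 14)"
      by (simp add: pw)
    have "(c2 * x2) * (c2 ^ 3 * x6) ^ 5 * inverse ((c1 * x2 ^ 3 / (x1 * x4)) ^ 5) * inverse (c2 * c1 * x6 ^ 3 / (x3 * x12))
        = c2 ^ 15 / c1 ^ 6 * (x1 ^ 5 * x3 * x4 ^ 5 * x6 ^ 2 * x12 * inverse (x2 ^ 14))"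
      if "x1 \<noteq> 0" "x2 \<noteq> 0" "x3 \<noteq> 0" "x4 \<noteq> 0" "x6 \<noteq> 0" "x12 \<noteq> 0" for x1 x2 x3 x4 x6 x12 :: complex
      using that c by (simp add: divide_simps power_mult_distrib) (simp add: eval_nat_numeral mult_ac)
    from this[OF nz[OF z]] show "eta_quotient [(2, 1), (6, 5), (1, -5), (3, -1)] (z + 1 / 2) = c2 ^ 15 / c1 ^ 6 * case_t CaseF z"
      unfolding 1 2 e1[OF z] e2 e3[OF z] e6 .
  qed (use c in simp)
  show "\<exists>C. C \<noteq> 0 \<and> (\<forall>z. Im z > 0 \<longrightarrow> eta_quotient [(1, 6), (6, 1), (2, -3), (3, -2)] (z + 1 / 2) = C * case_f CaseF z)"
  proof (intro exI[of _ "c1 ^ 4 / c2 ^ 2"] conjI allI impI)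
    fix z :: complex assume z: "Im z > 0"
    have 1: "eta_quotient [(1, 6), (6, 1), (2, -3), (3, -2)] w = dedekind_eta w ^ 6 * dedekind_eta (6 * w)
        * inverse (dedekind_eta (2 * w) ^ 3) * inverse (dedekind_eta (3 * w) ^ 2)" for w
      by (simp add: pw)
    have 2: "case_f CaseF z = dedekind_eta (2 * z) ^ 15 * dedekind_eta (3 * z) ^ 2 * dedekind_eta (12 * z) ^ 2
        * inverse (dedekind_eta z ^ 6) * inverse (dedekind_eta (4 * z) ^ 6) * inverse (dedekind_eta (6 * z) ^ 5)"
      by (simp add: pw)
    have "(c1 * x2 ^ 3 / (x1 * x4)) ^ 6 * (c2 ^ 3 * x6) * inverse ((c2 * x2) ^ 3) * inverse ((c2 * c1 * x6 ^ 3 / (x3 * x12)) ^ 2)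
        = c1 ^ 4 / c2 ^ 2 * (x2 ^ 15 * x3 ^ 2 * x12 ^ 2 * inverse (x1 ^ 6) * inverse (x4 ^ 6) * inverse (x6 ^ 5))"
      if "x1 \<noteq> 0" "x2 \<noteq> 0" "x3 \<noteq> 0" "x4 \<noteq> 0" "x6 \<noteq> 0" "x12 \<noteq> 0" for x1 x2 x3 x4 x6 x12 :: complex
      using that c by (simp add: divide_simps power_mult_distrib) (simp add: eval_nat_numeral mult_ac)
    from this[OF nz[OF z]] show "eta_quotient [(1, 6), (6, 1), (2, -3), (3, -2)] (z + 1 / 2) = c1 ^ 4 / c2 ^ 2 * case_f CaseF z"
      unfolding 1 2 e1[OF z] e2 e3[OF z] e6 .
  qed (use c in simp)
qed

lemma case_F_theta_form:
  "\<exists>C. C \<noteq> 0 \<and> (\<forall>z. Im z > 0 \<longrightarrow> case_g CaseF z = C * theta_form (eta_quotient [(2, 1), (6, 5), (1, -5), (3, -1)])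
     (eta_quotient [(1, 6), (6, 1), (2, -3), (3, -2)]) (z + 1 / 2))"
proof -
  let ?t = "eta_quotient [(2, 1), (6, 5), (1, -5), (3, -1)]" and ?f = "eta_quotient [(1, 6), (6, 1), (2, -3), (3, -2)]"
  obtain C where C: "C \<noteq> 0" "\<And>z. Im z > 0 \<Longrightarrow> ?t (z + 1 / 2) = C * case_t CaseF z"
    using case_F_half_shift(1) by blast
  obtain C' where C': "C' \<noteq> 0" "\<And>z. Im z > 0 \<Longrightarrow> ?f (z + 1 / 2) = C' * case_f CaseF z"
    using case_F_half_shift(2) by blast
  have hol: "?t holomorphic_on upper_half" "case_t CaseF holomorphic_on upper_half"
    unfolding case_t.simps by (rule eta_quotient_holomorphic; auto)+
  have "case_g CaseF z = inverse C' * theta_form ?t ?f (z + 1 / 2)" if z: "Im z > 0" for z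
  proof -
    have "(?t has_field_derivative deriv ?t (z + 1 / 2)) (at (z + 1 / 2))"
      by (rule holomorphic_derivI[OF hol(1)]) (use z in \<open>auto simp: open_halfspace_Im_gt\<close>)
    then have "((\<lambda>z. ?t (z + 1 / 2)) has_field_derivative deriv ?t (z + 1 / 2) * 1) (at z)"
      by (rule DERIV_chain2) (auto intro!: derivative_eq_intros)
    moreover have "((\<lambda>z. ?t (z + 1 / 2)) has_field_derivative C * deriv (case_t CaseF) z) (at z)"
    proof (rule has_field_derivative_transform_within_open[where S = upper_half])
      show "((\<lambda>z. C * case_t CaseF z) has_field_derivative C * deriv (case_t CaseF) z) (at z)"
        by (intro DERIV_cmult holomorphic_derivI[OF hol(2)]) (use z in \<open>auto simp: open_halfspace_Im_gt\<close>)
    qed (use z C(2) in \<open>auto simp: open_halfspace_Im_gt\<close>)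
    ultimately have "deriv ?t (z + 1 / 2) = C * deriv (case_t CaseF) z" using DERIV_unique by fastforce
    then show ?thesis
      using C(1) C'(1) by (simp only: case_g_eq theta_form_def C(2)[OF z] C'(2)[OF z]) (simp add: field_simps)
  qed
  with C'(1) show ?thesis by (intro exI[of _ "inverse C'"]) auto
qed

text \<open>An element of the conjugate group acts on \<open>z\<close> as its conjugate in
  \<open>Gamma0 6\<close> acts on \<open>z + 1/2\<close>, and with the same automorphy factor; the
  law is that of the translated pair.\<close>

lemma case_F_transform:
  "\<forall>M\<in>case_group CaseF. \<forall>z\<in>upper_half.
     case_g CaseF (moebius_action M z) = case_chi CaseF M * automorphy M z ^ 3 * case_g CaseF z"
proof (intro ballI)
  fix M z assume M: "M \<in> case_group CaseF" and "z \<in> upper_half"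
  then have z: "Im z > 0" "Im (z + 1 / 2) > 0" by simp_all
  obtain a b c d :: int where M': "M = matrix_inv shift_mat ** mat2 (of_int a) (of_int b) (of_int c) (of_int d) ** shift_mat"
    and det: "a * d - b * c = 1" and c6: "6 dvd c"
    using M by (auto simp: Gamma0_def cong_0_iff)
  define A where "A = mat2 (of_int a) (of_int b) (of_int c) (of_int d)"
  have entries: "M = mat2 (a - c / 2) ((a - c / 2) / 2 + b - d / 2) c (c / 2 + d)"
    unfolding M' matrix_inv_shift_mat by (simp add: shift_mat_def mat2_mult mat2_eq_iff field_simps)
  have "shift_mat ** M ** matrix_inv shift_mat = A"
    unfolding entries A_def matrix_inv_shift_mat by (simp add: shift_mat_def mat2_mult mat2_eq_iff field_simps)
  then have chi: "case_chi CaseF M = of_int (chi3 d)"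
    using kronecker_minus_3[OF odd_of_det_1[OF det c6]] by (simp add: kronecker_char_def A_def)
  have j: "automorphy M z = of_int c * (z + 1 / 2) + of_int d"
    by (simp add: entries automorphy_def field_simps)
  have jnz: "of_int c * (z + 1 / 2) + of_int d \<noteq> 0"
    by (rule int_linear_nonzero[OF z(2) det_1_nonzero(1)[OF det]])
  have act: "moebius_action M z + 1 / 2 = moebius_int a b c d (z + 1 / 2)"
  proof -
    have num: "of_real (M $ 1 $ 1) * z + of_real (M $ 1 $ 2)
      = of_int a * (z + 1 / 2) + of_int b - (of_int c * (z + 1 / 2) + of_int d) / 2"
      by (simp add: entries field_simps)
    have "(x - y / 2) / y + 1 / 2 = x / y" if "y \<noteq> 0" for x y :: complex
      using that by (simp add: field_simps)
    then show ?thesis unfolding moebius_action_def j num moebius_int_def using jnz by blast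
  qed
  let ?g = "theta_form (eta_quotient [(2, 1), (6, 5), (1, -5), (3, -1)]) (eta_quotient [(1, 6), (6, 1), (2, -3), (3, -2)])"
  obtain C where C: "\<And>z. Im z > 0 \<Longrightarrow> case_g CaseF z = C * ?g (z + 1 / 2)"
    using case_F_theta_form by blast
  have Im: "Im (moebius_action M z) > 0"
    using Im_moebius_int_pos[OF z(2) det] unfolding act[symmetric] by simp
  have "case_g CaseF (moebius_action M z) = C * ?g (moebius_int a b c d (z + 1 / 2))"
    using C[OF Im] by (simp only: act)
  also have "?g (moebius_int a b c d (z + 1 / 2)) = of_int (chi3 d) * automorphy M z ^ 3 * ?g (z + 1 / 2)"
    using Gamma0_6_transforms(3)[OF det c6] z(2) unfolding transforms_def j by blast
  also have "C * (of_int (chi3 d) * automorphy M z ^ 3 * ?g (z + 1 / 2)) = case_chi CaseF M * automorphy M z ^ 3 * case_g CaseF z"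
    unfolding chi C[OF z(1)] by (simp only: mult_ac)
  finally show "case_g CaseF (moebius_action M z) = case_chi CaseF M * automorphy M z ^ 3 * case_g CaseF z" .
qed

section \<open>The stabilizers of the cusp 0\<close>

lemma Gamma0_lower_triangular: "mat2 1 0 (real n) 1 \<in> Gamma0 N \<longleftrightarrow> N dvd n"
proof
  assume "mat2 1 0 (real n) 1 \<in> Gamma0 N"
  then obtain c :: int where "real n = of_int c" "int N dvd c" by (auto simp: Gamma0_def mat2_eq_iff cong_0_iff)
  then show "N dvd n" by (metis int_dvd_int_iff of_int_eq_iff of_int_of_nat_eq)
next
  assume "N dvd n"
  then show "mat2 1 0 (real n) 1 \<in> Gamma0 N"
    unfolding Gamma0_def
    by (intro CollectI exI[of _ 1] exI[of _ 0] exI[of _ "int n"]) (auto simp: cong_0_iff)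
qed

lemma Gamma1_lower_triangular: "mat2 1 0 (real n) 1 \<in> Gamma1 N \<longleftrightarrow> N dvd n"
proof
  assume "mat2 1 0 (real n) 1 \<in> Gamma1 N"
  then obtain c :: int where "real n = of_int c" "int N dvd c" by (auto simp: Gamma1_def mat2_eq_iff cong_0_iff)
  then show "N dvd n" by (metis int_dvd_int_iff of_int_eq_iff of_int_of_nat_eq)
next
  assume "N dvd n"
  then show "mat2 1 0 (real n) 1 \<in> Gamma1 N"
    unfolding Gamma1_def
    by (intro CollectI exI[of _ 1] exI[of _ 0] exI[of _ "int n"]) (auto simp: cong_0_iff)
qed

text \<open>Conjugated into \<open>Gamma0 6\<close> the matrix has upper right entry
  \<open>- n / 4\<close> and lower left entry \<open>n\<close>; integrality of the first and
  divisibility of the second by 6 together mean \<open>12 dvd n\<close>.\<close>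

lemma case_F_lower_triangular: "mat2 1 0 (real n) 1 \<in> case_group CaseF \<longleftrightarrow> 12 dvd n"
proof
  assume "mat2 1 0 (real n) 1 \<in> case_group CaseF"
  then obtain a b c d :: int where
    M: "mat2 1 0 (real n) 1 = matrix_inv shift_mat ** mat2 (of_int a) (of_int b) (of_int c) (of_int d) ** shift_mat"
    and c6: "6 dvd c"
    by (auto simp: Gamma0_def cong_0_iff)
  from M[unfolded matrix_inv_shift_mat, unfolded shift_mat_def mat2_mult mat2_eq_iff]
  have "1 = real_of_int a - real_of_int c / 2" "(real_of_int a - real_of_int c / 2) / 2 + real_of_int b - real_of_int d / 2 = 0"
    "real n = of_int c" "1 = real_of_int c / 2 + real_of_int d"
    by (auto simp: field_simps)
  then have "real_of_int (4 * (- b)) = of_int c" "c = int n" by (simp_all add: field_simps)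
  then have "4 * (- b) = c" by (simp only: of_int_eq_iff)
  then have "4 dvd int n" "6 dvd int n" using c6 \<open>c = int n\<close> by (metis dvd_triv_left, simp)
  then have "4 dvd n" "6 dvd n" by (metis int_dvd_int_iff of_nat_numeral)+
  then show "12 dvd n" by presburger
next
  assume "12 dvd n"
  then obtain k where k: "n = 12 * k" by blast
  have "mat2 (of_int (1 + 6 * int k)) (of_int (- 3 * int k)) (of_int (12 * int k)) (of_int (1 - 6 * int k)) \<in> Gamma0 6"
    unfolding Gamma0_def
    by (intro CollectI exI[of _ "1 + 6 * int k"] exI[of _ "- 3 * int k"] exI[of _ "12 * int k"] exI[of _ "1 - 6 * int k"])
       (simp add: cong_0_iff algebra_simps)
  moreover have "mat2 1 0 (real n) 1 = matrix_inv shift_mat **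
     mat2 (of_int (1 + 6 * int k)) (of_int (- 3 * int k)) (of_int (12 * int k)) (of_int (1 - 6 * int k)) ** shift_mat"
    unfolding matrix_inv_shift_mat by (simp add: shift_mat_def mat2_mult mat2_eq_iff k field_simps)
  ultimately show "mat2 1 0 (real n) 1 \<in> case_group CaseF" by auto
qed

lemma case_b_minimal:
  "0 < case_b c" "mat2 1 0 (real (case_b c)) 1 \<in> case_group c"
  "0 < n \<Longrightarrow> n < case_b c \<Longrightarrow> mat2 1 0 (real n) 1 \<notin> case_group c"
proof -
  have *: "mat2 1 0 (real n) 1 \<in> case_group c \<longleftrightarrow> case_b c dvd n" for n
    using case_F_lower_triangular[of n]
    by (cases c) (simp_all add: Gamma0_lower_triangular Gamma1_lower_triangular)
  show "0 < case_b c" by (cases c) simp_all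
  show "mat2 1 0 (real (case_b c)) 1 \<in> case_group c" unfolding * by simp
  show "mat2 1 0 (real n) 1 \<notin> case_group c" if "0 < n" "n < case_b c"
    unfolding * using that by (auto dest: dvd_imp_le)
qed

section \<open>The case of level 5\<close>

lemma kronecker_5: "kronecker a 5 = (if a mod 5 = 0 then 0 else if a mod 5 = 1 \<or> a mod 5 = 4 then 1 else -1)"
proof -
  have p: "prime (5 :: nat)" by simp
  then have "prime_factors (nat \<bar>5\<bar>) = {5}" "multiplicity 5 (nat \<bar>5\<bar>) = 1"
    by (simp_all add: prime_factorization_prime)
  then have K: "kronecker a 5 = Legendre a 5" by (simp add: kronecker_def kronecker_prime_def)
  have "a mod 5 = 0 \<or> a mod 5 = 1 \<or> a mod 5 = 2 \<or> a mod 5 = 3 \<or> a mod 5 = 4" by presburger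
  moreover have "QuadRes 5 a" if "a mod 5 = 1 \<or> a mod 5 = 4"
  proof -
    have "[1\<^sup>2 = a] (mod 5) \<or> [2\<^sup>2 = a] (mod 5)" using that by (auto simp: cong_def)
    then show ?thesis unfolding QuadRes_def by blast
  qed
  moreover have "\<not> QuadRes 5 a" if "a mod 5 = 2 \<or> a mod 5 = 3"
  proof
    assume "QuadRes 5 a"
    then obtain y where y: "y\<^sup>2 mod 5 = a mod 5" by (auto simp: QuadRes_def cong_def)
    have "y mod 5 = 0 \<or> y mod 5 = 1 \<or> y mod 5 = 2 \<or> y mod 5 = 3 \<or> y mod 5 = 4" by presburger
    moreover have "y\<^sup>2 mod 5 = ((y mod 5) * (y mod 5)) mod 5" by (simp add: power2_eq_square mod_mult_eq)
    ultimately show False using y that by (elim disjE) simp_all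
  qed
  ultimately show ?thesis unfolding K Legendre_def cong_def by auto
qed

text \<open>With \<open>rr_den\<close> this forms the Rogers-Ramanujan quotient:
  \<open>q * (rr_num q / rr_den q) ^ 5\<close> is the fifth power of the Rogers-Ramanujan continued
  fraction.\<close>

definition rr_num :: "complex \<Rightarrow> complex" where
  "rr_num q = qprod (q ^ 5) q * qprod (q ^ 5) (q ^ 4)"

definition rr_den :: "complex \<Rightarrow> complex" where
  "rr_den q = qprod (q ^ 5) (q ^ 2) * qprod (q ^ 5) (q ^ 3)"

lemma rr_nonzero:
  assumes "norm q < 1"
  shows "rr_num q \<noteq> 0" "rr_den q \<noteq> 0"
  using assms by (simp_all add: rr_num_def rr_den_def qprod_nonzero norm_power power_less_one_iff)

lemma rr_holomorphic: "rr_num holomorphic_on ball 0 1" "rr_den holomorphic_on ball 0 1"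
  unfolding rr_num_def[abs_def] rr_den_def[abs_def]
  by (intro holomorphic_intros; simp add: norm_power power_less_one_iff)+

text \<open>The factors are grouped in blocks of five. This evaluates the infinite product along the
  multiples of 5, so its convergence has to be known first.\<close>

lemma case_t_D_eq:
  assumes z: "Im z > 0"
  shows "case_t CaseD z = nome z * (rr_num (nome z) / rr_den (nome z)) ^ 5"
proof -
  define q where "q = nome z"
  have q: "norm q < 1" using z by (simp add: q_def norm_nome_less_1_iff)
  then have q5: "norm (q ^ 5) < 1" by (simp add: norm_power power_less_one_iff)
  define x where "x n = (1 - q ^ Suc n) powi (5 * kronecker (int (Suc n)) 5)" for n
  \<comment> \<open>\<open>u\<close> and \<open>v\<close> collect the residues with symbol 1 and -1;
    each product converges absolutely, and powers and inverses preserve convergence.\<close>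
  define u where "u n = (if int (Suc n) mod 5 \<in> {1, 4} then 1 - q ^ Suc n else 1)" for n
  define v where "v n = (if int (Suc n) mod 5 \<in> {2, 3} then 1 - q ^ Suc n else 1)" for n
  have conv: "convergent_prod (\<lambda>n. if P n then 1 - q ^ Suc n else 1)" for P
  proof (rule abs_convergent_prod_imp_convergent_prod, rule summable_imp_abs_convergent_prod)
    have "summable (\<lambda>n. norm q ^ n)" using q by (intro summable_geometric) simp
    then have "summable (\<lambda>n. norm q ^ Suc n)" by (rule summable_Suc_iff[THEN iffD2])
    then show "summable (\<lambda>n. norm ((if P n then 1 - q ^ Suc n else 1) - 1))"
      by (rule summable_comparison_test'[of _ 0]) (simp add: norm_power norm_mult)
  qed
  have x_eq: "x n = u n ^ 5 * inverse (v n) ^ 5" for n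
  proof -
    have "int (Suc n) mod 5 = 0 \<or> int (Suc n) mod 5 = 1 \<or> int (Suc n) mod 5 = 2 \<or> int (Suc n) mod 5 = 3 \<or> int (Suc n) mod 5 = 4"
      by presburger
    then show ?thesis unfolding x_def u_def v_def kronecker_5
      by (elim disjE) (simp_all add: power_int_minus power_inverse del: of_nat_Suc power_Suc)
  qed
  have "convergent_prod u" "convergent_prod v"
    unfolding u_def v_def by (rule conv)+
  then have "convergent_prod (\<lambda>n. u n ^ 5 * inverse (v n) ^ 5)"
    by (intro convergent_prod_mult convergent_prod_power convergent_prod_inverse)
  moreover have "x = (\<lambda>n. u n ^ 5 * inverse (v n) ^ 5)" by (rule ext) (rule x_eq)
  ultimately have "convergent_prod x" by simp
  then have lim: "(\<lambda>n. \<Prod>i<n. x i) \<longlonglongrightarrow> prodinf x"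
    using convergent_prod_LIMSEQ unfolding LIMSEQ_lessThan_iff_atMost by blast
  have "strict_mono (\<lambda>n::nat. 5 * n)" by (simp add: strict_mono_def)
  from LIMSEQ_subseq_LIMSEQ[OF lim this]
  have lim5: "(\<lambda>n. \<Prod>i<5*n. x i) \<longlonglongrightarrow> prodinf x" by (simp add: o_def)
  have block: "(\<Prod>i<5*n. x i) = (((\<Prod>i<n. 1 - (q ^ 5) ^ i * q) * (\<Prod>i<n. 1 - (q ^ 5) ^ i * q ^ 4)) /
      ((\<Prod>i<n. 1 - (q ^ 5) ^ i * q ^ 2) * (\<Prod>i<n. 1 - (q ^ 5) ^ i * q ^ 3))) ^ 5" for n
  proof (induction n)
    case (Suc n)
    have e: "x (5 * n) = (1 - (q ^ 5) ^ n * q) ^ 5" "x (Suc (5 * n)) = inverse (1 - (q ^ 5) ^ n * q ^ 2) ^ 5"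
      "x (Suc (Suc (5 * n))) = inverse (1 - (q ^ 5) ^ n * q ^ 3) ^ 5"
      "x (Suc (Suc (Suc (5 * n)))) = (1 - (q ^ 5) ^ n * q ^ 4) ^ 5" "x (Suc (Suc (Suc (Suc (5 * n))))) = 1"
    proof -
      have m: "int (Suc (5 * n)) mod 5 = 1" "int (Suc (Suc (5 * n))) mod 5 = 2" "int (Suc (Suc (Suc (5 * n)))) mod 5 = 3"
        "int (Suc (Suc (Suc (Suc (5 * n))))) mod 5 = 4" "int (Suc (Suc (Suc (Suc (Suc (5 * n)))))) mod 5 = 0"
        by presburger+
      have qj: "(q ^ 5) ^ n * q ^ j = q ^ (5 * n + j)" for j by (simp only: power_mult power_add)
      have q1: "q ^ Suc (5 * n) = (q ^ 5) ^ n * q"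
        using qj[of 1] by (simp only: power_one_right Suc_eq_plus1)
      have "q ^ Suc (Suc (5 * n)) = (q ^ 5) ^ n * q ^ 2"
        "q ^ Suc (Suc (Suc (5 * n))) = (q ^ 5) ^ n * q ^ 3" "q ^ Suc (Suc (Suc (Suc (5 * n)))) = (q ^ 5) ^ n * q ^ 4"
        unfolding qj by (simp_all add: eval_nat_numeral)
      with m q1 show "x (5 * n) = (1 - (q ^ 5) ^ n * q) ^ 5" "x (Suc (5 * n)) = inverse (1 - (q ^ 5) ^ n * q ^ 2) ^ 5"
        "x (Suc (Suc (5 * n))) = inverse (1 - (q ^ 5) ^ n * q ^ 3) ^ 5"
        "x (Suc (Suc (Suc (5 * n)))) = (1 - (q ^ 5) ^ n * q ^ 4) ^ 5" "x (Suc (Suc (Suc (Suc (5 * n))))) = 1"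
        by (simp_all add: x_eq u_def v_def del: of_nat_Suc power_Suc)
    qed
    have "5 * Suc n = Suc (Suc (Suc (Suc (Suc (5 * n)))))" by simp
    then have "(\<Prod>i<5 * Suc n. x i) = (\<Prod>i<5*n. x i) * x (5 * n) * x (Suc (5 * n)) * x (Suc (Suc (5 * n)))
        * x (Suc (Suc (Suc (5 * n)))) * x (Suc (Suc (Suc (Suc (5 * n)))))"
      by (simp only: prod.lessThan_Suc)
    also have "\<dots> = (((\<Prod>i<Suc n. 1 - (q ^ 5) ^ i * q) * (\<Prod>i<Suc n. 1 - (q ^ 5) ^ i * q ^ 4)) /
      ((\<Prod>i<Suc n. 1 - (q ^ 5) ^ i * q ^ 2) * (\<Prod>i<Suc n. 1 - (q ^ 5) ^ i * q ^ 3))) ^ 5"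
      unfolding e Suc.IH prod.lessThan_Suc
      by (simp only: power_mult_distrib power_divide divide_inverse inverse_mult_distrib power_inverse mult_1_right mult_1_left mult_ac)
    finally show ?case .
  qed simp
  have "(\<lambda>n. (((\<Prod>i<n. 1 - (q ^ 5) ^ i * q) * (\<Prod>i<n. 1 - (q ^ 5) ^ i * q ^ 4)) /
      ((\<Prod>i<n. 1 - (q ^ 5) ^ i * q ^ 2) * (\<Prod>i<n. 1 - (q ^ 5) ^ i * q ^ 3))) ^ 5)
      \<longlonglongrightarrow> ((qprod (q ^ 5) q * qprod (q ^ 5) (q ^ 4)) / (qprod (q ^ 5) (q ^ 2) * qprod (q ^ 5) (q ^ 3))) ^ 5"
    by (intro tendsto_intros qprod_LIMSEQ q5) (use rr_nonzero(2)[OF q] in \<open>simp add: rr_den_def\<close>)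
  with lim5 have "prodinf x = (rr_num q / rr_den q) ^ 5"
    unfolding block rr_num_def rr_den_def by (rule LIMSEQ_unique)
  moreover have "exp (2 * of_real pi * \<i> * of_nat (Suc n) * z) = q ^ Suc n" for n
  proof -
    have "exp (2 * of_real pi * \<i> * of_nat (Suc n) * z) = nome (of_nat (Suc n) * z)"
      by (simp only: nome_def mult_ac)
    then show ?thesis by (simp only: q_def nome_power)
  qed
  ultimately show ?thesis unfolding case_t.simps x_def[abs_def] q_def[symmetric]
    by (simp only: nome_def[symmetric] q_def)
qed

lemma case_t_D_inf: "has_qexp 1 1 1 (case_t CaseD)"
proof (rule has_qexpI[where \<phi> = "\<lambda>w. (rr_num w / rr_den w) ^ 5"])
  show "(\<lambda>w. (rr_num w / rr_den w) ^ 5) holomorphic_on ball 0 1"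
    by (intro holomorphic_intros rr_holomorphic) (simp add: rr_nonzero)
  show "(rr_num 0 / rr_den 0) ^ 5 = 1" by (simp add: rr_num_def rr_den_def)
qed (simp_all add: rr_nonzero case_t_D_eq del: case_t.simps)

lemma case_t_D_pos:
  assumes "y > 0"
  shows "\<exists>r>0. case_t CaseD (\<i> * of_real y) = of_real r"
proof -
  define q where "q = exp (- 2 * pi * y)"
  have q: "q > 0" "q < 1" using assms by (simp_all add: q_def)
  have "2 * of_real pi * \<i> * (\<i> * of_real y) = complex_of_real (- 2 * pi * y)" by (simp add: complex_eq_iff)
  then have n: "nome (\<i> * of_real y) = of_real q" by (simp only: nome_def q_def exp_of_real)
  have pos: "\<exists>r>0. qprod (of_real q ^ 5) (of_real q ^ Suc k) = of_real r" for k
  proof -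
    have "q ^ 5 < 1" "q ^ Suc k < 1" using q by (simp_all add: power_less_one_iff del: power_Suc)
    then show ?thesis using qprod_pos[of "q ^ 5" "q ^ Suc k"] q by simp
  qed
  obtain r1 where r1: "r1 > 0" "qprod (of_real q ^ 5) (of_real q) = of_real r1" using pos[of 0] by auto
  obtain r2 where r2: "r2 > 0" "qprod (of_real q ^ 5) (of_real q ^ 2) = of_real r2" using pos[of 1] by (auto simp: numeral_eq_Suc)
  obtain r3 where r3: "r3 > 0" "qprod (of_real q ^ 5) (of_real q ^ 3) = of_real r3" using pos[of 2] by (auto simp: numeral_eq_Suc)
  obtain r4 where r4: "r4 > 0" "qprod (of_real q ^ 5) (of_real q ^ 4) = of_real r4" using pos[of 3] by (auto simp: numeral_eq_Suc)
  have "case_t CaseD (\<i> * of_real y) = of_real (q * (r1 * r4 / (r2 * r3)) ^ 5)"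
    using assms by (simp add: case_t_D_eq n rr_num_def rr_den_def r1 r2 r3 r4 del: case_t.simps)
  then show ?thesis using q r1 r2 r3 r4 by (intro exI[of _ "q * (r1 * r4 / (r2 * r3)) ^ 5"]) simp
qed

text \<open>The leading exponents of the two Klein forms are -2/5 and -3/5; their difference 1/5
  becomes the factor \<open>nome z\<close> in the fifth power.\<close>

lemma case_t_D_klein_form:
  assumes z: "Im z > 0"
  shows "case_t CaseD z = (klein_form (1/5) 0 (5 * z) / klein_form (2/5) 0 (5 * z)) ^ 5"
proof -
  define q where "q = nome z"
  have q: "norm q < 1" using z by (simp add: q_def norm_nome_less_1_iff)
  then have q5: "norm (q ^ 5) < 1" by (simp add: norm_power power_less_one_iff)
  define P where "P = qprod (q ^ 5) (q ^ 5) ^ 2"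
  have P: "P \<noteq> 0" using qprod_nonzero[OF q5 q5] by (simp add: P_def)
  have n: "nome (5 * z) = q ^ 5" "nome (5 * z - z) = q ^ 4" "nome (2 * z) = q ^ 2" "nome (5 * z - 2 * z) = q ^ 3"
    by (simp_all add: q_def nome_power)
  have "klein z (5 * z) = nome (- z / 2) * rr_num q / P"
    unfolding klein_def n rr_num_def P_def by (simp add: q_def)
  moreover have "klein_form (1/5) 0 (5 * z) = nome (of_real (1/5) * z / 2) * klein z (5 * z)"
    by (rule klein_form_eq) simp
  ultimately have k1: "klein_form (1/5) 0 (5 * z) = nome (z / 10) * nome (- z / 2) * rr_num q / P" by simp
  have "klein (2 * z) (5 * z) = nome (- z) * rr_den q / P"
    unfolding klein_def n rr_den_def P_def by simp
  moreover have "klein_form (2/5) 0 (5 * z) = nome (of_real (2/5) * (2 * z) / 2) * klein (2 * z) (5 * z)"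
    by (rule klein_form_eq) simp
  ultimately have k2: "klein_form (2/5) 0 (5 * z) = nome (2 * z / 5) * nome (- z) * rr_den q / P" by simp
  have e: "(nome (z / 10) * nome (- z / 2) / (nome (2 * z / 5) * nome (- z))) ^ 5 = q"
    unfolding nome_diff[symmetric] nome_add[symmetric] nome_power q_def by (intro arg_cong[of _ _ nome]) (simp add: field_simps)
  have "klein_form (1/5) 0 (5 * z) / klein_form (2/5) 0 (5 * z)
      = (nome (z / 10) * nome (- z / 2) / (nome (2 * z / 5) * nome (- z))) * (rr_num q / rr_den q)"
    unfolding k1 k2 using P by simp
  then show ?thesis using e by (simp only: power_mult_distrib case_t_D_eq[OF z] q_def)
qed

section \<open>Expansions of t at all cusps in case D\<close>

lemma klein_form_left_add_int:
  assumes "Im \<tau> > 0"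
  shows "klein_form (x + of_int n) y \<tau> = (- nome (- of_real y / 2)) powi n * klein_form x y \<tau>"
proof -
  define K where "K = - nome (- of_real y / 2)"
  have K: "K \<noteq> 0" by (simp add: K_def)
  have step: "klein_form (v + 1) y \<tau> = K * klein_form v y \<tau>" for v
    unfolding K_def by (rule klein_form_left_add_1[OF assms])
  have "klein_form (x + of_int n) y \<tau> = K powi n * klein_form x y \<tau>"
  proof (induction n rule: int_induct[of _ 0])
    case (step1 i)
    have "klein_form (x + of_int (i + 1)) y \<tau> = K * klein_form (x + of_int i) y \<tau>"
      using step[of "x + of_int i"] by (simp add: add.assoc)
    moreover have "K powi (i + 1) = K powi i * K" using K by (simp add: power_int_add)
    ultimately show ?case using step1(2) by simp
  next
    case (step2 i)
    have "klein_form (x + of_int i) y \<tau> = K * klein_form (x + of_int (i - 1)) y \<tau>"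
      using step[of "x + of_int (i - 1)"] by simp
    then have "klein_form (x + of_int (i - 1)) y \<tau> = klein_form (x + of_int i) y \<tau> / K" using K by simp
    moreover have "K powi (i - 1) = K powi i / K" using K by (simp add: power_int_diff)
    ultimately show ?case using step2(2) by simp
  qed simp
  then show ?thesis by (simp only: K_def)
qed

text \<open>Only the class of the first characteristic modulo 1 matters, up to a factor that does
  not depend on \<tau>.\<close>

lemma klein_form_mod_5:
  "\<exists>K. K \<noteq> 0 \<and> (\<forall>\<tau>. Im \<tau> > 0 \<longrightarrow> klein_form (of_int a / 5) y \<tau> = K * klein_form (of_int (a mod 5) / 5) y \<tau>)"
proof -
  have "(of_int a / 5 :: real) = of_int (a mod 5) / 5 + of_int (a div 5)"
  proof -
    have "a = a mod 5 + a div 5 * 5" by simp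
    then have "(of_int a :: real) = of_int (a mod 5) + of_int (a div 5) * 5" by (metis of_int_add of_int_mult of_int_numeral)
    then show ?thesis by (simp add: add_divide_distrib)
  qed
  note eq = this
  show ?thesis
    unfolding eq
    by (intro exI[of _ "(- nome (- of_real y / 2)) powi (a div 5)"] conjI allI impI klein_form_left_add_int) simp
qed

text \<open>With first characteristic 0 the exponent vanishes. That 5 does not divide
  \<open>B\<close> means \<open>\<xi> \<noteq> 1\<close>, so the factor \<open>1 - \<xi>\<close> of
  the leading coefficient is nonzero.\<close>

lemma klein_form_0_has_qexp:
  assumes "e > 0" "k > 0" "h > 0" "g * h = e * k" "\<not> 5 dvd B"
  shows "\<exists>C. has_qexp h 0 C (\<lambda>z. klein_form 0 (of_int B / 5) ((of_nat g * z + of_int \<beta>) / of_nat e))"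
proof -
  define \<zeta> where "\<zeta> = nome (of_int \<beta> / of_nat e)"
  define \<xi> where "\<xi> = nome (of_int B / 5)"
  have "(of_int B / 5 :: complex) \<notin> \<int>"
  proof
    assume "(of_int B / 5 :: complex) \<in> \<int>"
    then obtain j :: int where "(of_int B / 5 :: complex) = of_int j" by (auto elim: Ints_cases)
    then have "(of_int B :: complex) = of_int (5 * j)" by simp
    then have "B = 5 * j" by (simp only: of_int_eq_iff)
    with assms(5) show False by simp
  qed
  then have \<xi>1: "\<xi> \<noteq> 1" by (simp add: \<xi>_def nome_eq_1_iff)
  have norm1: "norm \<zeta> = 1" "norm \<xi> = 1" by (simp_all add: \<zeta>_def \<xi>_def norm_nome)
  have lt: "norm (\<zeta> * w ^ k) < 1" if "norm w < 1" for w
    using that assms(2) by (simp add: norm_mult norm1 norm_power power_less_one_iff)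
  define \<phi> where "\<phi> w = nome (- (of_int B / 5) / 2) * ((1 - \<xi>) * qprod (\<zeta> * w ^ k) (\<zeta> * w ^ k * \<xi>)) *
      qprod (\<zeta> * w ^ k) (\<zeta> * w ^ k / \<xi>) / qprod (\<zeta> * w ^ k) (\<zeta> * w ^ k) ^ 2" for w
  have lt': "norm (\<zeta> * w ^ k * \<xi>) < 1" "norm (\<zeta> * w ^ k / \<xi>) < 1" if "norm w < 1" for w
    using lt[OF that] by (simp_all add: norm_mult norm_divide norm1)
  have nz: "\<phi> w \<noteq> 0" if "norm w < 1" for w
    using qprod_nonzero[OF lt lt] qprod_nonzero[OF lt lt'(1)] qprod_nonzero[OF lt lt'(2)] that \<xi>1
    by (simp add: \<phi>_def)
  have "has_qexp h 0 (\<phi> 0) (\<lambda>z. klein_form 0 (of_int B / 5) ((of_nat g * z + of_int \<beta>) / of_nat e))"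
  proof (rule has_qexpI[where \<phi> = \<phi>])
    show "\<phi> holomorphic_on ball 0 1"
      unfolding \<phi>_def[abs_def]
      by (intro holomorphic_intros) (use lt qprod_nonzero[OF lt lt] norm1 in auto)
    fix z :: complex assume z: "Im z > 0"
    have ge: "of_nat g / of_nat e = (of_nat k / of_nat h :: complex)"
      using arg_cong[OF assms(4), of "of_nat :: nat \<Rightarrow> complex"] assms(1,3) by (simp add: field_simps)
    have "of_nat k * (z / of_nat h) + of_int \<beta> / of_nat e = (of_nat g * z + of_int \<beta>) / (of_nat e :: complex)"
      using ge by (simp add: add_divide_distrib) (metis times_divide_eq_left mult.commute)
    moreover have "\<zeta> * nome (z / of_nat h) ^ k = nome (of_nat k * (z / of_nat h) + of_int \<beta> / of_nat e)"
      by (simp only: \<zeta>_def nome_power nome_add mult.commute)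
    ultimately have n: "nome ((of_nat g * z + of_int \<beta>) / of_nat e) = \<zeta> * nome (z / of_nat h) ^ k" by (simp only:)
    have "norm (nome ((of_nat g * z + of_int \<beta>) / of_nat e)) < 1"
      unfolding n by (rule lt[OF norm_nome_div_less_1[OF z assms(3)]])
    from qprod_rec[OF this, of \<xi>]
    have "klein (of_int B / 5) ((of_nat g * z + of_int \<beta>) / of_nat e) = \<phi> (nome (z / of_nat h))"
      by (simp add: klein_def \<phi>_def n nome_diff \<xi>_def[symmetric])
    then show "klein_form 0 (of_int B / 5) ((of_nat g * z + of_int \<beta>) / of_nat e)
        = nome (of_real 0 * z) * \<phi> (nome (z / of_nat h))"
      by (simp add: klein_form_def)
  qed (use assms(3) nz in auto)
  then show ?thesis by blast
qed

text \<open>The exponent is \<open>5 (x^2 - x) / 2\<close> with \<open>x = A / 5\<close>: the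
  quadratic factor of the Klein form contributes \<open>x^2 / 2\<close>, the factor
  \<open>nome (- u / 2)\<close> contributes \<open>- x / 2\<close>, and \<tau> grows like
  \<open>5 z\<close>. Both \<open>A\<close> and \<open>5 - A\<close> are positive, so the products
  are 1 at the cusp.\<close>

lemma klein_form_fifth_has_qexp:
  fixes A :: nat
  assumes "0 < A" "A < 5"
  shows "\<exists>C. has_qexp 1 (5 * (real A ^ 2 / 25 - real A / 5) / 2) C (\<lambda>z. klein_form (real A / 5) (of_int B / 5) (5 * z + of_int \<beta>))"
proof -
  define \<zeta> where "\<zeta> = nome (of_int \<beta> / 5)"
  define \<xi> where "\<xi> = nome (of_int B / 5)"
  have norm1: "norm \<zeta> = 1" "norm \<xi> = 1" by (simp_all add: \<zeta>_def \<xi>_def norm_nome)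
  define K where "K = nome ((of_nat A / 5 - 1) * (of_nat A * of_int \<beta> + of_int B) / 10)"
  define \<phi> where "\<phi> w = K * qprod ((\<zeta> * w) ^ 5) ((\<zeta> * w) ^ A * \<xi>) *
      qprod ((\<zeta> * w) ^ 5) ((\<zeta> * w) ^ (5 - A) / \<xi>) / qprod ((\<zeta> * w) ^ 5) ((\<zeta> * w) ^ 5) ^ 2" for w
  have lt: "norm ((\<zeta> * w) ^ 5) < 1" "norm ((\<zeta> * w) ^ A * \<xi>) < 1" "norm ((\<zeta> * w) ^ (5 - A) / \<xi>) < 1"
    if "norm w < 1" for w
    using that assms by (simp_all add: norm_mult norm_divide norm1 norm_power power_less_one_iff)
  have nz: "\<phi> w \<noteq> 0" if "norm w < 1" for w
    using qprod_nonzero[OF lt(1) lt(1)] qprod_nonzero[OF lt(1) lt(2)] qprod_nonzero[OF lt(1) lt(3)] that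
    by (simp add: \<phi>_def K_def)
  have "has_qexp 1 (5 * (real A ^ 2 / 25 - real A / 5) / 2) (\<phi> 0) (\<lambda>z. klein_form (real A / 5) (of_int B / 5) (5 * z + of_int \<beta>))"
  proof (rule has_qexpI[where \<phi> = \<phi>])
    show "\<phi> holomorphic_on ball 0 1"
      unfolding \<phi>_def[abs_def]
      by (intro holomorphic_intros) (use lt qprod_nonzero[OF lt(1) lt(1)] norm1 in auto)
    fix z :: complex assume z: "Im z > 0"
    define \<tau> where "\<tau> = 5 * z + of_int \<beta>"
    define u where "u = (of_nat A * \<tau> + of_int B) / 5"
    have n1: "nome \<tau> = (\<zeta> * nome z) ^ 5"
      unfolding \<zeta>_def nome_add[symmetric] nome_power by (intro arg_cong[of _ _ nome]) (simp add: \<tau>_def field_simps)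
    have n2: "nome u = (\<zeta> * nome z) ^ A * \<xi>"
      unfolding \<zeta>_def \<xi>_def nome_power nome_add[symmetric] by (intro arg_cong[of _ _ nome]) (simp add: \<tau>_def u_def field_simps)
    have n3: "nome (\<tau> - u) = (\<zeta> * nome z) ^ (5 - A) / \<xi>"
      unfolding \<zeta>_def \<xi>_def nome_power nome_add[symmetric] nome_diff[symmetric] using assms
      by (intro arg_cong[of _ _ nome]) (simp add: \<tau>_def u_def field_simps of_nat_diff)
    have n4: "nome (of_real (real A / 5) * u / 2) * nome (- u / 2) = nome (of_real (5 * (real A ^ 2 / 25 - real A / 5) / 2) * z) * K"
      unfolding K_def nome_add[symmetric]
      by (intro arg_cong[of _ _ nome]) (simp add: \<tau>_def u_def field_simps power2_eq_square)
    have "klein_form (real A / 5) (of_int B / 5) \<tau> = nome (of_real (real A / 5) * u / 2) * klein u \<tau>"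
      by (rule klein_form_eq) (simp add: u_def add_divide_distrib)
    also have "\<dots> = nome (of_real (real A / 5) * u / 2) * nome (- u / 2) * qprod (nome \<tau>) (nome u) * qprod (nome \<tau>) (nome (\<tau> - u))
        / qprod (nome \<tau>) (nome \<tau>) ^ 2"
      by (simp add: klein_def)
    also have "\<dots> = nome (of_real (5 * (real A ^ 2 / 25 - real A / 5) / 2) * z) * \<phi> (nome (z / of_nat 1))"
      unfolding n4 n1 n2 n3 \<phi>_def by (simp only: of_nat_1 div_by_1 mult.assoc times_divide_eq_right)
    finally have "klein_form (real A / 5) (of_int B / 5) \<tau>
       = nome (of_real (5 * (real A ^ 2 / 25 - real A / 5) / 2) * z) * \<phi> (nome (z / of_nat 1))" .
    then show "klein_form (real A / 5) (of_int B / 5) (5 * z + of_int \<beta>)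
       = nome (of_real (5 * (real A ^ 2 / 25 - real A / 5) / 2) * z) * \<phi> (nome (z / of_nat 1))"
      unfolding \<tau>_def .
  next
    show "(1::nat) > 0" by (rule zero_less_one)
    show "\<phi> 0 = \<phi> 0" by (rule refl)
  qed (rule nz)
  then show ?thesis by (rule exI)
qed

lemma gcd_5_abs: "gcd 5 (nat \<bar>c\<bar>) = (if 5 dvd c then 5 else 1)"
proof -
  have iff: "5 dvd nat \<bar>c\<bar> \<longleftrightarrow> 5 dvd c" by (simp add: dvd_nat_abs_iff)
  show ?thesis
  proof (cases "5 dvd c")
    case True
    then have "gcd 5 (nat \<bar>c\<bar>) = 5" by (intro gcd_nat.absorb1) (simp only: iff)
    with True show ?thesis by (simp only: if_True)
  next
    case False
    have "prime (5::nat)" by simp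
    then have "coprime 5 (nat \<bar>c\<bar>)" by (rule prime_imp_coprime) (simp only: iff False not_False_eq_True)
    then have "gcd 5 (nat \<bar>c\<bar>) = 1" by (rule coprime_imp_gcd_eq_1)
    with False show ?thesis by (simp only: if_False)
  qed
qed

text \<open>The common automorphy factor of the Klein forms cancels in the quotient. The coprimality
  is recorded because for \<open>e = 5\<close> it keeps the second characteristic away from the
  integers.\<close>

lemma case_t_D_moebius:
  fixes a b c d :: int
  assumes det: "a * d - b * c = 1" and g: "g = gcd 5 (nat \<bar>c\<bar>)"
  obtains e :: nat and x \<beta> :: int where "5 = g * e" "e > 0" "g > 0" "coprime (a * int e) x"
    "\<And>z. Im z > 0 \<Longrightarrow> case_t CaseD (moebius_int a b c d z) =
       (klein_form (of_int (a * int e) / 5) (of_int x / 5) ((of_nat g * z + of_int \<beta>) / of_nat e) /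
        klein_form (of_int (2 * (a * int e)) / 5) (of_int (2 * x) / 5) ((of_nat g * z + of_int \<beta>) / of_nat e)) ^ 5"
proof -
  have 5: "(5::nat) > 0" by simp
  obtain e :: nat and x y c' \<beta> :: int where e: "5 = g * e" "e > 0" "g > 0" "c = int g * c'"
    "(a * int e) * y - x * c' = 1"
    "\<And>z. Im z > 0 \<Longrightarrow> of_nat 5 * moebius_int a b c d z
        = moebius_int (a * int e) x c' y ((of_nat g * z + of_int \<beta>) / of_nat e)"
    by (rule hermite_decomposition[OF det 5 g]) (rule that)
  have "coprime (a * int e) x"
  proof (rule coprimeI)
    fix l assume "l dvd a * int e" "l dvd x"
    then have "l dvd (a * int e) * y - x * c'" by simp
    then show "is_unit l" by (simp only: e(5))
  qed
  moreover have "case_t CaseD (moebius_int a b c d z) =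
       (klein_form (of_int (a * int e) / 5) (of_int x / 5) ((of_nat g * z + of_int \<beta>) / of_nat e) /
        klein_form (of_int (2 * (a * int e)) / 5) (of_int (2 * x) / 5) ((of_nat g * z + of_int \<beta>) / of_nat e)) ^ 5"
    if z: "Im z > 0" for z
  proof -
    define w where "w = (of_nat g * z + of_int \<beta>) / (of_nat e :: complex)"
    have w: "Im w > 0" using z e(2,3) by (simp add: w_def)
    define j where "j = of_int c' * w + of_int y"
    have j: "j \<noteq> 0" unfolding j_def by (rule int_linear_nonzero[OF w det_1_nonzero(1)[OF e(5)]])
    have M: "5 * moebius_int a b c d z = moebius_int (a * int e) x c' y w" using e(6)[OF z] by (simp add: w_def)
    have k1: "klein_form (1/5) 0 (moebius_int (a * int e) x c' y w) * j = klein_form (of_int (a * int e) / 5) (of_int x / 5) w"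
      using klein_form_moebius[OF e(5) w, of "1/5" 0] by (simp add: j_def)
    have k2: "klein_form (2/5) 0 (moebius_int (a * int e) x c' y w) * j
        = klein_form (of_int (2 * (a * int e)) / 5) (of_int (2 * x) / 5) w"
    proof -
      have "of_int (a * int e) * (2/5) + of_int c' * 0 = (of_int (2 * (a * int e)) / 5 :: real)"
        "of_int x * (2/5) + of_int y * 0 = (of_int (2 * x) / 5 :: real)" by simp_all
      then show ?thesis using klein_form_moebius[OF e(5) w, of "2/5" 0] by (simp only: j_def)
    qed
    show ?thesis
      unfolding case_t_D_klein_form[OF Im_moebius_int_pos[OF z det]] M w_def[symmetric] k1[symmetric] k2[symmetric]
      using j by simp
  qed
  ultimately show ?thesis using e(1-3) by (intro that)
qed

text \<open>Here \<open>e = 5\<close>, so both first characteristics are integers and can be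
  replaced by 0; numerator and denominator then have order 0.\<close>

lemma case_t_D_cusp_0:
  assumes det: "a * d - b * c = 1" and c: "\<not> 5 dvd c"
  shows "\<exists>C. has_qexp 5 0 C (\<lambda>z. case_t CaseD (moebius_int a b c d z))"
proof -
  have g: "1 = gcd 5 (nat \<bar>c\<bar>)" unfolding gcd_5_abs using c by simp
  obtain e :: nat and x \<beta> :: int where e: "5 = 1 * e" "e > 0" "(1::nat) > 0" "coprime (a * int e) x"
    "\<And>z. Im z > 0 \<Longrightarrow> case_t CaseD (moebius_int a b c d z) =
       (klein_form (of_int (a * int e) / 5) (of_int x / 5) ((of_nat 1 * z + of_int \<beta>) / of_nat e) /
        klein_form (of_int (2 * (a * int e)) / 5) (of_int (2 * x) / 5) ((of_nat 1 * z + of_int \<beta>) / of_nat e)) ^ 5"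
    by (rule case_t_D_moebius[OF det g]) (rule that)
  have e5: "e = 5" using e(1) by simp
  have "\<not> 5 dvd x"
  proof
    assume "5 dvd x"
    moreover have "5 dvd a * int e" by (simp add: e5)
    ultimately have "is_unit (5::int)" using e(4) by (meson coprime_common_divisor)
    then show False by simp
  qed
  then have x: "\<not> 5 dvd x" "\<not> 5 dvd 2 * x" by presburger+
  obtain C1 where C1: "has_qexp 5 0 C1 (\<lambda>z. klein_form 0 (of_int x / 5) ((of_nat 1 * z + of_int \<beta>) / of_nat e))"
    using klein_form_0_has_qexp[of e 1 5 1 x \<beta>] x(1) e5 by auto
  obtain C2 where C2: "has_qexp 5 0 C2 (\<lambda>z. klein_form 0 (of_int (2 * x) / 5) ((of_nat 1 * z + of_int \<beta>) / of_nat e))"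
    using klein_form_0_has_qexp[of e 1 5 1 "2 * x" \<beta>] x(2) e5 by auto
  obtain K1 where K1: "K1 \<noteq> 0" "\<And>\<tau>. Im \<tau> > 0 \<Longrightarrow> klein_form (of_int (a * int e) / 5) (of_int x / 5) \<tau> = K1 * klein_form 0 (of_int x / 5) \<tau>"
    using klein_form_mod_5[of "a * int e" "of_int x / 5"] e5 by auto
  obtain K2 where K2: "K2 \<noteq> 0" "\<And>\<tau>. Im \<tau> > 0 \<Longrightarrow> klein_form (of_int (2 * (a * int e)) / 5) (of_int (2 * x) / 5) \<tau> = K2 * klein_form 0 (of_int (2 * x) / 5) \<tau>"
    using klein_form_mod_5[of "2 * (a * int e)" "of_int (2 * x) / 5"] e5 by auto
  have frac: "u / v * p * inverse q = (u * p) / (v * q)" for u v p q :: complex by (simp add: divide_inverse)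
  have "(0::nat) < 5" by simp
  from has_qexp_power[OF has_qexp_mult[OF has_qexp_mult[OF has_qexp_const[OF this, of "K1 / K2"] C1] has_qexp_inverse[OF C2]], of 5] K1(1) K2(1)
  have "has_qexp 5 (of_nat 5 * (0 + 0 + - 0)) ((K1 / K2 * C1 * inverse C2) ^ 5)
     (\<lambda>z. (K1 / K2 * klein_form 0 (of_int x / 5) ((of_nat 1 * z + of_int \<beta>) / of_nat e) *
        inverse (klein_form 0 (of_int (2 * x) / 5) ((of_nat 1 * z + of_int \<beta>) / of_nat e))) ^ 5)" by simp
  then have "has_qexp 5 0 ((K1 / K2 * C1 * inverse C2) ^ 5) (\<lambda>z. case_t CaseD (moebius_int a b c d z))"
  proof (rule has_qexp_cong)
    fix z :: complex assume z: "Im z > 0"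
    then have w: "Im ((of_nat 1 * z + of_int \<beta>) / of_nat e) > 0" using e(2) by simp
    show "(K1 / K2 * klein_form 0 (of_int x / 5) ((of_nat 1 * z + of_int \<beta>) / of_nat e) *
        inverse (klein_form 0 (of_int (2 * x) / 5) ((of_nat 1 * z + of_int \<beta>) / of_nat e))) ^ 5
      = case_t CaseD (moebius_int a b c d z)"
      unfolding e(5)[OF z] K1(2)[OF w] K2(2)[OF w] by (simp only: frac)
  qed simp
  then show ?thesis by blast
qed

text \<open>Here \<open>e = 1\<close>. Doubling exchanges the classes 1, 4 and 2, 3 modulo 5, and
  the two Klein forms have exponents differing by 1/5 in absolute value; the fifth power has a
  simple zero or a simple pole accordingly.\<close>

lemma case_t_D_cusp_inf:
  assumes det: "a * d - b * c = 1" and c: "5 dvd c"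
  shows "\<exists>C. has_qexp 1 (if a mod 5 = 1 \<or> a mod 5 = 4 then 1 else -1) C (\<lambda>z. case_t CaseD (moebius_int a b c d z))"
proof -
  have g: "5 = gcd 5 (nat \<bar>c\<bar>)" unfolding gcd_5_abs using c by simp
  obtain e :: nat and x \<beta> :: int where e: "5 = 5 * e" "e > 0" "(5::nat) > 0" "coprime (a * int e) x"
    "\<And>z. Im z > 0 \<Longrightarrow> case_t CaseD (moebius_int a b c d z) =
       (klein_form (of_int (a * int e) / 5) (of_int x / 5) ((of_nat 5 * z + of_int \<beta>) / of_nat e) /
        klein_form (of_int (2 * (a * int e)) / 5) (of_int (2 * x) / 5) ((of_nat 5 * z + of_int \<beta>) / of_nat e)) ^ 5"
    by (rule case_t_D_moebius[OF det g]) (rule that)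
  have e1: "e = 1" using e(1) by simp
  have a5: "\<not> 5 dvd a"
  proof
    assume "5 dvd a"
    then have "5 dvd a * d - b * c" using c by (intro dvd_diff) simp_all
    then show False by (simp add: det)
  qed
  define A where "A = nat (a mod 5)"
  define B where "B = nat (2 * a mod 5)"
  have A: "0 < A" "A < 5" "of_int (a mod 5) = real A" and B: "0 < B" "B < 5" "of_int (2 * a mod 5) = real B"
    unfolding A_def B_def using a5 by (auto simp: dvd_eq_mod_eq_0) presburger+
  obtain C1 where C1: "has_qexp 1 (5 * (real A ^ 2 / 25 - real A / 5) / 2) C1 (\<lambda>z. klein_form (real A / 5) (of_int x / 5) (5 * z + of_int \<beta>))"
    using klein_form_fifth_has_qexp[OF A(1,2)] by blast
  obtain C2 where C2: "has_qexp 1 (5 * (real B ^ 2 / 25 - real B / 5) / 2) C2 (\<lambda>z. klein_form (real B / 5) (of_int (2 * x) / 5) (5 * z + of_int \<beta>))"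
    using klein_form_fifth_has_qexp[OF B(1,2)] by blast
  obtain K1 where K1: "K1 \<noteq> 0" "\<And>\<tau>. Im \<tau> > 0 \<Longrightarrow> klein_form (of_int a / 5) (of_int x / 5) \<tau> = K1 * klein_form (real A / 5) (of_int x / 5) \<tau>"
    using klein_form_mod_5[of a "of_int x / 5"] unfolding A(3) by blast
  obtain K2 where K2: "K2 \<noteq> 0" "\<And>\<tau>. Im \<tau> > 0 \<Longrightarrow> klein_form (of_int (2 * a) / 5) (of_int (2 * x) / 5) \<tau> = K2 * klein_form (real B / 5) (of_int (2 * x) / 5) \<tau>"
    using klein_form_mod_5[of "2 * a" "of_int (2 * x) / 5"] unfolding B(3) by blast
  have "a mod 5 = 1 \<or> a mod 5 = 2 \<or> a mod 5 = 3 \<or> a mod 5 = 4" using a5 by presburger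
  then have r: "real 5 * (0 + 5 * (real A ^ 2 / 25 - real A / 5) / 2 + - (5 * (real B ^ 2 / 25 - real B / 5) / 2))
      = (if a mod 5 = 1 \<or> a mod 5 = 4 then 1 else -1)"
  proof (elim disjE)
    assume *: "a mod 5 = 1" then have "2 * a mod 5 = 2" by presburger
    then show ?thesis using * by (simp add: A_def B_def power2_eq_square)
  next
    assume *: "a mod 5 = 2" then have "2 * a mod 5 = 4" by presburger
    then show ?thesis using * by (simp add: A_def B_def power2_eq_square)
  next
    assume *: "a mod 5 = 3" then have "2 * a mod 5 = 1" by presburger
    then show ?thesis using * by (simp add: A_def B_def power2_eq_square)
  next
    assume *: "a mod 5 = 4" then have "2 * a mod 5 = 3" by presburger
    then show ?thesis using * by (simp add: A_def B_def power2_eq_square)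
  qed
  have frac: "u / v * p * inverse q = (u * p) / (v * q)" for u v p q :: complex by (simp add: divide_inverse)
  have "K1 / K2 \<noteq> 0" using K1(1) K2(1) by simp
  from has_qexp_power[OF has_qexp_mult[OF has_qexp_mult[OF has_qexp_const[OF zero_less_one this] C1] has_qexp_inverse[OF C2]], of 5]
  have "has_qexp 1 (if a mod 5 = 1 \<or> a mod 5 = 4 then 1 else -1) ((K1 / K2 * C1 * inverse C2) ^ 5)
     (\<lambda>z. case_t CaseD (moebius_int a b c d z))"
  proof (rule has_qexp_cong)
    fix z :: complex assume z: "Im z > 0"
    then have w: "Im (5 * z + of_int \<beta>) > 0" by simp
    have w': "(of_nat 5 * z + of_int \<beta>) / of_nat e = 5 * z + of_int \<beta>" "a * int e = a" by (simp_all add: e1)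
    show "(K1 / K2 * klein_form (real A / 5) (of_int x / 5) (5 * z + of_int \<beta>) *
        inverse (klein_form (real B / 5) (of_int (2 * x) / 5) (5 * z + of_int \<beta>))) ^ 5
      = case_t CaseD (moebius_int a b c d z)"
      unfolding e(5)[OF z] w' K1(2)[OF w] K2(2)[OF w] by (simp only: frac)
  qed (use r in simp)
  then show ?thesis by blast
qed

section \<open>The weight 1 form of case D as a square root\<close>

definition case_D_square :: "complex \<Rightarrow> complex" where
  "case_D_square w = inverse (case_t CaseD w) * (dedekind_eta (5 * w) ^ 5 / dedekind_eta w)"

lemma case_D_square_eq: "case_D_square w = inverse (case_t CaseD w) * eta_quotient [(5, 5), (1, -1)] w"
  by (simp add: case_D_square_def power_int_minus divide_inverse del: case_t.simps)

lemma case_D_square_inf: "has_qexp 1 0 1 case_D_square"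
proof -
  have "has_qexp 1 (eta_order 0 [(5, 5), (1, -1)]) 1 (eta_quotient [(5, 5), (1, -1)])"
    by (rule eta_quotient_inf) auto
  from has_qexp_mult[OF has_qexp_inverse[OF case_t_D_inf] this]
  have "has_qexp 1 (- 1 + eta_order 0 [(5, 5), (1, -1)]) 1
      (\<lambda>w. inverse (case_t CaseD w) * eta_quotient [(5, 5), (1, -1)] w)"
    by (simp only: inverse_1 mult_1_left)
  then show ?thesis
    by (rule has_qexp_cong) (simp_all only: case_D_square_eq, simp add: eta_order_def)
qed

text \<open>Unpacks the choice in \<open>log_branch\<close> once for all uses; its existence rests
  on holomorphy, nonvanishing and positivity on the imaginary axis.\<close>

lemma case_f_D_log:
  obtains L where "L holomorphic_on upper_half" "\<And>z. Im z > 0 \<Longrightarrow> exp (L z) = case_D_square z"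
    "\<And>y. y > 0 \<Longrightarrow> L (\<i> * of_real y) \<in> \<real>" "\<And>z. case_f CaseD z = exp (L z / 2)"
proof -
  have "\<exists>r>0. case_D_square (\<i> * of_real y) = of_real r" if y: "y > 0" for y
  proof -
    obtain r1 where r1: "r1 > 0" "case_t CaseD (\<i> * of_real y) = of_real r1" using case_t_D_pos[OF y] by blast
    have "\<exists>r>0. eta_quotient [(5, 5), (1, -1)] (\<i> * of_real y) = of_real r"
      by (rule eta_quotient_pos[OF _ y]) auto
    then obtain r2 where r2: "r2 > 0" "eta_quotient [(5, 5), (1, -1)] (\<i> * of_real y) = of_real r2"
      by blast
    have "case_D_square (\<i> * of_real y) = of_real (inverse r1 * r2)"
      unfolding case_D_square_eq r1(2) r2(2) by simp
    then show ?thesis using r1(1) r2(1) by (intro exI[of _ "inverse r1 * r2"]) simp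
  qed
  from someI_ex[OF log_branch_exists[OF has_qexp_holomorphic[OF case_D_square_inf] has_qexp_nonzero[OF case_D_square_inf] this]]
  have L: "log_branch case_D_square holomorphic_on upper_half"
    "\<forall>z\<in>upper_half. exp (log_branch case_D_square z) = case_D_square z"
    "\<forall>y>0. log_branch case_D_square (\<i> * of_real y) \<in> \<real>"
    unfolding log_branch_def[symmetric] by simp_all
  have "case_f CaseD z = exp (log_branch case_D_square z / 2)" for z
    by (simp only: case_f.simps case_D_square_def[abs_def])
  with L show ?thesis by (intro that) auto
qed

lemma case_f_D_holomorphic: "case_f CaseD holomorphic_on upper_half"
proof -
  obtain L where L: "L holomorphic_on upper_half" "\<And>z. Im z > 0 \<Longrightarrow> exp (L z) = case_D_square z"
    "\<And>y. y > 0 \<Longrightarrow> L (\<i> * of_real y) \<in> \<real>" and f: "\<And>z. case_f CaseD z = exp (L z / 2)"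
    by (rule case_f_D_log) (rule that)
  have "(\<lambda>z. exp (L z / 2)) holomorphic_on upper_half" by (intro holomorphic_intros L(1)) simp
  then show ?thesis unfolding f[symmetric] .
qed

lemma case_f_D_power2:
  assumes "Im z > 0"
  shows "case_f CaseD z ^ 2 = case_D_square z"
proof -
  obtain L where L: "L holomorphic_on upper_half" "\<And>z. Im z > 0 \<Longrightarrow> exp (L z) = case_D_square z"
    "\<And>y. y > 0 \<Longrightarrow> L (\<i> * of_real y) \<in> \<real>" and f: "\<And>z. case_f CaseD z = exp (L z / 2)"
    by (rule case_f_D_log) (rule that)
  show ?thesis unfolding f by (simp add: L(2)[OF assms] flip: exp_double)
qed

lemma case_f_D_inf: "has_qexp 1 0 1 (case_f CaseD)"
proof -
  obtain L where L: "L holomorphic_on upper_half" "\<And>z. Im z > 0 \<Longrightarrow> exp (L z) = case_D_square z"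
    "\<And>y. y > 0 \<Longrightarrow> L (\<i> * of_real y) \<in> \<real>" and f: "\<And>z. case_f CaseD z = exp (L z / 2)"
    by (rule case_f_D_log) (rule that)
  obtain l where l: "l holomorphic_on ball 0 1" "l 0 = 0"
    "\<And>z. Im z > 0 \<Longrightarrow> L z = 2 * of_real pi * \<i> * of_real 0 * z + l (nome z)"
    using has_qexp_real_log[OF case_D_square_inf L] by blast
  show ?thesis
  proof (rule has_qexpI[where \<phi> = "\<lambda>w. exp (l w / 2)"])
    show "(\<lambda>w. exp (l w / 2)) holomorphic_on ball 0 1" by (intro holomorphic_intros l(1)) simp
    show "exp (l 0 / 2) = 1" by (simp add: l(2))
    fix z :: complex assume "Im z > 0"
    then show "case_f CaseD z = nome (of_real 0 * z) * exp (l (nome (z / of_nat 1)) / 2)"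
      unfolding f by (simp add: l(3))
  qed simp_all
qed

text \<open>Only the square of \<open>f\<close> is an explicit product. Its order is that of
  \<open>eta (5 z)^5 / eta z\<close> minus that of \<open>t\<close>; the root is taken by
  continuity, which halves the order and leaves the sign in \<open>C\<close> open.\<close>

lemma case_f_D_cusp:
  assumes det: "a * d - b * c = 1" and h: "h > 0" "5 dvd (gcd 5 (nat \<bar>c\<bar>))\<^sup>2 * h"
    and t: "has_qexp h r C (\<lambda>z. case_t CaseD (moebius_int a b c d z))"
  shows "\<exists>C. has_qexp h ((eta_order c [(5, 5), (1, -1)] - r) / 2) C
    (\<lambda>z. case_f CaseD (moebius_int a b c d z) / (of_int c * z + of_int d))"
proof -
  have "\<exists>C. has_qexp h (eta_order c [(5, 5), (1, -1)]) C
      (\<lambda>z. eta_quotient [(5, 5), (1, -1)] (moebius_int a b c d z) / (of_int c * z + of_int d) ^ 2)"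
    by (rule eta_quotient_cusp[OF det h(1)]) (use h(2) in auto)
  then obtain C' where C': "has_qexp h (eta_order c [(5, 5), (1, -1)]) C'
      (\<lambda>z. eta_quotient [(5, 5), (1, -1)] (moebius_int a b c d z) / (of_int c * z + of_int d) ^ 2)" by blast
  have "has_qexp h (eta_order c [(5, 5), (1, -1)] - r) (inverse C * C')
      (\<lambda>z. (case_f CaseD (moebius_int a b c d z) / (of_int c * z + of_int d)) ^ 2)"
  proof (rule has_qexp_cong[OF has_qexp_mult[OF has_qexp_inverse[OF t] C']])
    fix z :: complex assume "Im z > 0"
    show "inverse (case_t CaseD (moebius_int a b c d z)) *
        (eta_quotient [(5, 5), (1, -1)] (moebius_int a b c d z) / (of_int c * z + of_int d) ^ 2)
      = (case_f CaseD (moebius_int a b c d z) / (of_int c * z + of_int d)) ^ 2"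
      unfolding power_divide case_f_D_power2[OF Im_moebius_int_pos[OF \<open>Im z > 0\<close> det]] case_D_square_eq by (simp only: times_divide_eq_right)
  qed simp
  moreover have "continuous_on upper_half (\<lambda>z. case_f CaseD (moebius_int a b c d z) / (of_int c * z + of_int d))"
  proof (intro holomorphic_on_imp_continuous_on holomorphic_on_divide)
    have "(case_f CaseD \<circ> moebius_int a b c d) holomorphic_on upper_half"
      by (rule holomorphic_on_compose_gen[OF moebius_int_holomorphic[OF det] case_f_D_holomorphic])
         (auto intro: Im_moebius_int_pos[OF _ det])
    then show "(\<lambda>z. case_f CaseD (moebius_int a b c d z)) holomorphic_on upper_half" by (simp only: o_def)
    show "(\<lambda>z. of_int c * z + of_int d) holomorphic_on upper_half" by (intro holomorphic_intros)
    show "of_int c * z + of_int d \<noteq> 0" if "z \<in> upper_half" for z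
      using that int_linear_nonzero[OF _ det_1_nonzero(1)[OF det]] by simp
  qed
  ultimately have "\<exists>C''. C'' ^ 2 = inverse C * C' \<and> has_qexp h ((eta_order c [(5, 5), (1, -1)] - r) / real 2) C''
      (\<lambda>z. case_f CaseD (moebius_int a b c d z) / (of_int c * z + of_int d))"
    by - (rule has_qexp_root, assumption, simp, assumption)
  then show ?thesis unfolding of_nat_numeral by blast
qed

lemma case_f_D_cusp_0:
  assumes det: "a * d - b * c = 1" and c: "\<not> 5 dvd c"
  shows "\<exists>C. has_qexp 5 0 C (\<lambda>z. case_f CaseD (moebius_int a b c d z) / (of_int c * z + of_int d))"
proof -
  have g: "gcd 5 (nat \<bar>c\<bar>) = 1" unfolding gcd_5_abs using c by simp
  have ord: "eta_order c [(5, 5), (1, -1)] = 0"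
    unfolding eta_order_def list.map sum_list.Cons sum_list.Nil prod.case g by simp
  obtain C where "has_qexp 5 0 C (\<lambda>z. case_t CaseD (moebius_int a b c d z))"
    using case_t_D_cusp_0[OF assms] by blast
  from case_f_D_cusp[OF det _ _ this] show ?thesis unfolding ord by simp
qed

lemma case_D_modular_pair: "modular_pair (case_t CaseD) (case_f CaseD) 5"
proof
  show "has_qexp 1 1 1 (case_t CaseD)" by (rule case_t_D_inf)
  show "has_qexp 1 0 1 (case_f CaseD)" by (rule case_f_D_inf)
  have S: "moebius_int 0 (-1) 1 0 = (\<lambda>z. - 1 / z)" by (simp add: fun_eq_iff moebius_int_def)
  show "\<exists>C. has_qexp 5 0 C (\<lambda>z. case_t CaseD (- 1 / z))"
    using case_t_D_cusp_0[of 0 0 "-1" 1] unfolding S by simp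
  have "\<exists>C. has_qexp 5 0 C (\<lambda>z. case_f CaseD (moebius_int 0 (-1) 1 0 z) / (of_int 1 * z + of_int 0))"
    by (rule case_f_D_cusp_0) simp_all
  then show "\<exists>C. has_qexp 5 0 C (\<lambda>z. case_f CaseD (- 1 / z) / z)"
    unfolding S by (simp only: of_int_1 of_int_0 mult_1_left add_0_right)
  show "\<exists>r>0. case_t CaseD (\<i> * of_real y) = of_real r" if "y > 0" for y
    using that by (rule case_t_D_pos)
qed

lemma case_D_cusp_bounded:
  "\<forall>M\<in>SL2Z. \<exists>Y>0. \<exists>C. \<forall>z. Im z \<ge> Y \<longrightarrow>
     norm (case_g CaseD (moebius_action M z) / automorphy M z ^ 3) \<le> C"
  unfolding case_g_eq
proof (rule cusp_bounded_SL2Z)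
  fix a b d c :: int assume det: "a * d - b * c = 1"
  note bd = theta_form_cusp_bounded[OF has_qexp_holomorphic[OF case_t_D_inf] det]
  show "\<exists>Y>0. \<exists>C. \<forall>z. Im z \<ge> Y \<longrightarrow>
     norm (theta_form (case_t CaseD) (case_f CaseD) (moebius_int a b c d z) / (of_int c * z + of_int d) ^ 3) \<le> C"
  proof (cases "5 dvd c")
    case False
    obtain C where C: "has_qexp 5 0 C (\<lambda>z. case_t CaseD (moebius_int a b c d z))"
      using case_t_D_cusp_0[OF det False] by blast
    obtain C' where C': "has_qexp 5 0 C' (\<lambda>z. case_f CaseD (moebius_int a b c d z) / (of_int c * z + of_int d))"
      using case_f_D_cusp_0[OF det False] by blast
    show ?thesis by (rule bd[OF C C']) simp
  next
    case True
    have g: "gcd 5 (nat \<bar>c\<bar>) = 5" unfolding gcd_5_abs using True by simp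
    \<comment> \<open>The order of \<open>f\<close> at this cusp is \<open>(1 - r) / 2\<close>, that
      is 0 or 1.\<close>
    define r :: real where "r = (if a mod 5 = 1 \<or> a mod 5 = 4 then 1 else -1)"
    have r: "r \<le> 1" by (simp add: r_def)
    obtain C where C: "has_qexp 1 r C (\<lambda>z. case_t CaseD (moebius_int a b c d z))"
      using case_t_D_cusp_inf[OF det True] unfolding r_def by blast
    have "5 dvd (gcd 5 (nat \<bar>c\<bar>))\<^sup>2 * 1" unfolding g by simp
    from case_f_D_cusp[OF det zero_less_one this C] obtain C' where
      C': "has_qexp 1 ((eta_order c [(5, 5), (1, -1)] - r) / 2) C'
        (\<lambda>z. case_f CaseD (moebius_int a b c d z) / (of_int c * z + of_int d))" by blast
    have "eta_order c [(5, 5), (1, -1)] = 1"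
      unfolding eta_order_def list.map sum_list.Cons sum_list.Nil prod.case g by (simp add: power2_eq_square)
    then have "(eta_order c [(5, 5), (1, -1)] - r) / 2 \<ge> 0" using r by simp
    then show ?thesis by (rule bd[OF C C'])
  qed
qed

text \<open>\<open>Gamma1 5\<close> enlarged by -1, since the descent may end at 1 or at -1. The
  residue of \<open>d\<close> follows from the determinant.\<close>

definition Gamma1_5_pm :: "int \<Rightarrow> int \<Rightarrow> int \<Rightarrow> int \<Rightarrow> bool" where
  "Gamma1_5_pm a b c d \<longleftrightarrow> a * d - b * c = 1 \<and> 5 dvd c \<and> (a mod 5 = 1 \<or> a mod 5 = 4)"

text \<open>As \<open>a\<close> and \<open>c\<close> are coprime, the two equalities would force
  \<open>|a| = 2\<close> and \<open>|c| = 2\<close>, against the residue of \<open>a\<close> and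
  \<open>5 dvd c\<close> respectively.\<close>

lemma Gamma1_5_pm_irregular:
  assumes "Gamma1_5_pm a b c d" "c \<noteq> 0"
  shows "a \<noteq> 0 \<and> int 5 * \<bar>a\<bar> \<noteq> 2 * \<bar>c\<bar> \<and> 2 * \<bar>a\<bar> \<noteq> \<bar>c\<bar>"
proof (intro conjI notI)
  have det: "a * d - b * c = 1" and c: "5 dvd c" and a: "a mod 5 = 1 \<or> a mod 5 = 4"
    using assms(1) by (auto simp: Gamma1_5_pm_def)
  show False if "a = 0" using a that by simp
  show False if eq: "int 5 * \<bar>a\<bar> = 2 * \<bar>c\<bar>"
  proof -
    have "even (int 5 * \<bar>a\<bar>)" unfolding eq by simp
    then obtain k where k: "a = 2 * k" by auto
    with eq have "c = k * 5 \<or> c = k * (- 5)" by (simp add: abs_mult) linarith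
    then have "k dvd a" "k dvd c" unfolding k by (simp, elim disjE) simp_all
    then have "k dvd a * d - b * c" by simp
    then have "\<bar>k\<bar> = 1" by (simp add: det)
    then have "a = 2 \<or> a = - 2" using k(1) by linarith
    then show False using a by (elim disjE) simp_all
  qed
  show False if eq: "2 * \<bar>a\<bar> = \<bar>c\<bar>"
  proof -
    from eq have "c = 2 * a \<or> c = (- 2) * a" by linarith
    then have "a dvd c" by (elim disjE) simp_all
    then have "a dvd a * d - b * c" by simp
    then have "\<bar>a\<bar> = 1" by (simp add: det)
    then have "c = 2 \<or> c = - 2" using eq by linarith
    then show False using c by (elim disjE) simp_all
  qed
qed

text \<open>The cusps 0 and -1/2 both have denominator prime to 5, so the single hypothesis
  \<open>cusp\<close>, with width 5 and order 0, serves both parabolic families.\<close>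

lemma case_D_transforms_pm:
  assumes \<epsilon>: "\<epsilon> 1 = 1" "\<epsilon> (-1) = (-1) ^ k" "\<And>x y. [x = y] (mod 5) \<Longrightarrow> \<epsilon> x = \<epsilon> y"
    and T: "\<And>z. Im z > 0 \<Longrightarrow> F (z + 1) = F z"
    and cusp: "\<And>a b c d. a * d - b * c = 1 \<Longrightarrow> \<not> 5 dvd c \<Longrightarrow>
      \<exists>C. has_qexp 5 0 C (\<lambda>z. F (moebius_int a b c d z) / (of_int c * z + of_int d) ^ k)"
    and M: "Gamma1_5_pm a b c d"
  shows "transforms F k \<epsilon> a b c d"
proof -
  have "\<exists>C. has_qexp 5 0 C (\<lambda>z. F (moebius_int 0 (-1) 1 0 z) / (of_int 1 * z + of_int 0) ^ k)" by (rule cusp) simp_all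
  moreover have "moebius_int 0 (-1) 1 0 = (\<lambda>z. - 1 / z)" by (simp add: fun_eq_iff moebius_int_def)
  ultimately obtain C where U: "has_qexp 5 0 C (\<lambda>z. F (- 1 / z) / z ^ k)" by auto
  have "\<exists>C. has_qexp 5 0 C (\<lambda>z. F (moebius_int 1 0 (-2) 1 z) / (of_int (-2) * z + of_int 1) ^ k)"
    by (rule cusp) simp_all
  then obtain C' where P: "has_qexp 5 0 C' (\<lambda>z. F (moebius_int 1 0 (-2) 1 z) / (1 - 2 * z) ^ k)" by auto
  have 0: "nome (of_real 0 * of_nat 5) = 1" by simp
  have 5: "(5::nat) > 0" "int 5 * (int 5 - 1) = 4 * int 5" "(5::int) dvd int 5" "(5::int) dvd 2 * int 5" by simp_all
  have mod5: "x mod 5 = y mod 5" if "x = y + 5 * n" for x y n :: int using that by simp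
  show ?thesis
  proof (rule congruence_transforms[of 5 5 Gamma1_5_pm \<epsilon> k 5, OF 5(1,1,2) _ _ _ _ Gamma1_5_pm_irregular \<epsilon> 5(3,4) T U 0 P 0 M])
    show "a * d - b * c = 1" if "Gamma1_5_pm a b c d" for a b c d using that by (simp add: Gamma1_5_pm_def)
    show "Gamma1_5_pm (a + n * c) (b + n * d) c d" if I: "Gamma1_5_pm a b c d" for a b c d n
    proof -
      obtain c' where "c = 5 * c'" using I by (auto simp: Gamma1_5_pm_def)
      then have "(a + n * c) mod 5 = a mod 5" by (intro mod5[of _ _ "n * c'"]) simp
      moreover have "(a + n * c) * d - (b + n * d) * c = a * d - b * c" by (simp add: algebra_simps)
      ultimately show ?thesis using I unfolding Gamma1_5_pm_def by presburger
    qed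
    show "Gamma1_5_pm a b (c + n * int 5 * a) (d + n * int 5 * b)" if I: "Gamma1_5_pm a b c d" for a b c d n
    proof -
      have "a * (d + n * int 5 * b) - b * (c + n * int 5 * a) = a * d - b * c" by (simp add: algebra_simps)
      moreover have "5 dvd c + n * int 5 * a" using I by (simp add: Gamma1_5_pm_def)
      ultimately show ?thesis using I by (simp only: Gamma1_5_pm_def)
    qed
    show "Gamma1_5_pm ((1 + 2 * e) * a + e * c) ((1 + 2 * e) * b + e * d) (- 4 * e * a + (1 - 2 * e) * c) (- 4 * e * b + (1 - 2 * e) * d)"
      if I: "Gamma1_5_pm a b c d" and e: "e = int 5 \<or> e = - int 5" for a b c d e
    proof -
      obtain e' where e': "e = 5 * e'" using e by (auto intro: that[of 1] that[of "-1"])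
      have "((1 + 2 * e) * a + e * c) mod 5 = a mod 5" by (rule mod5[of _ _ "2 * e' * a + e' * c"]) (simp add: e' algebra_simps)
      moreover have "5 dvd - 4 * e * a + (1 - 2 * e) * c"
      proof (rule dvd_add)
        show "5 dvd - 4 * e * a" by (simp add: e')
        show "5 dvd (1 - 2 * e) * c" using I by (simp add: Gamma1_5_pm_def)
      qed
      moreover have "((1 + 2 * e) * a + e * c) * (- 4 * e * b + (1 - 2 * e) * d)
          - ((1 + 2 * e) * b + e * d) * (- 4 * e * a + (1 - 2 * e) * c) = a * d - b * c" by (simp add: algebra_simps)
      ultimately show ?thesis using I by (simp only: Gamma1_5_pm_def)
    qed
  qed
qed

lemma case_D_transform:
  "\<forall>M\<in>case_group CaseD. \<forall>z\<in>upper_half.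
     case_g CaseD (moebius_action M z) = case_chi CaseD M * automorphy M z ^ 3 * case_g CaseD z"
proof (intro ballI)
  fix M z assume "M \<in> case_group CaseD" and z: "z \<in> upper_half"
  then obtain a b c d :: int where M: "M = mat2 (of_int a) (of_int b) (of_int c) (of_int d)"
    "a * d - b * c = 1" "5 dvd c" "[a = 1] (mod 5)" and d: "[d = 1] (mod 5)"
    by (auto simp: Gamma1_def cong_0_iff)
  have pm: "Gamma1_5_pm a b c d" using M(2-4) by (simp add: Gamma1_5_pm_def cong_def)
  \<comment> \<open>Weight 1 demands the value -1 at -1; on \<open>Gamma1 5\<close> itself
    \<epsilon> is 1, so the character disappears. The residues 0, 2 and 3 do not occur for
    \<open>d\<close>.\<close>
  define \<epsilon> where "\<epsilon> d = (if d mod 5 = 4 then - 1 else 1 :: int)" for d :: int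
  have per: "F (z + 1) = F z" if "has_qexp 1 r 1 F" "nome (of_real r) = 1" "Im z > 0" for F z r
    using has_qexp_shift[OF that(1,3)] that(2) by simp
  have t: "transforms (case_t CaseD) 0 (\<lambda>_. 1) a b c d"
  proof (rule case_D_transforms_pm[OF _ _ _ _ _ pm])
    show "case_t CaseD (z + 1) = case_t CaseD z" if "Im z > 0" for z
      by (rule per[OF case_t_D_inf _ that]) (rule nome_int_eq_1, simp)
    show "\<exists>C. has_qexp 5 0 C (\<lambda>z. case_t CaseD (moebius_int a b c d z) / (of_int c * z + of_int d) ^ 0)"
      if "a * d - b * c = 1" "\<not> 5 dvd c" for a b c d
      using case_t_D_cusp_0[OF that] by (simp only: power_0 div_by_1)
  qed simp_all
  have f: "transforms (case_f CaseD) 1 \<epsilon> a b c d"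
  proof (rule case_D_transforms_pm[OF _ _ _ _ _ pm])
    show "case_f CaseD (z + 1) = case_f CaseD z" if "Im z > 0" for z
      by (rule per[OF case_f_D_inf _ that]) (rule nome_int_eq_1, simp)
    show "\<exists>C. has_qexp 5 0 C (\<lambda>z. case_f CaseD (moebius_int a b c d z) / (of_int c * z + of_int d) ^ 1)"
      if "a * d - b * c = 1" "\<not> 5 dvd c" for a b c d
      using case_f_D_cusp_0[OF that] by (simp only: power_one_right)
  qed (simp_all add: \<epsilon>_def cong_def)
  have "transforms (case_g CaseD) 3 \<epsilon> a b c d"
    unfolding case_g_eq by (rule theta_form_transforms[OF has_qexp_holomorphic[OF case_t_D_inf] M(2) t f])
  moreover have "\<epsilon> d = 1" using d by (simp add: \<epsilon>_def cong_def)
  ultimately show "case_g CaseD (moebius_action M z) = case_chi CaseD M * automorphy M z ^ 3 * case_g CaseD z"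
    using z by (simp add: M(1) transforms_def moebius_action_mat2 automorphy_mat2)
qed

section \<open>Assembly of the six cases\<close>

lemma case_modular_pair: "modular_pair (case_t c) (case_f c) (case_b c)"
  by (cases c) (simp_all only: case_b.simps case_pairs case_D_modular_pair)

lemma case_g_modular_form: "modular_form 3 (case_group c) (case_chi c) (case_g c)"
proof -
  interpret modular_pair "case_t c" "case_f c" "case_b c" by (rule case_modular_pair)
  have "case_g c holomorphic_on upper_half"
    using g_holomorphic by (simp only: g_def[abs_def] case_g_def[abs_def])
  moreover have "\<forall>M\<in>case_group c. \<forall>z\<in>upper_half.
      case_g c (moebius_action M z) = case_chi c M * automorphy M z ^ 3 * case_g c z"
  proof (cases "c \<in> {CaseA, CaseC, CaseE, CaseG}")
    case False
    then have "c = CaseD \<or> c = CaseF" by (cases c) simp_all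
    then show ?thesis using case_D_transform case_F_transform by blast
  qed (rule eta_cases_transform)
  moreover have "\<forall>M\<in>SL2Z. \<exists>Y>0. \<exists>C. \<forall>z. Im z \<ge> Y \<longrightarrow>
      norm (case_g c (moebius_action M z) / automorphy M z ^ 3) \<le> C"
    using case_D_cusp_bounded case_cusp_bounded by (cases "c = CaseD") blast+
  ultimately show ?thesis unfolding modular_form_def by (intro conjI)
qed

theorem theorem2p3:
  fixes c :: apery_case
  shows "modular_form 3 (case_group c) (case_chi c) (case_g c)
    \<and> (0 < case_b c \<and> mat2 1 0 (real (case_b c)) 1 \<in> case_group c
        \<and> (\<forall>n::nat. 0 < n \<and> n < case_b c \<longrightarrow> mat2 1 0 (real n) 1 \<notin> case_group c))
    \<and> (\<forall>s. Re s > 0 \<longrightarrow> kappa_integrand c s absolutely_integrable_on {0<..})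
    \<and> (\<forall>m. regularizable (log_integral c m))
    \<and> (\<exists>k :: nat \<Rightarrow> complex.
          (\<exists>r>0. \<forall>s. Re s > 0 \<and> norm s < r \<longrightarrow> (\<lambda>n. k n * s ^ n) sums kappa c s)
        \<and> k 0 = 1
        \<and> k 1 = 0
        \<and> (\<forall>m. k (2 + m) = 4 * of_real pi ^ 2 / (of_nat (case_b c) * fact m)
                             * reg_value (log_integral c m)))"
proof -
  interpret modular_pair "case_t c" "case_f c" "case_b c" by (rule case_modular_pair)
  \<comment> \<open>The notions of the locale were copied literally from the global ones, so they
    are identified by unfolding.\<close>
  have g: "g = case_g c" by (simp only: fun_eq_iff g_def case_g_def simp_thms)
  have D: "D m = log_integral c m" for m
    by (simp only: fun_eq_iff D_def log_integral_def L_def g simp_thms)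
  have kint: "kint s = kappa_integrand c s" for s
    by (simp only: fun_eq_iff kint_def kappa_integrand_def simp_thms)
  define k :: "nat \<Rightarrow> complex" where
    "k n = (if n = 0 then 1 else if n = 1 then 0 else
       4 * of_real pi ^ 2 / (of_nat (case_b c) * fact (n - 2)) * reg_value (log_integral c (n - 2)))" for n
  have k: "k 0 = 1" "k 1 = 0"
    "k (2 + m) = 4 * of_real pi ^ 2 / (of_nat (case_b c) * fact m) * reg_value (D m)" for m
    by (simp_all add: k_def D)
  have "(\<lambda>n. k n * s ^ n) sums kappa c s" if "Re s > 0" "norm s < 1 / 8" for s
    using kappa_expansion[OF that k] by (simp only: kappa_def kint)
  then have "\<exists>r>0. \<forall>s. Re s > 0 \<and> norm s < r \<longrightarrow> (\<lambda>n. k n * s ^ n) sums kappa c s"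
    by (intro exI[of _ "1 / 8"]) simp
  moreover have "regularizable (log_integral c m)" for m
    using D_regularizes[of m] unfolding regularizable_def D by blast
  moreover have "kappa_integrand c s absolutely_integrable_on {0<..}" if "Re s > 0" for s
    using kint_integrable[OF that] by (simp only: kint)
  ultimately show ?thesis
    using case_g_modular_form[of c] case_b_minimal[where c = c] k unfolding D
    by (intro conjI allI impI exI[of _ k]; (elim conjE)?; blast)
qed

end
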